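(* Let $(R,\mathfrak{m})$ be a $d$-dimensional complete local ring with a perfect coefficient field. Then $\operatorname{size}\Omega^d(\operatorname{mod} R)<\infty$; hence $\operatorname{radius}\Omega^d(\operatorname{mod} R)<\infty$.
   Context: All modules are finitely generated; $\operatorname{mod} R$ is the category of finitely generated $R$-modules; subcategories are full and closed under isomorphism. A coefficient field is a subfield of $R$ mapping isomorphically onto the residue field. $\Omega^iX$ is the $i$-th syzygy in the minimal free resolution, $\Omega^0X=X$; $\Omega^d(\operatorname{mod} R)$ is the subcategory of modules isomorphic to $d$-th syzygies of $R$-modules. For subcategories $\mathcal{X},\mathcal{Y}$, $\mathcal{X}\circ\mathcal{Y}$ consists of modules $M$ with an exact sequence $0\to X\to M\to Y\to0$, $X\in\mathcal{X}$, $Y\in\mathcal{Y}$. Size: $|\mathcal{X}|=\operatorname{add}\mathcal{X}$ (direct summands of finite direct sums), $\mathcal{X}*\mathcal{Y}=|\,|\mathcal{X}|\circ|\mathcal{Y}|\,|$, $|\mathcal{X}|_1=|\mathcal{X}|$, $|\mathcal{X}|_r=|\mathcal{X}|_{r-1}*\mathcal{X}$; $\operatorname{size}\mathcal{X}$ is the infimum of $n\ge0$ with $\mathcal{X}\subseteq|G|_{n+1}$ for some $G\in\operatorname{mod} R$. Radius: $[\mathcal{X}]$ is the additive closure of the subcategory consisting of $R$ and all $\Omega^iX$, $i\ge0$, $X\in\mathcal{X}$; $[C]_1=[C]$, $[C]_r=[[C]_{r-1}\circ[C]]$; the radius of $\mathcal{X}$ is the infimum of $n\ge0$ with $\mathcal{X}\subseteq[C]_{n+1}$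 for some $C\in\operatorname{mod} R$. *)

theory Defs
  imports "HOL-Algebra.Algebra" "HOL-Library.Extended_Nat"
begin

definition krull_dim :: "('a, 'b) ring_scheme \<Rightarrow> enat" where
  "krull_dim R = Sup {enat n | n. \<exists>P. (\<forall>i\<le>n. primeideal (P i) R) \<and> (\<forall>i<n. P i \<subset> P (Suc i))}"

primrec ideal_pow :: "('a, 'b) ring_scheme \<Rightarrow> 'a set \<Rightarrow> nat \<Rightarrow> 'a set" where
  "ideal_pow R I 0 = carrier R"
| "ideal_pow R I (Suc n) = ideal_prod R I (ideal_pow R I n)"

definition madic_complete :: "('a, 'b) ring_scheme \<Rightarrow> 'a set \<Rightarrow> bool" where
  "madic_complete R m \<longleftrightarrow>
     (\<Inter>n. ideal_pow R m n) = {\<zero>\<^bsub>R\<^esub>} \<and>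
     (\<forall>x :: nat \<Rightarrow> 'a. (\<forall>n. x n \<in> carrier R) \<and> (\<forall>n. x (Suc n) \<ominus>\<^bsub>R\<^esub> x n \<in> ideal_pow R m n)
        \<longrightarrow> (\<exists>y\<in>carrier R. \<forall>n. y \<ominus>\<^bsub>R\<^esub> x n \<in> ideal_pow R m n))"

definition coefficient_field :: "('a, 'b) ring_scheme \<Rightarrow> 'a set \<Rightarrow> 'a set \<Rightarrow> bool" where
  "coefficient_field R m K \<longleftrightarrow>
     subfield K R \<and> bij_betw (\<lambda>k. m +>\<^bsub>R\<^esub> k) K (carrier (R Quot m))"

text \<open>A (sub)field K of R is perfect: characteristic 0, or characteristic p > 0 and the
  Frobenius map of K is surjective. (K contains the identity of R, so char K = char R.)\<close>
definition perfect_subfield :: "('a, 'b) ring_scheme \<Rightarrow> 'a set \<Rightarrow> bool" where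
  "perfect_subfield R K \<longleftrightarrow>
     (\<forall>p::nat. Factorial_Ring.prime p \<and> add_pow R p \<one>\<^bsub>R\<^esub> = \<zero>\<^bsub>R\<^esub> \<longrightarrow> (\<forall>a\<in>K. \<exists>b\<in>K. b [^]\<^bsub>R\<^esub> p = a))"

text \<open>All finitely generated R-modules are represented (up to isomorphism) by HOL-Algebra
  modules whose elements have the fixed type nat => 'a (every f.g. module is a quotient of
  some R^n, hence injects into this type).\<close>
type_synonym 'a umod = "('a, nat \<Rightarrow> 'a) module"

definition lin_map :: "('a, 'c) ring_scheme \<Rightarrow> ('a, 'b) module \<Rightarrow> ('a, 'e) module \<Rightarrow> ('b \<Rightarrow> 'e) \<Rightarrow> bool" where
  "lin_map R M N f \<longleftrightarrow> f \<in> carrier M \<rightarrow> carrier N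
     \<and> (\<forall>x\<in>carrier M. \<forall>y\<in>carrier M. f (x \<oplus>\<^bsub>M\<^esub> y) = f x \<oplus>\<^bsub>N\<^esub> f y)
     \<and> (\<forall>a\<in>carrier R. \<forall>x\<in>carrier M. f (a \<odot>\<^bsub>M\<^esub> x) = a \<odot>\<^bsub>N\<^esub> f x)"

definition mod_iso :: "('a, 'c) ring_scheme \<Rightarrow> ('a, 'b) module \<Rightarrow> ('a, 'e) module \<Rightarrow> bool" where
  "mod_iso R M N \<longleftrightarrow> module R M \<and> module R N \<and>
     (\<exists>f. lin_map R M N f \<and> bij_betw f (carrier M) (carrier N))"

definition gens_by :: "('a, 'c) ring_scheme \<Rightarrow> ('a, 'b) module \<Rightarrow> nat \<Rightarrow> (nat \<Rightarrow> 'b) \<Rightarrow> bool" where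
  "gens_by R M n g \<longleftrightarrow> g \<in> {..<n} \<rightarrow> carrier M \<and>
     (\<forall>x\<in>carrier M. \<exists>c\<in>{..<n} \<rightarrow> carrier R. x = (\<Oplus>\<^bsub>M\<^esub> i\<in>{..<n}. c i \<odot>\<^bsub>M\<^esub> g i))"

definition fin_gen :: "('a, 'c) ring_scheme \<Rightarrow> ('a, 'b) module \<Rightarrow> bool" where
  "fin_gen R M \<longleftrightarrow> module R M \<and> (\<exists>n g. gens_by R M n g)"

definition num_gens :: "('a, 'c) ring_scheme \<Rightarrow> ('a, 'b) module \<Rightarrow> nat" where
  "num_gens R M = (LEAST n. \<exists>g. gens_by R M n g)"

definition free_mod :: "('a, 'c) ring_scheme \<Rightarrow> nat \<Rightarrow> 'a umod" where
  "free_mod R n = (undefined :: 'a umod)\<lparr>carrier := {..<n} \<rightarrow>\<^sub>E carrier R,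
                   zero := (\<lambda>i\<in>{..<n}. \<zero>\<^bsub>R\<^esub>),
                   add := (\<lambda>u v. \<lambda>i\<in>{..<n}. u i \<oplus>\<^bsub>R\<^esub> v i),
                   smult := (\<lambda>a v. \<lambda>i\<in>{..<n}. a \<otimes>\<^bsub>R\<^esub> v i)\<rparr>"

definition ker_syz :: "('a, 'c) ring_scheme \<Rightarrow> ('a, 'b) module \<Rightarrow> nat \<Rightarrow> (nat \<Rightarrow> 'b) \<Rightarrow> 'a umod" where
  "ker_syz R M n g = (free_mod R n)\<lparr>carrier :=
     {c \<in> carrier (free_mod R n). (\<Oplus>\<^bsub>M\<^esub> i\<in>{..<n}. c i \<odot>\<^bsub>M\<^esub> g i) = \<zero>\<^bsub>M\<^esub>}\<rparr>"

definition first_syz :: "('a, 'c) ring_scheme \<Rightarrow> ('a, 'b) module \<Rightarrow> 'a umod \<Rightarrow> bool" where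
  "first_syz R M K \<longleftrightarrow> fin_gen R M \<and>
     (\<exists>g. gens_by R M (num_gens R M) g \<and> K = ker_syz R M (num_gens R M) g)"

primrec syzn :: "('a, 'c) ring_scheme \<Rightarrow> nat \<Rightarrow> 'a umod \<Rightarrow> 'a umod \<Rightarrow> bool" where
  "syzn R 0 N0 = (\<lambda>K. fin_gen R N0 \<and> K = N0)"
| "syzn R (Suc i) N0 = (\<lambda>K. \<exists>L. syzn R i N0 L \<and> first_syz R L K)"

definition syz_class :: "('a, 'c) ring_scheme \<Rightarrow> nat \<Rightarrow> 'a umod set" where
  "syz_class R d = {M. \<exists>N0 K. syzn R d N0 K \<and> mod_iso R M K}"

text \<open>add XC: f.g. modules that are direct summands of finite direct sums X_0 + ... + X_{n-1}
  of objects of XC, expressed by split maps M -> (+) X_i -> M composing to the identity.\<close>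
definition add_cl :: "('a, 'c) ring_scheme \<Rightarrow> 'a umod set \<Rightarrow> 'a umod set" where
  "add_cl R XC = {M. fin_gen R M \<and> (\<exists>(n::nat) Xs f g. (\<forall>i<n. Xs i \<in> XC) \<and>
      (\<forall>i<n. lin_map R M (Xs i) (f i) \<and> lin_map R (Xs i) M (g i)) \<and>
      (\<forall>x\<in>carrier M. x = (\<Oplus>\<^bsub>M\<^esub> i\<in>{..<n}. g i (f i x))))}"

definition circ_cl :: "('a, 'c) ring_scheme \<Rightarrow> 'a umod set \<Rightarrow> 'a umod set \<Rightarrow> 'a umod set" where
  "circ_cl R XC YC = {M. fin_gen R M \<and> (\<exists>N0\<in>XC. \<exists>Y\<in>YC. \<exists>f g.
      lin_map R N0 M f \<and> inj_on f (carrier N0) \<and>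
      lin_map R M Y g \<and> g ` carrier M = carrier Y \<and>
      f ` carrier N0 = {z \<in> carrier M. g z = \<zero>\<^bsub>Y\<^esub>})}"

definition star_cl :: "('a, 'c) ring_scheme \<Rightarrow> 'a umod set \<Rightarrow> 'a umod set \<Rightarrow> 'a umod set" where
  "star_cl R XC YC = add_cl R (circ_cl R (add_cl R XC) (add_cl R YC))"

text \<open>sball R XC r = |XC|_{r+1}.\<close>
primrec sball :: "('a, 'c) ring_scheme \<Rightarrow> 'a umod set \<Rightarrow> nat \<Rightarrow> 'a umod set" where
  "sball R XC 0 = add_cl R XC"
| "sball R XC (Suc r) = star_cl R (sball R XC r) XC"

definition mod_size :: "('a, 'c) ring_scheme \<Rightarrow> 'a umod set \<Rightarrow> enat" where
  "mod_size R XC = (INF n \<in> {n. \<exists>G. fin_gen R G \<and> XC \<subseteq> sball R {G} n}. enat n)"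

definition bracket_cl :: "('a, 'c) ring_scheme \<Rightarrow> 'a umod set \<Rightarrow> 'a umod set" where
  "bracket_cl R XC = add_cl R ({free_mod R 1} \<union> {K. \<exists>N0\<in>XC. \<exists>i. syzn R i N0 K})"

text \<open>rball R C r = [C]_{r+1}.\<close>
primrec rball :: "('a, 'c) ring_scheme \<Rightarrow> 'a umod \<Rightarrow> nat \<Rightarrow> 'a umod set" where
  "rball R C 0 = bracket_cl R {C}"
| "rball R C (Suc r) = bracket_cl R (circ_cl R (rball R C r) (bracket_cl R {C}))"

definition mod_radius :: "('a, 'c) ring_scheme \<Rightarrow> 'a umod set \<Rightarrow> enat" where
  "mod_radius R XC = (INF n \<in> {n. \<exists>C. fin_gen R C \<and> XC \<subseteq> rball R C n}. enat n)"

end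

theory Submission
  imports Defs
begin

text \<open>
  The size of the class of modules killed by an ideal \<open>I\<close> and embedded in long enough syzygy sequences is bounded
  by noetherian induction on \<open>I\<close>; the essential case is that of a prime \<open>P\<close>. By a Cohen-Gabber style
  choice of parameters (replacing \<open>y\<close> by \<open>y ^ p * (1 + z)\<close> in characteristic \<open>p\<close>), the domain
  \<open>A = R / P\<close> is finite and generically separable over a power series ring \<open>S\<close> over the coefficient
  field. Sufficiently high syzygies over \<open>A\<close> are \<open>S\<close>-free, so the syzygy sequence splits
  \<open>S\<close>-linearly, and averaging such a splitting along the separable generator gives an \<open>A\<close>-linear
  splitting up to one fixed \<open>x \<notin> P\<close>. Devissage modulo \<open>x\<close> then reduces to larger ideals.
\<close>

text \<open>The ring \<open>A\<close> is finite over \<open>S\<close> but need not be free. It is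
  free up to a nonzero \<open>c\<close> in \<open>S\<close>, and each comparison of a syzygy over
  \<open>A\<close> with one over \<open>S\<close> costs \<open>c^2\<close>: this is the origin of
  \<open>c^(2 s)\<close>. The other factor of \<open>x\<close> is a product of values f'(\<theta>),
  one for each generator \<theta> of \<open>A\<close> over \<open>S\<close>, and in characteristic p
  the obstacle is that these might vanish. A perfect coefficient field gives [S : S^p] <= p^d, hence
  [A : A^p] <= p^d on fraction fields, so d elements z of the maximal ideal generate the fraction
  field of \<open>A\<close> over that of \<open>A^p\<close>. With y^p (1 + z) as new parameters each
  z lies in the field generated by the new \<open>S\<close> and \<open>A^p\<close>, and separability
  follows as in MacLane's criterion. Devissage modulo \<open>x\<close> loses one syzygy degree at
  each exact sequence, so a bound on the modules alone does not survive the induction. Therefore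
  \<open>bnd R j\<close> bounds some choice of j-th syzygies of all modules in a class, and the
  bound on the lengths of prime chains above the ideal serves as j.\<close>

notation (input) carrier ("$_" [1000] 1000)
notation (input) monoid.mult (infixl "*:\<index>" 70)
notation (input) ring.add (infixl "+:\<index>" 65)
notation (input) a_minus ("_ -:\<index> _" [65, 66] 65)
notation (input) ring.zero ("#0\<index>")
notation (input) monoid.one ("#1\<index>")

abbreviation (input) subset_of (infix "<:" 50) where "A <: B \<equiv> (A::'a set) \<subseteq> B"
abbreviation (input) restrict_carrier ("_@:_" [1000, 1000] 1000) where "R@:S \<equiv> R\<lparr>carrier := S\<rparr>"
abbreviation (input) smult_in ("_ *[_] _" [70, 0, 71] 70) where "a *[M] x \<equiv> a \<odot>\<^bsub>M\<^esub> x"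
abbreviation (input) add_in ("_ +[_] _" [65, 0, 66] 65) where "x +[M] y \<equiv> x \<oplus>\<^bsub>M\<^esub> y"
abbreviation (input) minus_in ("_ -[_] _" [65, 0, 66] 65) where "x -[M] y \<equiv> x \<ominus>\<^bsub>M\<^esub> y"
abbreviation (input) zero_in ("0[_]") where "0[M] \<equiv> \<zero>\<^bsub>M\<^esub>"

syntax (input)
  "_sum_over" :: "index \<Rightarrow> idt \<Rightarrow> logic \<Rightarrow> logic \<Rightarrow> logic"  ("(3##__:_./ _)" [1000, 0, 51, 10] 10)
  "_sum_in" :: "logic \<Rightarrow> idt \<Rightarrow> logic \<Rightarrow> logic \<Rightarrow> logic"  ("(3##[_]_:_./ _)" [0, 0, 51, 10] 10)
translations
  "##\<^bsub>M\<^esub>i:A. b" \<rightharpoonup> "CONST finsum M (\<lambda>i. b) A"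
  "##[M]i:A. b" \<rightharpoonup> "CONST finsum M (\<lambda>i. b) A"

section \<open>Modules and linear maps\<close>

text \<open>\<open>lin_map\<close> is silent on whether source and target are modules. With both
  facts bundled, one hypothesis carries everything that a diagram chase needs.\<close>

definition lm :: "('a,'c) ring_scheme=> ('a,'b) module=> ('a,'e) module=> ('b=> 'e)=> bool" where
 "lm R M N f \<longleftrightarrow> module R M & module R N & lin_map R M N f"

definition sm :: "('a,'c) ring_scheme=> ('a,'b) module=> 'b set=> bool" where
 "sm R M U \<longleftrightarrow> U<:$M & 0[M]:U & (ALL x:U. ALL y:U. x+[M] y:U)
& (ALL a:$R. ALL x:U. a*[M] x:U)"

definition ses :: "('a,'c) ring_scheme=> ('a,'b) module=> ('a,'e) module=> ('a,'f) module
=> ('b=> 'e)=> ('e=> 'f)=> bool" where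
 "ses R V Y Z f g \<longleftrightarrow> lm R V Y f & lm R Y Z g & inj_on f ($V) &
g ` $Y = $Z & f ` $V = {y:$Y. g y = 0[Z]}"

text \<open>An inductive span spares finite sums in inductions over linear combinations, and the
  scalars can shrink to a subring while the module record stays the same.\<close>

inductive_set spn :: "('a,'c) ring_scheme=> ('a,'b) module=> 'b set=> 'b set"
 for R M V where
 zero: "0[M]:spn R M V"
| step: "a:$R==> x:V==> y:spn R M V==> a*[M] x+[M] y:spn R M V"

lemma (in abelian_group) diff_eq_iff:
 "x:$G==> y:$G==> x -: y = #0 \<longleftrightarrow> x = y"
 by(simp add:a_minus_def add.inv_solve_right')

context abelian_group begin

lemma add_diff_cancel: "x:$G==> y:$G==> (x -: y) +: y = x"
 by(simp add:a_minus_def a_assoc l_neg)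

lemma diff_add_cancel: "x:$G==> y:$G==> (x +: y) -: y = x"
 by(simp add:a_minus_def a_assoc r_neg)

lemma diff_self: "x:$G==> x -: x = #0"
 by(simp add:diff_eq_iff)

lemma diff_zero: "x:$G==> x -: #0 = x"
 using add_diff_cancel[of x "#0"] by simp

lemma add_diff_swap: "x:$G==> y:$G==> x +: (y -: x) = y"
 using a_comm add_diff_cancel by simp

lemma diff_add_diff:
 "[|x:$G; y:$G; x':$G; y':$G|] ==>
(x +: y) -: (x' +: y') = (x -: x') +: (y -: y')"
 by(simp add:a_minus_def minus_add a_ac)

end

locale mdl = module R M for R :: "('a,'c) ring_scheme" (structure) and M :: "('a,'b) module" (structure)

declare mdl.intro [intro?]

context mdl begin

lemma smult_diff:
 "[|a:$R; x:$M; y:$M|]==> a*[M] (x-[M] y) = a*[M] x-[M] a*[M] y"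
 by(simp add:a_minus_def smult_r_distr smult_r_minus)

lemma neg_eq_smult: "x:$M==> \<ominus>\<^bsub>M\<^esub> x = (\<ominus> #1)*[M] x"
 by(simp add:smult_l_minus)

lemma smD:
 assumes "sm R M U"
 shows "x:U==> x:$M" "0[M]:U" "x:U==> y:U==> x+[M] y:U"
  "a:$R==> x:U==> a*[M] x:U" "x:U==> \<ominus>\<^bsub>M\<^esub> x:U"
  "x:U==> y:U==> x-[M] y:U"
proof -
 show *: "x:U==> x:$M" "0[M]:U" "x:U==> y:U==> x+[M] y:U"
  "a:$R==> x:U==> a*[M] x:U" for x y a
  using assms by(auto simp:sm_def)
 show "x:U==> \<ominus>\<^bsub>M\<^esub> x:U" for x
  using * neg_eq_smult by simp
 thus "x:U==> y:U==> x-[M] y:U"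
  using * by(simp add:a_minus_def)
qed

lemma sm_submodule: "sm R M U==> submodule U R M"
 by(rule submoduleI) (auto simp:smD intro:smD)

lemma sm_module: "sm R M U==> module R (M\<lparr>carrier := U\<rparr>)"
 using submodule.submodule_is_module[OF sm_submodule] module_axioms by blast

lemma sm_lm: "sm R M U==> lm R (M\<lparr>carrier := U\<rparr>) M (%x. x)"
 using sm_module module_axioms by(auto simp:lm_def lin_map_def sm_def)

lemma sm_carrier: "sm R M ($M)"
 by(auto simp:sm_def)

lemma sm_zero: "sm R M {0[M]}"
 by(auto simp:sm_def)

lemma spn_closed: "V<:$M==> x:spn R M V==> x:$M"
proof -
 assume V: "V<:$M" and "x:spn R M V"
 from this(2) show "x:$M" by(induct rule: spn.induct) (use V in auto)
qed

lemma spn_incl: "V<:$M==> x:V==> x:spn R M V"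
 using spn.step[of "#1" R x V "0[M]" M] spn.zero[of M R V] by auto

lemma spn_add:
 assumes "V<:$M" "x:spn R M V" "y:spn R M V" shows "x+[M] y:spn R M V"
 using assms(2)
proof (induct rule: spn.induct)
 case zero thus ?case using assms spn_closed by simp
next
 case (step a x z)
 hence "a*[M] x+[M] z+[M] y = a*[M] x+[M] (z+[M] y)"
  using assms spn_closed by(meson M.a_assoc smult_closed subsetD)
 thus ?case using step spn.step by metis
qed

lemma spn_smult:
 assumes "V<:$M" "b:$R" "x:spn R M V" shows "b*[M] x:spn R M V"
 using assms(3)
proof (induct rule: spn.induct)
 case zero thus ?case using assms by(simp add:spn.zero)
next
 case (step a x z)
 have "x:$M" "z:$M" using step assms spn_closed by auto
 hence "b*[M] (a*[M] x+[M] z) = (b*:a)*[M] x+[M] b*[M] z"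
  using step assms by(simp add:smult_r_distr smult_assoc1)
 thus ?case using step assms spn.step by(metis R.m_closed)
qed

lemma spn_sm: "V<:$M==> sm R M (spn R M V)"
 by(auto simp:sm_def spn_closed spn.zero spn_add spn_smult)

lemma spn_least:
 assumes "sm R M U" "V<:U" shows "spn R M V<:U"
proof
 fix x assume "x:spn R M V" thus "x:U"
  by(induct rule: spn.induct) (use assms smD in auto)
qed

lemma sm_finsum:
 assumes "sm R M U" "finite I" "!!i. i:I==> h i:U" shows "finsum M h I:U"
 using assms(2,3)
proof (induct)
 case empty thus ?case using smD(2)[OF assms(1)] by simp
next
 case (insert i I)
 hence "h:I \<rightarrow> $M" "h i:$M" using smD(1)[OF assms(1)] by auto
 thus ?case using insert smD(3)[OF assms(1)] by simp
qed

text \<open>Linear combinations form a submodule containing the generators, and the span is the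
  least such. This links the inductive span with the sums in \<open>gens_by\<close>.\<close>

lemma spn_image_finsum:
 assumes g: "!!i. i:I==> g i:$M" and I: "finite I"
 shows "spn R M (g ` I) = {x. EX c:I \<rightarrow> $R. x = (##[M]i:I. c i*[M] g i)}" (is "?L = ?R")
proof
 have sub: "g ` I<:$M" using g by auto
 show "?R<:?L"
 proof
  fix x assume "x:?R"
  then obtain c where c: "c:I \<rightarrow> $R" "x = (##[M]i:I. c i*[M] g i)" by auto
  thus "x:?L"
   using sm_finsum[OF spn_sm[OF sub] I, of "%i. c i*[M] g i"] spn_smult[OF sub] spn_incl[OF sub]
   by(metis (no_types, lifting) PiE image_eqI)
 qed
 have "sm R M ?R" unfolding sm_def
 proof (intro conjI ballI)
  show "?R<:$M" using g by(auto intro!: M.finsum_closed)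
  show "0[M]:?R"
   using g by(auto intro!: bexI[of _ "%_.#0"] simp:M.add.finprod_one_eqI)
  fix x assume "x:?R"
  then obtain c where c: "c:I \<rightarrow> $R" "x = (##[M]i:I. c i*[M] g i)" by auto
  {
   fix y assume "y:?R"
   then obtain e where e: "e:I \<rightarrow> $R" "y = (##[M]i:I. e i*[M] g i)" by auto
   have "x+[M] y = (##[M]i:I. c i*[M] g i+[M] e i*[M] g i)"
    using c e g by(simp add:M.finsum_addf Pi_def)
   also have "... = (##[M]i:I.(c i +: e i)*[M] g i)"
    using c e g by(intro M.finsum_cong') (auto simp:Pi_def smult_l_distr)
   finally show "x+[M] y:?R" using c e by(auto intro!: bexI[of _ "%i. c i +: e i"])
  }
  fix a assume a: "a:$R"
  have "a*[M] x = (##[M]i:I. a*[M] (c i*[M] g i))"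
   using c g a I by(simp add:finsum_smult_ldistr Pi_def)
  also have "... = (##[M]i:I.(a*:c i)*[M] g i)"
   using c a g by(intro M.finsum_cong') (auto simp:Pi_def smult_assoc1)
  finally show "a*[M] x:?R" using c a by(auto intro!: bexI[of _ "%i. a*:c i"])
 qed
 moreover have "g ` I<:?R"
 proof (safe)
  fix j assume j: "j:I"
  have "(##[M]i:I.(if j = i then g i else 0[M])) = g j"
   using M.finsum_singleton[OF j I, of g] g by auto
  moreover have "(##[M]i:I.(if i = j then #1 else #0)*[M] g i) = (##[M]i:I.(if j = i then g i else 0[M]))"
   using g by(intro M.finsum_cong') auto
  ultimately show "EX c:I \<rightarrow> $R. g j = (##[M]i:I. c i*[M] g i)"
   by(intro bexI[of _ "%i. if i = j then #1 else #0"]) auto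
 qed
 ultimately show "?L<:?R" by(rule spn_least)
qed

lemma gens_by_iff:
 "gens_by R M n g \<longleftrightarrow> g:{..<n} \<rightarrow> $M & $M<:spn R M (g ` {..<n})"
 using spn_image_finsum[of "{..<n}" g] unfolding gens_by_def by(auto simp:Pi_def)

lemma fin_gen_iff: "fin_gen R M \<longleftrightarrow> (EX V. finite V & V<:$M & $M<:spn R M V)"
proof
 assume "fin_gen R M"
 thus "EX V. finite V & V<:$M & $M<:spn R M V"
  unfolding fin_gen_def gens_by_iff by(metis finite_imageI finite_lessThan image_subset_iff_funcset)
next
 assume "EX V. finite V & V<:$M & $M<:spn R M V"
 then obtain V where V: "finite V" "V<:$M" "$M<:spn R M V" by blast
 obtain n :: nat and g where "V = g ` {i. i < n}" using finite_imp_nat_seg_image_inj_on[OF V(1)] by blast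
 hence "gens_by R M n g" using V gens_by_iff[of n g] by(auto simp:lessThan_def)
 thus "fin_gen R M" unfolding fin_gen_def using module_axioms by blast
qed

end

lemma lmD:
 assumes "lm R M N f"
 shows "module R M" "module R N" "x:$M==> f x:$N"
  "x:$M==> y:$M==> f (x+[M] y) = f x+[N] f y"
  "a:$R==> x:$M==> f (a*[M] x) = a*[N] f x"
  "f 0[M] = 0[N]"
  "x:$M==> f (\<ominus>\<^bsub>M\<^esub> x) = \<ominus>\<^bsub>N\<^esub> f x"
  "x:$M==> y:$M==> f (x-[M] y) = f x-[N] f y"
proof -
 show *: "module R M" "module R N" "x:$M==> f x:$N"
  "x:$M==> y:$M==> f (x+[M] y) = f x+[N] f y"
  "a:$R==> x:$M==> f (a*[M] x) = a*[N] f x" for x y a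
  using assms by(auto simp:lm_def lin_map_def)
 interpret M: mdl R M by rule fact
 interpret N: mdl R N by rule fact
 show "f 0[M] = 0[N]" using *(5)[of "0[R]" "0[M]"] *(3)[of "0[M]"] by simp
 show n: "x:$M==> f (\<ominus>\<^bsub>M\<^esub> x) = \<ominus>\<^bsub>N\<^esub> f x" for x
  using * by(simp add:M.neg_eq_smult N.neg_eq_smult)
 show "x:$M==> y:$M==> f (x-[M] y) = f x-[N] f y"
  by(simp add:M.minus_eq N.minus_eq * n)
qed

lemma lmI:
 assumes "module R M" "module R N" "!!x. x:$M==> f x:$N"
  "!!x y. x:$M==> y:$M==> f (x+[M] y) = f x+[N] f y"
  "!!a x. a:$R==> x:$M==> f (a*[M] x) = a*[N] f x"
 shows "lm R M N f"
 using assms by(auto simp:lm_def lin_map_def)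

lemma lm_comp: "lm R M N f==> lm R N Q g==> lm R M Q (%x. g (f x))"
 by(rule lmI) (auto simp:lmD)

lemma lm_id: "module R M==> lm R M M (%x. x)"
 by(rule lmI) auto

lemma lm_zero: "module R M==> module R N==> lm R M N (%x. 0[N])"
proof (rule lmI)
 assume "module R N" then interpret N: mdl R N by rule
 show "0[N]:$N" "0[N] = 0[N]+[N] 0[N]" "a:$R==> 0[N] = a*[N] 0[N]" for a by auto
qed auto

lemma lm_add: assumes "lm R M N f" "lm R M N g" shows "lm R M N (%x. f x+[N] g x)"
proof -
 interpret N: mdl R N using lmD(2)[OF assms(1)] by rule
 note D = lmD[OF assms(1)] lmD[OF assms(2)]
 show ?thesis by(rule lmI) (simp_all add:D N.a_ac N.smult_r_distr)
qed

lemma lm_smult: assumes "lm R M N f" "a:$R" shows "lm R M N (%x. a*[N] f x)"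
proof -
 interpret N: mdl R N using lmD(2)[OF assms(1)] by rule
 note D = lmD[OF assms(1)]
 show ?thesis
 proof (rule lmI)
  fix b x assume "b:$R" "x:$M"
  thus "a*[N] f (b*[M] x) = b*[N] (a*[N] f x)"
   using assms by(simp add:D N.smult_assoc1[symmetric] N.m_comm)
 qed (simp_all add:D assms N.smult_r_distr)
qed

lemma lm_neg: assumes "lm R M N f" shows "lm R M N (%x. \<ominus>\<^bsub>N\<^esub> f x)"
proof -
 interpret N: mdl R N using lmD(2)[OF assms(1)] by rule
 note D = lmD[OF assms(1)]
 show ?thesis by(rule lmI) (simp_all add:D N.minus_add N.a_comm N.smult_r_minus)
qed

lemma lm_diff: assumes "lm R M N f" "lm R M N g" shows "lm R M N (%x. f x-[N] g x)"
proof -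
 interpret N: mdl R N using lmD(2)[OF assms(1)] by rule
 show ?thesis using lm_add[OF assms(1) lm_neg[OF assms(2)]] by(simp add:N.minus_eq)
qed

lemma lm_sum:
 assumes "module R M" "module R N" "finite I" "!!i. i:I==> lm R M N (h i)"
 shows "lm R M N (%x.##[N]i:I. h i x)"
 using assms(3,4)
proof (induct)
 case empty
 interpret N: mdl R N by rule fact
 show ?case using lm_zero[OF assms(1,2)] by simp
next
 case (insert j I)
 interpret N: mdl R N by rule fact
 interpret M: mdl R M by rule fact
 have "lm R M N (%x. h j x+[N] (##[N]i:I. h i x))" using insert by(auto intro:lm_add)
 moreover have "(##[N]i:insert j I. h i x) = h j x+[N] (##[N]i:I. h i x)" if "x:$M" for x
 proof -
  have "(%i. h i x):I \<rightarrow> $N" "h j x:$N" using that by(auto intro!: lmD(3)[OF insert.prems])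
  thus "(##[N]i:insert j I. h i x) = h j x+[N] (##[N]i:I. h i x)"
   using insert by simp
 qed
 ultimately show ?case by(auto simp:lm_def lin_map_def)
qed

lemma lm_finsum:
 assumes "lm R M N f" "finite I" "!!i. i:I==> h i:$M"
 shows "f (##[M]i:I. h i) = (##[N]i:I. f (h i))"
proof -
 interpret M: mdl R M using lmD(1)[OF assms(1)] by rule
 interpret N: mdl R N using lmD(2)[OF assms(1)] by rule
 show ?thesis using assms(2,3)
  by(induct) (simp_all add:lmD[OF assms(1)] Pi_def)
qed

lemma lm_ker: assumes "lm R M N f" shows "sm R M {x:$M. f x = 0[N]}"
proof -
 interpret M: mdl R M using lmD(1)[OF assms(1)] by rule
 interpret N: mdl R N using lmD(2)[OF assms(1)] by rule
 show ?thesis by(auto simp:sm_def lmD[OF assms])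
qed

lemma lm_vimage: assumes "lm R M N f" "sm R N U" shows "sm R M {x:$M. f x:U}"
proof -
 interpret M: mdl R M using lmD(1)[OF assms(1)] by rule
 interpret N: mdl R N using lmD(2)[OF assms(1)] by rule
 show ?thesis using assms(2) by(auto simp:sm_def lmD[OF assms(1)])
qed

lemma lm_image: assumes "lm R M N f" "sm R M U" shows "sm R N (f ` U)"
proof -
 interpret M: mdl R M using lmD(1)[OF assms(1)] by rule
 interpret N: mdl R N using lmD(2)[OF assms(1)] by rule
 note D = lmD[OF assms(1)] and S = M.smD[OF assms(2)]
 show ?thesis unfolding sm_def
 proof (intro conjI ballI)
  show "f ` U<:$N" using D S by auto
  show "0[N]:f ` U" using D(6) S(2) by(metis imageI)
  fix x assume x: "x:f ` U"
  show "x+[N] y:f ` U" if "y:f ` U" for y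
  proof -
   obtain u v where "u:U" "v:U" "x = f u" "y = f v" using x \<open>y:f ` U\<close> by blast
   hence "x+[N] y = f (u+[M] v)" "u+[M] v:U" using D(4) S by auto
   thus ?thesis by blast
  qed
  show "a*[N] x:f ` U" if "a:$R" for a
  proof -
   obtain u where "u:U" "x = f u" using x by blast
   hence "a*[N] x = f (a*[M] u)" "a*[M] u:U" using D(5) S \<open>a:$R\<close> by auto
   thus ?thesis by blast
  qed
 qed
qed

lemma lm_image_spn:
 assumes "lm R M N f" "V<:$M" shows "f ` spn R M V = spn R N (f ` V)"
proof
 interpret M: mdl R M using lmD(1)[OF assms(1)] by rule
 interpret N: mdl R N using lmD(2)[OF assms(1)] by rule
 have fX: "f ` V<:$N" using assms(2) lmD(3)[OF assms(1)] by blast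
 show "spn R N (f ` V)<:f ` spn R M V"
  using N.spn_least[OF lm_image[OF assms(1) M.spn_sm[OF assms(2)]]] M.spn_incl[OF assms(2)] by blast
 have "spn R M V<:{x:$M. f x:spn R N (f ` V)}"
  using M.spn_least[OF lm_vimage[OF assms(1) N.spn_sm[OF fX]]] assms(2) N.spn_incl[OF fX] by blast
 thus "f ` spn R M V<:spn R N (f ` V)" by blast
qed

lemma lm_inj: assumes "lm R M N f" "!!x. x:$M==> f x = 0[N]==> x = 0[M]"
 shows "inj_on f ($M)"
proof (rule inj_onI)
 interpret M: mdl R M using lmD(1)[OF assms(1)] by rule
 interpret N: mdl R N using lmD(2)[OF assms(1)] by rule
 fix x y assume "x:$M" "y:$M" "f x = f y"
 thus "x = y" using assms(2)[of "x-[M] y"] lmD[OF assms(1)]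
  by(metis M.diff_eq_iff M.minus_closed N.diff_eq_iff)
qed

lemma sesD:
 assumes "ses R V Y Z f g"
 shows "lm R V Y f" "lm R Y Z g" "inj_on f ($V)" "module R V" "module R Y" "module R Z"
  "x:$V==> g (f x) = 0[Z]"
  "z:$Z==> EX y:$Y. g y = z"
  "y:$Y==> g y = 0[Z]==> EX x:$V. f x = y"
  "x:$V==> f x = 0[Y]==> x = 0[V]"
proof -
 show *: "lm R V Y f" "lm R Y Z g" "inj_on f ($V)" using assms by(auto simp:ses_def)
 show "module R V" "module R Y" "module R Z" using * lmD by blast+
 show "x:$V==> g (f x) = 0[Z]" using assms unfolding ses_def by blast
 show "z:$Z==> EX y:$Y. g y = z" proof -
  have "$Z = g ` $Y" using assms by(simp add:ses_def)
  thus "z:$Z==> EX y:$Y. g y = z" by auto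
 qed
 show "y:$Y==> g y = 0[Z]==> EX x:$V. f x = y"
  using assms unfolding ses_def by(metis (mono_tags, lifting) image_iff mem_Collect_eq)
 interpret V: mdl R V by rule fact
 show "x:$V==> f x = 0[Y]==> x = 0[V]"
  using *(3) lmD(6)[OF *(1)] by(metis V.zero_closed inj_onD)
qed

lemma sesI:
 assumes "lm R V Y f" "lm R Y Z g"
  "!!x. x:$V==> f x = 0[Y]==> x = 0[V]"
  "!!z. z:$Z==> EX y:$Y. g y = z"
  "!!x. x:$V==> g (f x) = 0[Z]"
  "!!y. y:$Y==> g y = 0[Z]==> EX x:$V. f x = y"
 shows "ses R V Y Z f g"
 unfolding ses_def
proof (intro conjI)
 show "g ` $Y = $Z" using assms(4) lmD(3)[OF assms(2)] by blast
 show "f ` $V = {y:$Y. g y = 0[Z]}" using assms(5,6) lmD(3)[OF assms(1)] by blast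
qed (use assms lm_inj[OF assms(1)] in blast)+

lemma ses_kernel:
 assumes "lm R Y Z g" "g ` $Y = $Z"
 shows "ses R (Y\<lparr>carrier := {y:$Y. g y = 0[Z]}\<rparr>) Y Z (%x. x) g"
proof -
 interpret Y: mdl R Y using lmD(1)[OF assms(1)] by rule
 show ?thesis using assms Y.sm_lm[OF lm_ker[OF assms(1)]] by(auto simp:ses_def)
qed

text \<open>\<open>f\<close> is injective, so the preimage of \<open>h w\<close> is unique;
  uniqueness makes the chosen map linear.\<close>

lemma ses_lift:
 assumes s: "ses R V Y Z f g" and h: "lm R W Y h" and z: "!!w. w:$W==> g (h w) = 0[Z]"
 shows "EX h'. lm R W V h' & (ALL w:$W. f (h' w) = h w)"
proof -
 note D = sesD[OF s]
 interpret V: mdl R V by rule fact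
 interpret Y: mdl R Y by rule fact
 interpret W: mdl R W using lmD(1)[OF h] by rule
 have "ALL w:$W. EX x:$V. f x = h w" using D(9) lmD(3)[OF h] z by blast
 then obtain h' where h': "!!w. w:$W==> h' w:$V & f (h' w) = h w" by metis
 have "lm R W V h'"
 proof (rule lmI)
  fix w v assume w: "w:$W" "v:$W"
  hence "f (h' (w+[W] v)) = f (h' w+[V] h' v)" by(simp add:h' lmD[OF h] lmD[OF D(1)])
  thus "h' (w+[W] v) = h' w+[V] h' v"
   using inj_onD[OF D(3)] w h' W.a_closed V.a_closed by metis
 next
  fix a w assume w: "a:$R" "w:$W"
  hence "f (h' (a*[W] w)) = f (a*[V] h' w)" by(simp add:h' lmD[OF h] lmD[OF D(1)])
  thus "h' (a*[W] w) = a*[V] h' w"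
   using inj_onD[OF D(3)] w h' W.smult_closed V.smult_closed by metis
 qed (use W.module_axioms D h' in auto)
 thus ?thesis using h' by blast
qed

lemma ses_descend:
 assumes g: "lm R Y Z g" "g ` $Y = $Z" and h: "lm R Y W h"
  and z: "!!y. y:$Y==> g y = 0[Z]==> h y = 0[W]"
 shows "EX h'. lm R Z W h' & (ALL y:$Y. h' (g y) = h y)"
proof -
 interpret Y: mdl R Y using lmD(1)[OF h] by rule
 interpret W: mdl R W using lmD(2)[OF h] by rule
 interpret Z: mdl R Z using lmD(2)[OF g(1)] by rule
 have eq: "h y = h y'" if "y:$Y" "y':$Y" "g y = g y'" for y y'
 proof -
  have "g (y-[Y] y') = 0[Z]" using that lmD[OF g(1)] by(simp add:Z.diff_eq_iff)
  hence "h (y-[Y] y') = 0[W]" using z that by simp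
  thus ?thesis using that lmD[OF h] by(simp add:W.diff_eq_iff)
 qed
 define h' where "h' z = h (SOME y. y:$Y & g y = z)" for z
 have h': "h' (g y) = h y" if "y:$Y" for y
 proof -
  have "(SOME y'. y':$Y & g y' = g y):$Y & g (SOME y'. y':$Y & g y' = g y) = g y"
   by(rule someI[of _ y]) (use that in simp)
  thus ?thesis unfolding h'_def using eq that by blast
 qed
 have "lm R Z W h'"
 proof (rule lmI)
  fix x y assume "x:$Z" "y:$Z"
  then obtain u v where uv: "u:$Y" "v:$Y" "x = g u" "y = g v" using g(2) by blast
  hence "h' (x+[Z] y) = h' (g (u+[Y] v))" by(simp add:lmD[OF g(1)])
  thus "h' (x+[Z] y) = h' x+[W] h' y" using uv h' by(simp add:lmD[OF h])
 next
  fix a x assume a: "a:$R" and "x:$Z"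
  then obtain u where u: "u:$Y" "x = g u" using g(2) by blast
  hence "h' (a*[Z] x) = h' (g (a*[Y] u))" using a by(simp add:lmD[OF g(1)])
  thus "h' (a*[Z] x) = a*[W] h' x" using u h' a by(simp add:lmD[OF h])
 next
  fix x assume "x:$Z" thus "h' x:$W"
  proof -
   assume "x:$Z"
   then obtain u where "u:$Y" "x = g u" using g(2) by blast
   thus ?thesis using h' lmD(3)[OF h] by simp
  qed
 qed (use Z.module_axioms W.module_axioms in auto)
 thus ?thesis using h' by blast
qed

text \<open>Transport of structure along \<open>q\<close>, computed on chosen preimages. An
  injective \<open>q\<close> merely renames elements; a \<open>q\<close> that selects coset
  representatives produces a quotient.\<close>

definition imod :: "('a,'b) module=> ('b=> 'e)=> ('a,'e) module" where
 "imod M q = (undefined :: ('a,'e) module)\<lparr>carrier := q ` $M,zero := q 0[M],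
add := (%u v. q (inv_into ($M) q u+[M] inv_into ($M) q v)),
smult := (%a u. q (a*[M] inv_into ($M) q u))\<rparr>"

lemma imod:
 assumes M: "module R M" and U: "sm R M U"
  and q: "!!x y. x:$M==> y:$M==> q x = q y \<longleftrightarrow> x-[M] y:U"
 shows "lm R M (imod M q) q" "q ` $M = $(imod M q)"
  "{x:$M. q x = 0[imod M q]} = U"
proof -
 interpret M: mdl R M by rule fact
 let ?i = "inv_into ($M) q" and ?Q = "imod M q"
 note S = M.smD[OF U]
 have i: "?i (q x):$M" "?i (q x)-[M] x:U" if "x:$M" for x
  using that by(auto simp:inv_into_into q[symmetric] f_inv_into_f)
 have add:"q x+[?Q] q y = q (x+[M] y)" if "x:$M" "y:$M" for x y
 proof -
  have "(?i (q x)+[M] ?i (q y))-[M] (x+[M] y):U"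
   using i that S(3) by(simp add:M.diff_add_diff)
  thus ?thesis using q i that by(simp add:imod_def)
 qed
 have smult: "a*[?Q] q x = q (a*[M] x)" if "x:$M" "a:$R" for x a
 proof -
  have "a*[M] ?i (q x)-[M] a*[M] x:U"
   using i that S(4) by(simp add:M.smult_diff[symmetric])
  thus ?thesis using q i that by(simp add:imod_def)
 qed
 have zero: "0[?Q] = q 0[M]" by(simp add:imod_def)
 show c: "q ` $M = $?Q" by(simp add:imod_def)
 have "module R ?Q"
 proof (rule moduleI)
  show "abelian_group ?Q"
  proof (rule abelian_groupI)
   fix x assume "x:$?Q"
   then obtain u where u: "u:$M" "x = q u" using c by blast
   show "0[?Q]+[?Q] x = x" using u by(simp add:zero add)
   show "EX y:$?Q. y+[?Q] x = 0[?Q]"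
    using u c by(intro bexI[of _ "q (\<ominus>\<^bsub>M\<^esub> u)"]) (auto simp:add zero M.l_neg)
   fix y assume "y:$?Q"
   then obtain v where v: "v:$M" "y = q v" using c by blast
   show "x+[?Q] y:$?Q" using u v c by(auto simp:add)
   show "x+[?Q] y = y+[?Q] x" using u v by(simp add:add M.a_comm)
   fix z assume "z:$?Q"
   then obtain w where w: "w:$M" "z = q w" using c by blast
   show "x+[?Q] y+[?Q] z = x+[?Q] (y+[?Q] z)" using u v w by(simp add:add M.a_assoc)
  qed (use c zero in auto)
  fix a x assume a: "a:$R" and "x:$?Q"
  then obtain u where u: "u:$M" "x = q u" using c by blast
  show "a*[?Q] x:$?Q" using a u c by(auto simp:smult)
  { fix b assume b: "b:$R"
   show "(a+[R] b)*[?Q] x = a*[?Q] x+[?Q] b*[?Q] x"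
    using a b u by(simp add:smult add M.smult_l_distr)
   show "(a \<otimes>\<^bsub>R\<^esub> b)*[?Q] x = a*[?Q] (b*[?Q] x)"
    using a b u by(simp add:smult M.smult_assoc1) }
  fix y assume "y:$?Q"
  then obtain v where v: "v:$M" "y = q v" using c by blast
  show "a*[?Q] (x+[?Q] y) = a*[?Q] x+[?Q] a*[?Q] y"
   using a u v by(simp add:smult add M.smult_r_distr)
 next
  fix x assume "x:$?Q"
  then obtain u where u: "u:$M" "x = q u" using c by blast
  thus "\<one>\<^bsub>R\<^esub> *[?Q] x = x" by(simp add:smult)
 qed (rule M.R.cring_axioms)
 thus "lm R M ?Q q" using M c by(intro lmI) (auto simp:add smult)
 show "{x:$M. q x = 0[?Q]} = U"
  using S(1) q[OF _ M.zero_closed] by(auto simp:zero M.diff_zero)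
qed

text \<open>Choosing one representative in each coset realises the quotient on the element type of
  \<open>M\<close>; sets of cosets would leave the type \<open>'a umod\<close>.\<close>

lemma ex_quot:
 assumes "module R M" "sm R M U"
 shows "EX (Q :: ('a,'b) module) q. lm R (M :: ('a,'b) module) Q q & q ` $M = $Q &
(ALL x:$M. q x = 0[Q] \<longleftrightarrow> x:U)"
proof -
 interpret M: mdl R M by rule fact
 note S = M.smD[OF assms(2)]
 define q where "q x = (SOME y. y:$M & x-[M] y:U)" for x
 have *: "x-[M] z:U \<longleftrightarrow> y-[M] z:U" if "x:$M" "y:$M" "z:$M" "x-[M] y:U" for x y z
 proof -
  have 1: "x-[M] z = (x-[M] y)+[M] (y-[M] z)"
   using that by(simp add:M.minus_eq M.a_ac M.r_neg2 M.r_neg1)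
  have "y-[M] z = (x-[M] z)-[M] (x-[M] y)"
   unfolding 1 using that by(metis M.a_comm M.diff_add_cancel M.minus_closed)
  thus ?thesis using 1 S that by metis
 qed
 have qx: "q x:$M & x-[M] q x:U" if "x:$M" for x
  unfolding q_def using someI[of "%y. y:$M & x-[M] y:U" x] that S(2) M.diff_self[OF that] by auto
 have "q x = q y \<longleftrightarrow> x-[M] y:U" if "x:$M" "y:$M" for x y
 proof
  assume "x-[M] y:U"
  hence "(%z. z:$M & x-[M] z:U) = (%z. z:$M & y-[M] z:U)"
   using * that by blast
  thus "q x = q y" unfolding q_def by simp
 next
  assume "q x = q y"
  hence "x-[M] q y:U" "y-[M] q y:U" using qx[OF that(1)] qx[OF that(2)] by simp_all
  thus "x-[M] y:U"
   using *[OF that(1) conjunct1[OF qx[OF that(2)]] that(2)] *[OF that(2) conjunct1[OF qx[OF that(2)]] that(2)]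
    M.diff_self[OF that(2)] S(2) by simp
 qed
 from imod[OF assms this] show ?thesis by blast
qed

lemma fin_gen_surj:
 assumes "lm R M N f" "f ` $M = $N" "fin_gen R M" shows "fin_gen R N"
proof -
 interpret M: mdl R M using lmD(1)[OF assms(1)] by rule
 interpret N: mdl R N using lmD(2)[OF assms(1)] by rule
 obtain V where V: "finite V" "V<:$M" "$M<:spn R M V" using assms(3) M.fin_gen_iff by blast
 hence "$N<:spn R N (f ` V)" using lm_image_spn[OF assms(1) V(2)] assms(2) by blast
 thus ?thesis using N.fin_gen_iff V lmD(3)[OF assms(1)] by(metis assms(2) finite_imageI image_mono)
qed

lemma fin_gen_ext:
 assumes s: "ses R V Y Z f g" "fin_gen R V" "fin_gen R Z" shows "fin_gen R Y"
proof -
 note D = sesD[OF s(1)]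
 interpret V: mdl R V by rule fact
 interpret Y: mdl R Y by rule fact
 interpret Z: mdl R Z by rule fact
 obtain A where A: "finite A" "A<:$V" "$V<:spn R V A" using s V.fin_gen_iff by blast
 obtain B where B: "finite B" "B<:$Z" "$Z<:spn R Z B" using s Z.fin_gen_iff by blast
 obtain r where r: "!!z. z:$Z==> r z:$Y & g (r z) = z" using D(8) by metis
 let ?C = "f ` A \<union> r ` B"
 have C: "?C<:$Y" using A B r lmD(3)[OF D(1)] by blast
 have grB: "g ` (r ` B) = B" using r B(2) by force
 have "y:spn R Y ?C" if y: "y:$Y" for y
 proof -
  have "g y:spn R Z (g ` r ` B)" using y B lmD(3)[OF D(2)] grB by auto
  then obtain u where u: "u:spn R Y (r ` B)" "g u = g y"
   using lm_image_spn[OF D(2), of "r ` B"] C by(metis (no_types, lifting) Un_subset_iff imageE)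
  have rB: "r ` B<:$Y" and fA: "f ` A<:$Y" using C by auto
  have u1: "u:spn R Y ?C" using u Y.spn_least[OF Y.spn_sm[OF C], of "r ` B"] Y.spn_incl[OF C] by blast
  have uc: "u:$Y" using Y.spn_closed[OF rB] u by blast
  hence "g (y-[Y] u) = 0[Z]" using u y lmD[OF D(2)] by(simp add:Z.diff_eq_iff)
  then obtain x where x: "x:$V" "f x = y-[Y] u" using D(9)[of "y-[Y] u"] y uc by auto
  hence "y-[Y] u:spn R Y (f ` A)" using A lm_image_spn[OF D(1) A(2)] by(metis image_eqI subsetD)
  hence "y-[Y] u:spn R Y ?C" using Y.spn_least[OF Y.spn_sm[OF C], of "f ` A"] Y.spn_incl[OF C] by blast
  from Y.spn_add[OF C this u1] show ?thesis using y uc by(simp add:Y.add_diff_cancel)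
 qed
 thus ?thesis using Y.fin_gen_iff A(1) B(1) C by(metis finite_UnI finite_imageI subsetI)
qed

section \<open>Noetherian modules and biproducts\<close>

lemma (in cring) ideal_intro:
 assumes "J<:$R" "#0:J" "!!x y. x:J==> y:J==> x +: y:J"
  "!!a x. a:$R==> x:J==> a*:x:J"
 shows "ideal J R"
proof (rule idealI[OF ring_axioms])
 have neg: "\<ominus> x:J" if "x:J" for x
 proof -
  have "\<ominus> x = (\<ominus> #1)*:x" using that assms(1) by(auto simp:l_minus)
  thus ?thesis using assms(4)[of "\<ominus> #1" x] that by simp
 qed
 show "subgroup J (add_monoid R)"
  using assms neg by(intro add.subgroupI) (auto simp:a_inv_def)
 fix a x assume a: "a:J" "x:$R"
 thus "x*:a:J" using assms by blast
 thus "a*:x:J" using a assms(1) m_comm by(metis subsetD)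
qed

lemma spn_carrier_upd: "spn R (M\<lparr>carrier := U\<rparr>) V = spn R M V"
proof
 show "spn R (M\<lparr>carrier := U\<rparr>) V<:spn R M V"
 proof
  fix x assume "x:spn R (M\<lparr>carrier := U\<rparr>) V"
  thus "x:spn R M V" by(induct rule: spn.induct) (auto intro:spn.intros)
 qed
 show "spn R M V<:spn R (M\<lparr>carrier := U\<rparr>) V"
 proof
  fix x assume "x:spn R M V"
  thus "x:spn R (M\<lparr>carrier := U\<rparr>) V"
   by(induct rule: spn.induct)
    (use spn.intros[where M="M\<lparr>carrier := U\<rparr>" and R=R and V=V] in auto)
 qed
qed

context mdl begin

lemma spn_mono: "V<:W==> W<:$M==> spn R M V<:spn R M W"
 by(meson order_trans spn_incl spn_least spn_sm subsetI subset_iff)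

lemma spn_insert:
 assumes "x:$M" "V<:$M"
 shows "spn R M (insert x V) = {r*[M] x+[M] m | r m. r:$R & m:spn R M V}" (is "?L = ?R")
proof
 have iV: "insert x V<:$M" using assms by auto
 have "sm R M ?R" unfolding sm_def
 proof (intro conjI ballI)
  show "?R<:$M" using assms spn_closed[OF assms(2)] by auto
  show "0[M]:?R"
   using assms spn.zero[of M R V] by(intro CollectI exI[of _ "#0"] exI[of _ "0[M]"]) auto
  fix u assume "u:?R"
  then obtain r m where u: "u = r*[M] x+[M] m" "r:$R" "m:spn R M V" by blast
  have mc: "m:$M" using spn_closed[OF assms(2)] u by blast
  { fix v assume "v:?R"
   then obtain s n where v: "v = s*[M] x+[M] n" "s:$R" "n:spn R M V" by blast
   have nc: "n:$M" using spn_closed[OF assms(2)] v by blast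
   have "u+[M] v = (r +: s)*[M] x+[M] (m+[M] n)"
    using u v mc nc assms by(simp add:smult_l_distr M.a_ac)
   thus "u+[M] v:?R" using u v spn_add[OF assms(2)] by blast }
  fix a assume a: "a:$R"
  have "a*[M] u = (a*:r)*[M] x+[M] a*[M] m"
   using u mc a assms by(simp add:smult_r_distr smult_assoc1)
  thus "a*[M] u:?R" using u a spn_smult[OF assms(2)] by blast
 qed
 moreover have "insert x V<:?R"
 proof -
  have "x = #1*[M] x+[M] 0[M]" using assms by simp
  hence "x:?R" using spn.zero[of M R V] by blast
  moreover have "v:?R" if "v:V" for v
  proof -
   have "v = #0*[M] x+[M] v" using assms that by auto
   thus ?thesis using spn_incl[OF assms(2) that] by blast
  qed
  ultimately show ?thesis by blast
 qed
 ultimately show "?L<:?R" by(rule spn_least)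
 show "?R<:?L"
  using spn_incl[OF iV, of x] spn_smult[OF iV, of _ x] spn_add[OF iV] spn_mono[OF _ iV, of V] by blast
qed

text \<open>Induction on the number of generators: the coefficients at \<open>x\<close> occurring in
  \<open>U\<close> form an ideal, and finitely many elements of \<open>U\<close> realise its
  generators. Subtracting combinations of these leaves the part of \<open>U\<close> inside the span
  of the other generators.\<close>

lemma noeth_spn:
 assumes N: "noetherian_ring R" and V: "finite V" "V<:$M" "sm R M U" "U<:spn R M V"
 shows "EX W. finite W & W<:U & U = spn R M W"
 using V
proof (induct arbitrary: U)
 case empty
 have "spn R M {}<:{0[M]}" using spn_least[OF sm_zero] by blast
 hence "U = {0[M]}" using empty smD(2) by blast
 moreover have "spn R M {} = {0[M]}" using \<open>spn R M {}<:{0[M]}\<close> spn.zero by blast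
 ultimately show ?case by blast
next
 case (insert x V)
 have xc: "x:$M" and Vc: "V<:$M" using insert by auto
 note S = smD[OF insert(5)]
 note spc = spn_closed[OF Vc] and spa = spn_add[OF Vc] and sps = spn_smult[OF Vc]
 define J where "J = {r:$R. EX m:spn R M V. r*[M] x+[M] m:U}"
 have idl: "ideal {r:$R. EX m:spn R M V. r*[M] x+[M] m:T} R" if T: "sm R M T" for T
 proof (rule R.ideal_intro)
  note ST = smD[OF T]
  show "#0:{r:$R. EX m:spn R M V. r*[M] x+[M] m:T}"
   using xc ST(2) spn.zero[of M R V] by(auto intro!: bexI[of _ "0[M]"])
  fix r assume "r:{r:$R. EX m:spn R M V. r*[M] x+[M] m:T}"
  then obtain m where m: "r:$R" "m:spn R M V" "r*[M] x+[M] m:T" by blast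
  { fix s assume "s:{r:$R. EX m:spn R M V. r*[M] x+[M] m:T}"
   then obtain n where n: "s:$R" "n:spn R M V" "s*[M] x+[M] n:T" by blast
   have "(r +: s)*[M] x+[M] (m+[M] n) = (r*[M] x+[M] m)+[M] (s*[M] x+[M] n)"
    using m n xc spc by(simp add:smult_l_distr M.a_ac)
   thus "r +: s:{r:$R. EX m:spn R M V. r*[M] x+[M] m:T}"
    using m n spa ST(3) by(intro CollectI conjI bexI[of _ "m+[M] n"]) auto }
  fix a assume a: "a:$R"
  have "(a*:r)*[M] x+[M] a*[M] m = a*[M] (r*[M] x+[M] m)"
   using m a xc spc by(simp add:smult_r_distr smult_assoc1)
  thus "a*:r:{r:$R. EX m:spn R M V. r*[M] x+[M] m:T}"
   using m a sps ST(4) by(intro CollectI conjI bexI[of _ "a*[M] m"]) auto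
 qed auto
 have "ideal J R" unfolding J_def using idl[OF insert(5)] .
 then obtain A where A: "A<:$R" "finite A" "J = genideal R A"
  using noetherian_ring.finetely_gen[OF N] by blast
 have AJ: "A<:J" using A R.genideal_self by blast
 hence "ALL a:A. EX m:spn R M V. a*[M] x+[M] m:U" unfolding J_def by blast
 then obtain mm where mm: "!!a. a:A==> mm a:spn R M V & a*[M] x+[M] mm a:U" by metis
 define uA where "uA = (%a. a*[M] x+[M] mm a) ` A"
 have uAU: "uA<:U" unfolding uA_def using mm by blast
 have uAf: "finite uA" unfolding uA_def using A(2) by simp
 have uAc: "uA<:$M" using uAU insert(5) unfolding sm_def by(meson order_trans)
 note uA = uAf uAU uAc
 have UV: "sm R M (U \<inter> spn R M V)" using insert(5) spn_sm[OF Vc] by(simp add:sm_def le_infI1)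
 obtain W where W: "finite W" "W<:U \<inter> spn R M V" "U \<inter> spn R M V = spn R M W"
  using insert(3)[OF Vc UV Int_lower2] by(elim exE conjE)
 let ?W = "W \<union> uA"
 have Wc: "?W<:$M" using W uA spc by blast
 have "J<:{r:$R. EX m:spn R M V. r*[M] x+[M] m:spn R M uA}"
  unfolding A(3)
 proof (rule R.genideal_minimal[OF idl[OF spn_sm[OF uA(3)]]])
  show "A<:{r:$R. EX m:spn R M V. r*[M] x+[M] m:spn R M uA}"
  proof
   fix a assume a: "a:A"
   have "a*[M] x+[M] mm a:spn R M uA" using spn_incl[OF uA(3)] a unfolding uA_def by blast
   thus "a:{r:$R. EX m:spn R M V. r*[M] x+[M] m:spn R M uA}" using a A(1) mm by blast
  qed
 qed
 hence Jx: "EX m:spn R M V. r*[M] x+[M] m:spn R M uA" if "r:J" for r using that by blast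
 have "u:spn R M ?W" if u: "u:U" for u
 proof -
  have "u:spn R M (insert x V)" using u insert by blast
  then obtain r m where r: "u = r*[M] x+[M] m" "r:$R" "m:spn R M V"
   using spn_insert[OF xc Vc] by blast
  hence "r:J" using u unfolding J_def by blast
  then obtain m' where m': "m':spn R M V" "r*[M] x+[M] m':spn R M uA" using Jx by blast
  let ?w = "r*[M] x+[M] m'"
  have c: "m:$M" "m':$M" using r m' spc by auto
  \<comment> \<open>\<open>u\<close> and \<open>?w\<close> have the same coefficient at
    \<open>x\<close>, so their difference falls into the span of \<open>V\<close>, where the
    induction hypothesis applies.\<close>
  have "u-[M] ?w = m-[M] m'"
   using r c xc by(simp add:M.diff_add_diff M.diff_self)
  hence 1: "u-[M] ?w:spn R M V" using smD(6)[OF spn_sm[OF Vc]] r m' by simp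
  have wU: "?w:U" using spn_least[OF insert(5) uA(2)] m' by blast
  hence "u-[M] ?w:spn R M W" using 1 u S(6) W(3) by blast
  hence 2: "u-[M] ?w:spn R M ?W" using spn_mono[OF _ Wc, of W] by blast
  have 3: "?w:spn R M ?W" using m' spn_mono[OF _ Wc, of uA] by blast
  show ?thesis using spn_add[OF Wc 2 3] u wU S(1) by(simp add:M.add_diff_cancel)
 qed
 moreover have "spn R M ?W<:U" using spn_least[OF insert(5)] W uA by blast
 ultimately show ?case using W(1,2) uA by(intro exI[of _ ?W]) blast
qed

lemma noeth_sub:
 assumes "noetherian_ring R" "fin_gen R M" "sm R M U" shows "fin_gen R (M\<lparr>carrier := U\<rparr>)"
proof -
 obtain V where V: "finite V" "V<:$M" "$M<:spn R M V" using assms fin_gen_iff by blast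
 then obtain W where W: "finite W" "W<:U" "U = spn R M W"
  using noeth_spn[OF assms(1) V(1,2) assms(3)] smD(1)[OF assms(3)] by blast
 interpret U: mdl R "M\<lparr>carrier := U\<rparr>" by(rule mdl.intro) (rule sm_module[OF assms(3)])
 show ?thesis unfolding U.fin_gen_iff using W by(auto simp:spn_carrier_upd)
qed

end

lemma fin_gen_kernel:
 assumes "noetherian_ring R" "ses R V Y Z f g" "fin_gen R Y" shows "fin_gen R V"
proof -
 note D = sesD[OF assms(2)]
 interpret V: mdl R V by rule fact
 interpret Y: mdl R Y by rule fact
 let ?U = "f ` $V"
 have U: "sm R Y ?U" using lm_image[OF D(1) V.sm_carrier] .
 have 1: "ses R (Y\<lparr>carrier := ?U\<rparr>) Y Z (%x. x) g"
  using ses_kernel[OF D(2)] assms(2) unfolding ses_def by metis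
 obtain h where h: "lm R (Y\<lparr>carrier := ?U\<rparr>) V h" "ALL w:$(Y\<lparr>carrier := ?U\<rparr>). f (h w) = w"
  using ses_lift[OF assms(2) sesD(1)[OF 1]] sesD(7)[OF 1] by blast
 have "h (f v) = v" if "v:$V" for v
  using h that lmD(3)[OF h(1)] inj_onD[OF D(3)] by(metis imageI partial_object.select_convs(1) partial_object.update_convs(1) partial_object.surjective)
 hence "h ` $(Y\<lparr>carrier := ?U\<rparr>) = $V" using lmD(3)[OF h(1)] by force
 thus ?thesis using fin_gen_surj[OF h(1)] Y.noeth_sub[OF assms(1,3) U] by blast
qed

section \<open>Direct sums on the fixed element type\<close>

definition bip :: "('a,'c) ring_scheme=> 'a umod=> 'a umod=> 'a umod =>
((nat=> 'a)=> nat=> 'a)=> ((nat=> 'a)=> nat=> 'a)=> ((nat=> 'a)=> nat=> 'a)=> ((nat=> 'a)=> nat=> 'a)=> bool" where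
 "bip R M N P p q i j \<longleftrightarrow> lm R P M p & lm R P N q & lm R M P i & lm R N P j &
(ALL x:$M. p (i x) = x & q (i x) = 0[N]) & (ALL y:$N. q (j y) = y & p (j y) = 0[M]) &
(ALL w:$P. w = i (p w)+[P] j (q w))"

lemma bipD:
 assumes "bip R M N P p q i j"
 shows "lm R P M p" "lm R P N q" "lm R M P i" "lm R N P j"
  "x:$M==> p (i x) = x" "x:$M==> q (i x) = 0[N]"
  "y:$N==> q (j y) = y" "y:$N==> p (j y) = 0[M]"
  "w:$P==> w = i (p w)+[P] j (q w)"
  "x:$M==> y:$N==> p (i x+[P] j y) = x"
  "x:$M==> y:$N==> q (i x+[P] j y) = y"
  "x:$M==> y:$N==> i x+[P] j y:$P"
  "module R M" "module R N" "module R P"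
  "w:$P==> p w = 0[M]==> q w = 0[N]==> w = 0[P]"
proof -
 show *: "lm R P M p" "lm R P N q" "lm R M P i" "lm R N P j"
  "x:$M==> p (i x) = x" "x:$M==> q (i x) = 0[N]"
  "y:$N==> q (j y) = y" "y:$N==> p (j y) = 0[M]"
  "w:$P==> w = i (p w)+[P] j (q w)" for x y w
  using assms unfolding bip_def by blast+
 show m: "module R M" "module R N" "module R P" using * lmD by blast+
 interpret M: mdl R M by rule fact
 interpret N: mdl R N by rule fact
 interpret P: mdl R P by rule fact
 show "x:$M==> y:$N==> p (i x+[P] j y) = x"
  using lmD(4)[OF *(1), of "i x" "j y"] lmD(3)[OF *(3)] lmD(3)[OF *(4)] *(5,8) by simp
 show "x:$M==> y:$N==> q (i x+[P] j y) = y"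
  using lmD(4)[OF *(2), of "i x" "j y"] lmD(3)[OF *(3)] lmD(3)[OF *(4)] *(6,7) by simp
 show "x:$M==> y:$N==> i x+[P] j y:$P"
  using lmD(3)[OF *(3)] lmD(3)[OF *(4)] by simp
 show "w:$P==> p w = 0[M]==> q w = 0[N]==> w = 0[P]"
  using *(9)[of w] lmD(6)[OF *(3)] lmD(6)[OF *(4)] by simp
qed

text \<open>Packs two sequences into the even and odd positions of one, so that pairs of module
  elements again have the type \<open>nat => 'a\<close>.\<close>

definition interleave :: "(nat=> 'a) \<times> (nat=> 'a)=> nat=> 'a" where
 "interleave z = (%i. if even i then fst z (i div 2) else snd z (i div 2))"

lemma inj_interleave: "inj interleave"
proof (rule injI)
 fix z z' :: "(nat=> 'a) \<times> (nat=> 'a)" assume eq: "interleave z = interleave z'"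
 have "fst z i = fst z' i" "snd z i = snd z' i" for i
  using fun_cong[OF eq, of "2 * i"] fun_cong[OF eq, of "Suc (2 * i)"] by(auto simp:interleave_def)
 thus "z = z'" by(simp add:prod_eq_iff ext)
qed

definition pairmod :: "('a,'b) module=> ('a,'e) module=> ('a,'b \<times> 'e) module" where
 "pairmod M N = (undefined :: ('a,'b \<times> 'e) module)\<lparr>carrier := $M \<times> $N,
zero := (0[M],0[N]),add := (%u v.(fst u+[M] fst v,snd u+[N] snd v)),
smult := (%a u.(a*[M] fst u,a*[N] snd u))\<rparr>"

lemma module_pairmod:
 assumes "module R M" "module R N" shows "module R (pairmod M N)"
proof -
 interpret M: mdl R M by rule fact
 interpret N: mdl R N by rule fact
 show ?thesis
 proof (rule moduleI)
  show "abelian_group (pairmod M N)"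
  proof (rule abelian_groupI)
   fix x assume "x:$(pairmod M N)"
   thus "EX y:$(pairmod M N). y+[pairmod M N] x = 0[pairmod M N]"
    by(intro bexI[of _ "(\<ominus>\<^bsub>M\<^esub> fst x,\<ominus>\<^bsub>N\<^esub> snd x)"]) (auto simp:pairmod_def M.l_neg N.l_neg)
  qed (auto simp:pairmod_def M.a_ac N.a_ac)
 qed (auto simp:pairmod_def M.R.cring_axioms M.smult_l_distr N.smult_l_distr M.smult_r_distr
   N.smult_r_distr M.smult_assoc1 N.smult_assoc1)
qed

lemma ex_bip:
 fixes M N :: "'a umod"
 assumes "module R M" "module R N"
 shows "EX (P :: 'a umod) p q i j. bip R M N P p q i j"
proof -
 interpret M: mdl R M by rule fact
 interpret N: mdl R N by rule fact
 let ?Q = "pairmod M N"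
 interpret Q: mdl R ?Q using module_pairmod[OF assms] by rule
 have q: "interleave x = interleave y \<longleftrightarrow> x-[?Q] y:{0[?Q]}" if "x:$?Q" "y:$?Q" for x y
  using that Q.diff_eq_iff[OF that] by(simp add:inj_eq[OF inj_interleave])
 note I = imod[OF Q.module_axioms Q.sm_zero, of interleave, OF q]
 let ?P = "imod ?Q interleave" let ?d = "inv_into UNIV interleave"
 have d: "?d (interleave z) = z" for z by(rule inv_f_f[OF inj_interleave])
 have c: "interleave ` $?Q = $?P" using I(2) by blast
 note L = I(1)
 have P: "module R ?P" using lmD(2)[OF L] .
 interpret P: mdl R ?P using P by rule
 have "lm R ?P ?Q ?d"
 proof (rule lmI)
  fix x y assume "x:$?P" "y:$?P"
  then obtain u v where "u:$?Q" "v:$?Q" "x = interleave u" "y = interleave v" using c by blast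
  thus "?d (x+[?P] y) = ?d x+[?Q] ?d y" using lmD(4)[OF L] d by metis
 next
  fix a x assume "a:$R" "x:$?P"
  then obtain u where "u:$?Q" "x = interleave u" using c by blast
  thus "?d (a*[?P] x) = a*[?Q] ?d x" using lmD(5)[OF L \<open>a:$R\<close>] d by metis
 next
  fix x assume "x:$?P" thus "?d x:$?Q" using c d by(metis imageE)
 qed (use P Q.module_axioms in auto)
 moreover have "lm R ?Q M fst" "lm R ?Q N snd" "lm R M ?Q (%x.(x,0[N]))" "lm R N ?Q (%y.(0[M],y))"
  using assms Q.module_axioms by(auto intro!: lmI simp:pairmod_def)
 ultimately have *: "lm R ?P M (%w. fst (?d w))" "lm R ?P N (%w. snd (?d w))"
  "lm R M ?P (%x. interleave (x,0[N]))" "lm R N ?P (%y. interleave (0[M],y))"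
  using lm_comp L by blast+
 have "w = interleave (fst (?d w),0[N])+[?P] interleave (0[M],snd (?d w))" if w: "w:$?P" for w
 proof -
  obtain u where u: "u:$?Q" "w = interleave u" using c w by blast
  have "(fst u,0[N]):$?Q" "(0[M],snd u):$?Q" "u = (fst u,0[N])+[?Q] (0[M],snd u)"
   using u by(auto simp:pairmod_def)
  thus ?thesis using lmD(4)[OF L] u d by metis
 qed
 hence "bip R M N ?P (%w. fst (?d w)) (%w. snd (?d w)) (%x. interleave (x,0[N])) (%y. interleave (0[M],y))"
  unfolding bip_def using * by(simp add:d)
 thus ?thesis by blast
qed

lemma bip_ses: "bip R M N P p q i j==> ses R M P N i q"
proof -
 assume b: "bip R M N P p q i j"
 note B = bipD[OF b]
 interpret P: mdl R P by(rule mdl.intro) (rule B)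
 show "ses R M P N i q"
 proof (rule sesI[OF B(3,2)])
  fix x assume "x:$M" "i x = 0[P]" thus "x = 0[M]" using B(5)[of x] lmD(6)[OF B(1)] by simp
 next
  fix z assume "z:$N" thus "EX y:$P. q y = z" using B(7) lmD(3)[OF B(4)] by blast
 next
  fix y assume "y:$P" "q y = 0[N]"
  hence "i (p y) = y" using B(9)[of y] lmD(6)[OF B(4)] lmD(3)[OF B(3)] lmD(3)[OF B(1)] by simp
  thus "EX x:$M. i x = y" using lmD(3)[OF B(1)] \<open>y:$P\<close> by blast
 qed (use B in auto)
qed

lemma bip_fin_gen: "bip R M N P p q i j==> fin_gen R M==> fin_gen R N==> fin_gen R P"
 using fin_gen_ext bip_ses by metis

section \<open>Maps factoring through sums, and additive closures\<close>

text \<open>Maps that are finite sums of composites through objects of \<open>CC\<close>. The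
  identity being such a map means membership in the additive closure; a scalar multiple of it being
  such a map is the near-projectivity used over \<open>S\<close>.\<close>

inductive fac :: "('a,'c) ring_scheme=> 'a umod set=> 'a umod=> 'a umod=> ((nat=> 'a)=> nat=> 'a)=> bool"
 for R CC M N where
 zero: "module R M==> module R N==> (!!x. x:$M==> h x = 0[N])==> fac R CC M N h"
| step: "fac R CC M N h==> Y:CC==> lm R M Y f==> lm R Y N g ==>
(!!x. x:$M==> h' x = g (f x)+[N] h x)==> fac R CC M N h'"

lemma lm_cong:
 assumes "lm R M N f" "!!x. x:$M==> f' x = f x" shows "lm R M N f'"
proof -
 interpret M: mdl R M using lmD(1)[OF assms(1)] by rule
 show ?thesis using assms by(auto simp:lm_def lin_map_def Pi_def)
qed

lemma fac_lm: "fac R CC M N h==> lm R M N h"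
proof (induct rule: fac.induct)
 case (zero h) thus ?case using lm_cong[OF lm_zero[OF zero(1,2)]] by blast
next
 case (step h Y f g h') thus ?case using lm_cong[OF lm_add[OF lm_comp[OF step(4,5)] step(2)]] by blast
qed

lemma fac_cong: "fac R CC M N h==> (!!x. x:$M==> h' x = h x)==> fac R CC M N h'"
 by(erule fac.cases) (auto intro:fac.intros)

lemma fac_add:
 assumes "fac R CC M N h" "fac R CC M N k" shows "fac R CC M N (%x. h x+[N] k x)"
 using assms(1)
proof (induct rule: fac.induct)
 case (zero h)
 interpret N: mdl R N by rule fact
 show ?case using zero lmD(3)[OF fac_lm[OF assms(2)]] by(intro fac_cong[OF assms(2)]) auto
next
 case (step h Y f g h')
 interpret N: mdl R N using lmD(2)[OF step(5)] by rule
 show ?case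
  using step lmD(3)[OF fac_lm[OF assms(2)]] lmD(3)[OF fac_lm[OF step(1)]] lmD(3)[OF lm_comp[OF step(4,5)]]
  by(intro fac.step[OF step(2-5)]) (simp add:N.a_assoc)
qed

lemma fac_post:
 assumes "fac R CC M N h" "lm R N Q k" shows "fac R CC M Q (%x. k (h x))"
 using assms(1)
proof (induct rule: fac.induct)
 case (zero h) thus ?case using lmD[OF assms(2)] by(intro fac.zero) auto
next
 case (step h Y f g h')
 thus ?case using lmD(3)[OF fac_lm[OF step(1)]] lmD(3)[OF lm_comp[OF step(4,5)]]
  by(intro fac.step[OF step(2,3,4) lm_comp[OF step(5) assms(2)]]) (simp add:lmD(4)[OF assms(2)])
qed

lemma fac_pre:
 assumes "fac R CC M N h" "lm R Q M k" shows "fac R CC Q N (%x. h (k x))"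
 using assms(1)
proof (induct rule: fac.induct)
 case (zero h) thus ?case using lmD(1,2,3)[OF assms(2)] by(intro fac.zero) auto
next
 case (step h Y f g h')
 thus ?case using lmD(3)[OF assms(2)]
  by(intro fac.step[OF step(2,3) lm_comp[OF assms(2) step(4)] step(5)]) simp
qed

lemma fac_one:
 assumes "Y:CC" "lm R M Y f" "lm R Y N g" shows "fac R CC M N (%x. g (f x))"
proof -
 interpret N: mdl R N using lmD(2)[OF assms(3)] by rule
 have M: "module R M" using lmD(1)[OF assms(2)] .
 show ?thesis using lmD(3)[OF lm_comp[OF assms(2,3)]]
  by(intro fac.step[OF fac.zero[OF M N.module_axioms, where h="%_. 0[N]"] assms]) auto
qed

text \<open>Translates between the inductive form and the indexed families of maps in
  \<open>add_cl\<close>.\<close>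

lemma fac_sum_iff:
 assumes CC: "!!Y. Y:CC==> module R Y" and M: "module R M" and N: "module R N"
 shows "fac R CC M N h \<longleftrightarrow> (EX (n::nat) Vs f g.(ALL i<n. Vs i:CC) &
(ALL i<n. lin_map R M (Vs i) (f i) & lin_map R (Vs i) N (g i)) &
(ALL x:$M. h x = (##[N]i:{..<n}. g i (f i x))))" (is "_ \<longleftrightarrow> ?R h")
proof
 interpret N: mdl R N by rule fact
 assume "fac R CC M N h" thus "?R h"
 proof (induct rule: fac.induct)
  case (zero h) thus ?case by(intro exI[of _ 0]) simp
 next
  case (step h Y f g h')
  from step(2) obtain n :: nat and Vs F G where *: "ALL i<n. Vs i:CC"
   "ALL i<n. lin_map R M (Vs i) (F i) & lin_map R (Vs i) N (G i)"
   "ALL x:$M. h x = (##[N]i:{..<n}. G i (F i x))" by(elim exE conjE) (erule (2) that)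
  let ?V = "Vs(n := Y)" and ?F = "F(n := f)" and ?G = "G(n := g)"
  have "h' x = (##[N]i:{..<Suc n}. ?G i (?F i x))" if x: "x:$M" for x
  proof -
   have c: "(%i. G i (F i x)):{..<n} \<rightarrow> $N" "g (f x):$N"
    using *(2) x step(4,5) by(auto simp:lin_map_def lm_def Pi_def)
   hence "(##[N]i:{..<n}. ?G i (?F i x)) = (##[N]i:{..<n}. G i (F i x))"
    by(intro N.finsum_cong') auto
   moreover have "(%i. ?G i (?F i x)):{..<n} \<rightarrow> $N" using c by auto
   ultimately show ?thesis using c x *(3) step(6) by(simp add:lessThan_Suc)
  qed
  thus ?case using * step(3-5)
   by(intro exI[of _ "Suc n"] exI[of _ ?V] exI[of _ ?F] exI[of _ ?G]) (auto simp:less_Suc_eq lm_def)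
 qed
next
 interpret N: mdl R N by rule fact
 assume "?R h"
 then obtain n :: nat and Vs f g where *: "ALL i<n. Vs i:CC"
   "ALL i<n. lin_map R M (Vs i) (f i) & lin_map R (Vs i) N (g i)"
   "ALL x:$M. h x = (##[N]i:{..<n}. g i (f i x))" by(elim exE conjE) (erule (2) that)
 have "fac R CC M N (%x.##[N]i:{..<k}. g i (f i x))" if "k <= n" for k
  using that
 proof (induct k)
  case 0 show ?case using M N by(intro fac.zero) auto
 next
  case (Suc k)
  have k: "Vs k:CC" "lm R M (Vs k) (f k)" "lm R (Vs k) N (g k)" using * Suc M N CC by(auto simp:lm_def)
  have "(%i. g i (f i x)):{..<k} \<rightarrow> $N" "g k (f k x):$N" if "x:$M" for x
   using *(2) that Suc(2) by(auto simp:lin_map_def Pi_def)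
  hence eq: "(##[N]i:{..<Suc k}. g i (f i x)) = g k (f k x)+[N] (##[N]i:{..<k}. g i (f i x))"
   if "x:$M" for x using that by(simp add:lessThan_Suc)
  have IH: "fac R CC M N (%x.##[N]i:{..<k}. g i (f i x))" using Suc by simp
  show ?case by(rule fac.step[OF IH k eq])
 qed
 from this[of n] show "fac R CC M N h" using fac_cong *(3) by fastforce
qed

abbreviation FG :: "('a,'c) ring_scheme=> 'a umod set" where "FG R == {M. fin_gen R M}"

lemma FG_module: "M:FG R==> module R M" by(auto simp:fin_gen_def)

lemma add_cl_iff:
 assumes "CC<:FG R" shows "M:add_cl R CC \<longleftrightarrow> fin_gen R M & fac R CC M M (%x. x)"
proof (cases "fin_gen R M")
 case True
 hence M: "module R M" by(simp add:fin_gen_def)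
 have CC: "Y:CC==> module R Y" for Y using assms FG_module by blast
 show ?thesis using fac_sum_iff[OF CC M M, where h="%x. x"] True by(simp add:add_cl_def)
qed (simp add:add_cl_def)

lemma add_cl_FG: "add_cl R CC<:FG R" by(auto simp:add_cl_def)

lemma add_cl_incl: assumes "CC<:FG R" shows "CC<:add_cl R CC"
proof
 fix M assume M: "M:CC"
 hence "lm R M M (%x. x)" using assms FG_module lm_id by blast
 thus "M:add_cl R CC" using add_cl_iff[OF assms] fac_one[OF M] assms M by fastforce
qed

lemma add_cl_mono: "CC<:DD==> add_cl R CC<:add_cl R DD"
proof
 fix M assume sub: "CC<:DD" and "M:add_cl R CC"
 then obtain n Vs f g where "fin_gen R M" "ALL i<n. Vs i:CC"
   "ALL i<n. lin_map R M (Vs i) (f i) & lin_map R (Vs i) M (g i)"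
   "ALL x:$M. x = (##[M]i:{..<n::nat}. g i (f i x))"
  unfolding add_cl_def mem_Collect_eq by(elim exE conjE) (erule (3) that)
 moreover from this sub have "ALL i<n. Vs i:DD" by blast
 ultimately show "M:add_cl R DD" unfolding add_cl_def mem_Collect_eq
  by(intro conjI exI[of _ n] exI[of _ Vs] exI[of _ f] exI[of _ g])
qed

text \<open>Insert, at every intermediate object, a factorisation of its identity through
  \<open>CC\<close>.\<close>

lemma fac_add_cl:
 assumes "CC<:FG R" "fac R (add_cl R CC) M N h" shows "fac R CC M N h"
 using assms(2)
proof (induct rule: fac.induct)
 case (zero h) thus ?case by(rule fac.zero)
next
 case (step h Y f g h')
 have "fac R CC Y Y (%x. x)" using step add_cl_iff[OF assms(1)] by blast
 hence "fac R CC M N (%x. g (f x))" using fac_pre[OF fac_post[OF _ step(5)] step(4)] by blast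
 thus ?case using fac_cong[OF fac_add[OF _ step(2)]] step(6) by blast
qed

lemma add_cl_idem: assumes "CC<:FG R" shows "add_cl R (add_cl R CC) = add_cl R CC"
proof
 show "add_cl R (add_cl R CC)<:add_cl R CC"
  using fac_add_cl[OF assms] add_cl_iff[OF assms] add_cl_iff[OF add_cl_FG] by blast
 show "add_cl R CC<:add_cl R (add_cl R CC)" using add_cl_incl[OF add_cl_FG] by blast
qed

section \<open>Direct summands\<close>

definition smd :: "('a,'c) ring_scheme=> 'a umod=> 'a umod=> bool" where
 "smd R M N \<longleftrightarrow> (EX f g. lm R M N f & lm R N M g & (ALL x:$M. g (f x) = x))"

lemma smdI: "lm R M N f==> lm R N M g==> (!!x. x:$M==> g (f x) = x)==> smd R M N"
 unfolding smd_def by blast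

lemma smd_fin_gen: assumes "smd R M N" "fin_gen R N" shows "fin_gen R M"
proof -
 obtain f g where *: "lm R M N f" "lm R N M g" "ALL x:$M. g (f x) = x" using assms smd_def by metis
 hence "g ` $N = $M" using lmD(3) by(metis (no_types, lifting) image_subset_iff subsetI subset_antisym rev_image_eqI)
 thus ?thesis using fin_gen_surj * assms by blast
qed

lemma add_cl_smd: assumes "CC<:FG R" "smd R M N" "N:add_cl R CC" shows "M:add_cl R CC"
proof -
 obtain f g where *: "lm R M N f" "lm R N M g" "ALL x:$M. g (f x) = x" using assms smd_def by metis
 have "fac R CC M M (%x. x)"
  using fac_cong[OF fac_pre[OF fac_post[OF _ *(2)] *(1)], of _ "%x. x" "%x. x"] assms add_cl_iff * by metis
 thus ?thesis using assms add_cl_iff smd_fin_gen by blast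
qed

lemma add_cl_bip:
 assumes "CC<:FG R" "bip R M N P p q i j" "M:add_cl R CC" "N:add_cl R CC" shows "P:add_cl R CC"
proof -
 note B = bipD[OF assms(2)]
 have "fac R CC M M (%x. x)" "fac R CC N N (%x. x)" "fin_gen R M" "fin_gen R N"
  using assms add_cl_iff by blast+
 hence "fac R CC P P (%x. i (p x))" "fac R CC P P (%x. j (q x))" "fin_gen R P"
  using fac_pre[OF fac_post[OF _ B(3)] B(1)] fac_pre[OF fac_post[OF _ B(4)] B(2)] bip_fin_gen[OF assms(2)] by blast+
 moreover from this have "fac R CC P P (%x. i (p x)+[P] j (q x))" using fac_add by blast
 hence "fac R CC P P (%x. x)" by(rule fac_cong) (use B(9) in blast)
 ultimately show ?thesis using add_cl_iff[OF assms(1)] by blast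
qed

text \<open>Closure under direct sums merges the intermediate objects into one. In
  \<open>sball_ext\<close> this presents a module of a ball as a summand of a single
  extension.\<close>

lemma fac_single:
 assumes CC: "CC<:FG R" "CC ~= {}"
  "!!M N. M:CC==> N:CC==> EX P:CC. EX p q i j. bip R M N P p q i j"
  and h: "fac R CC M N h"
 shows "EX E:CC. EX f g. lm R M E f & lm R E N g & (ALL x:$M. h x = g (f x))"
 using h
proof (induct rule: fac.induct)
 case (zero h)
 obtain E where E: "E:CC" "module R E" using CC FG_module by blast
 show ?case using E zero lm_zero[OF zero(1) E(2)] lm_zero[OF E(2) zero(2)] by blast
next
 case (step h Y f g h')
 then obtain E a b where E: "E:CC" "lm R M E a" "lm R E N b" "ALL x:$M. h x = b (a x)" by blast
 obtain P p q i j where P: "P:CC" "bip R Y E P p q i j" using CC(3)[OF step(3) E(1)] by blast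
 note B = bipD[OF P(2)]
 interpret P: mdl R P by(rule mdl.intro) (rule B)
 have 1: "lm R M P (%x. i (f x)+[P] j (a x))" using lm_add lm_comp step(4) E(2) B(3,4) by blast
 have 2: "lm R P N (%w. g (p w)+[N] b (q w))" using lm_add lm_comp step(5) E(3) B(1,2) by blast
 have "h' x = g (p (i (f x)+[P] j (a x)))+[N] b (q (i (f x)+[P] j (a x)))" if "x:$M" for x
  using that B(10,11) lmD(3)[OF step(4)] lmD(3)[OF E(2)] step(6) E(4) by simp
 thus ?case using P(1) 1 2 by blast
qed

section \<open>Extensions and the balls generated by one module\<close>

lemma circ_cl_iff:
 assumes "AA<:FG R" "BB<:FG R"
 shows "M:circ_cl R AA BB \<longleftrightarrow> fin_gen R M & (EX N0:AA. EX Y:BB. EX f g. ses R N0 M Y f g)"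
 unfolding circ_cl_def ses_def lm_def using assms FG_module by(auto simp:fin_gen_def) blast+

lemma circ_cl_mono: "AA<:AA'==> BB<:BB'==> circ_cl R AA BB<:circ_cl R AA' BB'"
proof
 fix M assume a: "AA<:AA'" "BB<:BB'" "M:circ_cl R AA BB"
 from a(3) obtain N0 Y where *: "fin_gen R M" "N0:AA" "Y:BB" "EX f g. lin_map R N0 M f & inj_on f ($N0) &
lin_map R M Y g & g ` $M = $Y & f ` $N0 = {z:$M. g z = 0[Y]}"
  unfolding circ_cl_def mem_Collect_eq by(elim conjE bexE) (erule (3) that)
 have "N0:AA'" "Y:BB'" using * a by auto
 thus "M:circ_cl R AA' BB'"
  unfolding circ_cl_def mem_Collect_eq using *(1,4) by(intro conjI bexI[of _ N0] bexI[of _ Y])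
qed

lemma circ_cl_FG: "circ_cl R AA BB<:FG R" by(auto simp:circ_cl_def)

lemma ses_bip:
 assumes s: "ses R A M B f g" "ses R A' M' B' f' g'"
  and b: "bip R A A' PA p1 q1 i1 j1" "bip R M M' PM p2 q2 i2 j2" "bip R B B' PB p3 q3 i3 j3"
 shows "ses R PA PM PB (%x. i2 (f (p1 x))+[PM] j2 (f' (q1 x))) (%x. i3 (g (p2 x))+[PB] j3 (g' (q2 x)))"
proof -
 note D = sesD[OF s(1)] and D' = sesD[OF s(2)]
 note B1 = bipD[OF b(1)] and B2 = bipD[OF b(2)] and B3 = bipD[OF b(3)]
 interpret PB: mdl R PB by(rule mdl.intro) (rule B3)
 show ?thesis
 proof (rule sesI)
  show "lm R PA PM (%x. i2 (f (p1 x))+[PM] j2 (f' (q1 x)))"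
   by(rule lm_add[OF lm_comp[OF lm_comp[OF B1(1) D(1)] B2(3)] lm_comp[OF lm_comp[OF B1(2) D'(1)] B2(4)]])
  show "lm R PM PB (%x. i3 (g (p2 x))+[PB] j3 (g' (q2 x)))"
   by(rule lm_add[OF lm_comp[OF lm_comp[OF B2(1) D(2)] B3(3)] lm_comp[OF lm_comp[OF B2(2) D'(2)] B3(4)]])
 next
  fix x assume x: "x:$PA" and z: "i2 (f (p1 x))+[PM] j2 (f' (q1 x)) = 0[PM]"
  have c: "p1 x:$A" "q1 x:$A'" "f (p1 x):$M" "f' (q1 x):$M'"
   using x lmD(3)[OF B1(1)] lmD(3)[OF B1(2)] lmD(3)[OF D(1)] lmD(3)[OF D'(1)] by auto
  have "f (p1 x) = 0[M]" using arg_cong[OF z, of p2] B2(10) c lmD(6)[OF B2(1)] by simp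
  moreover have "f' (q1 x) = 0[M']" using arg_cong[OF z, of q2] B2(11) c lmD(6)[OF B2(2)] by simp
  ultimately show "x = 0[PA]" using D(10) D'(10) c B1(16)[OF x] by blast
 next
  fix z assume z: "z:$PB"
  obtain m where m: "m:$M" "g m = p3 z" using D(8) lmD(3)[OF B3(1) z] by blast
  obtain m' where m': "m':$M'" "g' m' = q3 z" using D'(8) lmD(3)[OF B3(2) z] by blast
  show "EX y:$PM. i3 (g (p2 y))+[PB] j3 (g' (q2 y)) = z"
   using m m' B2(10,11,12) B3(9)[OF z] by(intro bexI[of _ "i2 m+[PM] j2 m'"]) auto
 next
  fix x assume x: "x:$PA"
  have c: "p1 x:$A" "q1 x:$A'" "f (p1 x):$M" "f' (q1 x):$M'"
   using x lmD(3)[OF B1(1)] lmD(3)[OF B1(2)] lmD(3)[OF D(1)] lmD(3)[OF D'(1)] by auto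
  thus "i3 (g (p2 (i2 (f (p1 x))+[PM] j2 (f' (q1 x)))))+[PB] j3 (g' (q2 (i2 (f (p1 x))+[PM] j2 (f' (q1 x))))) = 0[PB]"
   using B2(10,11) D(7) D'(7) lmD(6)[OF B3(3)] lmD(6)[OF B3(4)] by simp
 next
  fix y assume y: "y:$PM" and z: "i3 (g (p2 y))+[PB] j3 (g' (q2 y)) = 0[PB]"
  have c: "p2 y:$M" "q2 y:$M'" "g (p2 y):$B" "g' (q2 y):$B'"
   using y lmD(3)[OF B2(1)] lmD(3)[OF B2(2)] lmD(3)[OF D(2)] lmD(3)[OF D'(2)] by auto
  have "g (p2 y) = 0[B]" using arg_cong[OF z, of p3] B3(10) c lmD(6)[OF B3(1)] by simp
  then obtain a where a: "a:$A" "f a = p2 y" using D(9) c by blast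
  have "g' (q2 y) = 0[B']" using arg_cong[OF z, of q3] B3(11) c lmD(6)[OF B3(2)] by simp
  then obtain a' where a': "a':$A'" "f' a' = q2 y" using D'(9) c by blast
  show "EX x:$PA. i2 (f (p1 x))+[PM] j2 (f' (q1 x)) = y"
   using a a' B1(10,11,12) B2(9)[OF y] by(intro bexI[of _ "i1 a+[PA] j1 a'"]) auto
 qed
qed

lemma sball_FG: "sball R {G} n<:FG R"
 by(cases n) (auto simp:add_cl_def star_cl_def)

lemma sball_idem: assumes "fin_gen R G" shows "add_cl R (sball R {G} n) = sball R {G} n"
proof -
 have G: "{G}<:FG R" using assms by simp
 show ?thesis by(cases n) (simp_all add:star_cl_def add_cl_idem[OF G] add_cl_idem[OF circ_cl_FG])
qed

lemma sball_Suc: assumes "fin_gen R G"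
 shows "sball R {G} (Suc n) = add_cl R (circ_cl R (sball R {G} n) (sball R {G} 0))"
 by(simp add:star_cl_def sball_idem[OF assms, of n])

lemma sball_SucI: assumes "fin_gen R G" "M:circ_cl R (sball R {G} n) (sball R {G} 0)"
 shows "M:sball R {G} (Suc n)"
 unfolding sball_Suc[OF assms(1)] using add_cl_incl[OF circ_cl_FG] assms(2) by(rule subsetD)

lemma sball_smd: assumes "fin_gen R G" "smd R M N" "N:sball R {G} n" shows "M:sball R {G} n"
 using add_cl_smd[OF sball_FG[of R G n] assms(2)] assms(3) sball_idem[OF assms(1)] by simp

lemma sball_bip:
 assumes "fin_gen R G" "bip R M N P p q i j" "M:sball R {G} n" "N:sball R {G} n" shows "P:sball R {G} n"
 using add_cl_bip[OF sball_FG[of R G n] assms(2)] assms(3,4) sball_idem[OF assms(1)] by simp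

lemma zero_mod_fg: assumes "module R M" shows "fin_gen R (M\<lparr>carrier := {0[M]}\<rparr>)"
proof -
 interpret M: mdl R M by rule fact
 interpret Z: mdl R "M\<lparr>carrier := {0[M]}\<rparr>" using M.sm_module[OF M.sm_zero] by rule
 show ?thesis unfolding Z.fin_gen_iff using spn.zero[of "M\<lparr>carrier := {0[M]}\<rparr>" R "{}"] by(intro exI[of _ "{}"]) auto
qed

lemma zero_in_add_cl:
 assumes "CC<:FG R" "module R Z" "$Z = {0[Z]}" shows "Z:add_cl R CC"
proof -
 interpret Z: mdl R Z by rule fact
 have "fin_gen R Z" unfolding Z.fin_gen_iff using assms(3) spn.zero[of Z R "{}"] by(intro exI[of _ "{}"]) auto
 moreover have "fac R CC Z Z (%x. x)" using assms by(intro fac.zero) auto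
 ultimately show ?thesis using add_cl_iff[OF assms(1)] by blast
qed

lemma ses_zero_right: assumes "module R M" shows "ses R M M (M\<lparr>carrier := {0[M]}\<rparr>) (%x. x) (%x. 0[M])"
proof -
 interpret M: mdl R M by rule fact
 have Z: "module R (M\<lparr>carrier := {0[M]}\<rparr>)" using M.sm_module[OF M.sm_zero] .
 show ?thesis using lm_id[OF assms] lm_zero[OF assms Z] by(intro sesI) auto
qed

text \<open>Index n stands for n + 1 layers, so a + 1 and b + 1 layers together give index a + b +
  1. In the step \<open>B\<close> is a summand of some \<open>B'\<close> with sub \<open>B1\<close>
  and quotient \<open>B2\<close>. Pulling \<open>M\<close> back along \<open>B' -> B\<close> gives a
  module with layers \<open>A\<close>, \<open>B1\<close>, \<open>B2\<close> of which
  \<open>M\<close> is a summand.\<close>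

lemma sball_ext:
 assumes G: "fin_gen R G" and A: "A:sball R {G} a"
 shows "ses R A M B f g==> B:sball R {G} b==> M:sball R {G} (a + b + 1)"
proof (induct b arbitrary: M B f g)
 case 0
 have "fin_gen R M" using fin_gen_ext[OF 0(1)] A 0(2) sball_FG by blast
 hence "M:circ_cl R (sball R {G} a) (sball R {G} 0)"
  using circ_cl_iff[OF sball_FG sball_FG] A 0 by blast
 from sball_SucI[OF G this] show ?case by simp
next
 case (Suc b)
 let ?C = "circ_cl R (sball R {G} b) (sball R {G} 0)"
 have B: "B:add_cl R ?C" using Suc(3) sball_Suc[OF G] by blast
 \<comment> \<open>\<open>fac_single\<close> needs an object even for the empty sum; the zero module
   is a trivial extension.\<close>
 have ne: "?C ~= {}"
 proof -
  let ?Z = "G\<lparr>carrier := {0[G]}\<rparr>"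
  have Gm: "module R G" using G by(simp add:fin_gen_def)
  have Z: "fin_gen R ?Z" using zero_mod_fg[OF Gm] .
  hence Zm: "module R ?Z" by(simp add:fin_gen_def)
  have "?Z:sball R {G} n" for n
   using zero_in_add_cl[OF sball_FG Zm, of G n] sball_idem[OF G, of n] by auto
  hence "?Z:?C" using circ_cl_iff[OF sball_FG sball_FG] Z ses_zero_right[OF Zm] by fastforce
  thus ?thesis by blast
 qed
 have bp: "EX P:?C. EX p q i j. bip R M N P p q i j" if MN: "M:?C" "N:?C" for M N
 proof -
  obtain A1 Y1 f1 g1 where 1: "fin_gen R M" "A1:sball R {G} b" "Y1:sball R {G} 0" "ses R A1 M Y1 f1 g1"
   using MN circ_cl_iff[OF sball_FG sball_FG] by blast
  obtain A2 Y2 f2 g2 where 2: "fin_gen R N" "A2:sball R {G} b" "Y2:sball R {G} 0" "ses R A2 N Y2 f2 g2"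
   using MN circ_cl_iff[OF sball_FG sball_FG] by blast
  note s = 1(4) 2(4)
  obtain PM p q i j where PM: "bip R M N PM p q i j" using ex_bip[OF sesD(5)[OF s(1)] sesD(5)[OF s(2)]] by blast
  obtain PA p1 q1 i1 j1 where PA: "bip R A1 A2 PA p1 q1 i1 j1" using ex_bip[OF sesD(4)[OF s(1)] sesD(4)[OF s(2)]] by blast
  obtain PY p2 q2 i2 j2 where PY: "bip R Y1 Y2 PY p2 q2 i2 j2" using ex_bip[OF sesD(6)[OF s(1)] sesD(6)[OF s(2)]] by blast
  have "PM:?C"
   using ses_bip[OF s PA PM PY] sball_bip[OF G PA 1(2) 2(2)] sball_bip[OF G PY 1(3) 2(3)] bip_fin_gen[OF PM 1(1) 2(1)]
    circ_cl_iff[OF sball_FG sball_FG] by blast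
  thus ?thesis using PM by blast
 qed
 have "fac R ?C B B (%x. x)" using B add_cl_iff[OF circ_cl_FG] by blast
 from fac_single[OF circ_cl_FG ne bp this] obtain B' s r where
  B': "B':?C" "lm R B B' s" "lm R B' B r" "ALL x:$B. x = r (s x)" by blast
 then obtain B1 B2 u v where B12: "B1:sball R {G} b" "B2:sball R {G} 0" "ses R B1 B' B2 u v"
  using circ_cl_iff[OF sball_FG sball_FG] by blast
 note D = sesD[OF Suc(2)] and E = sesD[OF B12(3)]
 obtain P p q i j where "bip R M B' P p q i j" using ex_bip[OF D(5) E(5)] by blast
 note P = bipD[OF this]
 interpret Pm: mdl R P by(rule mdl.intro) (rule P)
 interpret Bm: mdl R B by(rule mdl.intro) (rule D)
 let ?h = "%w. g (p w)-[B] r (q w)"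
 have h: "lm R P B ?h" using lm_diff[OF lm_comp[OF P(1) D(2)] lm_comp[OF P(2) B'(3)]] .
 \<comment> \<open>The pullback of \<open>g\<close> and \<open>r\<close>, cut out of the direct sum
   of \<open>M\<close> and \<open>B'\<close>.\<close>
 define U where "U = {w:$P. ?h w = 0[B]}"
 have Uiff: "w:U \<longleftrightarrow> w:$P & g (p w) = r (q w)" for w
  using lmD(3)[OF lm_comp[OF P(1) D(2)]] lmD(3)[OF lm_comp[OF P(2) B'(3)]] by(auto simp:U_def Bm.diff_eq_iff)
 have U: "sm R P U" unfolding U_def using lm_ker[OF h] .
 let ?M' = "P\<lparr>carrier := U\<rparr>"
 have M': "module R ?M'" using Pm.sm_module[OF U] .
 interpret M': mdl R ?M' using M' by rule
 have inc: "lm R ?M' P (%x. x)" using Pm.sm_lm[OF U] .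
 have vq: "lm R ?M' B2 (%w. v (q w))" using lm_comp[OF lm_comp[OF inc P(2)] E(2)] .
 have mk: "i m+[P] j b':U" if "m:$M" "b':$B'" "g m = r b'" for m b'
  using that P(10,11,12) Uiff by simp
 have vqs: "(%w. v (q w)) ` $?M' = $B2"
 proof
  show "$B2<:(%w. v (q w)) ` $?M'"
  proof
   fix z assume "z:$B2"
   then obtain b' where b': "b':$B'" "v b' = z" using E(8) by blast
   then obtain m where m: "m:$M" "g m = r b'" using D(8) lmD(3)[OF B'(3)] by blast
   show "z:(%w. v (q w)) ` $?M'" using mk[OF m(1) b'(1) m(2)] P(11)[OF m(1) b'(1)] b' by(intro image_eqI[of _ _ "i m+[P] j b'"]) auto
  qed
 qed (use lmD(3)[OF vq] in auto)
 \<comment> \<open>The part of the pullback lying over \<open>B1\<close>. It has sub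
   \<open>A\<close> and quotient \<open>B1\<close>, so the induction hypothesis applies to it, and
   the last layer \<open>B2\<close> is added afterwards.\<close>
 let ?M1 = "?M'\<lparr>carrier := {w:$?M'. v (q w) = 0[B2]}\<rparr>"
 have s1: "ses R ?M1 ?M' B2 (%x. x) (%w. v (q w))" using ses_kernel[OF vq vqs] .
 have "lm R ?M1 B' q" using lm_comp[OF lm_comp[OF sesD(1)[OF s1] inc] P(2)] .
 from ses_lift[OF B12(3) this] obtain k where k: "lm R ?M1 B1 k" "ALL w:$?M1. u (k w) = q w" by auto
 have "lm R A ?M1 (%x. i (f x))"
 proof (rule lmI[OF D(4) sesD(4)[OF s1]])
  fix x y assume x: "x:$A"
  have "i (f x):U" using x Uiff lmD(3)[OF D(1)] lmD(3)[OF P(3)] P(5,6) D(7) lmD(6)[OF B'(3)] by simp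
  thus "i (f x):$?M1" using x lmD(3)[OF D(1)] P(6) lmD(6)[OF E(2)] by simp
  { assume y: "y:$A"
   show "i (f (x+[A] y)) = i (f x)+[?M1] i (f y)"
    using x y lmD(4)[OF D(1)] lmD(4)[OF P(3)] lmD(3)[OF D(1)] by simp }
 next
  fix a x assume "a:$R" "x:$A"
  thus "i (f (a*[A] x)) = a*[?M1] i (f x)"
   using lmD(5)[OF D(1)] lmD(5)[OF P(3)] lmD(3)[OF D(1)] by simp
 qed
 hence s2: "ses R A ?M1 B1 (%x. i (f x)) k"
 proof (rule sesI[OF _ k(1)])
  fix x assume "x:$A" "i (f x) = 0[?M1]"
  thus "x = 0[A]" using D(10) P(5)[of "f x"] lmD(3)[OF D(1)] lmD(6)[OF P(1)] by simp
 next
  fix z assume z: "z:$B1"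
  hence uz: "u z:$B'" "v (u z) = 0[B2]" using lmD(3)[OF E(1)] E(7) by auto
  then obtain m where m: "m:$M" "g m = r (u z)" using D(8) lmD(3)[OF B'(3)] by blast
  let ?w = "i m+[P] j (u z)"
  have w: "?w:$?M1" using mk[OF m(1) uz(1) m(2)] P(11)[OF m(1) uz(1)] uz by simp
  hence "u (k ?w) = u z" using bspec[OF k(2) w] P(11)[OF m(1) uz(1)] by simp
  hence "k ?w = z" using inj_onD[OF E(3)] z lmD(3)[OF k(1) w] by blast
  thus "EX y:$?M1. k y = z" using w by blast
 next
  fix x assume x: "x:$A"
  hence w: "i (f x):$?M1" using lmD(3)[OF \<open>lm R A ?M1 (%x. i (f x))\<close>] by blast
  hence "u (k (i (f x))) = 0[B']" using bspec[OF k(2) w] P(6)[OF lmD(3)[OF D(1) x]] by simp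
  thus "k (i (f x)) = 0[B1]" using E(10) lmD(3)[OF k(1) w] by blast
 next
  fix y assume y: "y:$?M1" "k y = 0[B1]"
  hence qy: "q y = 0[B']" "y:U" using k(2) lmD(6)[OF E(1)] by auto
  hence yc: "y:$P" "g (p y) = 0[B]" using Uiff lmD(6)[OF B'(3)] by auto
  then obtain a where a: "a:$A" "f a = p y" using D(9) lmD(3)[OF P(1)] by blast
  hence "i (f a) = y" using P(9)[OF yc(1)] qy lmD(6)[OF P(4)] lmD(3)[OF P(3)] lmD(3)[OF P(1) yc(1)] by simp
  thus "EX x:$A. i (f x) = y" using a by blast
 qed
 have M1: "?M1:sball R {G} (a + b + 1)" using Suc(1)[OF s2 B12(1)] .
 have "fin_gen R ?M'" using fin_gen_ext[OF s1] M1 B12(2) sball_FG by blast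
 hence "?M':circ_cl R (sball R {G} (a + b + 1)) (sball R {G} 0)"
  using circ_cl_iff[OF sball_FG sball_FG] M1 B12(2) s1 by blast
 from sball_SucI[OF G this] have *: "?M':sball R {G} (a + Suc b + 1)" by simp
 \<comment> \<open>The section x -> (x, s (g x)) lands in the pullback because \<open>r\<close>
   undoes \<open>s\<close>.\<close>
 have "smd R M ?M'"
 proof (rule smdI)
  have l: "lm R M P (%x. i x+[P] j (s (g x)))" using lm_add[OF P(3) lm_comp[OF lm_comp[OF D(2) B'(2)] P(4)]] .
  have c: "i x+[P] j (s (g x)):U" if "x:$M" for x
   using mk[OF that lmD(3)[OF B'(2) lmD(3)[OF D(2) that]]] B'(4) lmD(3)[OF D(2) that] by simp
  show "lm R M ?M' (%x. i x+[P] j (s (g x)))"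
   using c lmD[OF l] M' by(intro lmI) auto
  show "lm R ?M' M p" using lm_comp[OF inc P(1)] .
  show "p (i x+[P] j (s (g x))) = x" if "x:$M" for x
   using that P(10) lmD(3)[OF B'(2) lmD(3)[OF D(2) that]] by simp
 qed
 thus ?case using sball_smd[OF G _ *] by blast
qed

lemma sball_mono_gen:
 assumes "fin_gen R G" "fin_gen R G'" "G:add_cl R {G'}" shows "sball R {G} n<:sball R {G'} n"
proof (induct n)
 have G': "{G'}<:FG R" using assms by simp
 case 0 show ?case using add_cl_mono[of "{G}" "add_cl R {G'}" R] assms(3) add_cl_idem[OF G'] by auto
next
 have G': "{G'}<:FG R" using assms by simp
 case (Suc n)
 have "sball R {G} 0<:sball R {G'} 0"
  using add_cl_mono[of "{G}" "add_cl R {G'}" R] assms(3) add_cl_idem[OF G'] by auto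
 thus ?case using Suc add_cl_mono[OF circ_cl_mono] sball_Suc[OF assms(1)] sball_Suc[OF assms(2)] by metis
qed

section \<open>Free modules, syzygies and balls\<close>

declare One_nat_def [simp del] sball.simps [simp del]

lemma free_mod_carrier: "$(free_mod R n) = {..<n} \<rightarrow>\<^sub>E $R"
 by(simp add:free_mod_def)

lemma free_mod_simps:
 "i < n==> (x+[free_mod R n] y) i = x i+[R] y i"
 "i < n==> (a*[free_mod R n] x) i = a \<otimes>\<^bsub>R\<^esub> x i"
 "i < n==> 0[free_mod R n] i = 0[R]"
 by(auto simp:free_mod_def)

lemma free_mod_eqI:
 "x:$(free_mod R n)==> y:$(free_mod R n)==> (!!i. i < n==> x i = y i)==> x = y"
 unfolding free_mod_carrier by(rule PiE_ext) auto

lemma free_mod_nth: "x:$(free_mod R n)==> i < n==> x i:$R"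
 by(auto simp:free_mod_def)

lemma (in cring) module_free: "module R (free_mod R n)"
proof -
 have c: "0[free_mod R n]:$(free_mod R n)"
  "x:$(free_mod R n)==> y:$(free_mod R n)==> x+[free_mod R n] y:$(free_mod R n)"
  "a:$R==> x:$(free_mod R n)==> a*[free_mod R n] x:$(free_mod R n)" for x y a
  by(auto simp:free_mod_def)
 note s = free_mod_simps[where R=R and n=n] and n = free_mod_nth[where R=R and n=n]
 show ?thesis
 proof (rule moduleI)
  show "abelian_group (free_mod R n)"
  proof (rule abelian_groupI)
   fix x assume x: "x:$(free_mod R n)"
   let ?y = "\<lambda>i\<in>{..<n}. \<ominus> x i"
   have y: "?y:$(free_mod R n)" using n[OF x] by(auto simp:free_mod_carrier)
   have "?y+[free_mod R n] x = 0[free_mod R n]"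
    by(rule free_mod_eqI[OF c(2)[OF y x] c(1)]) (simp add:s n[OF x] l_neg)
   thus "EX y:$(free_mod R n). y+[free_mod R n] x = 0[free_mod R n]" using y by blast
   show "0[free_mod R n]+[free_mod R n] x = x"
    by(rule free_mod_eqI[OF c(2)[OF c(1) x] x]) (simp add:s n[OF x])
   fix y assume y: "y:$(free_mod R n)"
   show "x+[free_mod R n] y = y+[free_mod R n] x"
    by(rule free_mod_eqI[OF c(2)[OF x y] c(2)[OF y x]]) (simp add:s n[OF x] n[OF y] a_comm)
   fix z assume z: "z:$(free_mod R n)"
   show "x+[free_mod R n] y+[free_mod R n] z = x+[free_mod R n] (y+[free_mod R n] z)"
    by(rule free_mod_eqI[OF c(2)[OF c(2)[OF x y] z] c(2)[OF x c(2)[OF y z]]]) (simp add:s n[OF x] n[OF y] n[OF z] a_assoc)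
  qed (use c in auto)
  fix a x assume a: "a:$R" and x: "x:$(free_mod R n)"
  show "a*[free_mod R n] x:$(free_mod R n)" using c a x by blast
  { fix b assume b: "b:$R"
   show "(a +: b)*[free_mod R n] x = a*[free_mod R n] x+[free_mod R n] b*[free_mod R n] x"
    by(rule free_mod_eqI[where R=R and n=n]) (use a b x in \<open>auto simp:c s n[OF x] l_distr\<close>)
   show "(a*:b)*[free_mod R n] x = a*[free_mod R n] (b*[free_mod R n] x)"
    by(rule free_mod_eqI[where R=R and n=n]) (use a b x in \<open>auto simp:c s n[OF x] m_assoc\<close>) }
  fix y assume y: "y:$(free_mod R n)"
  show "a*[free_mod R n] (x+[free_mod R n] y) = a*[free_mod R n] x+[free_mod R n] a*[free_mod R n] y"
   by(rule free_mod_eqI[where R=R and n=n]) (use a x y in \<open>auto simp:c s n[OF x] n[OF y] r_distr\<close>)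
 next
  fix x assume x: "x:$(free_mod R n)"
  show "#1*[free_mod R n] x = x" by(rule free_mod_eqI[where R=R and n=n]) (use x in \<open>auto simp:c s n[OF x]\<close>)
 qed (rule cring_axioms)
qed

lemma (in cring) free_finsum:
 assumes "finite I" "!!i. i:I==> h i:$(free_mod R n)" "k < n"
 shows "(##[free_mod R n]i:I. h i) k = (##i:I. h i k)"
proof -
 interpret F: mdl R "free_mod R n" by(rule mdl.intro) (rule module_free)
 show ?thesis using assms(1,2)
 proof (induct)
  case empty thus ?case using assms(3) by(simp add:free_mod_simps)
 next
  case (insert i I)
  have "h:I \<rightarrow> $(free_mod R n)" "h i:$(free_mod R n)" using insert by auto
  moreover have "(%i. h i k):I \<rightarrow> $R" "h i k:$R"
   using insert(4) free_mod_nth[where R=R and n=n, OF _ assms(3)] by auto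
  ultimately show ?case using insert assms(3) by(simp add:free_mod_simps)
 qed
qed

lemma (in cring) free_fin_gen: "fin_gen R (free_mod R n)"
proof -
 let ?e = "%i. \<lambda>k\<in>{..<n}. if i = k then #1 else #0"
 interpret F: mdl R "free_mod R n" by(rule mdl.intro) (rule module_free)
 have e: "?e i:$(free_mod R n)" for i by(auto simp:free_mod_carrier)
 have "x = (##[free_mod R n]i:{..<n}. x i*[free_mod R n] ?e i)" if x: "x:$(free_mod R n)" for x
 proof (rule free_mod_eqI[OF x])
  have c: "i < n==> x i*[free_mod R n] ?e i:$(free_mod R n)" for i using free_mod_nth[OF x] e by simp
  thus "(##[free_mod R n]i:{..<n}. x i*[free_mod R n] ?e i):$(free_mod R n)"
   by(intro F.finsum_closed) auto
  fix k assume k: "k < n"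
  have "(##[free_mod R n]i:{..<n}. x i*[free_mod R n] ?e i) k = (##i:{..<n}.(x i*[free_mod R n] ?e i) k)"
   using free_finsum[of "{..<n}" "%i. x i*[free_mod R n] ?e i" n k] c k by auto
  also have "... = (##i:{..<n}. if k = i then x i else #0)"
   using free_mod_nth[OF x] k by(intro finsum_cong') (auto simp:free_mod_simps)
  also have "... = x k" using finsum_singleton[of k "{..<n}" x] free_mod_nth[OF x] k by auto
  finally show "x k = (##[free_mod R n]i:{..<n}. x i*[free_mod R n] ?e i) k" by simp
 qed
 hence "gens_by R (free_mod R n) n ?e"
  unfolding gens_by_def using e free_mod_nth by(metis (no_types, lifting) Pi_I lessThan_iff)
 thus ?thesis unfolding fin_gen_def using module_free by blast
qed

lemma gens_map_lm:
 assumes "module R M" "g:{..<n} \<rightarrow> $M"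
 shows "lm R (free_mod R n) M (%c.##[M]i:{..<n}. c i*[M] g i)"
proof -
 interpret M: mdl R M by rule fact
 have g: "i < n==> g i:$M" for i using assms(2) by auto
 have "lm R (free_mod R n) M (%c. c i*[M] g i)" if i: "i:{..<n}" for i
  using i g M.module_free M.module_axioms
  by(intro lmI) (auto simp:free_mod_simps free_mod_nth M.smult_l_distr M.smult_assoc1)
 thus ?thesis by(intro lm_sum[OF M.module_free M.module_axioms]) auto
qed

lemma gens_by_ses:
 assumes "module R M" "gens_by R M n g"
 shows "ses R (ker_syz R M n g) (free_mod R n) M (%x. x) (%c.##[M]i:{..<n}. c i*[M] g i)"
proof -
 interpret M: mdl R M by rule fact
 have g: "g:{..<n} \<rightarrow> $M" using assms(2) by(simp add:gens_by_def)
 note L = gens_map_lm[OF assms(1) g]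
 have "(%c.##[M]i:{..<n}. c i*[M] g i) ` $(free_mod R n) = $M" (is "?h ` _ = _")
 proof
  show "?h ` $(free_mod R n)<:$M" using lmD(3)[OF L] by auto
  show "$M<:?h ` $(free_mod R n)"
  proof
   fix x assume "x:$M"
   then obtain c where c: "c:{..<n} \<rightarrow> $R" "x = ?h c" using assms(2) unfolding gens_by_def by blast
   have "?h (restrict c {..<n}) = ?h c" using c g by(intro M.finsum_cong') (auto simp:Pi_def)
   thus "x:?h ` $(free_mod R n)" using c by(intro image_eqI[of _ _ "restrict c {..<n}"]) (auto simp:free_mod_carrier)
  qed
 qed
 from ses_kernel[OF L this] show ?thesis by(simp add:ker_syz_def)
qed

section \<open>Finitely generated projective modules\<close>

abbreviation projc :: "('a,'c) ring_scheme=> 'a umod set" where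
 "projc R == add_cl R {free_mod R 1}"

lemma (in cring) free1_FG: "{free_mod R 1}<:FG R" using free_fin_gen by simp

text \<open>Only the map \<open>h\<close> has to factor through free modules, not the identity of
  \<open>E\<close>. The near-splitting argument needs this strength: there \<open>E\<close> is
  projective only up to a scalar.\<close>

lemma proj_lift:
 assumes E: "fac R {free_mod R 1} E Z h" and g: "lm R Y Z g" "g ` $Y = $Z"
 shows "EX h'. lm R E Y h' & (ALL x:$E. g (h' x) = h x)"
 using E
proof (induct rule: fac.induct)
 case (zero h)
 have Y: "module R Y" using lmD(1)[OF g(1)] .
 show ?case using lm_zero[OF zero(1) Y] lmD(6)[OF g(1)] zero(3) by auto
next
 case (step h F a b h')
 then obtain k where k: "lm R E Y k" "ALL x:$E. g (k x) = h x" by blast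
 interpret Y: mdl R Y using lmD(1)[OF g(1)] by rule
 interpret Z: mdl R Z using lmD(2)[OF g(1)] by rule
 have F: "F = free_mod R 1" using step by simp
 define e where "e = (\<lambda>i\<in>{..<1::nat}. \<one>\<^bsub>R\<^esub>)"
 have e: "e:$F" unfolding F by(auto simp:e_def free_mod_carrier)
 obtain y where y: "y:$Y" "g y = b e" using g(2) lmD(3)[OF step(5) e] by(metis imageE)
 have ex: "x = x 0*[F] e" "x 0:$R" if x: "x:$F" for x
 proof -
  interpret F: mdl R F using lmD(2)[OF step(4)] by rule
  show x0: "x 0:$R" using x free_mod_nth unfolding F by blast
  have c: "x 0*[F] e:$F" using x0 e by simp
  show "x = x 0*[F] e"
  proof (rule free_mod_eqI[where R=R and n=1])
   fix i :: nat assume "i < 1" thus "x i = (x 0*[F] e) i"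
    using x0 unfolding F e_def by(simp add:free_mod_simps)
  qed (use x c F in auto)
 qed
 have l: "lm R F Y (%c. c 0*[Y] y)"
  using y Y.module_free Y.module_axioms unfolding F
  by(intro lmI) (auto simp:free_mod_simps free_mod_nth Y.smult_l_distr Y.smult_assoc1)
 have gl: "g (c 0*[Y] y) = b c" if c: "c:$F" for c
 proof -
  have "g (c 0*[Y] y) = c 0*[Z] b e" using lmD(5)[OF g(1)] ex(2)[OF c] y by simp
  also have "... = b (c 0*[F] e)" using lmD(5)[OF step(5)] ex(2)[OF c] e by simp
  finally show ?thesis using ex(1)[OF c] by simp
 qed
 have "lm R E Y (%x. a x 0*[Y] y+[Y] k x)" using lm_add[OF lm_comp[OF step(4) l] k(1)] .
 moreover have "g (a x 0*[Y] y+[Y] k x) = h' x" if x: "x:$E" for x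
  using lmD(4)[OF g(1) lmD(3)[OF lm_comp[OF step(4) l] x] lmD(3)[OF k(1) x]] gl lmD(3)[OF step(4) x] k(2) step(6) x by simp
 ultimately show ?case by blast
qed

context cring begin

lemma projc_lift:
 fixes Z :: "'a umod"
 assumes E: "E:projc R" and h: "lm R E Z h" and g: "lm R Y Z g" "g ` $Y = $Z"
 shows "EX h'. lm R E Y h' & (ALL x:$E. g (h' x) = h x)"
 using proj_lift[OF fac_post[OF _ h] g, of E "%x. x"] add_cl_iff[OF free1_FG] E by blast

lemma projc_FG: "projc R<:FG R" using add_cl_FG .

lemma free_projc: "free_mod R n:projc R"
proof -
 interpret F: mdl R "free_mod R n" by(rule mdl.intro) (rule module_free)
 note s = free_mod_simps
 let ?h = "%k x. \<lambda>i\<in>{..<n}. if i < k then x i else #0"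
 have "fac R {free_mod R 1} (free_mod R n) (free_mod R n) (?h k)" if "k <= n" for k
  using that
 proof (induct k)
  case 0 show ?case by(rule fac.zero[OF module_free module_free]) (simp add:free_mod_def restrict_def)
 next
  case (Suc k)
  let ?f = "%x. \<lambda>i\<in>{..<1::nat}. x k" and ?g = "%c. \<lambda>i\<in>{..<n}. if i = k then c 0 else #0"
  have f: "lm R (free_mod R n) (free_mod R 1) ?f"
   using Suc(2) module_free by(intro lmI) (auto simp:free_mod_def fun_eq_iff)
  have g: "lm R (free_mod R 1) (free_mod R n) ?g"
   using Suc(2) module_free by(intro lmI) (auto simp:free_mod_def fun_eq_iff)
  have eq: "?h (Suc k) x = ?g (?f x)+[free_mod R n] ?h k x" if x: "x:$(free_mod R n)" for x
   using free_mod_nth[OF x] by(auto simp:free_mod_def fun_eq_iff less_Suc_eq)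
  show ?case by(rule fac.step[OF Suc(1) _ f g eq]) (use Suc(2) in auto)
 qed
 from this[OF order_refl] have "fac R {free_mod R 1} (free_mod R n) (free_mod R n) (%x. x)"
  by(rule fac_cong) (auto simp:free_mod_def fun_eq_iff PiE_def extensional_def)
 thus ?thesis using add_cl_iff[OF free1_FG] free_fin_gen by blast
qed

end

section \<open>Syzygies from arbitrary projective covers, and boundedness in syzygy degree j\<close>

definition syz :: "('a,'c) ring_scheme=> 'a umod=> 'a umod=> bool" where
 "syz R M L \<longleftrightarrow> fin_gen R M & fin_gen R L & (EX E:projc R. EX f g. ses R L E M f g)"

text \<open>The syzygy may be chosen separately for every module and from any projective cover. The
  constructions below yield covers that are rarely minimal; \<open>bnd_syzn\<close> returns to
  minimal resolutions at the end.\<close>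

primrec bnd :: "('a,'c) ring_scheme=> nat=> 'a umod set=> bool" where
 "bnd R 0 = (%AA. EX G n. fin_gen R G & AA<:sball R {G} n)"
| "bnd R (Suc j) = (%AA. EX BB. bnd R j BB & (ALL M:AA. EX L:BB. syz R M L))"

lemma bnd_mono: "bnd R j BB==> AA<:BB==> bnd R j AA"
proof (cases j)
 case 0
 assume "bnd R j BB" "AA<:BB"
 thus ?thesis unfolding 0 bnd.simps by(meson order_trans)
next
 case (Suc k)
 assume "bnd R j BB" "AA<:BB"
 thus ?thesis using Suc unfolding Suc bnd.simps by(meson subsetD)
qed

lemma bnd_FG: "bnd R j AA==> AA<:FG R"
proof (cases j)
 case 0
 assume "bnd R j AA"
 thus ?thesis unfolding 0 bnd.simps using sball_FG by(meson order_trans)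
next
 case (Suc k)
 assume "bnd R j AA"
 thus ?thesis unfolding Suc by(auto simp:syz_def)
qed

lemma bnd0_common:
 assumes "bnd R 0 AA" "bnd R 0 BB"
 shows "EX G n m. fin_gen R G & AA<:sball R {G} n & BB<:sball R {G} m"
proof -
 obtain G n where G: "fin_gen R G" "AA<:sball R {G} n" using assms by auto
 obtain H m where H: "fin_gen R H" "BB<:sball R {H} m" using assms by auto
 obtain P p q i j where P: "bip R G H P p q i j" using ex_bip[of R G H] G H by(auto simp:fin_gen_def)
 note B = bipD[OF P]
 have fP: "fin_gen R P" using bip_fin_gen[OF P G(1) H(1)] .
 hence PP: "{P}<:FG R" "P:add_cl R {P}" using add_cl_incl[of "{P}" R] by auto
 have "G:add_cl R {P}" using add_cl_smd[OF PP(1) smdI[OF B(3,1,5)] PP(2)] .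
 moreover have "H:add_cl R {P}" using add_cl_smd[OF PP(1) smdI[OF B(4,2,7)] PP(2)] .
 ultimately show ?thesis using sball_mono_gen[OF G(1) fP] sball_mono_gen[OF H(1) fP] G H fP by blast
qed

definition extc :: "('a,'c) ring_scheme=> 'a umod set=> 'a umod set=> 'a umod set" where
 "extc R AA BB = {Y. EX A:AA. EX B:BB. EX f g. ses R A Y B f g}"

context cring begin

text \<open>By projectivity the cover of \<open>B\<close> lifts to \<open>Y\<close>. Together with
  the cover of \<open>A\<close> it covers \<open>Y\<close>, and the kernel has sub \<open>KA\<close>
  and quotient \<open>KB\<close>.\<close>

lemma horseshoe:
 assumes s: "ses R A Y B f g" and sA: "syz R A KA" and sB: "syz R B KB"
 shows "EX KY. syz R Y KY & (EX u v. ses R KA KY KB u v)"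
proof -
 obtain EA ka a where EA: "EA:projc R" "ses R KA EA A ka a" using sA by(auto simp:syz_def)
 obtain EB kb b where EB: "EB:projc R" "ses R KB EB B kb b" using sB by(auto simp:syz_def)
 note D = sesD[OF s] and DA = sesD[OF EA(2)] and DB = sesD[OF EB(2)]
 have gs: "g ` $Y = $B" using s by(simp add:ses_def)
 obtain l where l: "lm R EB Y l" "ALL x:$EB. g (l x) = b x" using projc_lift[OF EB(1) DB(2) D(2) gs] by blast
 obtain E p q i j where bE: "bip R EA EB E p q i j" using ex_bip[OF DA(5) DB(5)] by blast
 note P = bipD[OF bE]
 have EP: "E:projc R" using add_cl_bip[OF free1_FG bE EA(1) EB(1)] .
 interpret Y: mdl R Y by(rule mdl.intro) (rule D)
 interpret A: mdl R A by(rule mdl.intro) (rule D)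
 interpret Bm: mdl R B by(rule mdl.intro) (rule D)
 interpret E: mdl R E by(rule mdl.intro) (rule P)
 let ?h = "%w. f (a (p w))+[Y] l (q w)"
 have h: "lm R E Y ?h" using lm_add[OF lm_comp[OF lm_comp[OF P(1) DA(2)] D(1)] lm_comp[OF P(2) l(1)]] .
 have cf: "x:$EA==> f (a x):$Y" for x using lmD(3)[OF lm_comp[OF DA(2) D(1)]] .
 have cl: "x:$EB==> l x:$Y" for x using lmD(3)[OF l(1)] .
 have hij: "?h (i x+[E] j y) = f (a x)+[Y] l y" if "x:$EA" "y:$EB" for x y
  using that P(10,11) by simp
 have gh: "g (?h w) = b (q w)" if "w:$E" for w
  using that lmD(4)[OF D(2) cf cl] lmD(3)[OF P(1)] lmD(3)[OF P(2)] D(7)[OF lmD(3)[OF DA(2)]] l(2) lmD(3)[OF DB(2)] by simp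
 have hs: "?h ` $E = $Y"
 proof
  show "$Y<:?h ` $E"
  proof
   fix y assume y: "y:$Y"
   obtain e where e: "e:$EB" "b e = g y" using DB(8) lmD(3)[OF D(2) y] by blast
   have "g (y-[Y] l e) = 0[B]" using lmD(8)[OF D(2) y cl[OF e(1)]] l(2) e lmD(3)[OF D(2) y] by(simp add:Bm.diff_eq_iff)
   then obtain x where x: "x:$A" "f x = y-[Y] l e" using D(9)[of "y-[Y] l e"] y cl[OF e(1)] by auto
   obtain c where c: "c:$EA" "a c = x" using DA(8) x by blast
   have "?h (i c+[E] j e) = y" using hij[OF c(1) e(1)] c x y cl[OF e(1)] by(simp add:Y.add_diff_cancel)
   thus "y:?h ` $E" using P(12)[OF c(1) e(1)] by blast
  qed
 qed (use lmD(3)[OF h] in auto)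
 let ?K = "E\<lparr>carrier := {w:$E. ?h w = 0[Y]}\<rparr>"
 have sK: "ses R ?K E Y (%x. x) ?h" using ses_kernel[OF h hs] .
 have inc: "lm R ?K E (%x. x)" using sesD(1)[OF sK] .
 have "lm R ?K EB q" using lm_comp[OF inc P(2)] .
 moreover have "b (q w) = 0[B]" if "w:$?K" for w using that gh[of w] lmD(6)[OF D(2)] by simp
 ultimately obtain v where v: "lm R ?K KB v" "ALL w:$?K. kb (v w) = q w" using ses_lift[OF EB(2)] by blast
 have "lm R KA E (%x. i (ka x))" using lm_comp[OF DA(1) P(3)] .
 moreover have "?h (i (ka x)) = 0[Y]" if "x:$KA" for x
  using lmD(3)[OF DA(1) that] P(5,6) DA(7)[OF that] lmD(6)[OF D(1)] lmD(6)[OF l(1)] by simp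
 ultimately obtain u where u: "lm R KA ?K u" "ALL x:$KA. u x = i (ka x)" using ses_lift[OF sK] by blast
 have "ses R KA ?K KB u v"
 proof (rule sesI[OF u(1) v(1)])
  fix x assume x: "x:$KA" "u x = 0[?K]"
  hence "i (ka x) = 0[E]" using u(2) by simp
  hence "ka x = 0[EA]" using P(5)[OF lmD(3)[OF DA(1) x(1)]] lmD(6)[OF P(1)] by simp
  thus "x = 0[KA]" using DA(10) x by blast
 next
  fix z assume z: "z:$KB"
  let ?e = "kb z"
  have e: "?e:$EB" "b ?e = 0[B]" using lmD(3)[OF DB(1) z] DB(7)[OF z] by auto
  hence "g (l ?e) = 0[B]" using l(2) by simp
  then obtain x where x: "x:$A" "f x = l ?e" using D(9) cl[OF e(1)] by blast
  obtain c where c: "c:$EA" "a c = \<ominus>\<^bsub>A\<^esub> x" using DA(8)[of "\<ominus>\<^bsub>A\<^esub> x"] x by auto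
  have "?h (i c+[E] j ?e) = 0[Y]" using hij[OF c(1) e(1)] c x lmD(7)[OF D(1) x(1)] cl[OF e(1)] by(simp add:Y.l_neg)
  hence w: "i c+[E] j ?e:$?K" using P(12)[OF c(1) e(1)] by simp
  have "kb (v (i c+[E] j ?e)) = kb z" using bspec[OF v(2) w] P(11)[OF c(1) e(1)] by simp
  hence "v (i c+[E] j ?e) = z" using inj_onD[OF DB(3)] lmD(3)[OF v(1) w] z by blast
  thus "EX y:$?K. v y = z" using w by blast
 next
  fix x assume x: "x:$KA"
  have "kb (v (u x)) = 0[EB]" using bspec[OF v(2) lmD(3)[OF u(1) x]] u(2) x P(6)[OF lmD(3)[OF DA(1) x]] by simp
  thus "v (u x) = 0[KB]" using DB(10)[OF lmD(3)[OF v(1) lmD(3)[OF u(1) x]]] by blast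
 next
  fix w assume w: "w:$?K" "v w = 0[KB]"
  hence qw: "q w = 0[EB]" using bspec[OF v(2) w(1)] lmD(6)[OF DB(1)] by simp
  have wc: "w:$E" "?h w = 0[Y]" using w by auto
  hence "f (a (p w)) = 0[Y]" using qw lmD(6)[OF l(1)] cf[OF lmD(3)[OF P(1) wc(1)]] by simp
  hence "a (p w) = 0[A]" using D(10) lmD(3)[OF DA(2) lmD(3)[OF P(1) wc(1)]] by blast
  then obtain x where x: "x:$KA" "ka x = p w" using DA(9) lmD(3)[OF P(1) wc(1)] by blast
  hence "u x = w" using u(2) P(9)[OF wc(1)] qw lmD(6)[OF P(4)] lmD(3)[OF P(3) lmD(3)[OF P(1) wc(1)]] by simp
  thus "EX x:$KA. u x = w" using x by blast
 qed
 moreover from this have "fin_gen R ?K" using fin_gen_ext sA sB by(auto simp:syz_def)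
 moreover have "fin_gen R Y" using fin_gen_ext[OF s] sA sB by(auto simp:syz_def)
 ultimately show ?thesis unfolding syz_def using EP sK by blast
qed

lemma bnd_ext: "bnd R j AA==> bnd R j BB==> bnd R j (extc R AA BB)"
proof (induct j arbitrary: AA BB)
 case 0
 obtain G n m where G: "fin_gen R G" "AA<:sball R {G} n" "BB<:sball R {G} m" using bnd0_common[OF 0] by blast
 have "extc R AA BB<:sball R {G} (n + m + 1)"
  using sball_ext[OF G(1)] G(2,3) by(fastforce simp:extc_def)
 thus ?case using G(1) unfolding bnd.simps by blast
next
 case (Suc j)
 obtain CC where C: "bnd R j CC" "ALL M:AA. EX L:CC. syz R M L" using Suc(2) by auto
 obtain DD where D: "bnd R j DD" "ALL M:BB. EX L:DD. syz R M L" using Suc(3) by auto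
 have "EX L:extc R CC DD. syz R Y L" if Y: "Y:extc R AA BB" for Y
 proof -
  obtain A B f g where AB: "A:AA" "B:BB" "ses R A Y B f g" using Y by(auto simp:extc_def)
  obtain KA KB where K: "KA:CC" "syz R A KA" "KB:DD" "syz R B KB" using AB C(2) D(2) by blast
  obtain KY u v where "syz R Y KY" "ses R KA KY KB u v" using horseshoe[OF AB(3) K(2,4)] by blast
  thus ?thesis using K(1,3) unfolding extc_def by blast
 qed
 thus ?case using Suc(1)[OF C(1) D(1)] by auto
qed

lemma bnd_projc: "bnd R j (projc R)"
proof (induct j)
 case 0 show ?case unfolding bnd.simps using free_fin_gen[of 1] sball.simps(1)[of R "{free_mod R 1}"] by blast
next
 case (Suc j)
 have "EX L:projc R. syz R E L" if E: "E:projc R" for E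
 proof -
  have fE: "fin_gen R E" using E projc_FG by blast
  hence Em: "module R E" by(simp add:fin_gen_def)
  interpret E: mdl R E by rule fact
  let ?Z = "E\<lparr>carrier := {0[E]}\<rparr>"
  have Z: "module R ?Z" using E.sm_module[OF E.sm_zero] .
  have "ses R ?Z E E (%x. x) (%x. x)" using E.sm_lm[OF E.sm_zero] lm_id[OF Em] by(intro sesI) auto
  hence "syz R E ?Z" unfolding syz_def using fE zero_mod_fg[OF Em] E by blast
  moreover have "?Z:projc R" using zero_in_add_cl[OF free1_FG Z] by simp
  ultimately show ?thesis by blast
 qed
 thus ?case using Suc by auto
qed

text \<open>Compose a cover \<open>E -> Y\<close> with \<open>Y -> Z\<close>: the kernel has the
  syzygy of \<open>Y\<close> as sub and \<open>A\<close> itself as quotient. Hence \<open>A\<close>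
  is needed one degree lower than \<open>Y\<close>.\<close>

lemma bnd_coker:
 assumes "bnd R (Suc j) YY" "bnd R j AA"
 shows "bnd R (Suc j) {Z. EX A:AA. EX Y:YY. EX f g. ses R A Y Z f g}"
proof -
 obtain CC where C: "bnd R j CC" "ALL M:YY. EX L:CC. syz R M L" using assms by auto
 have "EX L:extc R CC AA. syz R Z L" if A: "A:AA" and Y: "Y:YY" and s: "ses R A Y Z f g" for A Y Z f g
 proof -
  obtain L where L: "L:CC" "syz R Y L" using C(2) Y by blast
  then obtain E k p where E: "E:projc R" "ses R L E Y k p" by(auto simp:syz_def)
  note D = sesD[OF s] and DE = sesD[OF E(2)]
  interpret Z: mdl R Z by(rule mdl.intro) (rule D)
  have gp: "lm R E Z (%x. g (p x))" using lm_comp[OF DE(2) D(2)] .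
  have "(%x. g (p x)) ` $E = $Z"
   using s E(2) unfolding ses_def by(metis image_image)
  note s1 = ses_kernel[OF gp this]
  let ?K = "E\<lparr>carrier := {x:$E. g (p x) = 0[Z]}\<rparr>"
  have "lm R ?K Y p" using lm_comp[OF sesD(1)[OF s1] DE(2)] .
  then obtain v where v: "lm R ?K A v" "ALL w:$?K. f (v w) = p w" using ses_lift[OF s] by fastforce
  have "!!x. x:$L==> g (p (k x)) = 0[Z]" using DE(7) lmD(6)[OF D(2)] by simp
  then obtain u where u: "lm R L ?K u" "ALL x:$L. u x = k x" using ses_lift[OF s1 DE(1)] by blast
  have s2: "ses R L ?K A u v"
  proof (rule sesI[OF u(1) v(1)])
   fix x assume "x:$L" "u x = 0[?K]" thus "x = 0[L]" using DE(10) u(2) by simp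
  next
   fix z assume z: "z:$A"
   obtain e where e: "e:$E" "p e = f z" using DE(8) lmD(3)[OF D(1) z] by blast
   hence w: "e:$?K" using D(7)[OF z] by simp
   hence "f (v e) = f z" using bspec[OF v(2) w] e by simp
   hence "v e = z" using inj_onD[OF D(3)] lmD(3)[OF v(1) w] z by blast
   thus "EX y:$?K. v y = z" using w by blast
  next
   fix x assume x: "x:$L"
   have "f (v (u x)) = 0[Y]" using bspec[OF v(2) lmD(3)[OF u(1) x]] u(2) x DE(7) by simp
   thus "v (u x) = 0[A]" using D(10)[OF lmD(3)[OF v(1) lmD(3)[OF u(1) x]]] by blast
  next
   fix w assume w: "w:$?K" "v w = 0[A]"
   hence "p w = 0[Y]" using bspec[OF v(2) w(1)] lmD(6)[OF D(1)] by simp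
   thus "EX x:$L. u x = w" using DE(9) w u(2) by auto
  qed
  have fg: "fin_gen R ?K" using fin_gen_ext[OF s2] L(2) bnd_FG[OF assms(2)] A by(auto simp:syz_def)
  have "fin_gen R Z" using fin_gen_surj[OF D(2)] s L(2) by(auto simp:ses_def syz_def)
  hence "syz R Z ?K" unfolding syz_def using fg E(1) s1 by blast
  moreover have "?K:extc R CC AA" using s2 L(1) A by(auto simp:extc_def)
  ultimately show ?thesis by blast
 qed
 thus ?thesis using bnd_ext[OF C(1) assms(2)] by auto
qed

text \<open>The sequence splits as \<open>E\<close> is projective. In degree 0 this makes
  \<open>A\<close> a summand of \<open>W\<close>. In higher degree the complementary surjection
  \<open>W -> A\<close> has kernel \<open>E\<close>, so a syzygy of \<open>A\<close> has a syzygy of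
  \<open>W\<close> as sub and \<open>E\<close> as quotient.\<close>

lemma bnd_split:
 assumes "bnd R j WW"
 shows "bnd R j {A. EX W:WW. EX E:projc R. EX f g. ses R A W E f g}"
proof -
 have split:"EX t r. lm R E W t & lm R W A r & (ALL e:$E. g (t e) = e & r (t e) = 0[A]) & (ALL x:$A. r (f x) = x) &
(ALL w:$W. f (r w) = w-[W] t (g w))"
  if E: "E:projc R" and s: "ses R A W E f g" for A W E f g
 proof -
  note D = sesD[OF s]
  interpret W: mdl R W by(rule mdl.intro) (rule D)
  interpret E: mdl R E by(rule mdl.intro) (rule D)
  have "g ` $W = $E" using s by(simp add:ses_def)
  then obtain t where t: "lm R E W t" "ALL e:$E. g (t e) = e" using projc_lift[OF E lm_id[OF D(6)] D(2)] by blast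
  let ?h = "%w. w-[W] t (g w)"
  have h: "lm R W W ?h" using lm_diff[OF lm_id[OF D(5)] lm_comp[OF D(2) t(1)]] .
  have "g (?h w) = 0[E]" if "w:$W" for w
   using that lmD(8)[OF D(2) that lmD(3)[OF t(1) lmD(3)[OF D(2) that]]] t(2) lmD(3)[OF D(2) that] by(simp add:E.diff_self)
  then obtain r where r: "lm R W A r" "ALL w:$W. f (r w) = ?h w" using ses_lift[OF s h] by blast
  have 1: "r (t e) = 0[A]" if e: "e:$E" for e
  proof -
   have "f (r (t e)) = 0[W]" using r(2) lmD(3)[OF t(1) e] t(2) e by(simp add:W.diff_self)
   thus ?thesis using D(10) lmD(3)[OF r(1) lmD(3)[OF t(1) e]] by blast
  qed
  have 2: "r (f x) = x" if x: "x:$A" for x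
  proof -
   have "f (r (f x)) = f x" using r(2) lmD(3)[OF D(1) x] D(7)[OF x] lmD(6)[OF t(1)] by(simp add:W.diff_zero)
   thus ?thesis using inj_onD[OF D(3)] x lmD(3)[OF r(1) lmD(3)[OF D(1) x]] by blast
  qed
  show ?thesis using t r 1 2 by blast
 qed
 show ?thesis
 proof (cases j)
  case 0
  obtain G n where G: "fin_gen R G" "WW<:sball R {G} n" using assms 0 by auto
  have "A:sball R {G} n" if E: "W:WW" "E:projc R" and s: "ses R A W E f g" for A W E f g
  proof -
   obtain t r where "lm R W A r" "ALL x:$A. r (f x) = x" using split[OF E(2) s] by blast
   hence "smd R A W" using smdI[OF sesD(1)[OF s]] by blast
   thus ?thesis using sball_smd[OF G(1)] G(2) E by blast
  qed
  hence "{A. EX W:WW. EX E:projc R. EX f g. ses R A W E f g}<:sball R {G} n" by blast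
  thus ?thesis unfolding 0 bnd.simps using G(1) by blast
 next
  case (Suc k)
  obtain CC where C: "bnd R k CC" "ALL M:WW. EX L:CC. syz R M L" using assms Suc by auto
  have "EX L:extc R CC (projc R). syz R A L" if W: "W:WW" and E: "E:projc R" and s: "ses R A W E f g" for A W E f g
  proof -
   obtain t r where tr: "lm R E W t" "lm R W A r" "ALL e:$E. g (t e) = e & r (t e) = 0[A]"
    "ALL x:$A. r (f x) = x" "ALL w:$W. f (r w) = w-[W] t (g w)" using split[OF E s] by blast
   note D = sesD[OF s]
   interpret W: mdl R W by(rule mdl.intro) (rule D)
   have rs: "r ` $W = $A" using tr(4) lmD(3)[OF D(1)] lmD(3)[OF tr(2)] by force
   have sr: "ses R E W A t r"
   proof (rule sesI[OF tr(1,2)])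
    fix e assume "e:$E" "t e = 0[W]" thus "e = 0[E]" using tr(3) lmD(6)[OF D(2)] by metis
   next
    fix w assume w: "w:$W" "r w = 0[A]"
    hence "w-[W] t (g w) = 0[W]" using tr(5) lmD(6)[OF D(1)] by metis
    hence "w = t (g w)" using w lmD(3)[OF tr(1) lmD(3)[OF D(2) w(1)]] by(simp add:W.diff_eq_iff)
    thus "EX x:$E. t x = w" using lmD(3)[OF D(2) w(1)] by metis
   next
    fix z assume "z:$A" thus "EX y:$W. r y = z" using tr(4) lmD(3)[OF D(1)] by blast
   qed (use tr in auto)
   obtain L where L: "L:CC" "syz R W L" using C W by blast
   then obtain F u p where F: "F:projc R" "ses R L F W u p" by(auto simp:syz_def)
   note DF = sesD[OF F(2)]
   have rp: "lm R F A (%x. r (p x))" using lm_comp[OF DF(2) tr(2)] .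
   have "(%x. r (p x)) ` $F = $A" using rs F(2) unfolding ses_def by(metis image_image)
   note s1 = ses_kernel[OF rp this]
   let ?K = "F\<lparr>carrier := {x:$F. r (p x) = 0[A]}\<rparr>"
   have "lm R ?K W p" using lm_comp[OF sesD(1)[OF s1] DF(2)] .
   then obtain v where v: "lm R ?K E v" "ALL w:$?K. t (v w) = p w" using ses_lift[OF sr] by fastforce
   have "!!x. x:$L==> r (p (u x)) = 0[A]" using DF(7) lmD(6)[OF tr(2)] by simp
   then obtain u' where u': "lm R L ?K u'" "ALL x:$L. u' x = u x" using ses_lift[OF s1 DF(1)] by blast
   note Dr = sesD[OF sr]
   have s2: "ses R L ?K E u' v"
   proof (rule sesI[OF u'(1) v(1)])
    fix x assume "x:$L" "u' x = 0[?K]" thus "x = 0[L]" using DF(10) u'(2) by simp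
   next
    fix z assume z: "z:$E"
    obtain e where e: "e:$F" "p e = t z" using DF(8) lmD(3)[OF tr(1) z] by blast
    hence w: "e:$?K" using tr(3) z by simp
    hence "t (v e) = t z" using bspec[OF v(2) w] e by simp
    hence "v e = z" using inj_onD[OF Dr(3)] lmD(3)[OF v(1) w] z by blast
    thus "EX y:$?K. v y = z" using w by blast
   next
    fix x assume x: "x:$L"
    have "t (v (u' x)) = 0[W]" using bspec[OF v(2) lmD(3)[OF u'(1) x]] u'(2) x DF(7) by simp
    thus "v (u' x) = 0[E]" using Dr(10)[OF lmD(3)[OF v(1) lmD(3)[OF u'(1) x]]] by blast
   next
    fix w assume w: "w:$?K" "v w = 0[E]"
    hence "p w = 0[W]" using bspec[OF v(2) w(1)] lmD(6)[OF tr(1)] by simp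
    thus "EX x:$L. u' x = w" using DF(9) w u'(2) by auto
   qed
   have "fin_gen R E" using E projc_FG by blast
   hence fg: "fin_gen R ?K" using fin_gen_ext[OF s2] L(2) by(auto simp:syz_def)
   have "fin_gen R A" using fin_gen_surj[OF tr(2) rs] L(2) by(auto simp:syz_def)
   hence "syz R A ?K" unfolding syz_def using fg F(1) s1 by blast
   moreover have "?K:extc R CC (projc R)" using s2 L(1) E by(auto simp:extc_def)
   ultimately show ?thesis by blast
  qed
  thus ?thesis using bnd_ext[OF C(1) bnd_projc] Suc by auto
 qed
qed

text \<open>Pull \<open>Y -> Z\<close> back along a projective cover \<open>E -> Z\<close>. The
  pullback has a syzygy of \<open>Z\<close> as sub and \<open>Y\<close> as quotient; it also has
  \<open>A\<close> as sub and the projective \<open>E\<close> as quotient, so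
  \<open>bnd_split\<close> recovers \<open>A\<close>. The price is that \<open>Z\<close> must be
  bounded one degree higher.\<close>

lemma bnd_ker:
 assumes "bnd R (Suc j) ZZ" "bnd R j YY"
 shows "bnd R j {A. EX Y:YY. EX Z:ZZ. EX f g. ses R A Y Z f g}"
proof -
 obtain CC where C: "bnd R j CC" "ALL M:ZZ. EX L:CC. syz R M L" using assms by auto
 have "EX W:extc R CC YY. EX E:projc R. EX f g. ses R A W E f g"
  if YZ: "Y:YY" "Z:ZZ" and s: "ses R A Y Z f g" for A :: "'a umod" and Y Z f g
 proof -
  obtain L where L: "L:CC" "syz R Z L" using C YZ by blast
  then obtain E k b where E: "E:projc R" "ses R L E Z k b" by(auto simp:syz_def)
  note D = sesD[OF s] and DE = sesD[OF E(2)]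
  interpret Z: mdl R Z by(rule mdl.intro) (rule D)
  obtain P p q i j where bP: "bip R Y E P p q i j" using ex_bip[OF D(5) DE(5)] by blast
  note P = bipD[OF bP]
  interpret P: mdl R P by(rule mdl.intro) (rule P)
  let ?h = "%w. g (p w)-[Z] b (q w)"
  have h: "lm R P Z ?h" using lm_diff[OF lm_comp[OF P(1) D(2)] lm_comp[OF P(2) DE(2)]] .
  define U where "U = {w:$P. ?h w = 0[Z]}"
  have Uiff: "w:U \<longleftrightarrow> w:$P & g (p w) = b (q w)" for w
   using lmD(3)[OF lm_comp[OF P(1) D(2)]] lmD(3)[OF lm_comp[OF P(2) DE(2)]] by(auto simp:U_def Z.diff_eq_iff)
  have U: "sm R P U" unfolding U_def using lm_ker[OF h] .
  let ?W = "P\<lparr>carrier := U\<rparr>"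
  have inc: "lm R ?W P (%x. x)" using P.sm_lm[OF U] .
  have Wm: "module R ?W" using lmD(1)[OF inc] .
  have mk: "i y+[P] j e:U" if "y:$Y" "e:$E" "g y = b e" for y e
   using that P(10,11,12) Uiff by simp
  have into: "lm R V ?W l" if "lm R V P l" "!!x. x:$V==> l x:U" for V :: "'a umod" and l
   using that lmD[OF that(1)] Wm by(intro lmI) auto
  have lp: "lm R ?W Y p" and lq: "lm R ?W E q" using lm_comp[OF inc P(1)] lm_comp[OF inc P(2)] by auto
  have lL: "lm R L ?W (%x. j (k x))"
   using lmD(3)[OF DE(1)] lmD(3)[OF P(4)] P(7,8) DE(7) lmD(6)[OF D(2)]
   by(intro into[OF lm_comp[OF DE(1) P(4)]]) (simp add:Uiff)
  have lA: "lm R A ?W (%x. i (f x))"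
   using lmD(3)[OF D(1)] lmD(3)[OF P(3)] P(5,6) D(7) lmD(6)[OF DE(2)]
   by(intro into[OF lm_comp[OF D(1) P(3)]]) (simp add:Uiff)
  have s1: "ses R L ?W Y (%x. j (k x)) p"
  proof (rule sesI[OF lL lp])
   fix x assume x: "x:$L" "j (k x) = 0[?W]"
   hence "k x = 0[E]" using P(7)[OF lmD(3)[OF DE(1) x(1)]] lmD(6)[OF P(2)] by simp
   thus "x = 0[L]" using DE(10) x by blast
  next
   fix y assume y: "y:$Y"
   obtain e where e: "e:$E" "b e = g y" using DE(8) lmD(3)[OF D(2) y] by blast
   thus "EX w:$?W. p w = y" using mk[OF y e(1)] P(10)[OF y e(1)] by(intro bexI[of _ "i y+[P] j e"]) auto
  next
   fix x assume "x:$L" thus "p (j (k x)) = 0[Y]" using P(8) lmD(3)[OF DE(1)] by blast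
  next
   fix w assume w: "w:$?W" "p w = 0[Y]"
   hence wc: "w:$P" "b (q w) = 0[Z]" using Uiff lmD(6)[OF D(2)] by auto
   then obtain x where x: "x:$L" "k x = q w" using DE(9) lmD(3)[OF P(2)] by blast
   hence "j (k x) = w" using P(9)[OF wc(1)] w(2) lmD(6)[OF P(3)] lmD(3)[OF P(4) lmD(3)[OF P(2) wc(1)]] by simp
   thus "EX x:$L. j (k x) = w" using x by blast
  qed
  have s2: "ses R A ?W E (%x. i (f x)) q"
  proof (rule sesI[OF lA lq])
   fix x assume x: "x:$A" "i (f x) = 0[?W]"
   hence "f x = 0[Y]" using P(5)[OF lmD(3)[OF D(1) x(1)]] lmD(6)[OF P(1)] by simp
   thus "x = 0[A]" using D(10) x by blast
  next
   fix e assume e: "e:$E"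
   obtain y where y: "y:$Y" "g y = b e" using D(8) lmD(3)[OF DE(2) e] by blast
   thus "EX w:$?W. q w = e" using mk[OF y(1) e] P(11)[OF y(1) e] by(intro bexI[of _ "i y+[P] j e"]) auto
  next
   fix x assume "x:$A" thus "q (i (f x)) = 0[E]" using P(6) lmD(3)[OF D(1)] by blast
  next
   fix w assume w: "w:$?W" "q w = 0[E]"
   hence wc: "w:$P" "g (p w) = 0[Z]" using Uiff lmD(6)[OF DE(2)] by auto
   then obtain x where x: "x:$A" "f x = p w" using D(9) lmD(3)[OF P(1)] by blast
   hence "i (f x) = w" using P(9)[OF wc(1)] w(2) lmD(6)[OF P(4)] lmD(3)[OF P(3) lmD(3)[OF P(1) wc(1)]] by simp
   thus "EX x:$A. i (f x) = w" using x by blast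
  qed
  have "?W:extc R CC YY" using s1 L(1) YZ by(auto simp:extc_def)
  thus ?thesis using E(1) s2 by blast
 qed
 hence "{A :: 'a umod. EX Y:YY. EX Z:ZZ. EX f g. ses R A Y Z f g}<:{A. EX W:extc R CC YY. EX E:projc R. EX f g. ses R A W E f g}" by blast
 thus ?thesis using bnd_mono[OF bnd_split[OF bnd_ext[OF C(1) assms(2)]]] by blast
qed

end

section \<open>Powers of a module, cyclic modules and quotients\<close>

text \<open>Finite direct powers of \<open>B\<close> up to isomorphism. Unlike the additive closure
  they contain no proper summands, so syzygies and reductions modulo an element are again powers of
  one fixed module.\<close>

inductive_set pw :: "('a,'c) ring_scheme=> 'a umod=> 'a umod set" for R B where
 zero: "fin_gen R Z==> $Z = {0[Z]}==> Z:pw R B"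
| step: "N:pw R B==> bip R B N P p q i j==> P:pw R B"

lemma pw_add: assumes "fin_gen R B" shows "pw R B<:add_cl R {B}"
proof
 have B: "{B}<:FG R" using assms by simp
 fix N assume "N:pw R B" thus "N:add_cl R {B}"
 proof (induct rule: pw.induct)
  case (zero Z) thus ?case using zero_in_add_cl[OF B] by(auto simp:fin_gen_def)
 next
  case (step N P p q i j) thus ?case using add_cl_bip[OF B] add_cl_incl[OF B] by blast
 qed
qed

lemma pw_FG: "fin_gen R B==> pw R B<:FG R"
 using pw_add add_cl_FG by(meson order_trans)

lemma lm_inverse:
 assumes "lm R M N f" "bij_betw f ($M) ($N)"
 shows "EX g. lm R N M g & (ALL x:$M. g (f x) = x) & (ALL y:$N. f (g y) = y)"
proof -
 interpret M: mdl R M using lmD(1)[OF assms(1)] by rule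
 have s: "f ` $M = $N" and i: "inj_on f ($M)" using assms(2) by(auto simp:bij_betw_def)
 have z: "y:$M==> f y = 0[N]==> y = 0[M]" for y
  using inj_onD[OF i, of y "0[M]"] lmD(6)[OF assms(1)] by simp
 obtain g where g: "lm R N M g" "ALL y:$M. g (f y) = y"
  using ses_descend[OF assms(1) s lm_id[OF M.module_axioms] z] by blast
 have "f (g y) = y" if "y:$N" for y using that g(2) s by(metis imageE)
 thus ?thesis using g by blast
qed

lemma pw_iso:
 assumes "E:pw R B" "lm R E N f" "bij_betw f ($E) ($N)" shows "N:pw R B"
 using assms(1)
proof cases
 obtain g where g: "lm R N E g" "ALL x:$E. g (f x) = x" "ALL y:$N. f (g y) = y"
  using lm_inverse[OF assms(2,3)] by blast
 have s: "f ` $E = $N" using assms(3) by(simp add:bij_betw_def)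
 {
  case zero
  have "fin_gen R N" using fin_gen_surj[OF assms(2) s zero(1)] .
  moreover have "$N = {0[N]}" using s zero(2) lmD(6)[OF assms(2)] by(metis image_empty image_insert)
  ultimately show ?thesis by(rule pw.zero)
 next
  case (step N' p q i j)
  note P = bipD[OF step(2)]
  have "bip R B N' N (%x. p (g x)) (%x. q (g x)) (%x. f (i x)) (%x. f (j x))"
   unfolding bip_def
  proof (intro conjI ballI)
   fix w assume w: "w:$N"
   hence gw: "g w:$E" using lmD(3)[OF g(1)] by blast
   have "f (g w) = f (i (p (g w))+[E] j (q (g w)))" using P(9)[OF gw] by simp
   also have "... = f (i (p (g w)))+[N] f (j (q (g w)))"
    using lmD(4)[OF assms(2)] lmD(3)[OF P(3) lmD(3)[OF P(1) gw]] lmD(3)[OF P(4) lmD(3)[OF P(2) gw]] by blast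
   finally show "w = f (i (p (g w)))+[N] f (j (q (g w)))" using g(3) w by simp
  next
   show "lm R N B (%x. p (g x))" "lm R N N' (%x. q (g x))" using lm_comp[OF g(1) P(1)] lm_comp[OF g(1) P(2)] .
   show "lm R B N (%x. f (i x))" "lm R N' N (%x. f (j x))" using lm_comp[OF P(3) assms(2)] lm_comp[OF P(4) assms(2)] .
  next
   fix x assume x: "x:$B"
   show "p (g (f (i x))) = x" "q (g (f (i x))) = 0[N']" using g(2) lmD(3)[OF P(3) x] P(5,6) x by simp_all
  next
   fix x assume x: "x:$N'"
   show "q (g (f (j x))) = x" "p (g (f (j x))) = 0[B]" using g(2) lmD(3)[OF P(4) x] P(7,8) x by simp_all
  qed
  thus ?thesis using pw.step[OF step(1)] by blast
 }
qed

context cring begin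

lemma pw_syz:
 assumes "syz R B L" "N:pw R B" shows "EX T:pw R L. syz R N T"
 using assms(2)
proof (induct rule: pw.induct)
 case (zero Z)
 have Zm: "module R Z" using zero by(simp add:fin_gen_def)
 have "ses R Z Z Z (%x. x) (%x. x)" using lm_id[OF Zm] zero by(intro sesI) auto
 moreover have "Z:projc R" using zero_in_add_cl[OF free1_FG Zm zero(2)] .
 ultimately have "syz R Z Z" unfolding syz_def using zero by blast
 thus ?case using pw.zero[OF zero] by blast
next
 case (step N P p q i j)
 obtain T where T: "T:pw R L" "syz R N T" using step by blast
 obtain E k a where E: "E:projc R" "ses R L E B k a" using assms(1) by(auto simp:syz_def)
 obtain F l b where F: "F:projc R" "ses R T F N l b" using T by(auto simp:syz_def)
 obtain PL p1 q1 i1 j1 where PL: "bip R L T PL p1 q1 i1 j1" using ex_bip[OF sesD(4)[OF E(2)] sesD(4)[OF F(2)]] by blast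
 obtain PE p2 q2 i2 j2 where PE: "bip R E F PE p2 q2 i2 j2" using ex_bip[OF sesD(5)[OF E(2)] sesD(5)[OF F(2)]] by blast
 have "PE:projc R" using add_cl_bip[OF free1_FG PE E(1) F(1)] .
 moreover note ses_bip[OF E(2) F(2) PL PE step(3)]
 moreover have "fin_gen R P" using bip_fin_gen[OF step(3)] assms(1) T(2) by(auto simp:syz_def)
 moreover have "fin_gen R PL" using bip_fin_gen[OF PL] assms(1) T(2) by(auto simp:syz_def)
 ultimately have "syz R P PL" unfolding syz_def by blast
 thus ?case using pw.step[OF T(1) PL] by blast
qed

lemma ex_syz:
 assumes "noetherian_ring R" "fin_gen R M" shows "EX L. syz R (M :: 'a umod) L"
proof -
 obtain n g where g: "gens_by R M n g" "module R M" using assms by(auto simp:fin_gen_def)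
 note s = gens_by_ses[OF g(2,1)]
 have "syz R M (ker_syz R M n g)" unfolding syz_def
  using assms fin_gen_kernel[OF assms(1) s free_fin_gen] s free_projc by blast
 thus ?thesis by blast
qed

text \<open>Powers of \<open>B\<close> have powers of one syzygy of \<open>B\<close> as syzygies,
  and all powers of one module lie in the smallest ball that it generates.\<close>

lemma bnd_pw: assumes "noetherian_ring R" shows "fin_gen R B==> bnd R j (pw R B)"
proof (induct j arbitrary: B)
 case 0 thus ?case unfolding bnd.simps using pw_add sball.simps(1)[of R "{B}"] by blast
next
 case (Suc j)
 obtain L where L: "syz R B L" using ex_syz[OF assms Suc(2)] by blast
 hence "bnd R j (pw R L)" using Suc(1) by(auto simp:syz_def)
 thus ?case unfolding bnd.simps using pw_syz[OF L] by blast
qed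

text \<open>One copy of \<open>B\<close> for each member of a finite generating set.\<close>

lemma pw_surj:
 assumes B: "fin_gen R B" and M: "fin_gen R (M :: 'a umod)"
  and h: "!!y. y:$M==> EX h. lm R B M h & y:h ` $B"
 shows "EX E:pw R B. EX k. lm R E M k & k ` $E = $M"
proof -
 have Mm: "module R M" and Bm: "module R B" using M B by(auto simp:fin_gen_def)
 interpret M: mdl R M using Mm by rule
 interpret Bm: mdl R B using Bm by rule
 obtain V where V: "finite V" "V<:$M" "$M<:spn R M V" using M M.fin_gen_iff by blast
 from V(1,2) have "EX E:pw R B. EX k. lm R E M k & spn R M V<:k ` $E"
 proof (induct)
  case empty
  let ?Z = "M\<lparr>carrier := {0[M]}\<rparr>"
  have "?Z:pw R B" using zero_mod_fg[OF Mm] by(intro pw.zero) auto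
  moreover have "spn R M {}<:{0[M]}" using M.spn_least[OF M.sm_zero] by blast
  ultimately show ?case using M.sm_lm[OF M.sm_zero] by(intro bexI[of _ ?Z] exI[of _ "%x. x"]) auto
 next
  case (insert x V)
  then obtain E k where E: "E:pw R B" "lm R E M k" "spn R M V<:k ` $E" by auto
  obtain l b where l: "lm R B M l" "b:$B" "x = l b" using h[of x] insert(4) by auto
  obtain P p q i j where P: "bip R B E P p q i j" using ex_bip[OF Bm lmD(1)[OF E(2)]] by blast
  note D = bipD[OF P]
  interpret E: mdl R E using lmD(1)[OF E(2)] by rule
  let ?h = "%w. l (p w)+[M] k (q w)"
  have lh: "lm R P M ?h" using lm_add[OF lm_comp[OF D(1) l(1)] lm_comp[OF D(2) E(2)]] .
  interpret P: mdl R P by(rule mdl.intro) (rule D)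
  have "insert x V<:?h ` $P"
  proof
   fix v assume "v:insert x V"
   then consider "v = x" | "v:V" by blast
   thus "v:?h ` $P"
   proof cases
    case 1
    hence "?h (i b) = v" using D(5,6) l lmD(6)[OF E(2)] lmD(3)[OF l(1)] by simp
    thus ?thesis using lmD(3)[OF D(3) l(2)] by blast
   next
    case 2
    then obtain u where u: "u:$E" "v = k u" using E(3) M.spn_incl insert(4) by blast
    hence "?h (j u) = v" using D(7,8) lmD(6)[OF l(1)] lmD(3)[OF E(2)] by simp
    thus ?thesis using lmD(3)[OF D(4) u(1)] by blast
   qed
  qed
  hence "spn R M (insert x V)<:?h ` $P" using M.spn_least[OF lm_image[OF lh P.sm_carrier]] by blast
  thus ?case using pw.step[OF E(1) P] lh by blast
 qed
 then obtain E k where E: "E:pw R B" "lm R E M k" "spn R M V<:k ` $E" by blast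
 hence "k ` $E = $M" using V(3) lmD(3)[OF E(2)] by blast
 thus ?thesis using E by blast
qed

section \<open>Cyclic modules R / I, annihilators, and reduction modulo an element\<close>

definition cyc :: "'a umod=> (nat=> 'a)=> 'a set=> bool" where
 "cyc B e I \<longleftrightarrow> fin_gen R B & e:$B & (ALL b:$B. EX r:$R. b = r*[B] e) &
(ALL r:$R. r*[B] e = 0[B] \<longleftrightarrow> r:I)"

lemma ex_cyc: assumes "ideal I R" shows "EX B e. cyc B e I"
proof -
 interpret I: ideal I R by fact
 let ?F = "free_mod R 1"
 interpret F: mdl R ?F by(rule mdl.intro) (rule module_free)
 let ?e = "\<lambda>i\<in>{..<1::nat}.#1"
 have e: "?e:$?F" by(auto simp:free_mod_carrier)
 have c: "c = c 0*[?F] ?e" "c 0:$R" if c: "c:$?F" for c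
 proof -
  show c0: "c 0:$R" using free_mod_nth[OF c] by simp
  show "c = c 0*[?F] ?e"
   by(rule free_mod_eqI[where R=R and n=1]) (use c c0 F.smult_closed[OF c0 e] in \<open>auto simp:free_mod_simps\<close>)
 qed
 have U: "sm R ?F {c:$?F. c 0:I}"
  unfolding sm_def using I.I_l_closed by(auto simp:free_mod_simps)
 obtain B :: "'a umod" and q where B: "lm R ?F B q" "q ` $?F = $B" "ALL x:$?F. q x = 0[B] \<longleftrightarrow> x:{c:$?F. c 0:I}"
  using ex_quot[OF F.module_axioms U] by blast
 interpret B: mdl R B using lmD(2)[OF B(1)] by rule
 have "cyc B (q ?e) I" unfolding cyc_def
 proof (intro conjI ballI)
  show "fin_gen R B" using fin_gen_surj[OF B(1,2) free_fin_gen] .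
  show "q ?e:$B" using lmD(3)[OF B(1) e] .
  fix b assume "b:$B"
  then obtain x where x: "x:$?F" "b = q x" using B(2) by blast
  have "b = x 0*[B] q ?e" using lmD(5)[OF B(1) c(2)[OF x(1)] e] c(1)[OF x(1)] x(2) by simp
  thus "EX r:$R. b = r*[B] q ?e" using c(2)[OF x(1)] by blast
 next
  fix r assume r: "r:$R"
  have "r*[B] q ?e = q (r*[?F] ?e)" using lmD(5)[OF B(1) r e] by simp
  moreover have "r*[?F] ?e:$?F" "(r*[?F] ?e) 0 = r" using r e by(auto simp:free_mod_simps)
  ultimately show "r*[B] q ?e = 0[B] \<longleftrightarrow> r:I" using B(3) by simp
 qed
 thus ?thesis by blast
qed

lemma cyc_hom:
 assumes c: "cyc B e I" and M: "module R M" and y: "y:$M" "!!a. a:I==> a*[M] y = 0[M]"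
 shows "EX h. lm R B M h & (ALL r:$R. h (r*[B] e) = r*[M] y)"
proof -
 interpret M: mdl R M using M by rule
 have Bm: "module R B" using c by(simp add:cyc_def fin_gen_def)
 interpret B: mdl R B using Bm by rule
 note cy = c[unfolded cyc_def]
 have wd: "r*[M] y = r'*[M] y" if r: "r:$R" "r':$R" "r*[B] e = r'*[B] e" for r r'
 proof -
  have "(r -: r')*[B] e = 0[B]" using r cy by(simp add:a_minus_def B.smult_l_distr B.smult_l_minus B.r_neg)
  hence "r -: r':I" using cy r by simp
  hence "(r -: r')*[M] y = 0[M]" using y by blast
  hence "r*[M] y-[M] r'*[M] y = 0[M]" using r y by(simp add:a_minus_def M.smult_l_distr M.smult_l_minus)
  thus ?thesis using r y by(simp add:M.diff_eq_iff)
 qed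
 define h where "h b = (SOME r. r:$R & b = r*[B] e)*[M] y" for b
 have h: "h (r*[B] e) = r*[M] y" if r: "r:$R" for r
 proof -
  let ?s = "SOME s. s:$R & r*[B] e = s*[B] e"
  have "?s:$R & r*[B] e = ?s*[B] e" by(rule someI[of _ r]) (use r in simp)
  thus ?thesis unfolding h_def using wd[of ?s r] r by simp
 qed
 have "lm R B M h"
 proof (rule lmI[OF Bm M])
  fix b assume "b:$B"
  then obtain r where r: "r:$R" "b = r*[B] e" using cy by blast
  show "h b:$M" using r h y by simp
  { fix a assume "a:$R"
   hence "h (a*[B] b) = h ((a*:r)*[B] e)" using r cy by(simp add:B.smult_assoc1)
   thus "h (a*[B] b) = a*[M] h b" using r \<open>a:$R\<close> y by(simp add:h M.smult_assoc1) }
  fix b' assume "b':$B"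
  then obtain r' where r': "r':$R" "b' = r'*[B] e" using cy by blast
  have "b+[B] b' = (r +: r')*[B] e" using r r' cy by(simp add:B.smult_l_distr)
  thus "h (b+[B] b') = h b+[M] h b'" using r r' y by(simp add:h M.smult_l_distr)
 qed
 thus ?thesis using h by blast
qed

definition kill :: "'a set=> 'a umod set" where
 "kill I = {N. fin_gen R N & (ALL a:I. ALL x:$N. a*[N] x = 0[N])}"

definition reg :: "'a=> 'a umod=> bool" where
 "reg t N \<longleftrightarrow> (ALL x:$N. t*[N] x = 0[N]--> x = 0[N])"

definition quo :: "'a=> 'a umod=> 'a umod=> ((nat=> 'a)=> nat=> 'a)=> bool" where
 "quo t M Q q \<longleftrightarrow> lm R M Q q & q ` $M = $Q &
(ALL x:$M. q x = 0[Q] \<longleftrightarrow> (EX z:$M. x = t*[M] z))"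

lemma sm_mult: assumes "module R M" "t:$R" shows "sm R M {x:$M. EX z:$M. x = t*[M] z}"
proof -
 interpret M: mdl R M using assms(1) by rule
 have "lm R M M (%x. t*[M] x)" using lm_smult[OF lm_id[OF assms(1)] assms(2)] .
 from lm_image[OF this M.sm_carrier] have "sm R M ((%x. t*[M] x) ` $M)" .
 moreover have "{x:$M. EX z:$M. x = t*[M] z} = (%x. t*[M] x) ` $M" using assms(2) by auto
 ultimately show ?thesis by simp
qed

lemma ex_quo: assumes "module R M" "t:$R" shows "EX Q q. quo t M Q q"
proof -
 obtain Q :: "'a umod" and q where "lm R M Q q" "q ` $M = $Q"
  "ALL x:$M. q x = 0[Q] \<longleftrightarrow> x:{x:$M. EX z:$M. x = t*[M] z}"
  using ex_quot[OF assms(1) sm_mult[OF assms]] by blast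
 thus ?thesis unfolding quo_def by blast
qed

lemma quoD:
 assumes "quo t M Q q"
 shows "lm R M Q q" "q ` $M = $Q" "module R M" "module R Q"
  "x:$M==> q x = 0[Q]==> EX z:$M. x = t*[M] z"
  "t:$R==> z:$M==> q (t*[M] z) = 0[Q]"
proof -
 show *: "lm R M Q q" "q ` $M = $Q" using assms by(auto simp:quo_def)
 show m: "module R M" "module R Q" using lmD[OF *(1)] by auto
 show "x:$M==> q x = 0[Q]==> EX z:$M. x = t*[M] z" using assms by(auto simp:quo_def)
 interpret M: mdl R M using m(1) by rule
 show "t:$R==> z:$M==> q (t*[M] z) = 0[Q]"
  using assms M.smult_closed[of t z] unfolding quo_def by blast
qed

lemma quo_kill:
 assumes "quo t M Q q" "M:kill I" "t:$R" "I<:$R" shows "Q:kill (insert t I)"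
proof -
 note D = quoD[OF assms(1)]
 have "a*[Q] x = 0[Q]" if a: "a:insert t I" "a:$R" and x: "x:$Q" for a x
 proof -
  obtain y where y: "y:$M" "x = q y" using x D(2) by blast
  hence "a*[Q] x = q (a*[M] y)" using lmD(5)[OF D(1)] a by simp
  thus ?thesis using a y D(6) assms lmD(6)[OF D(1)] by(auto simp:kill_def)
 qed
 moreover have "fin_gen R Q" using fin_gen_surj[OF D(1,2)] assms(2) by(auto simp:kill_def)
 ultimately show ?thesis using assms(3,4) by(auto simp:kill_def)
qed

text \<open>Reduction modulo \<open>t\<close> stays left exact because Tor_1(M, R / t) is the
  t-torsion of \<open>M\<close> up to the t-torsion of the ring; concretely, an element of
  \<open>A\<close> divisible by \<open>t\<close> in \<open>E\<close> is already divisible in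
  \<open>A\<close> once \<open>M\<close> has no t-torsion.\<close>

lemma ses_quo:
 assumes s: "ses R A E M f g" and t: "t:$R" and r: "reg t M"
  and qa: "quo t A A' a" and qe: "quo t E E' b" and qm: "quo t M M' c"
 shows "EX f' g'. ses R A' E' M' f' g'"
proof -
 note D = sesD[OF s] and DA = quoD[OF qa] and DE = quoD[OF qe] and DM = quoD[OF qm]
 interpret A: mdl R A by(rule mdl.intro) (rule D)
 interpret E: mdl R E by(rule mdl.intro) (rule D)
 interpret M: mdl R M by(rule mdl.intro) (rule D)
 interpret E': mdl R E' by(rule mdl.intro) (rule DE)
 have "lm R A E' (%x. b (f x))" using lm_comp[OF D(1) DE(1)] .
 moreover have "b (f y) = 0[E']" if y: "y:$A" "a y = 0[A']" for y
 proof -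
  obtain z where z: "z:$A" "y = t*[A] z" using DA(5)[OF y] by blast
  hence "f y = t*[E] f z" using lmD(5)[OF D(1) t] by simp
  thus ?thesis using DE(6)[OF t] lmD(3)[OF D(1)] z by simp
 qed
 ultimately obtain f' where f': "lm R A' E' f'" "ALL y:$A. f' (a y) = b (f y)"
  using ses_descend[OF DA(1,2)] by blast
 have "lm R E M' (%x. c (g x))" using lm_comp[OF D(2) DM(1)] .
 moreover have "c (g y) = 0[M']" if y: "y:$E" "b y = 0[E']" for y
 proof -
  obtain z where z: "z:$E" "y = t*[E] z" using DE(5)[OF y] by blast
  hence "g y = t*[M] g z" using lmD(5)[OF D(2) t] by simp
  thus ?thesis using DM(6)[OF t] lmD(3)[OF D(2)] z by simp
 qed
 ultimately obtain g' where g': "lm R E' M' g'" "ALL y:$E. g' (b y) = c (g y)"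
  using ses_descend[OF DE(1,2)] by blast
 have "ses R A' E' M' f' g'"
 proof (rule sesI[OF f'(1) g'(1)])
  fix x assume x: "x:$A'" "f' x = 0[E']"
  then obtain y where y: "y:$A" "x = a y" using DA(2) by blast
  hence "b (f y) = 0[E']" using x f'(2) by simp
  then obtain e where e: "e:$E" "f y = t*[E] e" using DE(5) lmD(3)[OF D(1) y(1)] by blast
  hence "t*[M] g e = 0[M]" using lmD(5)[OF D(2) t e(1)] D(7)[OF y(1)] by simp
  hence "g e = 0[M]" using r lmD(3)[OF D(2) e(1)] unfolding reg_def by blast
  then obtain y' where y': "y':$A" "f y' = e" using D(9) e by blast
  hence "f y = f (t*[A] y')" using lmD(5)[OF D(1) t] e by simp
  hence "y = t*[A] y'" using inj_onD[OF D(3)] y y' t by blast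
  thus "x = 0[A']" using y DA(6)[OF t y'(1)] by simp
 next
  fix z assume "z:$M'"
  then obtain m where m: "m:$M" "z = c m" using DM(2) by blast
  then obtain e where e: "e:$E" "g e = m" using D(8) by blast
  thus "EX y:$E'. g' y = z" using g'(2) m lmD(3)[OF DE(1)] by blast
 next
  fix x assume "x:$A'"
  then obtain y where y: "y:$A" "x = a y" using DA(2) by blast
  thus "g' (f' x) = 0[M']" using f'(2) g'(2) lmD(3)[OF D(1)] D(7) lmD(6)[OF DM(1)] by simp
 next
  fix x assume x: "x:$E'" "g' x = 0[M']"
  then obtain e where e: "e:$E" "x = b e" using DE(2) by blast
  hence "c (g e) = 0[M']" using g'(2) x by simp
  then obtain m where m: "m:$M" "g e = t*[M] m" using DM(5) lmD(3)[OF D(2) e(1)] by blast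
  obtain e' where e': "e':$E" "g e' = m" using D(8) m by blast
  have "g (e-[E] t*[E] e') = 0[M]"
   using lmD(8)[OF D(2) e(1), of "t*[E] e'"] lmD(5)[OF D(2) t e'(1)] e' m t by(simp add:M.diff_eq_iff)
  then obtain y where y: "y:$A" "f y = e-[E] t*[E] e'" using D(9)[of "e-[E] t*[E] e'"] e e' t by auto
  have "f' (a y) = b e-[E'] b (t*[E] e')" using f'(2) y lmD(8)[OF DE(1) e(1)] e' t by simp
  also have "... = x" using DE(6)[OF t e'(1)] e lmD(3)[OF DE(1)] by(simp add:E'.diff_zero)
  finally show "EX x':$A'. f' x' = x" using lmD(3)[OF DA(1) y(1)] by blast
 qed
 thus ?thesis by blast
qed

end

section \<open>Reduction to primes\<close>

context cring begin

lemma pw_quo: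
 assumes t: "t:$R" and b: "quo t B B' b" and E: "E:pw R B"
 shows "EX E':pw R B'. EX q. quo t E E' q"
 using E
proof (induct rule: pw.induct)
 case (zero Z)
 have Zm: "module R Z" using zero by(simp add:fin_gen_def)
 interpret Z: mdl R Z using Zm by rule
 have "quo t Z Z (%x. x)" unfolding quo_def using lm_id[OF Zm] zero(2) t by auto
 thus ?case using pw.zero[OF zero] by blast
next
 case (step N P p q i j)
 then obtain N' n where N': "N':pw R B'" "quo t N N' n" by blast
 note P = bipD[OF step(3)] and QB = quoD[OF b] and QN = quoD[OF N'(2)]
 obtain P' p' q' i' j' where bP': "bip R B' N' P' p' q' i' j'" using ex_bip[OF QB(4) QN(4)] by blast
 note P' = bipD[OF bP']
 interpret P: mdl R P by(rule mdl.intro) (rule P)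
 interpret P': mdl R P' by(rule mdl.intro) (rule P')
 let ?h = "%w. i' (b (p w))+[P'] j' (n (q w))"
 have h: "lm R P P' ?h" using lm_add[OF lm_comp[OF lm_comp[OF P(1) QB(1)] P'(3)] lm_comp[OF lm_comp[OF P(2) QN(1)] P'(4)]] .
 have c: "p w:$B" "q w:$N" "b (p w):$B'" "n (q w):$N'" if "w:$P" for w
  using that lmD(3)[OF P(1)] lmD(3)[OF P(2)] lmD(3)[OF QB(1)] lmD(3)[OF QN(1)] by auto
 have "?h ` $P = $P'"
 proof
  show "$P'<:?h ` $P"
  proof
   fix w assume w: "w:$P'"
   obtain u where u: "u:$B" "p' w = b u" using QB(2) lmD(3)[OF P'(1) w] by blast
   obtain v where v: "v:$N" "q' w = n v" using QN(2) lmD(3)[OF P'(2) w] by blast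
   have "?h (i u+[P] j v) = w" using P(10,11)[OF u(1) v(1)] u v P'(9)[OF w] by simp
   thus "w:?h ` $P" using P(12)[OF u(1) v(1)] by blast
  qed
 qed (use lmD(3)[OF h] in auto)
 moreover have "?h w = 0[P'] \<longleftrightarrow> (EX z:$P. w = t*[P] z)" if w: "w:$P" for w
 proof
  assume z: "?h w = 0[P']"
  have "b (p w) = 0[B']" using arg_cong[OF z, of p'] P'(10) c[OF w] lmD(6)[OF P'(1)] by simp
  then obtain u where u: "u:$B" "p w = t*[B] u" using QB(5) c[OF w] by blast
  have "n (q w) = 0[N']" using arg_cong[OF z, of q'] P'(11) c[OF w] lmD(6)[OF P'(2)] by simp
  then obtain v where v: "v:$N" "q w = t*[N] v" using QN(5) c[OF w] by blast
  have "w = i (t*[B] u)+[P] j (t*[N] v)" using P(9)[OF w] u v by simp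
  also have "... = t*[P] (i u+[P] j v)"
   using lmD(5)[OF P(3) t u(1)] lmD(5)[OF P(4) t v(1)] lmD(3)[OF P(3) u(1)] lmD(3)[OF P(4) v(1)] t by(simp add:P.smult_r_distr)
  finally show "EX z:$P. w = t*[P] z" using P(12)[OF u(1) v(1)] by blast
 next
  assume "EX z:$P. w = t*[P] z"
  then obtain z where z: "z:$P" "w = t*[P] z" by blast
  have "b (p w) = 0[B']" using z lmD(5)[OF P(1) t z(1)] QB(6)[OF t] c[OF z(1)] by simp
  moreover have "n (q w) = 0[N']" using z lmD(5)[OF P(2) t z(1)] QN(6)[OF t] c[OF z(1)] by simp
  ultimately show "?h w = 0[P']" using lmD(6)[OF P'(3)] lmD(6)[OF P'(4)] by simp
 qed
 ultimately have "quo t P P' ?h" unfolding quo_def using h by blast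
 thus ?case using pw.step[OF N'(1) bP'] by blast
qed

lemma pw_reg:
 assumes "t:$R" "reg t B" "E:pw R B" shows "reg t E"
 using assms(3)
proof (induct rule: pw.induct)
 case (zero Z) thus ?case by(auto simp:reg_def)
next
 case (step N P p q i j)
 note P = bipD[OF step(3)]
 show ?case unfolding reg_def
 proof (intro ballI impI)
  fix w assume w: "w:$P" "t*[P] w = 0[P]"
  have "t*[B] p w = 0[B]" using lmD(5)[OF P(1) assms(1) w(1)] w(2) lmD(6)[OF P(1)] by simp
  moreover have "t*[N] q w = 0[N]" using lmD(5)[OF P(2) assms(1) w(1)] w(2) lmD(6)[OF P(2)] by simp
  ultimately have "p w = 0[B]" "q w = 0[N]"
   using assms(2) step(2) lmD(3)[OF P(1) w(1)] lmD(3)[OF P(2) w(1)] unfolding reg_def by blast+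
  thus "w = 0[P]" using P(16) w(1) by blast
 qed
qed

lemma pw_kill:
 assumes "I<:$R" "B:kill I" "E:pw R B" shows "E:kill I"
proof -
 have "ALL a:I. ALL x:$E. a*[E] x = 0[E]" using assms(3)
 proof (induct rule: pw.induct)
  case (zero Z)
  have Zm: "module R Z" using zero by(simp add:fin_gen_def)
  interpret Z: mdl R Z using Zm by rule
  show ?case using zero(2) assms(1) by auto
 next
  case (step N P p q i j)
  note P = bipD[OF step(3)]
  interpret P: mdl R P by(rule mdl.intro) (rule P)
  show ?case
  proof (intro ballI)
   fix a w assume a: "a:I" and w: "w:$P"
   hence ac: "a:$R" using assms by blast
   have "p (a*[P] w) = 0[B]" using lmD(5)[OF P(1) ac w] lmD(3)[OF P(1) w] assms(2) a by(simp add:kill_def)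
   moreover have "q (a*[P] w) = 0[N]" using lmD(5)[OF P(2) ac w] lmD(3)[OF P(2) w] step(2) a by simp
   ultimately show "a*[P] w = 0[P]" using P(16) ac w by simp
  qed
 qed
 moreover have "fin_gen R E" using assms pw_FG by(auto simp:kill_def)
 ultimately show ?thesis by(simp add:kill_def)
qed

lemma cyc_kill: assumes "ideal I R" "cyc B e I" shows "B:kill I"
proof -
 interpret I: ideal I R by fact
 have Bm: "module R B" using assms by(simp add:cyc_def fin_gen_def)
 interpret B: mdl R B using Bm by rule
 have "a*[B] b = 0[B]" if a: "a:I" and b: "b:$B" for a b
 proof -
  obtain r where r: "r:$R" "b = r*[B] e" using assms b unfolding cyc_def by blast
  have ac: "a:$R" using I.Icarr a .
  hence "a*[B] b = (a*:r)*[B] e" using r assms by(simp add:B.smult_assoc1 cyc_def)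
  moreover have "a*:r:I" using I.I_r_closed a r by blast
  ultimately show ?thesis using assms ac r unfolding cyc_def by simp
 qed
 thus ?thesis using assms by(auto simp:kill_def cyc_def)
qed

lemma cyc_reg: assumes "primeideal P R" "cyc B e P" "x:$R" "x~:P" shows "reg x B"
 unfolding reg_def
proof (intro ballI impI)
 interpret P: primeideal P R by fact
 have Bm: "module R B" using assms by(simp add:cyc_def fin_gen_def)
 interpret B: mdl R B using Bm by rule
 fix b assume b: "b:$B" "x*[B] b = 0[B]"
 obtain r where r: "r:$R" "b = r*[B] e" using assms b unfolding cyc_def by blast
 hence "(x*:r)*[B] e = 0[B]" using b assms by(simp add:B.smult_assoc1 cyc_def)
 hence "x*:r:P" using assms r unfolding cyc_def by simp
 hence "r:P" using P.I_prime assms r by blast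
 thus "b = 0[B]" using assms r unfolding cyc_def by simp
qed

lemma sub_kill:
 assumes "noetherian_ring R" "ses R M' E M f g" "E:kill I" "I<:$R" shows "M':kill I"
proof -
 note D = sesD[OF assms(2)]
 interpret M': mdl R M' by(rule mdl.intro) (rule D)
 have "a*[M'] x = 0[M']" if a: "a:I" and x: "x:$M'" for a x
 proof -
  have ac: "a:$R" using assms a by blast
  have "f (a*[M'] x) = 0[E]" using lmD(5)[OF D(1) ac x] lmD(3)[OF D(1) x] assms(3) a by(simp add:kill_def)
  thus ?thesis using D(10) ac x by simp
 qed
 thus ?thesis using fin_gen_kernel[OF assms(1,2)] assms(3) by(auto simp:kill_def)
qed

lemma sub_reg: assumes "ses R M' E M f g" "reg t E" "t:$R" shows "reg t M'"
 unfolding reg_def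
proof (intro ballI impI)
 note D = sesD[OF assms(1)]
 fix x assume x: "x:$M'" "t*[M'] x = 0[M']"
 hence "t*[E] f x = 0[E]" using lmD(5)[OF D(1) assms(3) x(1)] lmD(6)[OF D(1)] by simp
 thus "x = 0[M']" using assms(2) lmD(3)[OF D(1) x(1)] D(10) x(1) unfolding reg_def by blast
qed

text \<open>Resolve modules killed by \<open>P\<close> by powers of \<open>B\<close> = R / P. From
  index 1 on the kernels embed in such powers, so \<open>x\<close> acts injectively on them. The
  near-splitting makes the s-th kernel a summand of the preimage of its multiple by
  \<open>x\<close>, whose cokernel is killed by the larger ideal. The bound then climbs back to
  index 0.\<close>

lemma prime_step:
 assumes N: "noetherian_ring R" and P: "primeideal P R" and c: "cyc B e P"
  and x: "x:$R" "x~:P" and s: "1 <= s"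
  and lift: "!!M E f g.(ALL i<=s. ses R (M (Suc i)) (E i) (M i) (f i) (g i) & E i:pw R B)==> M 0:kill P ==>
EX h. lm R (M s) (E s) h & (ALL m:$(M s). g s (h m) = x*[M s] m)"
  and IH: "bnd R s (kill (insert x P))"
 shows "bnd R s (kill P)"
proof -
 interpret P: primeideal P R by fact
 have PR: "P<:$R" using P.Icarr by blast
 have B: "B:kill P" "reg x B" "fin_gen R B" using cyc_kill[OF P.is_ideal c] cyc_reg[OF P c x] c by(auto simp:cyc_def)
 have "EX E M' f g. E:pw R B & M':kill P & ses R M' E M f g" if M: "M:kill P" for M :: "'a umod"
 proof -
  have Mm: "module R M" and Mf: "fin_gen R M" using M by(auto simp:kill_def fin_gen_def)
  have "EX h. lm R B M h & y:h ` $B" if y: "y:$M" for y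
  proof -
   obtain h where h: "lm R B M h" "ALL r:$R. h (r*[B] e) = r*[M] y"
    using cyc_hom[OF c Mm y] M y by(auto simp:kill_def)
   interpret M: mdl R M using Mm by rule
   interpret B: mdl R B using lmD(1)[OF h(1)] by rule
   have "h e = y" using bspec[OF h(2), of \<one>] c y by(simp add:cyc_def)
   thus ?thesis using h c by(auto simp:cyc_def)
  qed
  from pw_surj[OF B(3) Mf this] obtain E k where E: "E:pw R B" "lm R E M k" "k ` $E = $M" by blast
  note s1 = ses_kernel[OF E(2,3)]
  have "E\<lparr>carrier := {y:$E. k y = 0[M]}\<rparr> : kill P" using sub_kill[OF N s1 pw_kill[OF PR B(1) E(1)] PR] .
  thus ?thesis using E(1) s1 by blast
 qed
 hence "ALL M:kill P. EX E M' f g. E:pw R B & M':kill P & ses R M' E M f g" by blast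
 then obtain nE nM nf ng where nx: "!!M. M:kill P==> nE M:pw R B & nM M:kill P & ses R (nM M) (nE M) M (nf M) (ng M)"
  by metis
 \<comment> \<open>One fixed choice of kernel, iterated: the i-th syzygy of \<open>N\<close> over R
   / P.\<close>
 define Mq where "Mq N i = (nM ^^ i) N" for N :: "'a umod" and i :: nat
 have Mk: "Mq N i:kill P" if "N:kill P" for N i using that nx by(induct i) (auto simp:Mq_def)
 have MS: "Mq N (Suc i) = nM (Mq N i)" for N i by(simp add:Mq_def)
 have Ms: "ses R (Mq N (Suc i)) (nE (Mq N i)) (Mq N i) (nf (Mq N i)) (ng (Mq N i))" "nE (Mq N i):pw R B" if "N:kill P" for N i
  using nx[OF Mk[OF that]] MS by auto
 have Mr: "reg x (Mq N (Suc i))" if "N:kill P" for N i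
  using sub_reg[OF Ms(1)[OF that] pw_reg[OF x(1) B(2) Ms(2)[OF that]] x(1)] .
 have Mm: "module R (Mq N i)" if "N:kill P" for N i using Mk[OF that, of i] by(auto simp:kill_def fin_gen_def)
 define QQ where "QQ i = {Q. EX N:kill P. EX q. quo x (Mq N i) Q q}" for i
 obtain B' b where B': "quo x B B' b" using ex_quo[of B x] B(3) x(1) by(auto simp:fin_gen_def)
 have B'f: "fin_gen R B'" using fin_gen_surj[OF quoD(1,2)[OF B'] B(3)] .
 \<comment> \<open>Reducing the sequences modulo \<open>x\<close> keeps them exact, and each
   application of \<open>bnd_ker\<close> costs one degree. The count starts at index 1, since
   \<open>x\<close> may have torsion on index 0.\<close>
 have Q: "bnd R (s - k) (QQ (Suc k))" if "k < s" for k
  using that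
 proof (induct k)
  case 0
  have "QQ (Suc 0)<:kill (insert x P)" unfolding QQ_def using quo_kill[OF _ Mk x(1) PR] by blast
  thus ?case using bnd_mono[OF IH] by simp
 next
  case (Suc k)
  have e: "s - k = Suc (s - Suc k)" using Suc by simp
  have "QQ (Suc (Suc k))<:{A. EX Y:pw R B'. EX Z:QQ (Suc k). EX f g. ses R A Y Z f g}"
  proof
   fix A assume "A:QQ (Suc (Suc k))"
   then obtain N q where N: "N:kill P" "quo x (Mq N (Suc (Suc k))) A q" by(auto simp:QQ_def)
   obtain E' qe where E': "E':pw R B'" "quo x (nE (Mq N (Suc k))) E' qe" using pw_quo[OF x(1) B' Ms(2)[OF N(1)]] by blast
   obtain Z z where Z: "quo x (Mq N (Suc k)) Z z" using ex_quo[OF Mm[OF N(1)] x(1)] by blast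
   have "EX f g. ses R A E' Z f g" using ses_quo[OF Ms(1)[OF N(1)] x(1) Mr[OF N(1)] N(2) E'(2) Z] .
   thus "A:{A. EX Y:pw R B'. EX Z:QQ (Suc k). EX f g. ses R A Y Z f g}" using E'(1) Z N(1) by(auto simp:QQ_def)
  qed
  moreover have "bnd R (s - Suc k) {A. EX Y:pw R B'. EX Z:QQ (Suc k). EX f g. ses R A Y Z f g}"
   using bnd_ker[OF _ bnd_pw[OF N B'f]] Suc e by simp
  ultimately show ?case using bnd_mono by blast
 qed
 have s': "Suc (s - 1) = s" "s - (s - 1) = Suc 0" "s - 1 < s" using s by auto
 \<comment> \<open>At index s exactly one degree is left, and the next \<open>bnd_ker\<close> spends
   it to reach a ball.\<close>
 have Q1: "bnd R (Suc 0) (QQ s)" using Q[OF s'(3)] s' by simp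
 obtain G n where G: "fin_gen R G" "{A. EX Y:pw R B. EX Z:QQ s. EX f g. ses R A Y Z f g}<:sball R {G} n"
  using bnd_ker[OF Q1 bnd_pw[OF N B(3)]] by auto
 have base: "Mq N s:sball R {G} n" if Nk: "N:kill P" for N
 proof -
  let ?M = "Mq N s" and ?E = "nE (Mq N s)" and ?g = "ng (Mq N s)"
  have "EX h. lm R (Mq N s) (nE (Mq N s)) h & (ALL m:$(Mq N s). ng (Mq N s) (h m) = x*[Mq N s] m)"
   by(rule lift[of "Mq N" "%i. nE (Mq N i)" "%i. nf (Mq N i)" "%i. ng (Mq N i)"]) (use Ms[OF Nk] Nk in \<open>auto simp:Mq_def\<close>)
  then obtain h where h: "lm R ?M ?E h" "ALL m:$?M. ?g (h m) = x*[?M] m" by blast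
  note D = sesD[OF Ms(1)[OF Nk, of s]]
  interpret M: mdl R ?M by(rule mdl.intro) (rule D)
  have r: "reg x ?M" using Mr[OF Nk, of "s - 1"] s' by simp
  obtain Z z where Z: "quo x ?M Z z" using ex_quo[OF D(6) x(1)] by blast
  note QZ = quoD[OF Z]
  have lx: "lm R ?M ?M (%m. x*[?M] m)" using lm_smult[OF lm_id[OF D(6)] x(1)] .
  have sx: "ses R ?M ?M Z (%m. x*[?M] m) z"
   by(rule sesI[OF lx QZ(1)]) (use r QZ x(1) in \<open>auto simp:reg_def\<close>, metis QZ(2) imageE, metis QZ(5))
  have zg: "lm R ?E Z (%u. z (?g u))" using lm_comp[OF D(2) QZ(1)] .
  have "(%u. z (?g u)) ` $?E = $Z" using QZ(2) Ms(1)[OF Nk, of s] unfolding ses_def by(metis image_image)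
  note sV = ses_kernel[OF zg this]
  \<comment> \<open>The preimage of \<open>x\<close> times \<open>?M\<close> in \<open>?E\<close>.
    Cancelling the injective factor \<open>x\<close> from \<open>?g\<close> gives a map
    \<open>k\<close> from \<open>?V\<close> to \<open>?M\<close>, and \<open>h\<close> is a section
    of \<open>k\<close>.\<close>
  let ?V = "?E\<lparr>carrier := {u:$?E. z (?g u) = 0[Z]}\<rparr>"
  have "lm R ?V ?M ?g" using lm_comp[OF sesD(1)[OF sV] D(2)] .
  then obtain k where k: "lm R ?V ?M k" "ALL u:$?V. x*[?M] k u = ?g u" using ses_lift[OF sx] by fastforce
  have hV: "h m:$?V" if m: "m:$?M" for m
   using h m lmD(3)[OF h(1) m] QZ(6)[OF x(1) m] by simp
  have "lm R ?M ?V h" using lmD[OF h(1)] hV sesD(4)[OF sV] by(intro lmI) auto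
  moreover have "k (h m) = m" if m: "m:$?M" for m
  proof -
   have "x*[?M] k (h m) = x*[?M] m" using bspec[OF k(2) hV[OF m]] h(2) m by simp
   thus ?thesis using inj_onD[OF sesD(3)[OF sx]] lmD(3)[OF k(1) hV[OF m]] m by blast
  qed
  ultimately have "smd R ?M ?V" using smdI k(1) by blast
  moreover have "?V:sball R {G} n" using sV Ms(2)[OF Nk, of s] Z Nk G(2) unfolding QQ_def by blast
  ultimately show ?thesis using sball_smd[OF G(1)] by blast
 qed
 \<comment> \<open>Descending from index s back to 0, every cokernel gains one degree.\<close>
 have "bnd R k {Mq N (s - k) | N. N:kill P}" if "k <= s" for k
  using that
 proof (induct k)
  case 0
  have "{Mq N (s - 0) | N. N:kill P}<:sball R {G} n" using base by auto
  thus ?case unfolding bnd.simps using G(1) by blast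
 next
  case (Suc k)
  have e: "s - k = Suc (s - Suc k)" using Suc(2) by simp
  have "{Mq N (s - Suc k) | N. N:kill P}<:{Z. EX A:{Mq N (s - k) | N. N:kill P}. EX Y:pw R B. EX f g. ses R A Y Z f g}"
   using Ms unfolding e by blast
  moreover have "bnd R (Suc k) {Z. EX A:{Mq N (s - k) | N. N:kill P}. EX Y:pw R B. EX f g. ses R A Y Z f g}"
   by(rule bnd_coker[OF bnd_pw[OF N B(3)] Suc(1)[OF Suc_leD[OF Suc(2)]]])
  ultimately show ?case using bnd_mono by blast
 qed
 from this[of s] have "bnd R s {Mq N 0 | N. N:kill P}" by simp
 moreover have "kill P<:{Mq N 0 | N. N:kill P}" by(auto simp:Mq_def)
 ultimately show ?thesis using bnd_mono by blast
qed

lemma noeth_induct: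
 assumes N: "noetherian_ring R" and step: "!!I. ideal I R==> (!!J. ideal J R==> I \<subset> J==> Pr J)==> Pr I" and I: "ideal I R"
 shows "Pr I"
proof (rule ccontr)
 assume "~Pr I"
 let ?A = "{J. ideal J R & ~Pr J}"
 have "EX M:?A. ALL Y:?A. M<:Y--> Y = M"
 proof (rule subset_Zorn_nonempty)
  show "?A ~= {}" using I \<open>~Pr I\<close> by blast
  fix C assume C: "C ~= {}" "subset.chain ?A C"
  hence "subset.chain {I. ideal I R} C" by(auto simp:pred_on.chain_def)
  hence "\<Union>C:C" using noetherian_ring.ideal_chain_is_trivial[OF N C(1)] by blast
  thus "\<Union>C:?A" using C(2) by(auto simp:pred_on.chain_def)
 qed
 then obtain M where M: "ideal M R" "~Pr M" "!!J. ideal J R==> ~Pr J==> M<:J==> J = M" by blast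
 thus False using step[OF M(1)] by blast
qed

section \<open>Enlarging an ideal by one element, and chains of primes\<close>

definition idadd :: "'a set=> 'a=> 'a set" where
 "idadd I a = {u +: a*:r | u r. u:I & r:$R}"

lemma idadd:
 assumes "ideal I R" "a:$R"
 shows "ideal (idadd I a) R" "I<:idadd I a" "a:idadd I a"
  "!!J. ideal J R==> I<:J==> a:J==> idadd I a<:J"
proof -
 interpret I: ideal I R by fact
 show 1: "I<:idadd I a"
 proof
  fix u assume u: "u:I"
  have "u = u +: a *: #0" using u I.Icarr assms by simp
  thus "u:idadd I a" unfolding idadd_def using u by blast
 qed
 have "a = #0 +: a *: #1" using assms by simp
 thus "a:idadd I a" unfolding idadd_def using I.zero_closed by blast
 show "ideal (idadd I a) R"
 proof (rule ideal_intro)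
  show "idadd I a<:$R" using I.Icarr assms by(auto simp:idadd_def)
  show "#0:idadd I a" using 1 I.zero_closed by blast
  fix x assume "x:idadd I a"
  then obtain u r where u: "x = u +: a*:r" "u:I" "r:$R" by(auto simp:idadd_def)
  have uc: "u:$R" using u I.Icarr by blast
  { fix y assume "y:idadd I a"
   then obtain v s where v: "y = v +: a*:s" "v:I" "s:$R" by(auto simp:idadd_def)
   have vc: "v:$R" using v I.Icarr by blast
   have "x +: y = (u +: v) +: a*:(r +: s)" using u v uc vc assms by(simp add:r_distr a_ac)
   thus "x +: y:idadd I a" unfolding idadd_def using u v I.a_closed by blast }
  fix c assume c: "c:$R"
  have "c*:x = c*:u +: a*:(c*:r)" using u uc c assms by(simp add:r_distr m_lcomm)
  thus "c*:x:idadd I a" unfolding idadd_def using u c I.I_l_closed by blast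
 qed
 fix J assume J: "ideal J R" "I<:J" "a:J"
 interpret J: ideal J R by fact
 show "idadd I a<:J" using J J.I_r_closed J.a_closed by(auto simp:idadd_def)
qed

lemma kill_idadd:
 assumes "ideal I R" "a:$R" shows "kill (insert a I)<:kill (idadd I a)"
proof
 interpret I: ideal I R by fact
 fix N assume N: "N:kill (insert a I)"
 have Nm: "module R N" using N by(auto simp:kill_def fin_gen_def)
 interpret N: mdl R N using Nm by rule
 have "c*[N] x = 0[N]" if "c:idadd I a" "x:$N" for c x
 proof -
  obtain u r where u: "c = u +: a*:r" "u:I" "r:$R" using \<open>c:idadd I a\<close> by(auto simp:idadd_def)
  have "c*[N] x = u*[N] x+[N] a*[N] (r*[N] x)"
   using u I.Icarr assms that by(simp add:N.smult_l_distr N.smult_assoc1)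
  thus ?thesis using N u that by(simp add:kill_def)
 qed
 thus "N:kill (idadd I a)" using N by(auto simp:kill_def)
qed

text \<open>Says that R / I has Krull dimension at most \<open>s\<close>: the forbidden chains have
  \<open>s + 2\<close> members.\<close>

definition chain_le :: "'a set=> nat=> bool" where
 "chain_le I s \<longleftrightarrow> ~(EX Q.(ALL i<=Suc s. primeideal (Q i) R & I<:Q i) & (ALL i<Suc s. Q i \<subset> Q (Suc i)))"

lemma chain_le_mono: "chain_le I s==> I<:J==> chain_le J s"
 unfolding chain_le_def by(meson order_trans)

end

section \<open>Noetherian local rings and induction over all ideals\<close>

locale noeth_local = cring R + noetherian_ring R for R (structure) +
 fixes m :: "'a set"
 assumes maxi: "maximalideal m R" and local: "!!I. maximalideal I R==> I = m"
begin

lemma proper_sub: assumes "ideal I R" "I ~= $R" shows "I<:m"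
proof -
 have "J ~= $R--> J<:m" if J: "ideal J R" for J
 proof (rule noeth_induct[OF noetherian_ring_axioms _ J])
  fix I assume I: "ideal I R" and IH: "!!J. ideal J R==> I \<subset> J==> J ~= $R--> J<:m"
  show "I ~= $R--> I<:m"
  proof (cases "maximalideal I R")
   case False
   show ?thesis
   proof
    assume ne: "I ~= $R"
    then obtain J where "ideal J R" "I<:J" "J<:$R" "J ~= I" "J ~= $R"
     using maximalidealI[OF I] False by metis
    thus "I<:m" using IH[of J] by blast
   qed
  qed (use local in blast)
 qed
 thus ?thesis using assms by blast
qed

lemma unit_outside: assumes "r:$R" "r~:m" shows "EX r':$R. r'*:r = #1"
proof -
 have "PIdl r = $R" using proper_sub[OF cgenideal_ideal[OF assms(1)]] cgenideal_self[OF assms(1)] assms(2) by blast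
 hence "#1:PIdl r" by simp
 thus ?thesis unfolding cgenideal_def by force
qed

text \<open>Such a module is a vector space over the residue field. Each new generator either lies
  in the previous span or contributes one more copy of \<open>B\<close>.\<close>

lemma kill_max_pw: assumes c: "cyc B e m" and N: "N:kill m" shows "N:pw R B"
proof -
 interpret m: maximalideal m R by(rule maxi)
 have Nm: "module R N" and Nf: "fin_gen R N" using N by(auto simp:kill_def fin_gen_def)
 have Bm: "module R B" using c by(auto simp:cyc_def fin_gen_def)
 interpret N: mdl R N using Nm by rule
 interpret Bm: mdl R B using Bm by rule
 obtain V where V: "finite V" "V<:$N" "$N<:spn R N V" using Nf N.fin_gen_iff by blast
 from V(1,2) have "EX E:pw R B. EX k. lm R E N k & k ` $E = spn R N V & inj_on k ($E)"
 proof (induct)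
  case empty
  let ?Z = "N\<lparr>carrier := {0[N]}\<rparr>"
  have "?Z:pw R B" using zero_mod_fg[OF Nm] by(intro pw.zero) auto
  moreover have "spn R N {} = {0[N]}" using N.spn_least[OF N.sm_zero, of "{}"] spn.zero by blast
  ultimately show ?case using N.sm_lm[OF N.sm_zero] by(intro bexI[of _ ?Z] exI[of _ "%x. x"]) auto
 next
  case (insert x V)
  then obtain E k where E: "E:pw R B" "lm R E N k" "k ` $E = spn R N V" "inj_on k ($E)" by auto
  have xc: "x:$N" and Vc: "V<:$N" using insert by auto
  show ?case
  proof (cases "x:spn R N V")
   case True
   have "spn R N (insert x V) = spn R N V"
    using N.spn_least[OF N.spn_sm[OF Vc], of "insert x V"] True N.spn_incl[OF Vc] N.spn_mono[of V "insert x V"] xc Vc by blast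
   thus ?thesis using E by auto
  next
   case False
   obtain l where l: "lm R B N l" "ALL r:$R. l (r*[B] e) = r*[N] x"
    using cyc_hom[OF c Nm xc] N xc by(auto simp:kill_def)
   obtain P p q i j where P: "bip R B E P p q i j" using ex_bip[OF Bm lmD(1)[OF E(2)]] by blast
   note D = bipD[OF P]
   interpret E: mdl R E using lmD(1)[OF E(2)] by rule
   let ?h = "%w. l (p w)+[N] k (q w)"
   have lh: "lm R P N ?h" using lm_add[OF lm_comp[OF D(1) l(1)] lm_comp[OF D(2) E(2)]] .
   have pr: "EX r:$R. p w = r*[B] e" if "w:$P" for w using c lmD(3)[OF D(1) that] unfolding cyc_def by blast
   have "inj_on ?h ($P)"
   proof (rule lm_inj[OF lh])
    fix w assume w: "w:$P" "?h w = 0[N]"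
    obtain r where r: "r:$R" "p w = r*[B] e" using pr w by blast
    have qc: "q w:$E" "k (q w):$N" using lmD(3)[OF D(2) w(1)] lmD(3)[OF E(2)] by auto
    have "r*[N] x+[N] k (q w) = 0[N]" using w r l by simp
    hence rx: "r*[N] x = \<ominus>\<^bsub>N\<^esub> k (q w)" using r xc qc by(metis N.minus_equality N.smult_closed)
    have "k (q w):spn R N V" using E(3) qc(1) by blast
    hence rs: "r*[N] x:spn R N V" using rx N.smD(5)[OF N.spn_sm[OF Vc]] by simp
    \<comment> \<open>Otherwise \<open>r\<close> is a unit and \<open>x\<close> would already lie in
      the span of \<open>V\<close>.\<close>
    have "r:m"
    proof (rule ccontr)
     assume "r~:m"
     then obtain r' where r': "r':$R" "r'*:r = #1" using unit_outside r by blast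
     have "r'*[N] (r*[N] x) = x" using r' r xc by(simp add:N.smult_assoc1[symmetric])
     thus False using N.spn_smult[OF Vc r'(1) rs] False by simp
    qed
    hence pw0: "p w = 0[B]" using r c unfolding cyc_def by simp
    hence "k (q w) = 0[N]" using w(2) lmD(6)[OF l(1)] qc by simp
    hence "q w = 0[E]" using inj_onD[OF E(4), of "q w" "0[E]"] qc lmD(6)[OF E(2)] by simp
    thus "w = 0[P]" using pw0 D(16) w by blast
   qed
   moreover have "?h ` $P = spn R N (insert x V)"
   proof
    show "?h ` $P<:spn R N (insert x V)"
    proof
     fix y assume "y:?h ` $P"
     then obtain w where w: "w:$P" "y = ?h w" by blast
     obtain r where r: "r:$R" "p w = r*[B] e" using pr w by blast
     have "k (q w):spn R N V" using E(3) lmD(3)[OF D(2) w(1)] by blast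
     thus "y:spn R N (insert x V)" unfolding N.spn_insert[OF xc Vc] using w r l(2) by auto
    qed
    show "spn R N (insert x V)<:?h ` $P"
    proof
     fix y assume "y:spn R N (insert x V)"
     then obtain r n where r: "y = r*[N] x+[N] n" "r:$R" "n:spn R N V" unfolding N.spn_insert[OF xc Vc] by blast
     obtain u where u: "u:$E" "n = k u" using r E(3) by blast
     have re: "r*[B] e:$B" using r c by(simp add:cyc_def)
     have "?h (i (r*[B] e)+[P] j u) = y" using D(10,11)[OF re u(1)] r u l(2) by simp
     thus "y:?h ` $P" using D(12)[OF re u(1)] by blast
    qed
   qed
   ultimately show ?thesis using pw.step[OF E(1) P] lh by blast
  qed
 qed
 then obtain E k where E: "E:pw R B" "lm R E N k" "k ` $E = spn R N V" "inj_on k ($E)" by blast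
 hence "bij_betw k ($E) ($N)" using V N.spn_closed[OF V(2)] by(auto simp:bij_betw_def)
 thus ?thesis using pw_iso[OF E(1,2)] by blast
qed

text \<open>The bound \<open>s\<close> on prime chains passes to larger ideals, so it stays fixed in
  the induction and can double as the syzygy degree required by \<open>prime_step\<close>.\<close>

lemma main_bnd:
 assumes thmB: "!!P s. primeideal P R==> P ~= m==> chain_le P s==> EX x:$R - P. ALL B e M E f g. cyc B e P -->
(ALL i<=s. ses R (M (Suc i)) (E i) (M i) (f i) (g i) & E i:pw R B)--> M 0:kill P -->
(EX h. lm R (M s) (E s) h & (ALL y:$(M s). g s (h y) = x*[M s] y))"
  and I: "ideal I R"
 shows "chain_le I s--> bnd R s (kill I)"
proof (rule noeth_induct[OF noetherian_ring_axioms _ I])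
 fix I assume I: "ideal I R" and IH: "!!J. ideal J R==> I \<subset> J==> chain_le J s--> bnd R s (kill J)"
 interpret I: ideal I R by fact
 have IR: "I<:$R" using I.Icarr by blast
 show "chain_le I s--> bnd R s (kill I)"
 proof
  assume ch: "chain_le I s"
  have IH': "bnd R s (kill (insert a I))" if a: "a:$R" "a~:I" for a
  proof -
   have "I \<subset> idadd I a" using idadd[OF I a(1)] a by blast
   hence "bnd R s (kill (idadd I a))" using IH[OF idadd(1)[OF I a(1)]] chain_le_mono[OF ch] by blast
   thus ?thesis using bnd_mono kill_idadd[OF I a(1)] by blast
  qed
  consider "I = $R" | "I ~= $R" "~primeideal I R" | "primeideal I R" "I = m" | "primeideal I R" "I ~= m" by blast
  thus "bnd R s (kill I)"
  proof cases
   case 1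
   have "kill I<:projc R"
   proof
    fix N assume N: "N:kill I"
    hence Nm: "module R N" by(auto simp:kill_def fin_gen_def)
    interpret N: mdl R N using Nm by rule
    have "y = 0[N]" if y: "y:$N" for y
     using N y 1 N.smult_one[OF y] one_closed unfolding kill_def by auto
    hence "$N = {0[N]}" using N.zero_closed by blast
    thus "N:projc R" using zero_in_add_cl[OF free1_FG Nm] by blast
   qed
   thus ?thesis using bnd_mono[OF bnd_projc] by blast
  next
   case 2
   then obtain a b where ab: "a:$R" "b:$R" "a*:b:I" "a~:I" "b~:I"
    using primeidealI[OF I cring_axioms] by metis
   \<comment> \<open>With a b in \<open>I\<close>, the submodule a N is killed by \<open>b\<close>
     and the quotient N / a N by \<open>a\<close>.\<close>
   have "kill I<:extc R (kill (insert b I)) (kill (insert a I))"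
   proof
    fix N assume N: "N:kill I"
    hence Nm: "module R N" and Nf: "fin_gen R N" by(auto simp:kill_def fin_gen_def)
    interpret N: mdl R N using Nm by rule
    obtain Q q where Q: "quo a N Q q" using ex_quo[OF Nm ab(1)] by blast
    note D = quoD[OF Q]
    note s1 = ses_kernel[OF D(1,2)]
    let ?A = "N\<lparr>carrier := {y:$N. q y = 0[Q]}\<rparr>"
    have "c*[N] y = 0[N]" if c: "c:insert b I" and y: "y:$N" "q y = 0[Q]" for c y
    proof -
     obtain z where z: "z:$N" "y = a*[N] z" using D(5) y by blast
     have "b*[N] y = (a*:b)*[N] z" using z ab by(simp add:N.smult_assoc1[symmetric] m_comm)
     hence "b*[N] y = 0[N]" using N z ab by(simp add:kill_def)
     thus ?thesis using c N y by(auto simp:kill_def)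
    qed
    hence "?A:kill (insert b I)" using fin_gen_kernel[OF noetherian_ring_axioms s1 Nf] by(simp add:kill_def)
    moreover have "Q:kill (insert a I)" using quo_kill[OF Q N ab(1) IR] .
    ultimately show "N:extc R (kill (insert b I)) (kill (insert a I))" unfolding extc_def using s1 by blast
   qed
   thus ?thesis using bnd_mono[OF bnd_ext[OF IH'[OF ab(2,5)] IH'[OF ab(1,4)]]] by blast
  next
   case 3
   obtain B e where B: "cyc B e I" using ex_cyc[OF I] by blast
   have "kill I<:pw R B" using kill_max_pw B 3 by blast
   thus ?thesis using bnd_mono[OF bnd_pw[OF noetherian_ring_axioms]] B by(auto simp:cyc_def)
  next
   case 4
   obtain B e where B: "cyc B e I" using ex_cyc[OF I] by blast
   interpret P: primeideal I R by(rule 4)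
   obtain x where x: "x:$R - I" "ALL B e M E f g. cyc B e I -->
(ALL i<=s. ses R (M (Suc i)) (E i) (M i) (f i) (g i) & E i:pw R B)--> M 0:kill I -->
(EX h. lm R (M s) (E s) h & (ALL y:$(M s). g s (h y) = x*[M s] y))" using thmB[OF 4 ch] by blast
   \<comment> \<open>A prime other than \<open>m\<close> is properly contained in \<open>m\<close>,
     which is already a chain of length one.\<close>
   have "1 <= s"
   proof (rule ccontr)
    assume "~1 <= s" hence s0: "s = 0" by simp
    have "I ~= $R" using P.I_notcarr by blast
    hence "I \<subset> m" using proper_sub[OF I] 4 by blast
    moreover have "primeideal m R" using maximalideal_prime[OF maxi] .
    moreover define Q where "Q = (%i::nat. if i = 0 then I else m)"
    ultimately have "(ALL i<=Suc 0. primeideal (Q i) R & I<:Q i) & (ALL i<Suc 0. Q i \<subset> Q (Suc i))" using 4(1) by auto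
    thus False using ch unfolding chain_le_def s0 by blast
   qed
   have xx: "x:$R" "x~:I" using x(1) by auto
   show ?thesis
   proof (rule prime_step[OF noetherian_ring_axioms 4(1) B xx \<open>1 <= s\<close>])
    fix M E f g assume "ALL i<=s. ses R (M (Suc i)) (E i) (M i) (f i) (g i) & E i:pw R B" "M 0:kill I"
    thus "EX h. lm R (M s) (E s) h & (ALL y:$(M s). g s (h y) = x*[M s] y)"
     using x(2)[rule_format, OF B, of M E f g] by blast
   qed (rule IH'[OF xx])
  qed
 qed
qed

end

section \<open>Size and radius\<close>

text \<open>The ambiguity of syzygies: different covers change the kernel by projective summands
  only. Allowing summands on one side makes this a preorder-like comparison that is easy to push to
  syzygies.\<close>

definition stab :: "('a,'c) ring_scheme=> 'a umod=> 'a umod=> bool" where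
 "stab R L N \<longleftrightarrow> (EX E:projc R. EX P p q i j. bip R N E P p q i j & smd R L P)"

context cring begin

text \<open>A form of Schanuel's lemma. The maps between \<open>L\<close> and \<open>P\<close> lift
  to the covers as \<open>u\<close> and \<open>v\<close>. On \<open>F\<close> the map v u - id
  vanishes in \<open>L\<close>, hence comes from some \<open>h\<close> into \<open>T\<close>.
  Restricted to \<open>T\<close> this reads id = v' u' - h k, so \<open>T\<close> is a summand of T'
  + F.\<close>

lemma stab_syz:
 assumes st: "stab R L N" and s: "ses R T F L k a" "F:projc R" and s': "ses R T' F' N k' a'" "F':projc R"
 shows "stab R T T'"
proof -
 obtain E P p q i j f g where E: "E:projc R" and bP: "bip R N E P p q i j"
  and f: "lm R L P f" "lm R P L g" "ALL x:$L. g (f x) = x" using st unfolding stab_def smd_def by blast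
 note P = bipD[OF bP] and D = sesD[OF s(1)] and D' = sesD[OF s'(1)]
 obtain H p1 q1 i1 j1 where bH: "bip R F' E H p1 q1 i1 j1" using ex_bip[OF D'(5) P(14)] by blast
 note H = bipD[OF bH]
 have Hp: "H:projc R" using add_cl_bip[OF free1_FG bH s'(2) E] .
 let ?b = "%w. i (a' (p1 w))+[P] j (q1 w)"
 have b: "lm R H P ?b" using lm_add[OF lm_comp[OF lm_comp[OF H(1) D'(2)] P(3)] lm_comp[OF H(2) P(4)]] .
 have sb: "ses R T' H P (%x. i1 (k' x)) ?b"
 proof (rule sesI[OF lm_comp[OF D'(1) H(3)] b])
  fix x assume x: "x:$T'" "i1 (k' x) = 0[H]"
  hence "k' x = 0[F']" using H(5)[OF lmD(3)[OF D'(1) x(1)]] lmD(6)[OF H(1)] by simp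
  thus "x = 0[T']" using D'(10) x by blast
 next
  fix z assume z: "z:$P"
  obtain u where u: "u:$F'" "a' u = p z" using D'(8) lmD(3)[OF P(1) z] by blast
  have "?b (i1 u+[H] j1 (q z)) = z" using H(10,11)[OF u(1) lmD(3)[OF P(2) z]] u P(9)[OF z] by simp
  thus "EX y:$H. ?b y = z" using H(12)[OF u(1) lmD(3)[OF P(2) z]] by blast
 next
  interpret Pm: mdl R P by(rule mdl.intro) (rule P)
  fix x assume x: "x:$T'"
  show "i (a' (p1 (i1 (k' x))))+[P] j (q1 (i1 (k' x))) = 0[P]"
   using H(5,6)[OF lmD(3)[OF D'(1) x]] D'(7)[OF x] lmD(6)[OF P(3)] lmD(6)[OF P(4)] by simp
 next
  interpret Hm: mdl R H by(rule mdl.intro) (rule H)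
  fix y assume y: "y:$H" "?b y = 0[P]"
  have c: "a' (p1 y):$N" "q1 y:$E" "p1 y:$F'" using lmD(3)[OF D'(2)] lmD(3)[OF H(1) y(1)] lmD(3)[OF H(2) y(1)] by auto
  have "a' (p1 y) = 0[N]" using arg_cong[OF y(2), of p] P(10)[OF c(1,2)] lmD(6)[OF P(1)] by simp
  then obtain x where x: "x:$T'" "k' x = p1 y" using D'(9) c by blast
  have "q1 y = 0[E]" using arg_cong[OF y(2), of q] P(11)[OF c(1,2)] lmD(6)[OF P(2)] by simp
  hence "i1 (k' x) = y" using x H(9)[OF y(1)] lmD(6)[OF H(4)] lmD(3)[OF H(3) c(3)] by simp
  thus "EX x:$T'. i1 (k' x) = y" using x by blast
 qed
 note Db = sesD[OF sb]
 have bs: "?b ` $H = $P" using sb by(simp add:ses_def)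
 have as: "a ` $F = $L" using s(1) by(simp add:ses_def)
 obtain u where u: "lm R F H u" "ALL x:$F. ?b (u x) = f (a x)" using projc_lift[OF s(2) lm_comp[OF D(2) f(1)] b bs] by blast
 obtain v where v: "lm R H F v" "ALL x:$H. a (v x) = g (?b x)" using projc_lift[OF Hp lm_comp[OF b f(2)] D(2) as] by blast
 interpret F: mdl R F by(rule mdl.intro) (rule D)
 interpret L: mdl R L by(rule mdl.intro) (rule D)
 interpret T: mdl R T by(rule mdl.intro) (rule D)
 have hl: "lm R F F (%x. v (u x)-[F] x)" using lm_diff[OF lm_comp[OF u(1) v(1)] lm_id[OF D(5)]] .
 have "a (v (u x)-[F] x) = 0[L]" if x: "x:$F" for x
 proof -
  have "a (v (u x)) = a x" using v(2) lmD(3)[OF u(1) x] u(2) x f(3) lmD(3)[OF D(2) x] by simp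
  thus ?thesis using lmD(8)[OF D(2) lmD(3)[OF v(1) lmD(3)[OF u(1) x]] x] lmD(3)[OF D(2) x] by(simp add:L.diff_self)
 qed
 then obtain h where h: "lm R F T h" "ALL x:$F. k (h x) = v (u x)-[F] x" using ses_lift[OF s(1) hl] by blast
 have "?b (u (k x)) = 0[P]" if "x:$T" for x
  using bspec[OF u(2) lmD(3)[OF D(1) that]] D(7)[OF that] lmD(6)[OF f(1)] by simp
 then obtain u' where u': "lm R T T' u'" "ALL x:$T. i1 (k' (u' x)) = u (k x)"
  using ses_lift[OF sb lm_comp[OF D(1) u(1)]] by blast
 have "a (v (i1 (k' x))) = 0[L]" if "x:$T'" for x
  using bspec[OF v(2) lmD(3)[OF Db(1) that]] Db(7)[OF that] lmD(6)[OF f(2)] by simp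
 then obtain v' where v': "lm R T' T v'" "ALL x:$T'. k (v' x) = v (i1 (k' x))"
  using ses_lift[OF s(1) lm_comp[OF Db(1) v(1)]] by blast
 have eq: "v' (u' x)-[T] h (k x) = x" if x: "x:$T" for x
 proof -
  have c: "v' (u' x):$T" "h (k x):$T" "k x:$F" "v (u (k x)):$F"
   using x lmD(3)[OF u'(1)] lmD(3)[OF v'(1)] lmD(3)[OF h(1)] lmD(3)[OF D(1)] lmD(3)[OF u(1)] lmD(3)[OF v(1)] by auto
  have "k (v' (u' x)-[T] h (k x)) = v (u (k x))-[F] (v (u (k x))-[F] k x)"
   using lmD(8)[OF D(1) c(1,2)] v'(2) u'(2) h(2) x c lmD(3)[OF u'(1) x] by simp
  also have "... = k x" using c(3,4) by(simp add:F.minus_eq F.minus_add F.a_assoc[symmetric] F.r_neg)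
  finally show ?thesis using inj_onD[OF D(3)] x c by blast
 qed
 obtain W p2 q2 i2 j2 where bW: "bip R T' F W p2 q2 i2 j2" using ex_bip[OF D'(4) D(5)] by blast
 note W = bipD[OF bW]
 have "smd R T W"
 proof (rule smdI)
  show "lm R T W (%x. i2 (u' x)+[W] j2 (k x))" using lm_add[OF lm_comp[OF u'(1) W(3)] lm_comp[OF D(1) W(4)]] .
  show "lm R W T (%w. v' (p2 w)-[T] h (q2 w))" using lm_diff[OF lm_comp[OF W(1) v'(1)] lm_comp[OF W(2) h(1)]] .
  show "v' (p2 (i2 (u' x)+[W] j2 (k x)))-[T] h (q2 (i2 (u' x)+[W] j2 (k x))) = x" if x: "x:$T" for x
   using W(10,11)[OF lmD(3)[OF u'(1) x] lmD(3)[OF D(1) x]] eq[OF x] by simp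
 qed
 thus ?thesis unfolding stab_def using s(2) bW by blast
qed

lemma stab_refl: assumes "module R N" shows "stab R N N"
proof -
 interpret N: mdl R N using assms by rule
 have Z: "module R (N\<lparr>carrier := {0[N]}\<rparr>)" using N.sm_module[OF N.sm_zero] .
 hence zp: "N\<lparr>carrier := {0[N]}\<rparr> : projc R" using zero_in_add_cl[OF free1_FG Z] by simp
 obtain P p q i j where P: "bip R N (N\<lparr>carrier := {0[N]}\<rparr>) P p q i j" using ex_bip[OF assms Z] by blast
 note B = bipD[OF P]
 have "smd R N P" using smdI[OF B(3,1,5)] .
 thus ?thesis unfolding stab_def using zp P by blast
qed

lemma first_syz_ses:
 assumes "first_syz R (L :: 'a umod) T"
 shows "EX n g. ses R T (free_mod R n) L (%x. x) g"
 using assms gens_by_ses unfolding first_syz_def fin_gen_def by blast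

lemma first_syz_fg: assumes "noetherian_ring R" "first_syz R (L :: 'a umod) T" shows "fin_gen R T" "fin_gen R L"
 using first_syz_ses[OF assms(2)] fin_gen_kernel[OF assms(1) _ free_fin_gen] assms(2) by(auto simp:first_syz_def)

text \<open>\<open>syzn\<close> adds the last syzygy, whereas the recursion of \<open>bnd\<close>
  peels off the first one.\<close>

lemma syzn_front:
 assumes N: "noetherian_ring R"
 shows "syzn R (Suc i) N0 T==> EX L. first_syz R N0 L & syzn R i L T"
proof (induct i arbitrary: T)
 case 0 thus ?case using first_syz_fg[OF N] by auto
next
 case (Suc i)
 then obtain L' where L': "syzn R (Suc i) N0 L'" "first_syz R L' T" by auto
 thus ?case using Suc(1)[OF L'(1)] by auto
qed

text \<open>The claim covers all \<open>L\<close> stably below \<open>M\<close>, not only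
  \<open>M\<close> itself: one step of the minimal resolution produces a module that is merely
  stably comparable with the syzygy chosen by \<open>bnd\<close>.\<close>

lemma bnd_syzn:
 assumes N: "noetherian_ring R"
 shows "bnd R j AA==> EX G n. fin_gen R G & (ALL M:AA. ALL L T. stab R L M--> syzn R j L T--> T:sball R {G} n)"
proof (induct j arbitrary: AA)
 case 0
 \<comment> \<open>The projective complement in \<open>stab\<close> has to lie in balls of the same
   generator; adding it as one more extension gives the index n + k + 1.\<close>
 have "bnd R 0 (projc R)" by(rule bnd_projc)
 from bnd0_common[OF 0 this] obtain G n k where G: "fin_gen R G" "AA<:sball R {G} n" "projc R<:sball R {G} k" by blast
 have "T:sball R {G} (n + k + 1)" if M: "M:AA" "stab R L M" "syzn R 0 L T" for M L T
 proof -
  have T: "T = L" using M by simp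
  obtain E P p q i j where E: "E:projc R" "bip R M E P p q i j" "smd R L P" using M unfolding stab_def by blast
  have "P:sball R {G} (n + k + 1)" using sball_ext[OF G(1) _ bip_ses[OF E(2)]] G M E by blast
  thus ?thesis using sball_smd[OF G(1) E(3)] T by blast
 qed
 thus ?case using G(1) by blast
next
 case (Suc j)
 then obtain BB where B: "bnd R j BB" "ALL M:AA. EX L:BB. syz R M L" by auto
 obtain G n where G: "fin_gen R G" "ALL M:BB. ALL L T. stab R L M--> syzn R j L T--> T:sball R {G} n" using Suc(1)[OF B(1)] by blast
 have "T:sball R {G} n" if M: "M:AA" "stab R L M" "syzn R (Suc j) L T" for M L T
 proof -
  obtain L' where L': "first_syz R L L'" "syzn R j L' T" using syzn_front[OF N M(3)] by blast
  obtain r g where s: "ses R L' (free_mod R r) L (%x. x) g" using first_syz_ses[OF L'(1)] by blast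
  obtain M' where M': "M':BB" "syz R M M'" using B(2) M(1) by blast
  then obtain F' k' a' where s': "F':projc R" "ses R M' F' M k' a'" by(auto simp:syz_def)
  have "stab R L' M'" using stab_syz[OF M(2) s free_projc s'(2,1)] .
  thus ?thesis using G(2) M'(1) L'(2) by blast
 qed
 thus ?case using G(1) by blast
qed

text \<open>Zeroth syzygies are allowed in \<open>bracket_cl\<close>, so it contains the additive
  closure, and an induction compares the balls layer by layer.\<close>

lemma sball_rball: assumes "fin_gen R G" shows "sball R {G} n<:rball R G n"
proof -
 have br: "add_cl R CC<:bracket_cl R CC" if "CC<:FG R" for CC
 proof -
  have "CC<:{free_mod R 1} \<union> {T. EX N0:CC. EX i. syzn R i N0 T}"
  proof
   fix M assume M: "M:CC"
   hence "syzn R 0 M M" using that by auto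
   thus "M:{free_mod R 1} \<union> {T. EX N0:CC. EX i. syzn R i N0 T}" using M by blast
  qed
  thus ?thesis unfolding bracket_cl_def by(rule add_cl_mono)
 qed
 show ?thesis
 proof (induct n)
  case 0 show ?case using br[of "{G}"] assms by(simp add:sball.simps)
 next
  case (Suc n)
  have "circ_cl R (sball R {G} n) (sball R {G} 0)<:circ_cl R (rball R G n) (bracket_cl R {G})"
   using circ_cl_mono[OF Suc] br[of "{G}"] assms by(simp add:sball.simps)
  hence "add_cl R (circ_cl R (sball R {G} n) (sball R {G} 0))<:add_cl R (circ_cl R (rball R G n) (bracket_cl R {G}))"
   by(rule add_cl_mono)
  thus ?case unfolding sball_Suc[OF assms] rball.simps using br[OF circ_cl_FG] by(meson order_trans)
 qed
qed

lemma size_radius_finite: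
 assumes N: "noetherian_ring R" and b: "bnd R d (FG R)"
 shows "mod_size R (syz_class R d) < \<infinity> & mod_radius R (syz_class R d) < \<infinity>"
proof -
 obtain G n where G: "fin_gen R G" "ALL M:FG R. ALL L T. stab R L M--> syzn R d L T--> T:sball R {G} n" using bnd_syzn[OF N b] by blast
 have sz: "syz_class R d<:sball R {G} n"
 proof
  fix M assume "M:syz_class R d"
  then obtain N0 T where NT: "syzn R d N0 T" "mod_iso R M T" by(auto simp:syz_class_def)
  have "fin_gen R N0"
  proof (cases d)
   case 0 thus ?thesis using NT by simp
  next
   case (Suc k) thus ?thesis using NT(1) syzn_front[OF N, of k N0 T] by(auto simp:first_syz_def)
  qed
  hence T: "T:sball R {G} n" using G(2) NT(1) stab_refl by(auto simp:fin_gen_def)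
  obtain f where f: "lm R M T f" "bij_betw f ($M) ($T)" using NT(2) by(auto simp:mod_iso_def lm_def)
  obtain g where g: "lm R T M g" "ALL x:$M. g (f x) = x" using lm_inverse[OF f] by blast
  have "smd R M T" using smdI[OF f(1) g(1)] g(2) by blast
  thus "M:sball R {G} n" using sball_smd[OF G(1) _ T] by blast
 qed
 have "mod_size R (syz_class R d) <= enat n" unfolding mod_size_def
  by(rule INF_lower) (use G(1) sz in blast)
 moreover have "mod_radius R (syz_class R d) <= enat n" unfolding mod_radius_def
  by(rule INF_lower) (use G(1) sz sball_rball[OF G(1), of n] in blast)
 ultimately show ?thesis using le_less_trans[of _ "enat n" \<infinity>] by simp
qed

end

lemma (in noeth_local) size_radius_local:
 assumes d: "krull_dim R = enat d"
  and thmB: "!!P s. primeideal P R==> P ~= m==> chain_le P s==> EX x:$R - P. ALL B e M E f g. cyc B e P -->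
(ALL i<=s. ses R (M (Suc i)) (E i) (M i) (f i) (g i) & E i:pw R B)--> M 0:kill P -->
(EX h. lm R (M s) (E s) h & (ALL y:$(M s). g s (h y) = x*[M s] y))"
 shows "mod_size R (syz_class R d) < \<infinity> & mod_radius R (syz_class R d) < \<infinity>"
proof -
 have "chain_le { #0} d" unfolding chain_le_def
 proof
  assume "EX Q.(ALL i<=Suc d. primeideal (Q i) R & { #0}<:Q i) & (ALL i<Suc d. Q i \<subset> Q (Suc i))"
  hence "enat (Suc d):{enat n | n. EX P.(ALL i<=n. primeideal (P i) R) & (ALL i<n. P i \<subset> P (Suc i))}" by blast
  hence "enat (Suc d) <= krull_dim R" unfolding krull_dim_def by(rule Sup_upper)
  thus False using d by simp
 qed
 hence "bnd R d (kill { #0})" using main_bnd[OF thmB zeroideal] by blast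
 moreover have "FG R<:kill { #0}"
 proof
  fix N assume N: "N:FG R"
  hence Nm: "module R N" by(auto simp:fin_gen_def)
  interpret N: mdl R N using Nm by rule
  show "N:kill { #0}" using N by(auto simp:kill_def)
 qed
 ultimately have "bnd R d (FG R)" using bnd_mono by blast
 thus ?thesis using size_radius_finite[OF noetherian_ring_axioms] by blast
qed

section \<open>Near-splittings over rings of finite global dimension\<close>

text \<open>Invariant: multiplication by \<open>c\<close> on \<open>M\<close> differs from a map
  through \<open>Z\<close> by one that factors through free modules. Passing to kernels costs
  \<open>c'\<close> twice: once to lift \<open>f\<close> to the covers, as \<open>E\<close> is
  projective only up to \<open>c'\<close>, and once to factor the remaining error, which passes
  through \<open>E\<close>.\<close>

lemma near_step:
 fixes Z Z' :: "'a umod" and R :: "('a,'c) ring_scheme"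
 assumes s: "ses R M' E M a p" and s': "ses R Z' F Z k q"
  and F: "fac R {free_mod R 1} F F (%x. x)"
  and E: "fac R {free_mod R 1} E E (%x. c'*[E] x)"
  and c: "c':$R" "c:$R"
  and f: "lm R M Z f" and g: "lm R Z M g" and M: "fac R {free_mod R 1} M M (%x. c*[M] x-[M] g (f x))"
 shows "EX f' g'. lm R M' Z' f' & lm R Z' M' g' &
fac R {free_mod R 1} M' M' (%x.(c' \<otimes>\<^bsub>R\<^esub> (c' \<otimes>\<^bsub>R\<^esub> c))*[M'] x-[M'] g' (f' x))"
proof -
 note D = sesD[OF s] and D' = sesD[OF s']
 interpret M: mdl R M by(rule mdl.intro) (rule D)
 interpret E: mdl R E by(rule mdl.intro) (rule D)
 interpret M': mdl R M' by(rule mdl.intro) (rule D)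
 have ps: "p ` $E = $M" and qs: "q ` $F = $Z" using s s' by(auto simp:ses_def)
 obtain v where v: "lm R F E v" "ALL x:$F. p (v x) = g (q x)"
  using proj_lift[OF fac_post[OF F lm_comp[OF D'(2) g]] D(2) ps] by blast
 obtain u where u: "lm R E F u" "ALL x:$E. q (u x) = f (p (c'*[E] x))"
  using proj_lift[OF fac_post[OF E lm_comp[OF D(2) f]] D'(2) qs] by blast
 obtain k1 where k1: "lm R M E k1" "ALL x:$M. p (k1 x) = c*[M] x-[M] g (f x)"
  using proj_lift[OF M D(2) ps] by blast
 \<comment> \<open>The last summand cancels the error term already known on \<open>M\<close>, so
   \<open>?H\<close> takes values in the kernel \<open>M'\<close>.\<close>
 let ?H = "%x.((c' \<otimes>\<^bsub>R\<^esub> c)*[E] x-[E] v (u x))-[E] c'*[E] k1 (p x)"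
 have cc: "c' \<otimes>\<^bsub>R\<^esub> c:$R" using c by simp
 have H: "lm R E E ?H"
  using lm_diff[OF lm_diff[OF lm_smult[OF lm_id[OF D(5)] cc] lm_comp[OF u(1) v(1)]] lm_smult[OF lm_comp[OF D(2) k1(1)] c(1)]] .
 have pH: "p (?H x) = 0[M]" if x: "x:$E" for x
 proof -
  have cx: "u x:$F" "v (u x):$E" "p x:$M" "k1 (p x):$E" "f (p x):$Z" "g (f (p x)):$M"
   using x lmD(3)[OF u(1)] lmD(3)[OF v(1)] lmD(3)[OF D(2)] lmD(3)[OF k1(1)] lmD(3)[OF f] lmD(3)[OF g] by auto
  have 1: "p (v (u x)) = c'*[M] g (f (p x))"
   using v(2) cx(1) u(2) x lmD(5)[OF D(2) c(1) x] lmD(5)[OF f c(1) cx(3)] lmD(5)[OF g c(1) cx(5)] by simp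
  have "p (?H x) = ((c' \<otimes>\<^bsub>R\<^esub> c)*[M] p x-[M] c'*[M] g (f (p x)))-[M] c'*[M] (c*[M] p x-[M] g (f (p x)))"
   using x cx c 1 k1(2) by(simp add:lmD(8)[OF D(2)] lmD(5)[OF D(2)])
  also have "... = 0[M]" using c cx by(simp add:M.smult_diff M.smult_assoc1 M.diff_self)
  finally show ?thesis .
 qed
 then obtain h where h: "lm R E M' h" "ALL x:$E. a (h x) = ?H x" using ses_lift[OF s H] by blast
 have "q (u (a x)) = 0[Z]" if x: "x:$M'" for x
  using bspec[OF u(2) lmD(3)[OF D(1) x]] lmD(5)[OF D(2) c(1) lmD(3)[OF D(1) x]] D(7)[OF x] c lmD(6)[OF f] by simp
 then obtain u' where u': "lm R M' Z' u'" "ALL x:$M'. k (u' x) = u (a x)" using ses_lift[OF s' lm_comp[OF D(1) u(1)]] by blast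
 have "p (v (k x)) = 0[M]" if x: "x:$Z'" for x
  using bspec[OF v(2) lmD(3)[OF D'(1) x]] D'(7)[OF x] lmD(6)[OF g] by simp
 then obtain v' where v': "lm R Z' M' v'" "ALL x:$Z'. a (v' x) = v (k x)" using ses_lift[OF s lm_comp[OF D'(1) v(1)]] by blast
 have eq: "(c' \<otimes>\<^bsub>R\<^esub> c)*[M'] x-[M'] v' (u' x) = h (a x)" if x: "x:$M'" for x
 proof -
  have cx: "u' x:$Z'" "v' (u' x):$M'" "a x:$E" "h (a x):$M'" "u (a x):$F" "v (u (a x)):$E"
   using x lmD(3)[OF u'(1)] lmD(3)[OF v'(1)] lmD(3)[OF D(1)] lmD(3)[OF h(1)] lmD(3)[OF u(1)] lmD(3)[OF v(1)] by auto
  have "k1 (p (a x)) = 0[E]" using D(7)[OF x] lmD(6)[OF k1(1)] by simp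
  hence "a (h (a x)) = (c' \<otimes>\<^bsub>R\<^esub> c)*[E] a x-[E] v (u (a x))"
   using bspec[OF h(2) cx(3)] c cx cc by(simp add:E.diff_zero)
  also have "... = a ((c' \<otimes>\<^bsub>R\<^esub> c)*[M'] x-[M'] v' (u' x))"
   using x cx cc v'(2) u'(2) by(simp add:lmD(8)[OF D(1)] lmD(5)[OF D(1)])
  finally show ?thesis using inj_onD[OF D(3)] cx x cc by(metis M'.minus_closed M'.smult_closed)
 qed
 have "fac R {free_mod R 1} M' M' (%x. h (c'*[E] a x))" using fac_pre[OF fac_post[OF E h(1)] D(1)] .
 moreover have "(c' \<otimes>\<^bsub>R\<^esub> (c' \<otimes>\<^bsub>R\<^esub> c))*[M'] x-[M'] c'*[M'] v' (u' x) = h (c'*[E] a x)" if x: "x:$M'" for x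
 proof -
  have cx: "v' (u' x):$M'" "a x:$E" using x lmD(3)[OF u'(1)] lmD(3)[OF v'(1)] lmD(3)[OF D(1)] by auto
  have "h (c'*[E] a x) = c'*[M'] ((c' \<otimes>\<^bsub>R\<^esub> c)*[M'] x-[M'] v' (u' x))" using eq[OF x] lmD(5)[OF h(1) c(1) cx(2)] by simp
  thus ?thesis using x cx c cc by(simp add:M'.smult_diff M'.smult_assoc1[symmetric])
 qed
 ultimately have "fac R {free_mod R 1} M' M' (%x.(c' \<otimes>\<^bsub>R\<^esub> (c' \<otimes>\<^bsub>R\<^esub> c))*[M'] x-[M'] c'*[M'] v' (u' x))"
  by(rule fac_cong)
 thus ?thesis using u'(1) lm_smult[OF v'(1) c(1)] by blast
qed

text \<open>Projective dimension at most \<open>j\<close>, with projectivity expressed by an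
  identity that factors through free modules.\<close>

primrec pdl :: "('a,'c) ring_scheme=> nat=> 'a umod=> bool" where
 "pdl R 0 = (%Z. fac R {free_mod R 1} Z Z (%x. x))"
| "pdl R (Suc j) = (%Z. EX Z' F k q. ses R Z' F Z k q & fac R {free_mod R 1} F F (%x. x) & pdl R j Z')"

text \<open>A true resolution of \<open>Z\<close> runs against the near-projective one of
  \<open>M 0\<close>. After \<open>s\<close> steps \<open>Z\<close> has been replaced by a
  projective module, so the map through it is itself harmless and the scalar alone factors through
  free modules.\<close>

lemma (in cring) near_chain:
 assumes c': "c':$R"
 shows "pdl R s Z==> c:$R==> (ALL i<s. ses R (M (Suc i)) (E i) (M i) (a i) (p i) & fac R {free_mod R 1} (E i) (E i) (%x. c'*[E i] x)) ==>
lm R (M 0) Z f==> lm R Z (M 0) g==> fac R {free_mod R 1} (M 0) (M 0) (%x. c*[M 0] x-[M 0] g (f x)) ==>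
fac R {free_mod R 1} (M s) (M s) (%x.(c' [^] (2 * s)*:c)*[M s] x)"
proof (induct s arbitrary: Z c M E a p f g)
 case 0
 interpret M: mdl R "M 0" using lmD(1)[OF 0(4)] by rule
 have "fac R {free_mod R 1} (M 0) (M 0) (%x. g (f x))" using fac_pre[OF fac_post[OF _ 0(5)] 0(4)] 0(1) by simp
 from fac_add[OF 0(6) this] show ?case
  by(rule fac_cong) (use 0(2) lmD(3)[OF 0(4)] lmD(3)[OF 0(5)] in \<open>simp add:M.add_diff_cancel\<close>)
next
 case (Suc s)
 obtain Z' F k q where Z': "ses R Z' F Z k q" "fac R {free_mod R 1} F F (%x. x)" "pdl R s Z'" using Suc(2) by auto
 have 0: "ses R (M (Suc 0)) (E 0) (M 0) (a 0) (p 0)" "fac R {free_mod R 1} (E 0) (E 0) (%x. c'*[E 0] x)" using Suc(4) by auto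
 obtain f' g' where f': "lm R (M (Suc 0)) Z' f'" "lm R Z' (M (Suc 0)) g'"
  "fac R {free_mod R 1} (M (Suc 0)) (M (Suc 0)) (%x.(c'*:(c'*:c))*[M (Suc 0)] x-[M (Suc 0)] g' (f' x))"
  using near_step[OF 0(1) Z'(1,2) 0(2) c' Suc(3,5,6,7)] by blast
 have "fac R {free_mod R 1} (M (Suc s)) (M (Suc s)) (%x.(c' [^] (2 * s)*:(c'*:(c'*:c)))*[M (Suc s)] x)"
  by(rule Suc(1)[of Z' "c'*:(c'*:c)" "%i. M (Suc i)" "%i. E (Suc i)" "%i. a (Suc i)" "%i. p (Suc i)" f' g',
     OF Z'(3) _ _ f']) (use c' Suc(3,4) in auto)
 moreover have "c' [^] (2 * s)*:(c'*:(c'*:c)) = c' [^] (2 * Suc s)*:c"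
  using c' Suc(3) by(simp add:m_assoc)
 ultimately show ?case by simp
qed

text \<open>Once multiplication by the scalar on \<open>M s\<close> factors through free modules, it
  lifts along the surjection \<open>p s\<close>; the lift is the section up to that scalar.\<close>

lemma (in cring) near_split:
 assumes c': "c':$R" and pd: "pdl R s (M 0)"
  and s: "ALL i<=s. ses R (M (Suc i)) (E i) (M i) (a i) (p i) & fac R {free_mod R 1} (E i) (E i) (%x. c'*[E i] x)"
 shows "EX h. lm R (M s) (E s) h & (ALL y:$(M s). p s (h y) = c' [^] (2 * s)*[M s] y)"
proof -
 have s0: "ses R (M (Suc 0)) (E 0) (M 0) (a 0) (p 0)" and ss: "ses R (M (Suc s)) (E s) (M s) (a s) (p s)" using s by auto
 have m: "module R (M 0)" using sesD(6)[OF s0] .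
 interpret M: mdl R "M 0" using m by rule
 \<comment> \<open>Initial data: \<open>Z\<close> is \<open>M 0\<close> itself, both maps are
   identities, the scalar is 1 and the error is 0.\<close>
 have "fac R {free_mod R 1} (M 0) (M 0) (%x.#1*[M 0] x-[M 0] x)"
  by(rule fac.zero[OF m m]) (simp add:M.diff_self)
 from near_chain[OF c' pd one_closed, where M=M and E=E and a=a and p=p and f="%x. x" and g="%x. x",
   OF _ lm_id[OF m] lm_id[OF m] this]
 have "fac R {free_mod R 1} (M s) (M s) (%x.(c' [^] (2 * s) *: #1)*[M s] x)" using s by auto
 hence "fac R {free_mod R 1} (M s) (M s) (%x. c' [^] (2 * s)*[M s] x)" using c' by simp
 moreover have "p s ` $(E s) = $(M s)" using ss by(simp add:ses_def)
 ultimately show ?thesis using proj_lift[OF _ sesD(2)[OF ss]] by blast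
qed

section \<open>Finite free resolutions\<close>

definition basis :: "('a,'c) ring_scheme=> ('a,'b) module=> nat=> (nat=> 'b)=> bool" where
 "basis R Z n g \<longleftrightarrow> gens_by R Z n g &
(ALL c:$(free_mod R n).(##[Z]i:{..<n}. c i*[Z] g i) = 0[Z]--> c = 0[free_mod R n])"

text \<open>Projective dimension read off from kernels of explicit generating families, ending in a
  module with a basis. Generators, relations and bases are what can be lifted from Z / t Z to
  \<open>Z\<close>, which the more flexible \<open>pdl\<close> does not show.\<close>

primrec pdf :: "('a,'c) ring_scheme=> nat=> 'a umod=> bool" where
 "pdf R 0 = (%Z. module R Z & (EX n g. basis R Z n g))"
| "pdf R (Suc j) = (%Z. module R Z & (EX n g. gens_by R Z n g & pdf R j (ker_syz R Z n g)))"

context cring begin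

lemma free_fac: "fac R {free_mod R 1} (free_mod R n) (free_mod R n) (%x. x)"
 using free_projc add_cl_iff[OF free1_FG] by blast

lemma pdf_pdl: "pdf R j Z==> pdl R j Z"
proof (induct j arbitrary: Z)
 case 0
 then obtain n g where Z: "module R Z" "gens_by R Z n g"
  "ALL c:$(free_mod R n).(##[Z]i:{..<n}. c i*[Z] g i) = 0[Z]--> c = 0[free_mod R n]" by(auto simp:basis_def)
 let ?h = "%c.##[Z]i:{..<n}. c i*[Z] g i"
 note s = gens_by_ses[OF Z(1,2)]
 have h: "lm R (free_mod R n) Z ?h" and hs: "?h ` $(free_mod R n) = $Z" using s by(auto simp:ses_def)
 have "inj_on ?h ($(free_mod R n))" using lm_inj[OF h] Z(3) by blast
 then obtain k where k: "lm R Z (free_mod R n) k" "ALL y:$Z. ?h (k y) = y"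
  using lm_inverse[OF h] hs by(auto simp:bij_betw_def)
 have "fac R {free_mod R 1} Z Z (%x. ?h (k x))" using fac_pre[OF fac_post[OF free_fac h] k(1)] .
 hence "fac R {free_mod R 1} Z Z (%x. x)" by(rule fac_cong) (use k(2) in simp)
 thus ?case by simp
next
 case (Suc j)
 then obtain n g where Z: "module R Z" "gens_by R Z n g" "pdf R j (ker_syz R Z n g)" by auto
 thus ?case using gens_by_ses[OF Z(1,2)] free_fac Suc(1)[OF Z(3)] by auto
qed

lemma pdf_Suc: "pdf R j Z==> pdf R (Suc j) Z"
proof (induct j arbitrary: Z)
 case 0
 then obtain n g where Z: "module R Z" "gens_by R Z n g"
  "ALL c:$(free_mod R n).(##[Z]i:{..<n}. c i*[Z] g i) = 0[Z]--> c = 0[free_mod R n]" by(auto simp:basis_def)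
 let ?K = "ker_syz R Z n g"
 have m: "module R ?K" using sesD(4)[OF gens_by_ses[OF Z(1,2)]] .
 interpret L: mdl R ?K using m by rule
 have z: "0[?K] = 0[free_mod R n]" by(simp add:ker_syz_def)
 have "x = 0[?K]" if "x:$?K" for x using that Z(3) z by(auto simp:ker_syz_def)
 hence "gens_by R ?K 0 (%_. undefined)" by(auto simp:gens_by_def)
 moreover have "c = 0[free_mod R 0]" if "c:$(free_mod R 0)" for c using that by(auto simp:free_mod_def)
 ultimately have "basis R ?K 0 (%_. undefined)" by(simp add:basis_def)
 thus ?case using Z m by auto
next
 case (Suc j) thus ?case by auto
qed

lemma pdf_mono: "pdf R j Z==> j <= k==> pdf R k Z"
 by(induct k) (auto simp:le_Suc_eq pdf_Suc simp del:pdf.simps)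

end

section \<open>The ring as a module over itself, and restriction of scalars to a subring\<close>

definition selfm :: "('a,'c) ring_scheme=> ('a,'a) module" where
 "selfm R = (undefined :: ('a,'a) module)\<lparr>carrier := $R,zero := 0[R],add := (%x y. x+[R] y),
smult := (%a x. a \<otimes>\<^bsub>R\<^esub> x)\<rparr>"

lemma selfm_simps [simp]: "$(selfm R) = $R" "0[selfm R] = 0[R]"
 "x+[selfm R] y = x+[R] y" "a*[selfm R] x = a \<otimes>\<^bsub>R\<^esub> x"
 by(auto simp:selfm_def)

lemma (in cring) module_selfm: "module R (selfm R)"
proof (rule moduleI[OF cring_axioms])
 show "abelian_group (selfm R)"
  by(rule abelian_groupI) (auto simp:a_ac intro:l_neg exI[of _ "\<ominus> _"] bexI[of _ "\<ominus> _"])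
qed (auto simp:l_distr r_distr m_assoc)

lemma (in cring) sub_cring: "subring B R==> cring (R@:B)"
 using subcringI' subcring_iff subringE(1) by blast

lemma module_restrict:
 assumes "module R M" "subring B R" shows "module (R@:B) M"
proof -
 interpret M: module R M by fact
 have B: "b:B==> b:$R" for b using subringE(1)[OF assms(2)] by blast
 show ?thesis
  by(rule moduleI[OF M.sub_cring[OF assms(2)] M.abelian_group_axioms])
   (simp_all add:B M.smult_l_distr M.smult_r_distr M.smult_assoc1)
qed

lemma lm_restrict: "lm R M N f==> subring B R==> lm (R@:B) M N f"
 unfolding lm_def using module_restrict[of R M B] module_restrict[of R N B] subringE(1)[of B R]
 by(auto simp:lin_map_def)

lemma ses_restrict: "ses R V Y Z f g==> subring B R==> ses (R@:B) V Y Z f g"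
 unfolding ses_def using lm_restrict[of R V Y f B] lm_restrict[of R Y Z g B] by simp

lemma spn_restrict_mono: assumes "B<:$R" shows "spn (R@:B) M V<:spn R M V"
proof
 fix x assume "x:spn (R@:B) M V"
 thus "x:spn R M V" by(induct rule: spn.induct) (use assms in \<open>auto intro:spn.intros\<close>)
qed

section \<open>Power series extensions\<close>

lemma (in ring) ideal_sm: "ideal J R==> sm R (selfm R) J"
proof -
 assume "ideal J R" then interpret J: ideal J R .
 show ?thesis unfolding sm_def using J.Icarr J.I_l_closed by auto
qed

locale pser = domain R for R (structure) + fixes C :: "'a set" and t :: 'a
 assumes subC: "subring C R" and tR: "t:$R" and t0: "t ~= #0"
  and dec: "s:$R==> EX c:C. EX s':$R. s = c +: t*:s'"
  and triv: "c:C==> s:$R==> c = t*:s==> c = #0"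
  and sep: "s:$R==> (!!n::nat. EX s':$R. s = t [^] n*:s')==> s = #0"
  and lim: "(!!n::nat. cs n:C)==> EX a. ALL n. a n:$R & a n = cs n +: t*:a (Suc n)"
begin

abbreviation RC where "RC == R@:C"

lemma CR: "c:C==> c:$R" using subringE(1)[OF subC] by blast

definition sepm :: "('a,'e) module=> bool" where
 "sepm Z \<longleftrightarrow> (ALL z:$Z.(ALL n::nat. EX z':$Z. z = t [^] n*[Z] z')--> z = 0[Z])"

text \<open>Nakayama in the complete setting. Expanding z again and again modulo \<open>t\<close>
  produces coefficient sequences in \<open>C\<close>; \<open>lim\<close> sums them to coefficients
  in \<open>R\<close>, and separatedness shows that nothing is lost.\<close>

lemma nak:
 assumes Z: "module R Z" "sepm Z" and V: "finite V" "V<:$Z"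
  and st: "!!z. z:$Z==> EX w:spn RC Z V. EX z':$Z. z = w+[Z] t*[Z] z'"
 shows "$Z<:spn R Z V"
proof
 interpret Z: mdl R Z using Z(1) by rule
 interpret ZC: mdl RC Z using module_restrict[OF Z(1) subC] by rule
 obtain n :: nat and g where V': "V = g ` {..<n}" using finite_imp_nat_seg_image_inj_on[OF V(1)] by(auto simp:lessThan_def)
 have g: "i < n==> g i:$Z" for i using V V' by auto
 have "EX c z'. c:{..<n} \<rightarrow> C & z':$Z & z = (##[Z]i:{..<n}. c i*[Z] g i)+[Z] t*[Z] z'" if z: "z:$Z" for z
 proof -
  obtain w z' where w: "w:spn RC Z V" "z':$Z" "z = w+[Z] t*[Z] z'" using st[OF z] by blast
  then obtain c where "c:{..<n} \<rightarrow> C" "w = (##[Z]i:{..<n}. c i*[Z] g i)"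
   unfolding V' using ZC.spn_image_finsum[of "{..<n}" g] g by auto
  thus ?thesis using w by blast
 qed
 hence "ALL z:$Z. EX c z'. c:{..<n} \<rightarrow> C & z':$Z & z = (##[Z]i:{..<n}. c i*[Z] g i)+[Z] t*[Z] z'"
  by(rule ballI)
 from bchoice[OF this] obtain cf where "ALL z:$Z. EX z'. cf z:{..<n} \<rightarrow> C & z':$Z &
z = (##[Z]i:{..<n}. cf z i*[Z] g i)+[Z] t*[Z] z'" by(elim exE)
 from bchoice[OF this] obtain zf where cz': "ALL z:$Z. cf z:{..<n} \<rightarrow> C & zf z:$Z &
z = (##[Z]i:{..<n}. cf z i*[Z] g i)+[Z] t*[Z] zf z" by(elim exE)
 note cz = bspec[OF cz']
 fix z assume z: "z:$Z"
 define zs where "zs k = (zf ^^ k) z" for k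
 have zs: "zs k:$Z" for k by(induct k) (use z cz in \<open>auto simp:zs_def\<close>)
 define c where "c k i = (if i < n then cf (zs k) i else #0)" for k i
 have c: "c k i:C" for k i using cz[OF zs[of k]] subringE(2)[OF subC] by(auto simp:c_def)
 have "EX a. ALL k. a k:$R & a k = c k i +: t*:a (Suc k)" for i using lim[of "%k. c k i"] c by blast
 then obtain aa where aa: "!!i k. aa i k:$R & aa i k = c k i +: t*:aa i (Suc k)" by metis
 have aaR: "aa i k:$R" for i k using aa[of i k] by(rule conjunct1)
 have cR: "c k i:$R" for k i using c CR by blast
 define W where "W k = (##[Z]i:{..<n}. aa i k*[Z] g i)" for k
 have Wc: "W k:$Z" for k unfolding W_def using g aaR by(intro Z.finsum_closed) auto
 have W: "W k = (##[Z]i:{..<n}. c k i*[Z] g i)+[Z] t*[Z] W (Suc k)" for k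
 proof -
  have "aa i k*[Z] g i = c k i*[Z] g i+[Z] t*[Z] (aa i (Suc k)*[Z] g i)" if "i < n" for i
   using conjunct2[OF aa[of i k]] aaR[of i "Suc k"] g[OF that] tR cR[of k i] by(metis Z.smult_assoc1 Z.smult_l_distr m_closed)
  hence "W k = (##[Z]i:{..<n}. c k i*[Z] g i+[Z] t*[Z] (aa i (Suc k)*[Z] g i))"
   unfolding W_def using g aaR tR cR by(intro Z.finsum_cong') auto
  also have "... = (##[Z]i:{..<n}. c k i*[Z] g i)+[Z] (##[Z]i:{..<n}. t*[Z] (aa i (Suc k)*[Z] g i))"
   using g aaR tR cR by(intro Z.finsum_addf) auto
  also have "(##[Z]i:{..<n}. t*[Z] (aa i (Suc k)*[Z] g i)) = t*[Z] W (Suc k)"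
   unfolding W_def using g aaR tR by(intro Z.finsum_smult_ldistr[symmetric]) auto
  finally show ?thesis .
 qed
 have zsS: "zs k = (##[Z]i:{..<n}. c k i*[Z] g i)+[Z] t*[Z] zs (Suc k)" for k
 proof -
  have "(##[Z]i:{..<n}. cf (zs k) i*[Z] g i) = (##[Z]i:{..<n}. c k i*[Z] g i)"
   using g cR by(intro Z.finsum_cong') (auto simp:c_def)
  moreover have "zf (zs k) = zs (Suc k)" by(simp add:zs_def)
  ultimately show ?thesis using cz[OF zs[of k]] by metis
 qed
 have sc: "(##[Z]i:{..<n}. c k i*[Z] g i):$Z" for k using g cR by(intro Z.finsum_closed) auto
 \<comment> \<open>Difference between the k-th remainder of the expansion and the value of the k-th
   tail. It satisfies d k = t * d (k + 1), so d 0 is divisible by every power of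
   \<open>t\<close>.\<close>
 define d where "d k = zs k-[Z] W k" for k
 have dc: "d k:$Z" for k using zs Wc by(simp add:d_def)
 have dS: "d k = t*[Z] d (Suc k)" for k
 proof -
  let ?c = "##[Z]i:{..<n}. c k i*[Z] g i"
  have "d k = (?c+[Z] t*[Z] zs (Suc k))-[Z] (?c+[Z] t*[Z] W (Suc k))" unfolding d_def using zsS[of k] W[of k] by simp
  also have "... = t*[Z] zs (Suc k)-[Z] t*[Z] W (Suc k)"
   using sc[of k] zs[of "Suc k"] Wc[of "Suc k"] tR by(simp add:Z.diff_add_diff Z.diff_self)
  also have "... = t*[Z] d (Suc k)" using zs[of "Suc k"] Wc[of "Suc k"] tR by(simp add:d_def Z.smult_diff)
  finally show ?thesis .
 qed
 have "d 0 = t [^] k*[Z] d k" for k :: nat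
 proof (induct k)
  case 0 thus ?case using dc by simp
 next
  case (Suc k)
  have "t [^] k*[Z] (t*[Z] d (Suc k)) = t [^] Suc k*[Z] d (Suc k)" using tR dc by(simp add:Z.smult_assoc1)
  thus ?case using Suc dS[of k] by simp
 qed
 hence "d 0 = 0[Z]" using Z(2) dc unfolding sepm_def by blast
 hence "z = W 0" using zs[of 0] Wc[of 0] by(simp add:d_def zs_def Z.diff_eq_iff)
 moreover have "W 0:spn R Z V" unfolding V'
  using Z.spn_image_finsum[of "{..<n}" g] g aaR W_def by auto
 ultimately show "z:spn R Z V" by simp
qed

text \<open>Hilbert's basis theorem for power series. The constant terms of the t-saturation of
  \<open>J\<close> form an ideal of \<open>C\<close>, and lifts of its generators generate the
  saturation by \<open>nak\<close>. \<open>J\<close> itself differs from it only below some power of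
  \<open>t\<close>, where finitely generated \<open>C\<close>-modules control it.\<close>

lemma noeth_pser: assumes N: "noetherian_ring RC" shows "noetherian_ring R"
proof (rule noetherian_ringI)
 fix J assume J: "ideal J R"
 interpret J: ideal J R by fact
 interpret RC: cring RC using sub_cring[OF subC] .
 interpret S: mdl R "selfm R" using module_selfm by rule
 interpret SC: mdl RC "selfm R" using module_restrict[OF module_selfm subC] by rule
 have tn: "t [^] (n::nat):$R" for n using tR by simp
 \<comment> \<open>The t-saturation: elements that some power of \<open>t\<close> brings into
   \<open>J\<close>. Dividing by \<open>t\<close> stays inside it, as the successive approximation
   requires.\<close>
 define J' where "J' = {z:$R. EX n::nat. t [^] n*:z:J}"
 have J'R: "z:J'==> z:$R" for z by(simp add:J'_def)
 have up: "t [^] (n + k)*:z:J" if "t [^] n*:z:J" "z:$R" for n k :: nat and z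
 proof -
  have "t [^] (n + k)*:z = t [^] k*:(t [^] n*:z)" using that tR by(simp add:nat_pow_mult[symmetric] m_ac)
  thus ?thesis using J.I_l_closed that tn by simp
 qed
 have smJ': "sm R (selfm R) J'" unfolding sm_def
 proof (intro conjI ballI)
  show "J'<:$(selfm R)" by(auto simp:J'_def)
  show "0[selfm R]:J'" using tR by(auto simp:J'_def)
  fix z assume z: "z:J'"
  then obtain n :: nat where n: "t [^] n*:z:J" "z:$R" by(auto simp:J'_def)
  { fix y assume "y:J'"
   then obtain k :: nat where k: "t [^] k*:y:J" "y:$R" by(auto simp:J'_def)
   have "t [^] (n + k)*:(z +: y):J" using up[OF n, of k] up[OF k, of n] n k tn by(simp add:r_distr add.commute)
   thus "z+[selfm R] y:J'" using n k by(auto simp:J'_def) }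
  fix a assume a: "a:$R"
  have "t [^] n*:(a*:z) = a*:(t [^] n*:z)" using a n tn by(simp add:m_lcomm)
  hence "t [^] n*:(a*:z):J" using J.I_l_closed[OF n(1) a] by simp
  thus "a*[selfm R] z:J'" using n a by(auto simp:J'_def)
 qed
 note SJ = S.smD[OF smJ', simplified]
 have sat: "z:J'" if z: "z:$R" "t*:z:J'" for z
 proof -
  obtain n :: nat where n: "t [^] n*:(t*:z):J" using z by(auto simp:J'_def)
  hence "t [^] Suc n*:z:J" using z tR by(simp add:m_assoc)
  thus ?thesis using z unfolding J'_def by blast
 qed
 have idl: "ideal {c:C. EX w:T. EX s:$R. w = c +: t*:s} RC" if T: "sm RC (selfm R) T" for T
 proof (rule RC.ideal_intro)
  note ST = SC.smD[OF T, simplified]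
  show "0[RC]:{c:C. EX w:T. EX s:$R. w = c +: t*:s}"
   using ST(2) tR subringE(2)[OF subC] by(auto intro!: bexI[of _ \<zero>])
  fix x assume "x:{c:C. EX w:T. EX s:$R. w = c +: t*:s}"
  then obtain w s where x: "x:C" "w:T" "s:$R" "w = x +: t*:s" by blast
  { fix y assume "y:{c:C. EX w:T. EX s:$R. w = c +: t*:s}"
   then obtain v r where y: "y:C" "v:T" "r:$R" "v = y +: t*:r" by blast
   have "w +: v = (x +: y) +: t*:(s +: r)" using x y CR tR by(simp add:r_distr a_ac)
   moreover have "w +: v:T" "x +: y:C" using ST(3) x y subringE(7)[OF subC] by auto
   ultimately show "x+[RC] y:{c:C. EX w:T. EX s:$R. w = c +: t*:s}"
    using x y by(intro CollectI conjI bexI[of _ "w +: v"] bexI[of _ "s +: r"]) simp_all }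
  fix a assume "a:$RC" hence a: "a:C" by simp
  have "a*:w = a*:x +: t*:(a*:s)" using x a CR tR by(simp add:r_distr m_lcomm)
  moreover have "a*:w:T" "a*:x:C" "a*:s:$R" using ST(4) x a subringE(6)[OF subC] CR by auto
  ultimately show "a \<otimes>\<^bsub>RC\<^esub> x:{c:C. EX w:T. EX s:$R. w = c +: t*:s}"
   by(intro CollectI conjI bexI[of _ "a*:w"] bexI[of _ "a*:s"]) simp_all
 qed auto
 have smJC: "sm RC (selfm R) J'" using SJ CR by(auto simp:sm_def)
 obtain A where A: "A<:C" "finite A" "{c:C. EX w:J'. EX s:$R. w = c +: t*:s} = genideal RC A"
  using noetherian_ring.finetely_gen[OF N idl[OF smJC]] by auto
 have "A<:{c:C. EX w:J'. EX s:$R. w = c +: t*:s}" unfolding A(3) using RC.genideal_self[of A] A(1) by simp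
 hence "ALL a:A. EX w s. w:J' & s:$R & w = a +: t*:s" by blast
 then obtain za sa where za: "!!a. a:A==> za a:J' & sa a:$R & za a = a +: t*:sa a" by metis
 define V where "V = za ` A"
 have V: "finite V" "V<:J'" unfolding V_def using A(2) za by blast+
 have VR: "V<:$R" using V(2) J'R by blast
 have VS: "V<:$(selfm R)" using VR by simp
 have spV: "spn RC (selfm R) V<:J'" using SC.spn_least[OF smJC V(2)] .
 have DT: "{c:C. EX w:J'. EX s:$R. w = c +: t*:s}<:{c:C. EX w:spn RC (selfm R) V. EX s:$R. w = c +: t*:s}"
  unfolding A(3)
 proof (rule RC.genideal_minimal[OF idl[OF SC.spn_sm[OF VS]]], rule subsetI)
  fix a assume a: "a:A"
  have "za a:spn RC (selfm R) V" using SC.spn_incl[OF VS] a by(auto simp:V_def)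
  thus "a:{c:C. EX w:spn RC (selfm R) V. EX s:$R. w = c +: t*:s}" using za[OF a] a A(1) by blast
 qed
 have st: "EX w:spn RC (selfm R) V. EX z':J'. z = w +: t*:z'" if z: "z:J'" for z
 proof -
  obtain c s where c: "c:C" "s:$R" "z = c +: t*:s" using dec J'R[OF z] by blast
  hence "c:{c:C. EX w:J'. EX s:$R. w = c +: t*:s}" using z by blast
  then obtain w s1 where w: "w:spn RC (selfm R) V" "s1:$R" "w = c +: t*:s1" using DT by blast
  have wJ: "w:J'" using w spV by blast
  have cR: "c:$R" "w:$R" using c CR J'R wJ by auto
  have e: "z -: w = t*:(s -: s1)" using c w cR tR by(simp add:diff_add_diff diff_self) (simp add:a_minus_def r_distr r_minus)
  have "z -: w:J'" using SJ(6)[OF z wJ] by(simp add:a_minus_def selfm_def a_inv_def m_inv_def)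
  hence "s -: s1:J'" using sat[of "s -: s1"] e c w by simp
  moreover have "z = w +: t*:(s -: s1)" using e cR J'R[OF z] by(metis add_diff_swap)
  ultimately show ?thesis using w by blast
 qed
 let ?Z = "(selfm R)\<lparr>carrier := J'\<rparr>"
 have "$?Z<:spn R ?Z V"
 proof (rule nak)
  show "module R ?Z" using S.sm_module[OF smJ'] .
  show "sepm ?Z" unfolding sepm_def
  proof (intro ballI impI)
   fix z assume z: "z:$?Z" and a: "ALL n::nat. EX z':$?Z. z = t [^] n*[?Z] z'"
   have "EX s':$R. z = t [^] n*:s'" for n :: nat using spec[OF a, of n] J'R by auto
   thus "z = 0[?Z]" using sep[of z] z J'R by simp
  qed
  show "EX w:spn RC ?Z V. EX z':$?Z. z = w+[?Z] t*[?Z] z'" if "z:$?Z" for z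
   using st[of z] that by(simp add:spn_carrier_upd)
 qed (use V in auto)
 hence J'V: "J'<:spn R (selfm R) V" by(simp add:spn_carrier_upd)
 have "EX n::nat. ALL v:V'. t [^] n*:v:J" if "finite V'" "V'<:J'" for V'
  using that
 proof (induct)
  case (insert v V')
  then obtain n :: nat where n: "ALL v:V'. t [^] n*:v:J" by blast
  obtain k :: nat where k: "t [^] k*:v:J" using insert by(auto simp:J'_def)
  have "ALL u:insert v V'. t [^] (n + k)*:u:J" using up[of n _ k] up[of k v n] n k insert(4) J'R by(auto simp:add.commute)
  thus ?case by blast
 qed auto
 then obtain n :: nat where n: "ALL v:V. t [^] n*:v:J" using V by blast
 \<comment> \<open>The products of \<open>V\<close> with the powers of \<open>t\<close> below k span
   \<open>J'\<close> over \<open>C\<close> modulo t^k J'. For k = n the remainder is generated by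
   t^n V, which lies in \<open>J\<close>.\<close>
 define Vk where "Vk k = (\<Union>i<k.(%v. t [^] i*:v) ` V)" for k :: nat
 have Vk: "finite (Vk k)" "Vk k<:$(selfm R)" for k using V(1) VR tn by(auto simp:Vk_def)
 have VkS: "Vk k<:Vk (Suc k)" "(%x. t [^] k*:x) ` V<:Vk (Suc k)" for k by(auto simp:Vk_def lessThan_Suc)
 have dk: "EX w:spn RC (selfm R) (Vk k). EX z':J'. z = w +: t [^] k*:z'" if "z:J'" for z k
  using that
 proof (induct k)
  case 0
  have "#0:spn RC (selfm R) (Vk 0)" using spn.zero[of "selfm R" RC "Vk 0"] by simp
  moreover have "z = #0 +: t [^] (0::nat)*:z" using J'R[OF 0] by simp
  ultimately show ?case using 0 by blast
 next
  case (Suc k)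
  then obtain w z' where w: "w:spn RC (selfm R) (Vk k)" "z':J'" "z = w +: t [^] k*:z'" by blast
  obtain w1 z1 where w1: "w1:spn RC (selfm R) V" "z1:J'" "z' = w1 +: t*:z1" using st[OF w(2)] by blast
  have c: "w:$R" "w1:$R" "z1:$R" using SC.spn_closed[OF Vk(2) w(1)] SC.spn_closed[OF VS w1(1)] J'R[OF w1(2)] by auto
  have l: "lm RC (selfm R) (selfm R) (%x. t [^] k*:x)"
   using lm_restrict[OF lm_smult[OF lm_id[OF module_selfm] tn] subC] by simp
  have "t [^] k*:w1:spn RC (selfm R) ((%x. t [^] k*:x) ` V)" using lm_image_spn[OF l VS] w1(1) by blast
  hence a: "t [^] k*:w1:spn RC (selfm R) (Vk (Suc k))"
   using SC.spn_mono[OF VkS(2)[of k] Vk(2)] by blast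
  have b: "w:spn RC (selfm R) (Vk (Suc k))" using SC.spn_mono[OF VkS(1)[of k] Vk(2)] w(1) by blast
  have "z = (w +: t [^] k*:w1) +: t [^] Suc k*:z1" using w w1 c tn tR by(simp add:r_distr m_assoc a_assoc)
  moreover have "w +: t [^] k*:w1:spn RC (selfm R) (Vk (Suc k))" using SC.spn_add[OF Vk(2) b a] by simp
  ultimately show ?case using w1(2) by blast
 qed
 have smU: "sm RC (selfm R) (J \<inter> spn RC (selfm R) (Vk n))"
  using SC.spn_sm[OF Vk(2)[of n]] J.Icarr J.I_l_closed CR by(auto simp:sm_def)
 obtain W where W: "finite W" "W<:J \<inter> spn RC (selfm R) (Vk n)" "J \<inter> spn RC (selfm R) (Vk n) = spn RC (selfm R) W"
  using SC.noeth_spn[OF N Vk smU Int_lower2] by(elim exE conjE)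
 define G where "G = W \<union> (%v. t [^] n*:v) ` V"
 have GJ: "G<:J" "finite G" using W n V by(auto simp:G_def)
 have GR: "G<:$R" using GJ J.Icarr by blast
 have JG: "J<:spn R (selfm R) G"
 proof
  fix z assume z: "z:J"
  have "z:J'" unfolding J'_def using z J.Icarr by(auto intro!: exI[of _ "0::nat"])
  then obtain w z' where w: "w:spn RC (selfm R) (Vk n)" "z':J'" "z = w +: t [^] n*:z'" using dk by blast
  have c: "w:$R" "z':$R" "z:$R" using SC.spn_closed[OF Vk(2) w(1)] J'R[OF w(2)] J.Icarr z by auto
  have l: "lm R (selfm R) (selfm R) (%x. t [^] n*:x)" using lm_smult[OF lm_id[OF module_selfm] tn] by simp
  have a: "t [^] n*:z':spn R (selfm R) ((%v. t [^] n*:v) ` V)" using lm_image_spn[OF l VS] J'V w(2) by blast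
  have aG: "t [^] n*:z':spn R (selfm R) G" using S.spn_mono[of "(%v. t [^] n*:v) ` V" G] GR a by(auto simp:G_def)
  have aJ: "t [^] n*:z':J" using S.spn_least[OF ideal_sm[OF J] GJ(1)] aG by blast
  have "w = z -: t [^] n*:z'" using w c tn by(simp add:diff_add_cancel)
  hence "w:J" using z aJ J.a_inv_closed J.a_closed by(simp add:a_minus_def)
  hence "w:spn RC (selfm R) W" using w(1) W(3) by blast
  hence "w:spn R (selfm R) W" using spn_restrict_mono[of C R "selfm R" W] CR by blast
  hence "w:spn R (selfm R) G" using S.spn_mono[of W G] GR by(auto simp:G_def)
  thus "z:spn R (selfm R) G" using S.spn_add[of G w "t [^] n*:z'"] GR aG w(3) by simp
 qed
 have "spn R (selfm R) G<:genideal R G"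
  using S.spn_least[OF ideal_sm[OF genideal_ideal[OF GR]]] genideal_self[OF GR] by blast
 moreover have "genideal R G<:J" using genideal_minimal[OF J GJ(1)] .
 ultimately have "J = genideal R G" using JG by blast
 thus "\<exists>A\<subseteq>$R. finite A & J = genideal R A" using GR GJ(2) by blast
qed

end

section \<open>Projective dimension over power series extensions\<close>

context pser begin

text \<open>The constant term of a power series: projection of \<open>R\<close> onto
  \<open>C\<close> along t R.\<close>

definition rho :: "'a=> 'a" where
 "rho s = (SOME c. c:C & (EX s':$R. s = c +: t*:s'))"

lemma rhoD: assumes "s:$R" shows "rho s:C" "EX s':$R. s = rho s +: t*:s'"
proof -
 have "rho s:C & (EX s':$R. s = rho s +: t*:s')"
  unfolding rho_def by(rule someI_ex) (use dec[OF assms] in blast)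
 thus "rho s:C" "EX s':$R. s = rho s +: t*:s'" by auto
qed

lemma rho_eq: assumes "c:C" "s':$R" shows "rho (c +: t*:s') = c"
proof -
 have cR: "c:$R" using CR assms by blast
 hence x: "c +: t*:s':$R" using assms tR by simp
 obtain s1 where s1: "s1:$R" "c +: t*:s' = rho (c +: t*:s') +: t*:s1" using rhoD(2)[OF x] by blast
 let ?r = "rho (c +: t*:s')"
 have r: "?r:C" "?r:$R" using rhoD(1)[OF x] CR by auto
 have ts: "t*:s':$R" "t*:s1:$R" using assms s1 tR by auto
 have "c -: ?r = t*:s1 -: t*:s'"
 proof -
  have "(c +: t*:s') -: (?r +: t*:s') = (?r +: t*:s1) -: (?r +: t*:s')" using s1(2) by simp
  thus ?thesis using cR r ts by(simp add:diff_add_diff diff_self)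
 qed
 also have "... = t*:(s1 -: s')" using assms s1 tR by(simp add:a_minus_def r_distr r_minus)
 finally have e: "c -: ?r = t*:(s1 -: s')" .
 have "c -: ?r:C" using assms r subringE(5,7)[OF subC] by(simp add:a_minus_def)
 hence "c -: ?r = #0" using triv[OF _ _ e] s1 assms by simp
 thus ?thesis using cR r by(simp add:diff_eq_iff)
qed

lemma rho_add: assumes "x:$R" "y:$R" shows "rho (x +: y) = rho x +: rho y"
proof -
 obtain x' where x': "x':$R" "x = rho x +: t*:x'" using rhoD(2)[OF assms(1)] by blast
 obtain y' where y': "y':$R" "y = rho y +: t*:y'" using rhoD(2)[OF assms(2)] by blast
 have r: "rho x:C" "rho y:C" "rho x:$R" "rho y:$R" using rhoD(1) assms CR by auto
 have "x +: y = (rho x +: t*:x') +: (rho y +: t*:y')" using x'(2) y'(2) by simp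
 also have "... = (rho x +: rho y) +: t*:(x' +: y')" using x'(1) y'(1) r tR by(simp add:r_distr a_ac)
 finally show ?thesis using rho_eq[of "rho x +: rho y" "x' +: y'"] r x' y' subringE(7)[OF subC] by simp
qed

lemma rho_mult: assumes "c:C" "x:$R" shows "rho (c*:x) = c*:rho x"
proof -
 obtain x' where x': "x':$R" "x = rho x +: t*:x'" using rhoD(2)[OF assms(2)] by blast
 have r: "rho x:C" "rho x:$R" "c:$R" using rhoD(1) assms CR by auto
 have "c*:x = c*:(rho x +: t*:x')" using x'(2) by simp
 also have "... = c*:rho x +: t*:(c*:x')" using x'(1) r tR by(simp add:r_distr m_lcomm)
 finally show ?thesis using rho_eq[of "c*:rho x" "c*:x'"] r x' assms subringE(6)[OF subC] by simp
qed

text \<open>\<open>Q\<close> is Z / t Z seen as a module over \<open>C\<close> = R / t R.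
  Torsion-freeness and separatedness of \<open>Z\<close> are what lets a free resolution of
  \<open>Q\<close> be lifted.\<close>

definition tq :: "'a umod=> 'a umod=> ((nat=> 'a)=> nat=> 'a)=> bool" where
 "tq Z Q q \<longleftrightarrow> module R Z & lm RC Z Q q & q ` $Z = $Q &
(ALL z:$Z. q z = 0[Q] \<longleftrightarrow> (EX z':$Z. z = t*[Z] z')) & reg t Z & sepm Z"

lemma tqD:
 assumes "tq Z Q q"
 shows "module R Z" "lm RC Z Q q" "q ` $Z = $Q" "module RC Q" "module RC Z"
  "z:$Z==> q z = 0[Q]==> EX z':$Z. z = t*[Z] z'"
  "z':$Z==> q (t*[Z] z') = 0[Q]"
  "z:$Z==> t*[Z] z = 0[Z]==> z = 0[Z]" "sepm Z"
  "s:$R==> z:$Z==> q (s*[Z] z) = rho s*[Q] q z"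
proof -
 show *: "module R Z" "lm RC Z Q q" "q ` $Z = $Q" "sepm Z"
  "z:$Z==> q z = 0[Q]==> EX z':$Z. z = t*[Z] z'"
  "z:$Z==> t*[Z] z = 0[Z]==> z = 0[Z]" for z
  using assms unfolding tq_def reg_def by auto
 show m: "module RC Q" "module RC Z" using lmD(1,2)[OF *(2)] by auto
 interpret Z: mdl R Z using *(1) by rule
 show t: "q (t*[Z] z') = 0[Q]" if "z':$Z" for z'
  using assms that Z.smult_closed[OF tR that] unfolding tq_def by blast
 interpret Q: mdl RC Q using m(1) by rule
 show "q (s*[Z] z) = rho s*[Q] q z" if s: "s:$R" and z: "z:$Z"
 proof -
  obtain s' where s': "s':$R" "s = rho s +: t*:s'" using rhoD(2)[OF s] by blast
  have r: "rho s:C" "rho s:$R" using rhoD(1)[OF s] CR by auto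
  have "s*[Z] z = (rho s +: t*:s')*[Z] z" using s'(2) by simp
  also have "... = rho s*[Z] z+[Z] t*[Z] (s'*[Z] z)" using s'(1) r z tR by(simp add:Z.smult_l_distr Z.smult_assoc1)
  finally have "q (s*[Z] z) = q (rho s*[Z] z)+[Q] q (t*[Z] (s'*[Z] z))"
   using lmD(4)[OF *(2)] r z s' tR by simp
  also have "... = rho s*[Q] q z" using lmD(5)[OF *(2), of "rho s" z] r z t[of "s'*[Z] z"] s' lmD(3)[OF *(2) z] by simp
  finally show ?thesis .
 qed
qed

lemma pd_gens:
 assumes "tq Z Q q" "gens_by RC Q n g"
 shows "EX z. gens_by R Z n z & (ALL i<n. z i:$Z & q (z i) = g i)"
proof -
 note T = tqD[OF assms(1)]
 interpret Z: mdl R Z using T(1) by rule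
 interpret ZC: mdl RC Z using T(5) by rule
 interpret Q: mdl RC Q using T(4) by rule
 have g: "g i:$Q" if "i < n" for i using assms(2) that by(auto simp:gens_by_def)
 have gs: "$Q<:spn RC Q (g ` {..<n})" using assms(2) Q.gens_by_iff by blast
 have "ALL i. EX z. i < n--> z:$Z & q z = g i" using g T(3) by(metis imageE)
 then obtain z where z: "!!i. i < n==> z i:$Z & q (z i) = g i" by metis
 let ?V = "z ` {..<n}"
 have V: "finite ?V" "?V<:$Z" using z by auto
 have qV: "q ` ?V = g ` {..<n}" using z by(force simp:image_image)
 have "$Z<:spn R Z ?V"
 proof (rule nak[OF T(1,9) V])
  fix y assume y: "y:$Z"
  have "q y:q ` spn RC Z ?V" unfolding lm_image_spn[OF T(2) V(2)] qV using gs lmD(3)[OF T(2) y] by blast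
  then obtain w where w: "w:spn RC Z ?V" "q w = q y" by auto
  have wc: "w:$Z" using ZC.spn_closed[OF V(2) w(1)] .
  have "q (y-[Z] w) = 0[Q]" using lmD(8)[OF T(2) y wc] w lmD(3)[OF T(2) y] by(simp add:Q.diff_self)
  then obtain z' where z': "z':$Z" "y-[Z] w = t*[Z] z'" using T(6)[of "y-[Z] w"] y wc by auto
  hence "y = w+[Z] t*[Z] z'" using Z.add_diff_swap[OF wc y] by simp
  thus "EX w:spn RC Z ?V. EX z':$Z. y = w+[Z] t*[Z] z'" using w(1) z'(1) by blast
 qed
 hence "gens_by R Z n z" using Z.gens_by_iff z by auto
 thus ?thesis using z by blast
qed

lemma rho_free: "s:$(free_mod R n)==> (\<lambda>i\<in>{..<n}. rho (s i)):$(free_mod RC n)"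
 using rhoD(1) free_mod_nth by(auto simp:free_mod_carrier)

lemma pd_rel:
 assumes "tq Z Q q" "!!i. i < n==> z i:$Z & q (z i) = g i" "!!i. i < n==> s i:$R"
 shows "q (##[Z]i:{..<n::nat}. s i*[Z] z i) = (##[Q]i:{..<n}. rho (s i)*[Q] g i)"
proof -
 note T = tqD[OF assms(1)]
 interpret Z: mdl R Z using T(1) by rule
 interpret Q: mdl RC Q using T(4) by rule
 have "q (##[Z]i:{..<n}. s i*[Z] z i) = (##[Q]i:{..<n}. q (s i*[Z] z i))"
  by(rule lm_finsum[OF T(2)]) (use assms in auto)
 also have "... = (##[Q]i:{..<n}. rho (s i)*[Q] g i)"
 proof (rule Q.finsum_cong')
  show "(%i. rho (s i)*[Q] g i):{..<n} \<rightarrow> $Q"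
   using assms rhoD(1) lmD(3)[OF T(2)] Q.smult_closed by fastforce
  show "q (s i*[Z] z i) = rho (s i)*[Q] g i" if "i:{..<n}" for i
   using T(10)[of "s i" "z i"] assms that by simp
 qed simp
 finally show ?thesis .
qed

lemma t_sum:
 assumes "module R (Z :: 'a umod)" "!!i. i < n==> z i:$Z" "!!i. i < n==> s' i:$R" "!!i. i < n==> s i = t*:s' i"
 shows "(##[Z]i:{..<n}. s i*[Z] z i) = t*[Z] (##[Z]i:{..<n::nat}. s' i*[Z] z i)"
proof -
 interpret Z: mdl R Z using assms(1) by rule
 have "t*[Z] (##[Z]i:{..<n}. s' i*[Z] z i) = (##[Z]i:{..<n}. t*[Z] (s' i*[Z] z i))"
  using assms tR by(intro Z.finsum_smult_ldistr) auto
 also have "... = (##[Z]i:{..<n}. s i*[Z] z i)"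
  using assms tR by(intro Z.finsum_cong') (auto simp:Z.smult_assoc1)
 finally show ?thesis by simp
qed

text \<open>A relation among lifts of a basis has zero constant terms, so it is divisible by
  \<open>t\<close>; without t-torsion the quotient is again a relation. Repeating this makes every
  coefficient divisible by all powers of \<open>t\<close>.\<close>

lemma pd_basis:
 assumes tq: "tq Z Q q" and b: "basis RC Q n g" and z: "!!i. i < n==> z i:$Z & q (z i) = g i" and gz: "gens_by R Z n z"
 shows "basis R Z n z"
proof -
 note T = tqD[OF tq]
 interpret Z: mdl R Z using T(1) by rule
 let ?rel = "%s. s:$(free_mod R n) & (##[Z]i:{..<n}. s i*[Z] z i) = 0[Z]"
 have st: "EX s'. ?rel s' & (ALL i<n. s i = t*:s' i)" if s: "?rel s" for s
 proof -
  have sR: "s i:$R" if "i < n" for i using s free_mod_nth that by blast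
  let ?c = "\<lambda>i\<in>{..<n}. rho (s i)"
  interpret Q: mdl RC Q using T(4) by rule
  have gQ: "g i:$Q" if "i < n" for i using b that by(auto simp:basis_def gens_by_def)
  have "(##[Q]i:{..<n}. ?c i*[Q] g i) = (##[Q]i:{..<n}. rho (s i)*[Q] g i)"
   by(rule Q.finsum_cong') (use rhoD(1)[OF sR] gQ Q.smult_closed in auto)
  also have "... = 0[Q]" using pd_rel[where n=n and z=z and s=s, OF tq z sR] s lmD(6)[OF T(2)] by simp
  finally have c0: "?c = 0[free_mod RC n]" using b rho_free[of s n] s unfolding basis_def by blast
  have r0: "rho (s i) = #0" if "i < n" for i using fun_cong[OF c0, of i] that by(simp add:free_mod_simps)
  have "ALL i. EX y. i < n--> y:$R & s i = t*:y"
  proof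
   fix i show "EX y. i < n--> y:$R & s i = t*:y"
    using rhoD(2)[OF sR[of i]] r0[of i] tR by(cases "i < n") auto
  qed
  then obtain y where y: "!!i. i < n==> y i:$R & s i = t*:y i" by metis
  let ?s = "\<lambda>i\<in>{..<n}. y i"
  have s': "?s:$(free_mod R n)" using y by(auto simp:free_mod_carrier)
  have "t*[Z] (##[Z]i:{..<n}. ?s i*[Z] z i) = 0[Z]"
   using t_sum[OF T(1), of n z ?s s] z y s by simp
  moreover have "(##[Z]i:{..<n}. ?s i*[Z] z i):$Z" using z y by(intro Z.finsum_closed) auto
  ultimately have "(##[Z]i:{..<n}. ?s i*[Z] z i) = 0[Z]" using T(8) by blast
  thus ?thesis using s' y by(intro exI[of _ ?s]) auto
 qed
 have stk: "EX s'. ?rel s' & (ALL i<n. s i = t [^] k*:s' i)" if s: "?rel s" for s and k :: nat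
 proof (induct k)
  case 0 show ?case using s free_mod_nth[of s R n] by(intro exI[of _ s]) auto
 next
  case (Suc k)
  then obtain s1 where s1: "?rel s1" "ALL i<n. s i = t [^] k*:s1 i" by blast
  obtain s2 where s2: "?rel s2" "ALL i<n. s1 i = t*:s2 i" using st[OF s1(1)] by blast
  have "ALL i<n. s i = t [^] Suc k*:s2 i" using s1(2) s2 free_mod_nth[of s2 R n] tR by(simp add:m_assoc)
  thus ?case using s2(1) by blast
 qed
 have "s = 0[free_mod R n]" if s: "?rel s" for s
 proof (rule free_mod_eqI)
  interpret F: mdl R "free_mod R n" by(rule mdl.intro) (rule module_free)
  show "0[free_mod R n]:$(free_mod R n)" by simp
  fix i assume i: "i < n"
  have "s i = #0"
  proof (rule sep)
   show "s i:$R" using s free_mod_nth i by blast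
   show "EX s':$R. s i = t [^] k*:s'" for k :: nat using stk[OF s, of k] i free_mod_nth by blast
  qed
  thus "s i = 0[free_mod R n] i" using i by(simp add:free_mod_simps)
 qed (use s in blast)
 thus ?thesis using gz unfolding basis_def by blast
qed

lemma free_sepm: assumes "Z = (free_mod R n)\<lparr>carrier := U\<rparr>" "U<:$(free_mod R n)" "0[free_mod R n]:U"
 shows "sepm Z" "reg t Z"
proof -
 interpret F: mdl R "free_mod R n" by(rule mdl.intro) (rule module_free)
 have z: "0[free_mod R n]:$(free_mod R n)" by simp
 show "sepm Z" unfolding sepm_def
 proof (intro ballI impI)
  fix s assume s: "s:$Z" and h: "ALL k::nat. EX z':$Z. s = t [^] k*[Z] z'"
  have sc: "s:$(free_mod R n)" using s assms by auto
  have "s = 0[free_mod R n]"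
  proof (rule free_mod_eqI[OF sc z])
   fix i assume i: "i < n"
   have "s i = #0"
   proof (rule sep)
    show "s i:$R" using free_mod_nth[OF sc i] .
    fix k :: nat
    obtain z' where z': "z':$Z" "s = t [^] k*[Z] z'" using h by blast
    hence "s i = t [^] k*:z' i" using assms(1) i by(simp add:free_mod_simps)
    moreover have "z' i:$R" using z' assms(1,2) free_mod_nth[OF _ i] by auto
    ultimately show "EX s':$R. s i = t [^] k*:s'" by blast
   qed
   thus "s i = 0[free_mod R n] i" using i by(simp add:free_mod_simps)
  qed
  thus "s = 0[Z]" using assms(1) by simp
 qed
 show "reg t Z" unfolding reg_def
 proof (intro ballI impI)
  fix s assume s: "s:$Z" and h: "t*[Z] s = 0[Z]"
  have sc: "s:$(free_mod R n)" using s assms by auto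
  have "s = 0[free_mod R n]"
  proof (rule free_mod_eqI[OF sc z])
   fix i assume i: "i < n"
   have "t*:s i = #0" using fun_cong[OF h, of i] assms(1) i by(simp add:free_mod_simps)
   hence "s i = #0" using integral tR t0 free_mod_nth[OF sc i] by blast
   thus "s i = 0[free_mod R n] i" using i by(simp add:free_mod_simps)
  qed
  thus "s = 0[Z]" using assms(1) by simp
 qed
qed

text \<open>Kernels commute with reduction modulo \<open>t\<close> because \<open>Z\<close> has no
  t-torsion. This carries the hypotheses of \<open>pd_lift\<close> one step along the
  resolution.\<close>

lemma tq_ker:
 assumes tq: "tq Z Q q" and z: "!!i. i < n==> z i:$Z & q (z i) = g i"
  and gz: "gens_by R Z n z" and gg: "gens_by RC Q n g"
 shows "tq (ker_syz R Z n z) (ker_syz RC Q n g) (%s. \<lambda>i\<in>{..<n}. rho (s i))" (is "tq ?Z ?Q ?q")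
proof -
 note T = tqD[OF tq]
 interpret Z: mdl R Z using T(1) by rule
 interpret Q: mdl RC Q using T(4) by rule
 have Zm: "module R ?Z" using sesD(4)[OF gens_by_ses[OF T(1) gz]] .
 have Qm: "module RC ?Q" using sesD(4)[OF gens_by_ses[OF T(4) gg]] .
 interpret F: mdl R "free_mod R n" by(rule mdl.intro) (rule module_free)
 interpret FC: mdl RC "free_mod RC n" using cring.module_free[OF sub_cring[OF subC]] by rule
 have gQ: "g i:$Q" if "i < n" for i using gg that by(auto simp:gens_by_def)
 have Zc: "s:$?Z \<longleftrightarrow> s:$(free_mod R n) & (##[Z]i:{..<n}. s i*[Z] z i) = 0[Z]" for s by(simp add:ker_syz_def)
 have Qc: "s:$?Q \<longleftrightarrow> s:$(free_mod RC n) & (##[Q]i:{..<n}. s i*[Q] g i) = 0[Q]" for s by(simp add:ker_syz_def)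
 have ops: "0[?Z] = 0[free_mod R n]" "u+[?Z] v = u+[free_mod R n] v" "a*[?Z] v = a*[free_mod R n] v"
  "0[?Q] = 0[free_mod RC n]" "u+[?Q] v = u+[free_mod RC n] v" "a*[?Q] v = a*[free_mod RC n] v" for u v a
  by(auto simp:ker_syz_def)
 have relq: "(##[Q]i:{..<n}. ?q s i*[Q] g i) = q (##[Z]i:{..<n}. s i*[Z] z i)" if s: "s:$(free_mod R n)" for s
 proof -
  have sR: "s i:$R" if "i < n" for i using s free_mod_nth that by blast
  have "(##[Q]i:{..<n}. ?q s i*[Q] g i) = (##[Q]i:{..<n}. rho (s i)*[Q] g i)"
   by(rule Q.finsum_cong') (use rhoD(1)[OF sR] gQ Q.smult_closed in auto)
  thus ?thesis using pd_rel[where n=n and z=z and s=s, OF tq z sR] by simp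
 qed
 have qin: "?q s:$?Q" if "s:$?Z" for s
  using relq[of s] rho_free[of s n] that lmD(6)[OF T(2)] unfolding Zc Qc by simp
 have l: "lm RC ?Z ?Q ?q"
 proof (rule lmI[OF module_restrict[OF Zm subC] Qm qin])
  fix x y assume xy: "x:$?Z" "y:$?Z"
  hence c: "x:$(free_mod R n)" "y:$(free_mod R n)" using Zc by auto
  show "?q (x+[?Z] y) = ?q x+[?Q] ?q y" unfolding ops
  proof (rule free_mod_eqI[where R=RC and n=n])
   show "?q (x+[free_mod R n] y):$(free_mod RC n)" using rho_free[of "x+[free_mod R n] y" n] c by simp
   show "?q x+[free_mod RC n] ?q y:$(free_mod RC n)" using rho_free c by simp
   fix i assume "i < n" thus "?q (x+[free_mod R n] y) i = (?q x+[free_mod RC n] ?q y) i"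
    using rho_add[OF free_mod_nth[OF c(1)] free_mod_nth[OF c(2)]] by(simp add:free_mod_simps)
  qed
 next
  fix a x assume a': "a:$RC" and x: "x:$?Z"
  hence a: "a:C" "a:$R" and c: "x:$(free_mod R n)" using Zc CR by auto
  show "?q (a*[?Z] x) = a*[?Q] ?q x" unfolding ops
  proof (rule free_mod_eqI[where R=RC and n=n])
   show "?q (a*[free_mod R n] x):$(free_mod RC n)" using rho_free[of "a*[free_mod R n] x" n] c a by simp
   show "a*[free_mod RC n] ?q x:$(free_mod RC n)" using FC.smult_closed[OF a' rho_free[OF c]] .
   fix i assume "i < n" thus "?q (a*[free_mod R n] x) i = (a*[free_mod RC n] ?q x) i"
    using rho_mult[OF a(1) free_mod_nth[OF c]] by(simp add:free_mod_simps)
  qed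
 qed
 have k: "?q s = 0[?Q] \<longleftrightarrow> (EX s':$?Z. s = t*[?Z] s')" if s: "s:$?Z" for s
 proof
  have sc: "s:$(free_mod R n)" using s Zc by blast
  have sR: "s i:$R" if "i < n" for i using sc free_mod_nth that by blast
  assume e: "?q s = 0[?Q]"
  have r0: "rho (s i) = #0" if "i < n" for i using fun_cong[OF e, of i] that unfolding ops by(simp add:free_mod_simps)
  have "ALL i. EX y. i < n--> y:$R & s i = t*:y"
  proof
   fix i show "EX y. i < n--> y:$R & s i = t*:y"
    using rhoD(2)[OF sR[of i]] r0[of i] tR by(cases "i < n") auto
  qed
  then obtain y where y: "!!i. i < n==> y i:$R & s i = t*:y i" by metis
  let ?s = "\<lambda>i\<in>{..<n}. y i"
  have s': "?s:$(free_mod R n)" using y by(auto simp:free_mod_carrier)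
  have "t*[Z] (##[Z]i:{..<n}. ?s i*[Z] z i) = 0[Z]"
   using t_sum[OF T(1), of n z ?s s] z y s Zc by simp
  moreover have "(##[Z]i:{..<n}. ?s i*[Z] z i):$Z" using z y by(intro Z.finsum_closed) auto
  ultimately have "(##[Z]i:{..<n}. ?s i*[Z] z i) = 0[Z]" using T(8) by blast
  hence "?s:$?Z" using s' Zc by blast
  moreover have "s = t*[?Z] ?s" unfolding ops
   by(rule free_mod_eqI[OF sc F.smult_closed[OF tR s']]) (use y in \<open>simp add:free_mod_simps\<close>)
  ultimately show "EX s':$?Z. s = t*[?Z] s'" by blast
 next
  assume "EX s':$?Z. s = t*[?Z] s'"
  then obtain s' where s': "s':$?Z" "s = t*[?Z] s'" by blast
  hence sc': "s':$(free_mod R n)" and sc: "s:$(free_mod R n)" using s Zc by auto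
  have C0: "#0:C" using subringE(2)[OF subC] .
  show "?q s = 0[?Q]" unfolding ops
  proof (rule free_mod_eqI[where R=RC and n=n, OF rho_free[OF sc] FC.zero_closed])
   fix i assume i: "i < n"
   have "s i = #0 +: t*:s' i" using s'(2) i free_mod_nth[OF sc' i] tR unfolding ops by(simp add:free_mod_simps)
   thus "?q s i = 0[free_mod RC n] i" using rho_eq[OF C0 free_mod_nth[OF sc' i]] i by(simp add:free_mod_simps)
  qed
 qed
 have surj: "?q ` $?Z = $?Q"
 proof
  show "?q ` $?Z<:$?Q" using qin by blast
  show "$?Q<:?q ` $?Z"
  proof
   fix c assume c: "c:$?Q"
   hence cc: "c:$(free_mod RC n)" using Qc by blast
   have cC: "c i:C" "c i:$R" if "i < n" for i using free_mod_nth[OF cc that] CR by auto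
   have cR: "c:$(free_mod R n)" using cc CR by(auto simp:free_mod_carrier PiE_iff)
   have rc: "rho (c i) = c i" if "i < n" for i using rho_eq[OF cC(1)[OF that] zero_closed] cC[OF that] tR by simp
   have "?q c = c" by(rule free_mod_eqI[where R=RC and n=n, OF rho_free[OF cR] cc]) (use rc in simp)
   hence "q (##[Z]i:{..<n}. c i*[Z] z i) = 0[Q]" using relq[OF cR] c Qc by simp
   moreover have wc: "(##[Z]i:{..<n}. c i*[Z] z i):$Z" using z cC by(intro Z.finsum_closed) auto
   ultimately obtain z' where z': "z':$Z" "(##[Z]i:{..<n}. c i*[Z] z i) = t*[Z] z'" using T(6) by blast
   obtain s where s: "s:$(free_mod R n)" "(##[Z]i:{..<n}. s i*[Z] z i) = z'"
    using sesD(8)[OF gens_by_ses[OF T(1) gz] z'(1)] by blast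
   note L = sesD(2)[OF gens_by_ses[OF T(1) gz]]
   \<comment> \<open>A relation \<open>c\<close> over \<open>C\<close> holds over \<open>R\<close>
     only up to a multiple t z'. Writing z' as a combination with coefficients \<open>s\<close> and
     subtracting t s makes it exact without changing constant terms.\<close>
   let ?s = "c-[free_mod R n] t*[free_mod R n] s"
   have ts: "t*[free_mod R n] s:$(free_mod R n)" using s tR by simp
   have sc: "?s:$(free_mod R n)" using cR ts by simp
   have "(##[Z]i:{..<n}. ?s i*[Z] z i) = 0[Z]"
    using lmD(8)[OF L cR ts] lmD(5)[OF L tR s(1)] s(2) z' wc tR by(simp add:Z.diff_self)
   hence sZ: "?s:$?Z" using sc Zc by blast
   have "?q ?s = c"
   proof (rule free_mod_eqI[where R=RC and n=n, OF rho_free[OF sc] cc])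
    fix i assume i: "i < n"
    have "?s+[free_mod R n] t*[free_mod R n] s = c" using F.add_diff_cancel[OF cR ts] .
    hence "?s i +: t*:s i = c i" using i by(metis free_mod_simps(1,2))
    moreover have si: "s i:$R" "?s i:$R" using free_mod_nth[OF s(1) i] free_mod_nth[OF sc i] by auto
    ultimately have "?s i = c i -: t*:s i" using tR by(metis diff_add_cancel m_closed)
    hence "?s i = c i +: t*:(\<ominus> s i)" using si tR by(simp add:a_minus_def r_minus)
    thus "?q ?s i = c i" using rho_eq[OF cC(1)[OF i], of "\<ominus> s i"] si i by simp
   qed
   thus "c:?q ` $?Z" using sZ by(metis image_eqI)
  qed
 qed
 have U: "?Z = (free_mod R n)\<lparr>carrier := $?Z\<rparr>" "$?Z<:$(free_mod R n)" "0[free_mod R n]:$?Z"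
  using module.axioms(2)[OF Zm] abelian_monoid.zero_closed[OF abelian_group.axioms(1)[OF module.axioms(2)[OF Zm]]]
  by(auto simp:ker_syz_def)
 show ?thesis unfolding tq_def using Zm l surj k free_sepm[OF U] by blast
qed

lemma pd_lift: "pdf RC i Q==> tq Z Q q==> pdf R i Z"
proof (induct i arbitrary: Z Q q)
 case 0
 then obtain n g where b: "basis RC Q n g" by auto
 hence gg: "gens_by RC Q n g" by(simp add:basis_def)
 obtain z where z: "gens_by R Z n z" "ALL i<n. z i:$Z & q (z i) = g i" using pd_gens[OF 0(2) gg] by blast
 have "basis R Z n z" using pd_basis[OF 0(2) b _ z(1)] z(2) by blast
 thus ?case using tqD(1)[OF 0(2)] by auto
next
 case (Suc i)
 then obtain n g where g: "gens_by RC Q n g" "pdf RC i (ker_syz RC Q n g)" by auto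
 obtain z where z: "gens_by R Z n z" "ALL i<n. z i:$Z & q (z i) = g i" using pd_gens[OF Suc(3) g(1)] by blast
 have "tq (ker_syz R Z n z) (ker_syz RC Q n g) (%s. \<lambda>i\<in>{..<n}. rho (s i))" using tq_ker[OF Suc(3) _ z(1) g(1)] z(2) by blast
 hence "pdf R i (ker_syz R Z n z)" using Suc(1)[OF g(2)] by blast
 thus ?case using z(1) tqD(1)[OF Suc(3)] by auto
qed

text \<open>The kernel of a free cover of \<open>M\<close> lies in a free module, hence has no
  t-torsion and is t-separated. Its reduction modulo \<open>t\<close> is a module over
  \<open>C\<close>, whose resolution lifts; the cover itself adds one to the length.\<close>

lemma gd_step:
 assumes N: "noetherian_ring RC" and gd: "!!M :: 'a umod. fin_gen RC M==> pdf RC i M" and M: "fin_gen R (M :: 'a umod)"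
 shows "pdf R (Suc i) M"
proof -
 obtain n g where g: "gens_by R M n g" "module R M" using M by(auto simp:fin_gen_def)
 let ?Z = "ker_syz R M n g"
 note s = gens_by_ses[OF g(2,1)]
 have Zm: "module R ?Z" using sesD(4)[OF s] .
 interpret Z: mdl R ?Z using Zm by rule
 have Zf: "fin_gen R ?Z" using fin_gen_kernel[OF noeth_pser[OF N] s free_fin_gen] .
 obtain Q q where Q: "quo t ?Z Q q" using ex_quo[OF Zm tR] by blast
 note D = quoD[OF Q]
 have lC: "lm RC ?Z Q q" using lm_restrict[OF D(1) subC] .
 have "sepm ?Z" "reg t ?Z" using free_sepm[of ?Z "$?Z" n] Z.zero_closed by(auto simp:ker_syz_def)
 hence tq: "tq ?Z Q q" unfolding tq_def using Zm lC D(2) Q by(auto simp:quo_def)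
 note T = tqD[OF tq]
 interpret Qm: mdl RC Q using T(4) by rule
 obtain V where V: "finite V" "V<:$?Z" "$?Z<:spn R ?Z V" using Zf Z.fin_gen_iff by blast
 have qV: "q ` V<:$Q" using V lmD(3)[OF lC] by blast
 \<comment> \<open>Finite generation of \<open>Q\<close> must be shown over \<open>C\<close>, not
   over \<open>R\<close>. A scalar of \<open>R\<close> acts on \<open>Q\<close> through its constant
   term, so the same generators suffice.\<close>
 let ?T = "{z:$?Z. q z:spn RC Q (q ` V)}"
 have "sm R ?Z ?T" unfolding sm_def
 proof (intro conjI ballI)
  show "0[?Z]:?T" using Z.zero_closed lmD(6)[OF lC] spn.zero[of Q RC "q ` V"] by simp
  fix x assume x: "x:?T"
  show "x+[?Z] y:?T" if "y:?T" for y using x that lmD(4)[OF lC] Qm.spn_add[OF qV] by simp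
  show "a*[?Z] x:?T" if "a:$R" for a
   using x that T(10)[of a x] Qm.spn_smult[OF qV, of "rho a" "q x"] rhoD(1) by simp
 qed auto
 moreover have "V<:?T" using V(2) Qm.spn_incl[OF qV] by blast
 ultimately have "spn R ?Z V<:?T" by(rule Z.spn_least)
 hence VT: "$?Z<:?T" using V(3) by(rule order_trans[rotated])
 have "$Q<:spn RC Q (q ` V)"
 proof
  fix y assume "y:$Q"
  then obtain z where "z:$?Z" "y = q z" using T(3) by(metis imageE)
  thus "y:spn RC Q (q ` V)" using subsetD[OF VT] by simp
 qed
 hence "fin_gen RC Q" using Qm.fin_gen_iff V(1) qV by blast
 hence "pdf R i ?Z" using pd_lift[OF gd tq] by blast
 thus ?thesis using g by auto
qed

end

text \<open>A generating family of least length is a basis: in a nontrivial relation some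
  coefficient is invertible, so that generator could be dropped.\<close>

lemma (in cring) field_pdf:
 assumes inv: "!!a. a:$R==> a ~= #0==> EX b:$R. b*:a = #1" and N: "fin_gen R (N :: 'a umod)"
 shows "pdf R 0 N"
proof -
 have Nm: "module R N" using N by(simp add:fin_gen_def)
 interpret N: mdl R N using Nm by rule
 define n where "n = (LEAST n. EX g. gens_by R N n g)"
 obtain g where g: "gens_by R N n g" unfolding n_def using N LeastI_ex[of "%n. EX g. gens_by R N n g"] by(auto simp:fin_gen_def)
 have gN: "g i:$N" if "i < n" for i using g that by(auto simp:gens_by_def)
 have "c = 0[free_mod R n]" if c: "c:$(free_mod R n)" "(##[N]i:{..<n}. c i*[N] g i) = 0[N]" for c
 proof (rule ccontr)
  assume ne: "c ~= 0[free_mod R n]"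
  interpret F: mdl R "free_mod R n" by(rule mdl.intro) (rule module_free)
  obtain k where k: "k < n" "c k ~= #0" using ne free_mod_eqI[OF c(1) F.zero_closed] by(auto simp:free_mod_simps)
  have cR: "c i:$R" if "i < n" for i using free_mod_nth[OF c(1) that] .
  obtain b where b: "b:$R" "b*:c k = #1" using inv[OF cR[OF k(1)] k(2)] by blast
  let ?I = "{..<n} - {k}"
  let ?V = "g ` ?I"
  have V: "?V<:$N" using gN by auto
  have eq: "{..<n} = insert k ?I" using k by auto
  let ?w = "##[N]i:?I. c i*[N] g i"
  have "(##[N]i:insert k ?I. c i*[N] g i) = c k*[N] g k+[N] ?w"
   by(rule N.finsum_insert) (use cR gN k in auto)
  hence s: "c k*[N] g k+[N] ?w = 0[N]" using c(2) eq by simp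
  have ws: "?w:spn R N ?V"
   by(rule N.sm_finsum[OF N.spn_sm[OF V]]) (use cR N.spn_smult[OF V] N.spn_incl[OF V] in auto)
  have wc: "?w:$N" using N.spn_closed[OF V ws] .
  have "c k*[N] g k = \<ominus>\<^bsub>N\<^esub> ?w" using s wc cR[OF k(1)] gN[OF k(1)] by(metis N.minus_equality N.smult_closed)
  hence "c k*[N] g k:spn R N ?V" using N.smD(5)[OF N.spn_sm[OF V] ws] by simp
  hence "b*[N] (c k*[N] g k):spn R N ?V" using N.spn_smult[OF V b(1)] by blast
  moreover have "b*[N] (c k*[N] g k) = g k" using b cR[OF k(1)] gN[OF k(1)] by(simp add:N.smult_assoc1[symmetric])
  ultimately have gk: "g k:spn R N ?V" by simp
  have "g ` {..<n}<:spn R N ?V" using gk N.spn_incl[OF V] eq by blast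
  hence "spn R N (g ` {..<n})<:spn R N ?V" using N.spn_least[OF N.spn_sm[OF V]] by blast
  hence cV: "$N<:spn R N ?V" using g N.gens_by_iff by blast
  obtain n' :: nat and h where h: "?V = h ` {i. i < n'}" "inj_on h {i. i < n'}" using finite_imp_nat_seg_image_inj_on[of ?V] by auto
  have "n' = card ?V" using h card_image[OF h(2)] by simp
  also have "... <= card ?I" by(rule card_image_le) simp
  also have "... < n" using k by simp
  finally have "n' < n" .
  moreover have "gens_by R N n' h" using N.gens_by_iff[of n' h] cV V h(1) by(auto simp:lessThan_def)
  ultimately show False using not_less_Least[of n' "%n. EX g. gens_by R N n g"] unfolding n_def by blast
 qed
 hence "basis R N n g" using g by(simp add:basis_def)
 thus ?thesis using Nm by auto
qed

section \<open>Separatedness and power series subrings\<close>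

lemma (in noetherian_ring) noeth_stab:
 fixes J :: "nat=> 'a set"
 assumes "!!n. ideal (J n) R" "!!n. J n<:J (Suc n)"
 shows "EX n. ALL k>=n. J k = J n"
proof -
 have mono: "i <= j==> J i<:J j" for i j using lift_Suc_mono_le[of J, OF assms(2)] .
 have "subset.chain {I. ideal I R} (range J)" unfolding subset_chain_def
 proof (intro conjI ballI)
  fix U V assume "U:range J" "V:range J"
  then obtain i j where "U = J i" "V = J j" by blast
  thus "U<:V | V<:U" using mono[of i j] mono[of j i] nat_le_linear[of i j] by blast
 qed (use assms(1) in blast)
 hence "\<Union>(range J):range J" using ideal_chain_is_trivial by blast
 then obtain n where "\<Union>(range J) = J n" by blast
 thus ?thesis using mono by blast
qed

context noeth_local begin

lemma m_ideal: "ideal m R" using maxi by(rule maximalideal.axioms(1))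

lemma mR: "x:m==> x:$R" using ideal.Icarr[OF m_ideal] .

lemma unit_one_minus:
 assumes "x:m" shows "EX v:$R. v*:(#1 -: x) = #1" "#1 +: x~:m"
proof -
 interpret m: ideal m R by(rule m_ideal)
 have 1: "#1~:m" using m.one_imp_carrier maximalideal.I_notcarr[OF maxi] by blast
 have "#1 -: x~:m"
 proof
  assume "#1 -: x:m"
  hence "(#1 -: x) +: x:m" using assms by simp
  thus False using 1 mR[OF assms] by(simp add:add_diff_cancel)
 qed
 thus "EX v:$R. v*:(#1 -: x) = #1" using unit_outside[of "#1 -: x"] mR[OF assms] by(auto simp:Units_def)
 show "#1 +: x~:m"
 proof
  assume "#1 +: x:m"
  hence "(#1 +: x) -: x:m" using assms by(simp add:a_minus_def)
  thus False using 1 mR[OF assms] by(simp add:diff_add_cancel)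
 qed
qed

text \<open>Krull intersection by two ascending chains instead of Artin-Rees. The colon ideals (I :
  t^k) become stationary at some J; then the ideals generated by J and the cofactors b n of t^n
  become stationary too.\<close>

lemma krull:
 assumes I: "ideal I R" and t: "t:m" and a: "a:$R"
  and dec: "!!n::nat. EX u:I. EX r:$R. a = u +: t [^] n*:r"
 shows "a:I"
proof -
 interpret I: ideal I R by fact
 note [simp] = mR[OF t]
 define Q where "Q k = {x:$R. t [^] k*:x:I}" for k :: nat
 have Qi: "ideal (Q k) R" for k
 proof (rule ideal_intro)
  fix x assume x: "x:Q k"
  show "x +: y:Q k" if "y:Q k" for y using x that by(simp add:Q_def r_distr)
  show "c*:x:Q k" if "c:$R" for c
   using x that I.I_l_closed[of "t [^] k*:x" c] by(simp add:Q_def m_lcomm)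
 qed (auto simp:Q_def)
 have QS: "Q k<:Q (Suc k)" for k
 proof
  fix x assume x: "x:Q k"
  have "t [^] Suc k*:x = t*:(t [^] k*:x)" using x by(simp add:Q_def m_ac)
  thus "x:Q (Suc k)" using x I.I_l_closed[of "t [^] k*:x" t] by(simp add:Q_def)
 qed
 obtain k where k: "ALL j>=k. Q j = Q k" using noeth_stab[of Q] Qi QS by blast
 let ?J = "Q k"
 have IJ: "I<:?J"
 proof
  fix x assume x: "x:I"
  hence "t [^] k*:x:I" by(rule I.I_l_closed) (rule nat_pow_closed[OF mR[OF t]])
  thus "x:?J" unfolding Q_def using I.Icarr[OF x] by(intro CollectI conjI)
 qed
 have sat: "x:?J" if "x:$R" "t [^] n*:x:?J" for x and n :: nat
 proof -
  have "t [^] k*:(t [^] n*:x):I" using that(2) unfolding Q_def by blast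
  moreover have "t [^] k*:(t [^] n*:x) = t [^] (k + n)*:x" using that(1) by(simp add:nat_pow_mult[symmetric] m_assoc)
  ultimately have "t [^] (k + n)*:x:I" by simp
  hence "x:Q (k + n)" using that by(simp add:Q_def)
  thus ?thesis using k by(metis le_add1)
 qed
 interpret J: ideal ?J R by(rule Qi)
 obtain u b where ub: "!!n::nat. u n:I" "!!n::nat. b n:$R" "!!n::nat. a = u n +: t [^] n*:b n"
  using dec by metis
 have uR: "u n:$R" for n using ub I.Icarr by blast
 have step: "b n -: t*:b (Suc n):?J" for n
 proof (rule sat[of _ n])
  have e: "u n +: t [^] n*:b n = u (Suc n) +: t [^] Suc n*:b (Suc n)" using ub(3) by metis
  have "t [^] n*:(b n -: t*:b (Suc n)) = t [^] n*:b n -: t [^] Suc n*:b (Suc n)"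
   using ub(2) by(simp add:a_minus_def r_distr r_minus m_assoc)
  also have "... = ((u n +: t [^] n*:b n) -: t [^] Suc n*:b (Suc n)) -: u n"
   using ub(2) uR by(simp add:a_minus_def) (simp add:a_ac r_neg1 r_neg2)
  also have "... = u (Suc n) -: u n" unfolding e using ub(2) uR by(simp add:diff_add_cancel)
  also have "... : ?J" using ub(1) IJ J.a_closed J.a_inv_closed unfolding a_minus_def by blast
  finally show "t [^] n*:(b n -: t*:b (Suc n)):?J" .
 qed (use ub in auto)
 \<comment> \<open>Modulo J, b n equals t * b (n + 1), so these ideals ascend. Once they are
   stationary, b (n + 1) is a multiple of b n, hence of t * b (n + 1), modulo J; since
   \<open>1 - t r\<close> is a unit, b (n + 1) lies in J.\<close>
 obtain n where n: "ALL i>=n. idadd ?J (b i) = idadd ?J (b n)"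
 proof -
  have "idadd ?J (b i)<:idadd ?J (b (Suc i))" for i
  proof (rule idadd(4)[OF Qi ub(2) idadd(1,2)[OF Qi ub(2)]])
   have "b i = (b i -: t*:b (Suc i)) +: b (Suc i)*:t" using ub(2) by(simp add:add_diff_cancel m_comm)
   thus "b i:idadd ?J (b (Suc i))" unfolding idadd_def using step[of i] mR[OF t] by blast
  qed
  thus ?thesis using noeth_stab[of "%i. idadd ?J (b i)"] idadd(1)[OF Qi ub(2)] that by blast
 qed
 have "b (Suc n):idadd ?J (b n)" using n idadd(3)[OF Qi ub(2)[of "Suc n"]] by(metis le_Suc_eq order_refl)
 then obtain j r where j: "j:?J" "r:$R" "b (Suc n) = j +: b n*:r" by(auto simp:idadd_def)
 define w where "w = b n -: t*:b (Suc n)"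
 define B where "B = b (Suc n)"
 have c: "w:$R" "B:$R" "j:$R" "t:$R"
  using ub(2) mR[OF t] J.Icarr[OF j(1)] by(simp_all add:w_def B_def)
 have bn: "b n = w +: t*:B" unfolding w_def B_def by(rule add_diff_cancel[symmetric]) (use ub(2) c(4) in auto)
 have "B = j +: (w +: t*:B)*:r" using j(3) unfolding bn B_def[symmetric] .
 also have "... = (j +: w*:r) +: B*:(t*:r)" using c j(2) by(simp add:l_distr a_assoc, simp add:m_ac)
 finally have "B = (j +: w*:r) +: B*:(t*:r)" .
 from arg_cong[OF this, of "%z. z -: B*:(t*:r)"]
 have e: "B -: B*:(t*:r) = j +: w*:r" by(rule trans[OF _ diff_add_cancel]) (use c j(2) in auto)
 have "w:?J" using step[of n] by(simp add:w_def)
 hence jw: "j +: w*:r:?J" using j(1) J.I_r_closed[of w r] j(2) by simp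
 have "t*:r:m" using ideal.I_r_closed[OF m_ideal t j(2)] .
 then obtain v where v: "v:$R" "v*:(#1 -: t*:r) = #1" using unit_one_minus(1) by blast
 have "B = (v*:(#1 -: t*:r))*:B" unfolding v(2) using c(2) by simp
 also have "... = v*:(B -: B*:(t*:r))" using v(1) c j(2) by(simp add:a_minus_def l_distr r_distr r_minus l_minus m_ac)
 also have "... : ?J" unfolding e using J.I_l_closed[OF jw v(1)] .
 finally have "b (Suc n):?J" unfolding B_def .
 hence "t [^] Suc n*:b (Suc n):?J" using J.I_l_closed nat_pow_closed[OF c(4)] by blast
 hence "u (Suc n) +: t [^] Suc n*:b (Suc n):?J" using ub(1)[of "Suc n"] IJ by(intro J.a_closed) auto
 hence "a:?J" unfolding ub(3)[of "Suc n", symmetric] .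
 moreover have "u k:?J" using ub(1) IJ by blast
 moreover have "t [^] k*:b k = a -: u k"
 proof -
  have "a = t [^] k*:b k +: u k" using ub(2,3)[of k] uR[of k] c(4) by(simp add:a_comm)
  thus ?thesis using diff_add_cancel[of "t [^] k*:b k" "u k"] ub(2)[of k] uR[of k] c(4) by simp
 qed
 ultimately have "t [^] k*:b k:?J" by(simp add:a_minus_def)
 hence "b k:?J" using sat ub(2) by blast
 hence "t [^] k*:b k:I" unfolding Q_def by blast
 hence "u k +: t [^] k*:b k:I" using ub(1)[of k] by(intro I.a_closed)
 thus ?thesis unfolding ub(3)[of k, symmetric] .
qed

end

section \<open>Complete local domains and their subrings of power series\<close>

lemma (in ring) subring_sub: "subring C R==> subring S R==> C<:S==> subring C (R@:S)"
proof -
 assume a: "subring C R" "subring S R" "C<:S"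
 interpret S: ring "R@:S" using subring_is_ring[OF a(2)] .
 show ?thesis using S.subring_iff[of C] subring_is_ring[OF a(1)] a(3) by simp
qed

text \<open>Completeness enters only as summability of series in a single element of
  \<open>m\<close>, in the form of \<open>pser\<close>. This form passes to R / P by lifting
  coefficients, and it is all that building a tower one variable at a time requires.\<close>

locale cdom = noeth_local R m + domain R for R (structure) and m + fixes K
 assumes subK: "subring K R"
  and invK: "k:K==> k ~= #0==> EX k':K. k'*:k = #1"
  and decK: "r:$R==> EX k:K. EX u:m. r = k +: u"
  and perf: "Factorial_Ring.prime p==> [p] \<cdot> #1 = #0==> a:K==> EX b:K. b [^] (p::nat) = a"
  and lim: "t:m==> (!!n::nat. cs n:$R)==> EX a. ALL n. a n:$R & a n = cs n +: t*:a (Suc n)"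
begin

text \<open>The image of C[[t]] in \<open>R\<close> as a greatest fixed point: the largest
  \<open>V\<close> contained in \<open>C + t V\<close>. Membership is shown by exhibiting an
  invariant set, as in \<open>psx_coind\<close>.\<close>

definition psx :: "'a set=> 'a=> 'a set" where
 "psx C t = \<Union>{V. V<:$R & (ALL x:V. EX c:C. EX y:V. x = c +: t*:y)}"

lemma psx_coind: "V<:$R==> (!!x. x:V==> EX c:C. EX y:V. x = c +: t*:y)==> V<:psx C t"
 unfolding psx_def by(intro Union_upper CollectI conjI ballI)

lemma psx_R: "x:psx C t==> x:$R"
 unfolding psx_def by blast

lemma psx_unfold: "x:psx C t==> EX c:C. EX y:psx C t. x = c +: t*:y"
proof -
 assume "x:psx C t"
 then obtain V where V: "V<:$R" "ALL x:V. EX c:C. EX y:V. x = c +: t*:y" "x:V"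
  unfolding psx_def by(elim UnionE CollectE conjE) (rule that)
 then obtain c y where "c:C" "y:V" "x = c +: t*:y" by blast
 moreover have "V<:psx C t" using psx_coind[of V C t] V by blast
 ultimately show ?thesis by blast
qed

context fixes C t assumes C: "subring C R" and t: "t:m"
begin

lemma psx_intro: assumes "c:C" "y:psx C t" shows "c +: t*:y:psx C t"
proof -
 have "insert (c +: t*:y) (psx C t)<:psx C t"
 proof (rule psx_coind)
  show "insert (c +: t*:y) (psx C t)<:$R" using assms psx_R[of _ C t] subringE(1)[OF C] mR[OF t] by auto
  fix x assume x: "x:insert (c +: t*:y) (psx C t)"
  show "EX c':C. EX y':insert (c +: t*:y) (psx C t). x = c' +: t*:y'"
  proof (cases "x = c +: t*:y")
   case True
   show ?thesis by(rule bexI[of _ c], rule bexI[of _ y], rule True, rule insertI2, rule assms(2), rule assms(1))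
  next
   case False
   hence "x:psx C t" using x by simp
   from psx_unfold[OF this] show ?thesis by blast
  qed
 qed
 thus ?thesis by blast
qed

lemma psx_C: "C<:psx C t"
proof (rule psx_coind)
 show "EX c:C. EX y:C. x = c +: t*:y" if "x:C" for x
  using that subringE(1,2)[OF C] mR[OF t] by(intro bexI[of _ x] bexI[of _ "#0"]) auto
qed (use subringE(1)[OF C] in blast)

lemma psx_t: "t:psx C t"
 using psx_intro[OF subringE(2)[OF C], of \<one>] psx_C subringE(3)[OF C] mR[OF t] by auto

lemma psx_subring: "subring (psx C t) R"
proof -
 let ?S = "psx C t"
 note [simp] = mR[OF t]
 have CR: "c:$R" if "c:C" for c using that subringE(1)[OF C] by blast
 note SR = psx_R[of _ C t]
 have add:"x +: y:?S" if xy: "x:?S" "y:?S" for x y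
 proof -
  have "{x +: y | x y. x:?S & y:?S}<:?S"
  proof (rule psx_coind)
   fix z assume "z:{x +: y | x y. x:?S & y:?S}"
   then obtain x y where z: "z = x +: y" "x:?S" "y:?S" by blast
   obtain c x' where x: "c:C" "x':?S" "x = c +: t*:x'" using psx_unfold[OF z(2)] by blast
   obtain e y' where y: "e:C" "y':?S" "y = e +: t*:y'" using psx_unfold[OF z(3)] by blast
   have "z = (c +: e) +: t*:(x' +: y')" using x y z CR SR by(simp add:r_distr a_ac)
   thus "EX c:C. EX y:{x +: y | x y. x:?S & y:?S}. z = c +: t*:y"
    using x(2) y(2) subringE(7)[OF C x(1) y(1)] by blast
  qed (use SR in auto)
  thus ?thesis using xy by blast
 qed
 have Cm: "c*:y:?S" if xy: "c:C" "y:?S" for c y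
 proof -
  have "{c*:y | y. y:?S}<:?S"
  proof (rule psx_coind)
   fix z assume "z:{c*:y | y. y:?S}"
   then obtain y where z: "z = c*:y" "y:?S" by blast
   obtain e y' where y: "e:C" "y':?S" "y = e +: t*:y'" using psx_unfold[OF z(2)] by blast
   have "z = c*:e +: t*:(c*:y')" using y z CR SR xy(1) by(simp add:r_distr m_lcomm)
   thus "EX e:C. EX y:{c*:y | y. y:?S}. z = e +: t*:y" using y(2) subringE(6)[OF C xy(1) y(1)] by blast
  qed (use SR CR xy in auto)
  thus ?thesis using xy by blast
 qed
 show ?thesis
 proof (rule subringI)
  show "?S<:$R" using SR by blast
  show "#1:?S" using psx_C subringE(3)[OF C] by blast
  show "\<ominus> x:?S" if "x:?S" for x
   using Cm[of "\<ominus> #1" x] that SR[OF that] subringE(3,5)[OF C] by(simp add:l_minus)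
  show "x +: y:?S" if "x:?S" "y:?S" for x y using add that by blast
  show "x*:y:?S" if xy: "x:?S" "y:?S" for x y
  proof -
   \<comment> \<open>Products alone are not invariant: multiplying out (c + t x') y leaves c y,
     whose own tail has to be carried along. The summand \<open>w\<close> absorbs it.\<close>
   let ?V = "{x*:y +: w | x w. x:?S & w:?S}"
   have yR: "y:$R" using SR[OF xy(2)] .
   have "?V<:?S"
   proof (rule psx_coind)
    fix z assume "z:?V"
    then obtain x w where z: "z = x*:y +: w" "x:?S" "w:?S" by blast
    obtain c x' where x: "c:C" "x':?S" "x = c +: t*:x'" using psx_unfold[OF z(2)] by blast
    obtain f z' where f: "f:C" "z':?S" "c*:y +: w = f +: t*:z'" using psx_unfold[OF add[OF Cm[OF x(1) xy(2)] z(3)]] by blast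
    have "z = (c*:y +: w) +: t*:(x'*:y)" using x z CR SR yR by(simp add:l_distr m_assoc a_ac)
    also have "... = f +: t*:(x'*:y +: z')" unfolding f(3) using f(1,2) x(2) CR SR yR by(simp add:r_distr a_ac)
    finally show "EX c:C. EX y:?V. z = c +: t*:y" using f(1,2) x(2) by blast
   qed (use SR yR in auto)
   moreover have "x*:y = x*:y +: #0" "#0:?S" using SR xy psx_C subringE(2)[OF C] by auto
   ultimately show ?thesis using xy(1) by blast
  qed
 qed
qed

text \<open>The ideal \<open>P\<close> certifies that constant terms are unique: it contains
  \<open>t\<close> but meets \<open>C\<close> only in 0. Separatedness comes from
  \<open>krull\<close>.\<close>

lemma psx_pser:
 assumes t0: "t ~= #0" and triv: "!!c. c:C==> c:P==> c = #0" and P: "ideal P R" "t:P"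
 shows "pser (R@:(psx C t)) C t"
proof (intro pser.intro pser_axioms.intro)
 let ?S = "psx C t"
 show "domain (R@:?S)" using subring_is_domain[OF psx_subring] .
 show "subring C (R@:?S)" using subring_sub[OF C psx_subring psx_C] .
 show "c = 0[R@:?S]" if "c:C" "s:$(R@:?S)" "c = t \<otimes>\<^bsub>R@:?S\<^esub> s" for c s
  using triv[OF that(1)] ideal.I_r_closed[OF P, of s] that psx_R[of s C t] by simp
 show "s = 0[R@:?S]" if s: "s:$(R@:?S)"
  and d: "!!n::nat. EX s':$(R@:?S). s = t [^]\<^bsub>R@:?S\<^esub> n \<otimes>\<^bsub>R@:?S\<^esub> s'" for s
 proof -
  have "s:{ #0}"
  proof (rule krull[OF zeroideal t])
   fix n :: nat
   obtain s' where "s':?S" "s = t [^] n*:s'" using d[of n] by(auto simp:nat_pow_consistent[symmetric])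
   thus "EX u:{ #0}. EX r:$R. s = u +: t [^] n*:r" using psx_R[of s' C t] mR[OF t] by auto
  qed (use s psx_R in auto)
  thus ?thesis by simp
 qed
 show "EX a. ALL n. a n:$(R@:?S) & a n = cs n+[R@:?S] t \<otimes>\<^bsub>R@:?S\<^esub> a (Suc n)"
  if cs: "!!n::nat. cs n:C" for cs
 proof -
  have "cs n:$R" for n using cs subringE(1)[OF C] by blast
  from lim[where cs=cs, OF t this] obtain a where a: "ALL n. a n:$R & a n = cs n +: t*:a (Suc n)"
   by(elim exE) (erule that)
  have aR: "a n:$R" and ae: "a n = cs n +: t*:a (Suc n)" for n using spec[OF a, of n] by(rule conjunct1, rule conjunct2)
  \<comment> \<open>The set of all tails is invariant, so the sums stay in the subring.\<close>
  have "range a<:?S"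
  proof (rule psx_coind)
   show "range a<:$R" using aR by blast
   fix x assume "x:range a"
   then obtain n where n: "x = a n" by blast
   show "EX c:C. EX y:range a. x = c +: t*:y" unfolding n
    by(rule bexI[of _ "cs n"], rule bexI[of _ "a (Suc n)"], rule ae, rule rangeI, rule cs)
  qed
  hence aS: "a n:?S" for n by blast
  show ?thesis
  proof (intro exI allI conjI)
   show "a n:$(R@:?S)" for n using aS by simp
   show "a n = cs n+[R@:?S] t \<otimes>\<^bsub>R@:?S\<^esub> a (Suc n)" for n by(rule trans[OF ae[of n]]) simp
  qed
 qed
 show "EX c:C. EX s':$(R@:?S). s = c+[R@:?S] t \<otimes>\<^bsub>R@:?S\<^esub> s'" if "s:$(R@:?S)" for s
  using psx_unfold[of s C t] that by simp
 show "t:$(R@:?S)" "t ~= 0[R@:?S]" using t0 psx_t by auto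
qed

end

end

section \<open>Noether normalization\<close>

lemma selfm_minus [simp]: "x-[selfm R] y = x-[R] y"
 by(simp add:a_minus_def a_inv_def m_inv_def selfm_def)

context cdom begin

lemma K_m: assumes "k:K" "k:m" shows "k = #0"
proof (rule ccontr)
 assume "k ~= #0"
 then obtain k' where k': "k':K" "k'*:k = #1" using invK assms by blast
 hence "#1:m" using ideal.I_l_closed[OF m_ideal assms(2), of k'] subringE(1)[OF subK] by auto
 thus False using ideal.one_imp_carrier[OF m_ideal] maximalideal.I_notcarr[OF maxi] by blast
qed

lemma noeth_K: "noetherian_ring (R@:K)"
proof -
 interpret RK: cring "R@:K" using sub_cring[OF subK] .
 show ?thesis
 proof (rule RK.noetherian_ringI)
  fix J assume J: "ideal J (R@:K)"
  interpret J: ideal J "R@:K" by fact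
  show "\<exists>A\<subseteq>$(R@:K). finite A & J = genideal (R@:K) A"
  proof (cases "J = { #0}")
   case True
   have "genideal (R@:K) { #0} = J"
    using RK.genideal_minimal[OF J, of "{ #0}"] RK.genideal_self[of "{ #0}"] True subringE(2)[OF subK] by auto
   thus ?thesis using subringE(2)[OF subK] by(intro exI[of _ "{ #0}"]) auto
  next
   case False
   then obtain k where k: "k:J" "k ~= #0" using J.zero_closed by auto
   then obtain k' where k': "k':K" "k'*:k = #1" using invK J.Icarr by auto
   hence "#1:J" using J.I_l_closed[OF k(1), of k'] by simp
   hence "J = K" using J.one_imp_carrier by simp
   moreover have "genideal (R@:K) K = K"
    using RK.genideal_minimal[OF J, of K] RK.genideal_self[of K] \<open>J = K\<close> by auto
   moreover have "genideal (R@:K) { #1} = K"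
   proof -
    have i: "ideal (genideal (R@:K) { #1}) (R@:K)" using RK.genideal_ideal[of "{ #1}"] subringE(3)[OF subK] by simp
    show ?thesis using ideal.one_imp_carrier[OF i] RK.genideal_self[of "{ #1}"] subringE(3)[OF subK] by simp
   qed
   ultimately show ?thesis using subringE(3)[OF subK] by(intro exI[of _ "{ #1}"]) auto
  qed
 qed
qed

text \<open>\<open>K[[y 0, ..., y (j - 1)]]\<close> as a subring of \<open>R\<close>.\<close>

primrec tw :: "(nat=> 'a)=> nat=> 'a set" where
 "tw y 0 = K"
| "tw y (Suc j) = psx (tw y j) (y j)"

text \<open>Parameters adapted to a chain of primes descending from \<open>m\<close> to 0. That
  \<open>y j\<close> separates neighbouring primes forces analytic independence; the last clause
  makes the parameters generate an m-primary ideal.\<close>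

definition sysp :: "nat=> (nat=> 'a set)=> (nat=> 'a)=> bool" where
 "sysp d P y \<longleftrightarrow> P 0 = m & P d = { #0} & (ALL j<=d. primeideal (P j) R) &
(ALL j<d. P (Suc j)<:P j & y j:P j & y j~:P (Suc j)) & (ALL Q. primeideal Q R--> y ` {..<d}<:Q--> Q = m)"

context fixes d P y assumes sys: "sysp d P y"
begin

lemma Pm: "j <= d==> P j<:m"
proof (induct j)
 case (Suc j) thus ?case using sys unfolding sysp_def by(metis Suc_leD Suc_le_lessD subset_trans)
qed (use sys in \<open>simp add:sysp_def\<close>)

lemma ym: "j < d==> y j:m" "j < d==> y j ~= #0"
proof -
 assume j: "j < d"
 show "y j:m" using sys Pm[of j] j by(auto simp:sysp_def)
 have "ideal (P (Suc j)) R" using sys j by(auto simp:sysp_def primeideal_def)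
 thus "y j ~= #0" using sys j additive_subgroup.zero_closed[OF ideal.axioms(1)] unfolding sysp_def by metis
qed

text \<open>The crux is that \<open>tw y j\<close> meets \<open>P j\<close> only in 0. If c + t x'
  lies in P (j + 1), then c lies in \<open>P j\<close>, hence c = 0; as t is outside the prime P (j
  + 1), x' lies in it. Iterating, the element is divisible by all powers of t.\<close>

lemma tower:
 "j <= d==> subring (tw y j) R & (ALL c:tw y j. c:P j--> c = #0) & noetherian_ring (R@:(tw y j)) &
(ALL N :: 'a umod. fin_gen (R@:(tw y j)) N--> pdf (R@:(tw y j)) j N)"
proof (induct j)
 case 0
 interpret RK: cring "R@:K" using sub_cring[OF subK] .
 have "pdf (R@:K) 0 N" if "fin_gen (R@:K) N" for N :: "'a umod"
  using RK.field_pdf[OF _ that] invK by simp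
 thus ?case using subK noeth_K K_m sys by(simp add:sysp_def)
next
 case (Suc j)
 let ?C = "tw y j" and ?t = "y j"
 have j: "j < d" using Suc by simp
 have IH: "subring ?C R" "!!c. c:?C==> c:P j==> c = #0" "noetherian_ring (R@:?C)"
  "!!N :: 'a umod. fin_gen (R@:?C) N==> pdf (R@:?C) j N" using Suc by auto
 note t = ym[OF j]
 have S: "P (Suc j)<:P j" "?t:P j" "?t~:P (Suc j)" "primeideal (P j) R" "primeideal (P (Suc j)) R" using sys j by(auto simp:sysp_def)
 have Pi: "ideal (P j) R" using S(4) by(rule primeideal.axioms(1))
 note sub = psx_subring[OF IH(1) t(1)]
 note ps = psx_pser[OF IH(1) t IH(2) Pi S(2)]
 have st: "EX x':psx ?C ?t. x':P (Suc j) & x = ?t*:x'" if x: "x:psx ?C ?t" "x:P (Suc j)" for x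
 proof -
  obtain c x' where c: "c:?C" "x':psx ?C ?t" "x = c +: ?t*:x'" using psx_unfold[OF x(1)] by blast
  have R: "c:$R" "x':$R" "?t:$R" using c(1) subringE(1)[OF IH(1)] psx_R[OF c(2)] mR[OF t(1)] by auto
  interpret Pj: ideal "P j" R by(rule Pi)
  have "x -: ?t*:x':P j" using x(2) S(1) Pj.I_r_closed[OF S(2) R(2)] by(auto simp:a_minus_def)
  hence "c:P j" using c(3) R by(simp add:diff_add_cancel)
  hence "c = #0" using IH(2) c(1) by blast
  hence e: "x = ?t*:x'" using c(3) R by simp
  thus ?thesis using primeideal.I_prime[OF S(5) R(3,2)] x(2) S(3) c(2) by blast
 qed
 have "x = #0" if x: "x:psx ?C ?t" "x:P (Suc j)" for x
 proof -
  have k: "EX x':psx ?C ?t. x':P (Suc j) & x = ?t [^] n*:x'" for n :: nat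
  proof (induct n)
   case 0 thus ?case using x psx_R[OF x(1)] by auto
  next
   case (Suc n)
   then obtain x' where x': "x':psx ?C ?t" "x':P (Suc j)" "x = ?t [^] n*:x'" by blast
   obtain x1 where x1: "x1:psx ?C ?t" "x1:P (Suc j)" "x' = ?t*:x1" using st[OF x'(1,2)] by blast
   have "x = ?t [^] Suc n*:x1" using x' x1 psx_R[OF x1(1)] mR[OF t(1)] by(simp add:m_assoc)
   thus ?case using x1 by blast
  qed
  have "x:{ #0}"
  proof (rule krull[OF zeroideal t(1) psx_R[OF x(1)]])
   fix n :: nat
   obtain x' where "x':psx ?C ?t" "x = ?t [^] n*:x'" using k[of n] by blast
   thus "EX u:{ #0}. EX r:$R. x = u +: ?t [^] n*:r" using psx_R[of x'] mR[OF t(1)] by auto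
  qed
  thus ?thesis by simp
 qed
 moreover have "noetherian_ring (R@:(psx ?C ?t))" using pser.noeth_pser[OF ps] IH(3) by simp
 moreover have "pdf (R@:(psx ?C ?t)) (Suc j) N" if "fin_gen (R@:(psx ?C ?t)) N" for N :: "'a umod"
  using pser.gd_step[OF ps, of j N] IH(3,4) that by simp
 ultimately show ?case using sub by simp
qed

lemma tower_pser: assumes j: "j < d" shows "pser (R@:(tw y (Suc j))) (tw y j) (y j)"
proof -
 have "subring (tw y j) R" "!!c. c:tw y j==> c:P j==> c = #0" using tower[of j] j by auto
 moreover have "ideal (P j) R" "y j:P j" using sys j by(auto simp:sysp_def primeideal_def)
 ultimately show ?thesis using psx_pser[OF _ ym[OF j], of "tw y j" "P j"] by simp
qed

end

text \<open>Finite dimension of R / I over \<open>K\<close>, for I with no prime above it other than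
  \<open>m\<close>. When a b lies in \<open>I\<close>, representatives for I + a R together with
  \<open>a\<close> times those for I + b R suffice.\<close>

lemma fd:
 assumes I: "ideal I R"
 shows "(ALL Q. primeideal Q R--> I<:Q--> Q = m)--> (EX e. finite e & e<:$R &
(ALL a:$R. EX w:spn (R@:K) (selfm R) e. EX u:I. a = w +: u))"
proof (rule noeth_induct[OF noetherian_ring_axioms _ I])
 interpret M: mdl "R@:K" "selfm R" using module_restrict[OF module_selfm subK] by rule
 let ?G = "%I. EX e. finite e & e<:$R & (ALL a:$R. EX w:spn (R@:K) (selfm R) e. EX u:I. a = w +: u)"
 fix I assume I: "ideal I R" and IH: "!!J. ideal J R==> I \<subset> J==> (ALL Q. primeideal Q R--> J<:Q--> Q = m)--> ?G J"
 interpret I: ideal I R by fact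
 show "(ALL Q. primeideal Q R--> I<:Q--> Q = m)--> ?G I"
 proof
  assume pr: "ALL Q. primeideal Q R--> I<:Q--> Q = m"
  consider "I = $R" | "primeideal I R" | "I ~= $R" "~primeideal I R" by blast
  thus "?G I"
  proof cases
   case 1
   have "EX w:spn (R@:K) (selfm R) {}. EX u:I. a = w +: u" if a: "a:$R" for a
    using spn.zero[of "selfm R" "R@:K" "{}"] a 1 by(intro bexI[of _ \<zero>] bexI[of _ a]) auto
   thus ?thesis by blast
  next
   case 2
   hence Im: "I = m" using pr by blast
   have "EX w:spn (R@:K) (selfm R) { #1}. EX u:I. a = w +: u" if a: "a:$R" for a
   proof -
    obtain k u where k: "k:K" "u:m" "a = k +: u" using decK[OF a] by blast
    have "k *: #1:spn (R@:K) (selfm R) { #1}" using M.spn_smult[of "{ #1}" k \<one>] M.spn_incl[of "{ #1}" \<one>] k by simp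
    moreover have "k *: #1 = k" using k(1) subringE(1)[OF subK] by auto
    ultimately show ?thesis using k Im by auto
   qed
   thus ?thesis by(intro exI[of _ "{ #1}"]) auto
  next
   case 3
   then obtain a b where ab: "a:$R" "b:$R" "a*:b:I" "a~:I" "b~:I"
    using primeidealI[OF I cring_axioms] by blast
   have G: "?G (idadd I x)" if x: "x:$R" "x~:I" for x
   proof -
    have i: "I \<subset> idadd I x" using idadd[OF I x(1)] x(2) by blast
    have "ALL Q. primeideal Q R--> idadd I x<:Q--> Q = m" using pr i by blast
    thus ?thesis using IH[OF idadd(1)[OF I x(1)] i] by blast
   qed
   obtain e where e: "finite e" "e<:$R" "ALL r:$R. EX w:spn (R@:K) (selfm R) e. EX u:idadd I a. r = w +: u"
    using G[OF ab(1,4)] by blast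
   obtain e' where e': "finite e'" "e'<:$R" "ALL r:$R. EX w:spn (R@:K) (selfm R) e'. EX u:idadd I b. r = w +: u"
    using G[OF ab(2,5)] by blast
   let ?E = "e \<union> (%x. a*:x) ` e'"
   have E: "?E<:$(selfm R)" using e(2) e'(2) ab(1) by auto
   have l: "lm (R@:K) (selfm R) (selfm R) (%x. a*:x)"
    using lm_restrict[OF lm_smult[OF lm_id[OF module_selfm] ab(1)] subK] by simp
   have "EX w:spn (R@:K) (selfm R) ?E. EX u:I. r = w +: u" if r: "r:$R" for r
   proof -
    obtain w u1 s where w: "w:spn (R@:K) (selfm R) e" "u1:I" "s:$R" "r = w +: (u1 +: a*:s)"
     using e(3) r unfolding idadd_def by blast
    obtain v u2 s' where v: "v:spn (R@:K) (selfm R) e'" "u2:I" "s':$R" "s = v +: (u2 +: b*:s')"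
     using e'(3) w(3) unfolding idadd_def by blast
    have c: "w:$R" "v:$R" "u1:$R" "u2:$R"
     using M.spn_closed[OF _ w(1)] M.spn_closed[OF _ v(1)] e(2) e'(2) w(2) v(2) I.Icarr by auto
    have "r = (w +: a*:v) +: (u1 +: (a*:u2 +: (a*:b)*:s'))"
     using w(4) v(3,4) c ab by(simp add:r_distr m_assoc a_ac)
    moreover have "u1 +: (a*:u2 +: (a*:b)*:s'):I" using w(2) I.I_l_closed[OF v(2) ab(1)] I.I_r_closed[OF ab(3) v(3)] by simp
    moreover have "w:spn (R@:K) (selfm R) ?E" using M.spn_mono[OF _ E, of e] w(1) by auto
    moreover have "a*:v:spn (R@:K) (selfm R) ((%x. a*:x) ` e')"
     using lm_image_spn[OF l, of e'] e'(2) v(1) by(metis image_eqI selfm_simps(1))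
    hence "a*:v:spn (R@:K) (selfm R) ?E" using M.spn_mono[OF _ E, of "(%x. a*:x) ` e'"] by auto
    ultimately show ?thesis using M.spn_add[OF E, of w "a*:v"] by auto
   qed
   thus ?thesis using e e' E by(intro exI[of _ ?E]) auto
  qed
 qed
qed

text \<open>The parameters enter the scalars one at a time. Modulo the parameters not yet used,
  \<open>R\<close> is separated for the next one by \<open>krull\<close>, so \<open>nak\<close>
  turns generation modulo that parameter into generation over the larger ring by the same
  set.\<close>

lemma tower_gen:
 assumes sys: "sysp d P y"
 shows "EX e. finite e & e<:$R & $R<:spn (R@:(tw y d)) (selfm R) e"
proof -
 have yR: "y ` {j..<d}<:$R" for j using ym(1)[OF sys] mR by auto
 have gi: "ideal (genideal R (y ` {j..<d})) R" for j using genideal_ideal[OF yR] .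
 have "ALL Q. primeideal Q R--> genideal R (y ` {0..<d})<:Q--> Q = m"
 proof (intro allI impI)
  fix Q assume Q: "primeideal Q R" "genideal R (y ` {0..<d})<:Q"
  hence "y ` {..<d}<:Q" using genideal_self[OF yR[of 0]] by(auto simp:lessThan_atLeast0)
  thus "Q = m" using sys Q(1) unfolding sysp_def by blast
 qed
 then obtain e where e: "finite e" "e<:$R" and b: "ALL a:$R. EX w:spn (R@:K) (selfm R) e. EX u:genideal R (y ` {0..<d}). a = w +: u"
  using fd[OF gi[of 0]] by blast
 have eS: "e<:$(selfm R)" using e by simp
 have "ALL a:$R. EX w:spn (R@:(tw y j)) (selfm R) e. EX u:genideal R (y ` {j..<d}). a = w +: u" if "j <= d" for j
  using that
 proof (induct j)
  case 0 thus ?case using b by simp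
 next
  case (Suc j)
  hence j: "j < d" and IH: "ALL a:$R. EX w:spn (R@:(tw y j)) (selfm R) e. EX u:genideal R (y ` {j..<d}). a = w +: u" by auto
  let ?I = "genideal R (y ` {Suc j..<d})" and ?S = "tw y (Suc j)" and ?t = "y j"
  have sC: "subring (tw y j) R" and sS: "subring ?S R" using tower[OF sys, of j] tower[OF sys, of "Suc j"] j by auto
  interpret MC: mdl "R@:(tw y j)" "selfm R" using module_restrict[OF module_selfm sC] by rule
  interpret MS: mdl "R@:?S" "selfm R" using module_restrict[OF module_selfm sS] by rule
  note tm = ym(1)[OF sys j] and tR = mR[OF ym(1)[OF sys j]]
  note ps = tower_pser[OF sys j]
  \<comment> \<open>\<open>Q\<close> is \<open>R\<close> modulo the parameters with index above
    j.\<close>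
  obtain Q :: "('a,'a) module" and q where Q: "lm R (selfm R) Q q" "q ` $(selfm R) = $Q" "ALL x:$(selfm R). q x = 0[Q] \<longleftrightarrow> x:?I"
   using ex_quot[OF module_selfm ideal_sm[OF gi[of "Suc j"]]] by blast
  interpret Q: mdl R Q using lmD(2)[OF Q(1)] by rule
  interpret I: ideal ?I R by(rule gi)
  have q0: "q x = 0[Q] \<longleftrightarrow> x:?I" if "x:$R" for x using Q(3) that by simp
  have qc: "q x:$Q" if "x:$R" for x using lmD(3)[OF Q(1)] that by simp
  have qa: "q (x +: x') = q x+[Q] q x'" if "x:$R" "x':$R" for x x' using lmD(4)[OF Q(1)] that by simp
  have qs: "q (r*:x) = r*[Q] q x" if "x:$R" "r:$R" for x r using lmD(5)[OF Q(1)] that by simp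
  have sub: "genideal R (y ` {j..<d})<:idadd ?I ?t"
  proof (rule genideal_minimal[OF idadd(1)[OF gi tR]])
   have "{j..<d} = insert j {Suc j..<d}" using j by auto
   thus "y ` {j..<d}<:idadd ?I ?t" using idadd(2,3)[OF gi[of "Suc j"] tR] genideal_self[OF yR[of "Suc j"]] by auto
  qed
  have "$Q<:spn (R@:?S) Q (q ` e)"
  proof (rule pser.nak[OF ps module_restrict[OF lmD(2)[OF Q(1)] sS]])
   show "pser.sepm (R@:?S) ?t Q" unfolding pser.sepm_def[OF ps]
   proof (intro ballI impI)
    fix z assume z: "z:$Q" and a: "ALL n::nat. EX z':$Q. z = ?t [^]\<^bsub>R@:?S\<^esub> n*[Q] z'"
    obtain x where x: "x:$R" "z = q x" using z Q(2) by auto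
    have "x:?I"
    proof (rule krull[OF gi tm x(1)])
     fix n :: nat
     obtain z' where z': "z':$Q" "z = ?t [^] n*[Q] z'" using a by(auto simp:nat_pow_consistent[symmetric])
     obtain x' where x': "x':$R" "z' = q x'" using z'(1) Q(2) by auto
     have tx: "?t [^] n*:x':$R" using x' tR by simp
     have "q (x -: ?t [^] n*:x') = 0[Q]" using lmD(8)[OF Q(1), of x "?t [^] n*:x'"] x x' z' qs[OF x'(1), of "?t [^] n"] tx tR qc[OF x(1)] by(simp add:Q.diff_self)
     hence "x -: ?t [^] n*:x':?I" using q0 x tx by simp
     moreover have "x = (x -: ?t [^] n*:x') +: ?t [^] n*:x'" using x tx by(simp add:add_diff_cancel)
     ultimately show "EX u:?I. EX r:$R. x = u +: ?t [^] n*:r" using x'(1) by blast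
    qed
    thus "z = 0[Q]" using x q0 by simp
   qed
   show "finite (q ` e)" "q ` e<:$Q" using e qc by auto
   fix z assume z: "z:$Q"
   obtain x where x: "x:$R" "z = q x" using z Q(2) by auto
   obtain w u where w: "w:spn (R@:(tw y j)) (selfm R) e" "u:genideal R (y ` {j..<d})" "x = w +: u" using IH x(1) by blast
   obtain u' r where u: "u':?I" "r:$R" "u = u' +: ?t*:r" using sub w(2) by(auto simp:idadd_def)
   have c: "w:$R" "u':$R" using MC.spn_closed[OF eS w(1)] I.Icarr[OF u(1)] by auto
   have "z = q w+[Q] (q u'+[Q] ?t*[Q] q r)" using x(2) w(3) u c tR qa qs by simp
   hence "z = q w+[Q] ?t*[Q] q r" using q0[OF c(2)] u c tR qc by simp
   moreover have "q w:spn (R@:(tw y j)) Q (q ` e)"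
    using lm_image_spn[OF lm_restrict[OF Q(1) sC] eS] w(1) by(metis image_eqI)
   ultimately show "EX w:spn (R\<lparr>carrier := ?S,carrier := tw y j\<rparr>) Q (q ` e). EX z':$Q. z = w+[Q] ?t*[Q] z'"
    using qc[OF u(2)] by auto
  qed
  hence sp: "$Q<:q ` spn (R@:?S) (selfm R) e" using lm_image_spn[OF lm_restrict[OF Q(1) sS] eS] by simp
  show ?case
  proof
   fix a assume a: "a:$R"
   then obtain w where w: "w:spn (R@:?S) (selfm R) e" "q a = q w" using sp qc[OF a] by blast
   have wc: "w:$R" using MS.spn_closed[OF eS w(1)] by simp
   have "q (a -: w) = 0[Q]" using lmD(8)[OF Q(1), of a w] a wc w(2) qc by(simp add:Q.diff_self)
   hence "a -: w:?I" using q0 a wc by simp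
   moreover have "a = w +: (a -: w)" using a wc by(simp add:add_diff_swap)
   ultimately show "EX w:spn (R@:?S) (selfm R) e. EX u:?I. a = w +: u" using w(1) by blast
  qed
 qed
 from this[OF le_refl] have f: "ALL a:$R. EX w:spn (R@:(tw y d)) (selfm R) e. EX u:genideal R {}. a = w +: u" by simp
 have "genideal R {}<:{ #0}" using genideal_minimal[OF zeroideal, of "{}"] by simp
 moreover have "subring (tw y d) R" using tower[OF sys] by simp
 then interpret MS: mdl "R@:(tw y d)" "selfm R" using module_restrict[OF module_selfm] by(intro mdl.intro)
 have "$R<:spn (R@:(tw y d)) (selfm R) e"
 proof
  fix a assume "a:$R"
  then obtain w where "w:spn (R@:(tw y d)) (selfm R) e" "a = w +: #0" using f calculation by blast
  thus "a:spn (R@:(tw y d)) (selfm R) e" using MS.spn_closed[OF eS] by simp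
 qed
 thus ?thesis using e by blast
qed

end

section \<open>Frobenius and linear systems over domains\<close>

lemma (in abelian_monoid) finsum_swap:
 assumes "finite I" "finite J" "!!i j. i:I==> j:J==> f i j:$G"
 shows "(##i:I.##j:J. f i j) = (##j:J.##i:I. f i j)"
 using assms(1,3)
proof (induct I)
 case empty thus ?case using finsum_zero[of J] by simp
next
 case (insert i I)
 have "(##i:insert i I.##j:J. f i j) = (##j:J. f i j) +: (##j:J.##i:I. f i j)"
  using insert by(subst finsum_insert) (auto intro!: finsum_closed)
 also have "... = (##j:J. f i j +: (##i:I. f i j))" using insert by(intro finsum_addf[symmetric]) (auto intro!: finsum_closed)
 also have "... = (##j:J.##i:insert i I. f i j)"
  using insert by(intro finsum_cong') (auto intro!: finsum_closed finsum_insert[symmetric])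
 finally show ?case .
qed

lemma (in abelian_monoid) finsum_Times:
 assumes "finite I" "finite J" "!!i j. i:I==> j:J==> f (i,j):$G"
 shows "(##p:I \<times> J. f p) = (##i:I.##j:J. f (i,j))"
 using assms(1,3)
proof (induct I)
 case (insert i I)
 have "(##p:insert i I \<times> J. f p) = (##p:Pair i ` J \<union> I \<times> J. f p)" by(rule arg_cong[of _ _ "finsum G f"]) auto
 also have "... = (##p:Pair i ` J. f p) +: (##p:I \<times> J. f p)"
  using insert assms(2) by(intro finsum_Un_disjoint) auto
 also have "(##p:Pair i ` J. f p) = (##j:J. f (i,j))" using insert by(subst finsum_reindex) (auto simp:inj_on_def)
 finally show ?case using insert by(subst finsum_insert) (auto intro!: finsum_closed)
qed simp

lemma finsum_selfm [simp]: "finsum (selfm R) f I = finsum R f I"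
 by(simp add:finsum_def finprod_def selfm_def)

context ring begin

text \<open>Binomial theorem with A k i j in the role of (X + Y)^k X^i Y^j. The abstract recursion
  serves both powers of a sum and the iterated commutators in \<open>pstep\<close>.\<close>

lemma pascal:
 fixes A :: "nat=> nat=> nat=> 'a"
 assumes c: "!!k i j. A k i j:$R" and S: "!!k i j. A (Suc k) i j = A k (Suc i) j +: A k i (Suc j)"
 shows "A k i j = (##l:{..k}. [(k choose l)] \<cdot> A 0 (i + k - l) (j + l))"
proof (induct k arbitrary: i j)
 case 0 show ?case using c finsum_0[of "%l. [(0 choose l)] \<cdot> A 0 (i + 0 - l) (j + l)"] by simp
next
 case (Suc k)
 let ?F = "%l. A 0 (i + Suc k - l) (j + l)"
 have e1: "(##l:{..k}. [(k choose l)] \<cdot> A 0 (Suc i + k - l) (j + l)) = (##l:{..Suc k}. [(k choose l)] \<cdot> ?F l)"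
  using c by(subst finsum_Suc) (auto intro!: finsum_closed simp:binomial_eq_0)
 have "A (Suc k) i j = (##l:{..Suc k}. [(k choose l)] \<cdot> ?F l) +: (##l:{..k}. [(k choose l)] \<cdot> A 0 (i + k - l) (Suc j + l))"
  unfolding S Suc[of "Suc i" j] Suc[of i "Suc j"] e1 ..
 also have "(##l:{..Suc k}. [(k choose l)] \<cdot> ?F l) = (##l:{..k}. [(k choose Suc l)] \<cdot> ?F (Suc l)) +: ?F 0"
  using c by(subst finsum_Suc2) auto
 also have "((##l:{..k}. [(k choose Suc l)] \<cdot> ?F (Suc l)) +: ?F 0) +: (##l:{..k}. [(k choose l)] \<cdot> A 0 (i + k - l) (Suc j + l))
= ((##l:{..k}. [(k choose l)] \<cdot> A 0 (i + k - l) (Suc j + l)) +: (##l:{..k}. [(k choose Suc l)] \<cdot> ?F (Suc l))) +: ?F 0"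
  using c by(simp add:a_ac finsum_closed)
 also have "(##l:{..k}. [(k choose l)] \<cdot> A 0 (i + k - l) (Suc j + l)) +: (##l:{..k}. [(k choose Suc l)] \<cdot> ?F (Suc l))
= (##l:{..k}. [(Suc k choose Suc l)] \<cdot> ?F (Suc l))"
  using c by(subst finsum_addf[symmetric]) (auto simp:add.nat_pow_mult)
 also have "... +: ?F 0 = (##l:{..Suc k}. [(Suc k choose l)] \<cdot> ?F l)" by(rule trans[OF _ finsum_Suc2[symmetric]]) (use c in auto)
 finally show ?case .
qed

end

context cring begin

lemma charp_mult: assumes "[p] \<cdot> #1 = #0" "p dvd (n::nat)" "x:$R" shows "[n] \<cdot> x = #0"
proof -
 obtain c where n: "n = p * c" using assms(2) by blast
 have "[p] \<cdot> x = [p] \<cdot> #1*:x" using add_pow_ldistr[of \<one> x p] assms(3) by simp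
 hence "[p] \<cdot> x = #0" using assms by simp
 hence "[c] \<cdot> ([p] \<cdot> x) = #0" by simp
 thus ?thesis using add.nat_pow_pow[OF assms(3), of c p] n by simp
qed

lemma charp_ndvd: assumes p: "Factorial_Ring.prime (p::nat)" "[p] \<cdot> #1 = #0" and "~p dvd k" "x:$R" "[k] \<cdot> x = #0" shows "x = #0"
proof -
 have "gcd k p = 1" using prime_imp_coprime[OF p(1) assms(3)] by(simp add:coprime_iff_gcd_eq_1 gcd.commute)
 moreover have "k ~= 0" using assms(3) by(metis dvd_0_right)
 ultimately obtain u v where uv: "k * u = p * v + 1" using bezout_nat[of k p] by auto
 have "[(k * u)] \<cdot> x = [u] \<cdot> ([k] \<cdot> x)" using add.nat_pow_pow[OF assms(4), of u k] by simp
 hence "[(k * u)] \<cdot> x = #0" using assms by simp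
 moreover have "[(p * v + 1)] \<cdot> x = [(p * v)] \<cdot> x +: [(1::nat)] \<cdot> x" using add.nat_pow_mult[OF assms(4)] by simp
 ultimately show ?thesis using uv charp_mult[OF p(2), of "p * v" x] assms(4) by simp
qed

text \<open>In characteristic p all inner binomial coefficients vanish.\<close>

lemma pascal_p:
 fixes A :: "nat=> nat=> nat=> 'a"
 assumes p: "Factorial_Ring.prime p" "[p] \<cdot> #1 = #0"
  and c: "!!k i j. A k i j:$R" and S: "!!k i j. A (Suc k) i j = A k (Suc i) j +: A k i (Suc j)"
 shows "A p i j = A 0 (i + p) j +: A 0 i (j + p)"
proof -
 let ?F = "%l. [(p choose l)] \<cdot> A 0 (i + p - l) (j + l)"
 obtain q where q: "p = Suc q" using prime_gt_0_nat[OF p(1)] gr0_implies_Suc by blast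
 have Fc: "?F l:$R" for l using c by simp
 have "?F l = (if 0 = l then ?F l else #0)" if "l:{..q}" for l
 proof (cases "l = 0")
  case False
  hence "p dvd (p choose l)" using dvd_choose_prime[of l p] that q p(1) by simp
  thus ?thesis using False charp_mult[OF p(2) _ c] by simp
 qed simp
 hence "(##l:{..q}. ?F l) = (##l:{..q}. if 0 = l then ?F l else #0)" using Fc by(intro finsum_cong') auto
 also have "... = ?F 0" using Fc by(intro finsum_singleton) auto
 also have "... = A 0 (i + p) j" using c by simp
 finally have e: "(##l:{..q}. ?F l) = A 0 (i + p) j" .
 have "A p i j = (##l:{..p}. ?F l)" by(rule pascal[of A, OF c S])
 also have "{..p} = {..Suc q}" using q by simp
 also have "(##l:{..Suc q}. ?F l) = ?F (Suc q) +: (##l:{..q}. ?F l)" using Fc by(intro finsum_Suc) auto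
 finally have "A p i j = ?F p +: (##l:{..q}. ?F l)" using q by simp
 thus ?thesis unfolding e using c by(simp add:a_comm)
qed

lemma frob_add: assumes p: "Factorial_Ring.prime p" "[p] \<cdot> #1 = #0" and xy: "x:$R" "y:$R"
 shows "(x +: y) [^] (p::nat) = x [^] p +: y [^] p"
proof -
 let ?A = "%(k::nat) (i::nat) (j::nat).(x +: y) [^] k*:(x [^] i*:y [^] j)"
 have "?A p 0 0 = ?A 0 (0 + p) 0 +: ?A 0 0 (0 + p)"
 proof (rule pascal_p[of p ?A 0 0, OF p])
  fix k i j :: nat
  define w where "w = (x +: y) [^] k"
  have w: "w:$R" "x [^] i:$R" "y [^] j:$R" using xy by(auto simp:w_def)
  have "w*:(x +: y)*:(x [^] i*:y [^] j) = w*:(x [^] i*:x*:y [^] j) +: w*:(x [^] i*:(y [^] j*:y))"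
   using w xy by(simp add:r_distr l_distr, simp add:m_ac)
  thus "?A (Suc k) i j = ?A k (Suc i) j +: ?A k i (Suc j)" using xy unfolding w_def by simp
 qed (use xy in auto)
 thus ?thesis using xy by simp
qed

lemma frob_neg: assumes p: "Factorial_Ring.prime p" "[p] \<cdot> #1 = #0" and x: "x:$R" shows "(\<ominus> x) [^] (p::nat) = \<ominus> (x [^] p)"
proof -
 have "(\<ominus> x) [^] p +: x [^] p = #0 [^] p" using frob_add[OF p, of "\<ominus> x" x] x by(simp add:l_neg)
 also have "... = #0" using prime_gt_0_nat[OF p(1)] by(cases p) auto
 finally show ?thesis using x by(metis a_inv_closed minus_equality nat_pow_closed)
qed

lemma frob_subring: assumes p: "Factorial_Ring.prime p" "[p] \<cdot> #1 = #0" and B: "subring B R" shows "subring ((%x. x [^] (p::nat)) ` B) R"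
proof -
 have BR: "b:$R" if "b:B" for b using that subringE(1)[OF B] by blast
 show ?thesis
 proof (rule subringI)
  show "#1:(%x. x [^] p) ` B" using subringE(3)[OF B] by(metis image_eqI nat_pow_one)
  fix h assume "h:(%x. x [^] p) ` B"
  then obtain x where x: "x:B" "h = x [^] p" by blast
  show "\<ominus> h:(%x. x [^] p) ` B" using frob_neg[OF p BR[OF x(1)]] x subringE(5)[OF B x(1)] by(metis image_eqI)
  fix h' assume "h':(%x. x [^] p) ` B"
  then obtain y where y: "y:B" "h' = y [^] p" by blast
  show "h*:h':(%x. x [^] p) ` B" using nat_pow_distrib[of x y p] BR x y subringE(6)[OF B x(1) y(1)] by(metis image_eqI)
  show "h +: h':(%x. x [^] p) ` B" using frob_add[OF p, of x y] BR x y subringE(7)[OF B x(1) y(1)] by(metis image_eqI)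
 qed (use BR in auto)
qed

end

context domain begin

lemma pow_eq_zero: "x:$R==> x [^] (n::nat) = #0==> x = #0"
 by(induct n) (use integral in auto)

lemma frob_inj: assumes p: "Factorial_Ring.prime p" "[p] \<cdot> #1 = #0" and "x:$R" "y:$R" "x [^] (p::nat) = y [^] p" shows "x = y"
proof -
 have "(x -: y) [^] p = #0" using frob_add[OF p, of x "\<ominus> y"] frob_neg[OF p] assms(3-5) by(simp add:a_minus_def r_neg)
 hence "x -: y = #0" using pow_eq_zero assms by blast
 thus ?thesis using assms diff_eq_iff by simp
qed

text \<open>Gaussian elimination without division: one unknown is eliminated by cross-multiplication
  with a pivot, and the smaller system is solved by induction.\<close>

lemma homog:
 fixes a :: "'e=> 'i=> 'a"
 assumes B: "subring B R" and E: "finite E"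
 shows "finite I==> card E < card I==> (!!e i. e:E==> i:I==> a e i:B) ==>
EX x:I \<rightarrow> B.(EX i:I. x i ~= #0) & (ALL e:E.(##i:I. a e i*:x i) = #0)"
 using E
proof (induct E arbitrary: I a)
 case empty
 hence "I ~= {}" by auto
 thus ?case using subringE(3)[OF B] by(intro bexI[of _ "%_.#1"]) auto
next
 case (insert e E)
 have BR: "b:$R" if "b:B" for b using that subringE(1)[OF B] by blast
 have a: "a f i:B" if "f:insert e E" "i:I" for f i using insert(6) that by blast
 show ?case
 proof (cases "ALL i:I. a e i = #0")
  case True
  have "card E < card I" using insert by simp
  then obtain x where x: "x:I \<rightarrow> B" "EX i:I. x i ~= #0" "ALL e:E.(##i:I. a e i*:x i) = #0"
   using insert(3)[OF insert(4), of a] a by blast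
  have "x i:$R" if "i:I" for i using x(1) BR that by blast
  hence "(##i:I. a e i*:x i) = (##i:I.#0)" using True by(intro finsum_cong') auto
  thus ?thesis using x by(intro bexI[of _ x]) auto
 next
  case False
  then obtain k where k: "k:I" "a e k ~= #0" by blast
  define J where "J = I - {k}"
  have IJ: "I = insert k J" "finite J" "k~:J" using k insert(4) by(auto simp:J_def)
  have "card E < card J" using insert IJ by simp
  moreover define a' where "a' f i = a e k*:a f i -: a f k*:a e i" for f i
  have aR: "a f i:$R" if "f:insert e E" "i:I" for f i using a[OF that] BR by blast
  have "a' f i:B" if "f:E" "i:J" for f i
   unfolding a'_def a_minus_def using that a k(1) IJ(1) subringE(5,6,7)[OF B] by simp
  ultimately obtain x where x: "x:J \<rightarrow> B" "EX i:J. x i ~= #0" "ALL e:E.(##i:J. a' e i*:x i) = #0"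
   using insert(3)[OF IJ(2), of a'] by blast
  have xR: "x i:$R" if "i:J" for i using x(1) that BR by blast
  have aJ: "a f i:$R" if "f:insert e E" "i:J" for f i using aR that IJ(1) by blast
  define \<sigma> where "\<sigma> f = (##i:J. a f i*:x i)" for f
  have \<sigma>R: "\<sigma> f:$R" if "f:insert e E" for f unfolding \<sigma>_def using aJ[OF that] xR by(intro finsum_closed) auto
  have smB: "(##i:J. h i):B" if "h:J \<rightarrow> B" for h
   using IJ(2) that by(induct J) (use BR subringE(2,7)[OF B] in \<open>auto simp:finsum_insert Pi_def\<close>)
  have \<sigma>B: "\<sigma> e:B" unfolding \<sigma>_def using a[of e] funcset_mem[OF x(1)] IJ(1) subringE(6)[OF B] by(intro smB Pi_I) simp
  \<comment> \<open>Scaling the other unknowns by the pivot \<open>a e k\<close> makes the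
    eliminated one solvable inside \<open>B\<close>.\<close>
  define x' where "x' i = (if i = k then \<ominus> \<sigma> e else a e k*:x i)" for i
  have ek: "a e k:B" "a e k:$R" using a aR k(1) by auto
  have xB: "x i:B" if "i:J" for i using x(1) that by blast
  have x'B: "x':I \<rightarrow> B" using xB \<sigma>B ek subringE(5,6)[OF B] by(auto simp:x'_def IJ(1))
  have x'R: "x' i:$R" if "i:I" for i using x'B BR that by blast
  have eq: "(##i:I. a f i*:x' i) = a e k *: \<sigma> f -: a f k *: \<sigma> e" if f: "f:insert e E" for f
  proof -
   have "(##i:I. a f i*:x' i) = a f k*:x' k +: (##i:J. a f i*:x' i)"
    unfolding IJ(1) using IJ(2,3) aR[OF f] x'R unfolding IJ(1) by(intro finsum_insert) auto
   also have "(##i:J. a f i*:x' i) = (##i:J. a e k*:(a f i*:x i))"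
    using aJ[OF f] xR ek IJ(3) by(intro finsum_cong') (auto simp:x'_def m_lcomm)
   also have "... = a e k *: \<sigma> f" unfolding \<sigma>_def using aJ[OF f] xR ek by(intro finsum_rdistr[symmetric]) (auto simp:IJ(2))
   finally show ?thesis using \<sigma>R f aR[OF f k(1)] ek by(simp add:x'_def a_minus_def r_minus a_comm)
  qed
  have "(##i:I. a f i*:x' i) = #0" if f: "f:insert e E" for f
  proof (cases "f = e")
   case True thus ?thesis using eq[OF f] \<sigma>R ek by(simp add:diff_self)
  next
   case False
   hence fE: "f:E" using f by simp
   have "#0 = (##i:J. a' f i*:x i)" using x(3) fE by simp
   also have "... = (##i:J. a e k*:(a f i*:x i) +: (\<ominus> a f k)*:(a e i*:x i))"
    using aJ[OF f] aJ[of e] xR ek aR[OF f k(1)] by(intro finsum_cong') (auto simp:a'_def a_minus_def l_distr l_minus m_assoc)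
   also have "... = (##i:J. a e k*:(a f i*:x i)) +: (##i:J.(\<ominus> a f k)*:(a e i*:x i))"
    using aJ[OF f] aJ[of e] xR ek aR[OF f k(1)] by(intro finsum_addf) auto
   also have "(##i:J. a e k*:(a f i*:x i)) = a e k *: \<sigma> f" unfolding \<sigma>_def using aJ[OF f] xR ek by(intro finsum_rdistr[symmetric]) (auto simp:IJ(2))
   also have "(##i:J.(\<ominus> a f k)*:(a e i*:x i)) = (\<ominus> a f k) *: \<sigma> e" unfolding \<sigma>_def
    using aJ[of e] xR aR[OF f k(1)] by(intro finsum_rdistr[symmetric]) (auto simp:IJ(2))
   finally show ?thesis using eq[OF f] \<sigma>R[OF f] \<sigma>R[of e] aR[OF f k(1)] ek by(simp add:a_minus_def l_minus)
  qed
  moreover have "EX i:I. x' i ~= #0"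
  proof -
   obtain i where i: "i:J" "x i ~= #0" using x(2) by blast
   hence "x' i ~= #0" using integral[of "a e k" "x i"] ek k xR IJ(3) by(auto simp:x'_def)
   thus ?thesis using i IJ(1) by blast
  qed
  ultimately show ?thesis using x'B by blast
 qed
qed

end

section \<open>Near-independence over a subring\<close>

context domain begin

abbreviation sp :: "'a set=> 'a set=> 'a set" where
 "sp B V == spn (R@:B) (selfm R) V"

text \<open>The part of \<open>R\<close> in the span of \<open>V\<close> over the fraction field of
  \<open>B\<close>. Clearing denominators replaces the construction of fraction fields, and likewise
  in \<open>ind\<close>.\<close>

definition cl :: "'a set=> 'a set=> 'a set" where
 "cl B V = {a:$R. EX b:B. b ~= #0 & b*:a:sp B V}"

definition ind :: "'a set=> 'i set=> ('i=> 'a)=> bool" where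
 "ind B I v \<longleftrightarrow> finite I & v:I \<rightarrow> $R &
(ALL b:I \<rightarrow> B.(##i:I. b i*:v i) = #0--> (ALL i:I. b i = #0))"

lemma indD:
 assumes "ind B I v"
 shows "finite I" "i:I==> v i:$R"
  "(!!i. i:I==> b i:B)==> (##i:I. b i*:v i) = #0==> i:I==> b i = #0"
 using assms unfolding ind_def by blast+

lemma indI:
 assumes "finite I" "!!i. i:I==> v i:$R"
  "!!b i.(!!i. i:I==> b i:B)==> (##i:I. b i*:v i) = #0==> i:I==> b i = #0"
 shows "ind B I v"
 unfolding ind_def using assms(1,2) by(auto intro:assms(3))

context fixes B assumes B: "subring B R"
begin

lemma BR: "b:B==> b:$R" using subringE(1)[OF B] by blast

lemma mdl_self: "mdl (R@:B) (selfm R)"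
 using module_restrict[OF module_selfm B] by rule

lemma sp_fin:
 assumes "finite I" "!!i. i:I==> v i:$R"
 shows "x:sp B (v ` I) \<longleftrightarrow> (EX c.(ALL i:I. c i:B) & x = (##i:I. c i*:v i))"
proof -
 interpret M: mdl "R@:B" "selfm R" by(rule mdl_self)
 have "sp B (v ` I) = {x. EX c:I \<rightarrow> B. x = (##i:I. c i*:v i)}" using M.spn_image_finsum[of I v] assms by auto
 thus ?thesis by auto
qed

lemma B_finsum: "finite I==> (!!i. i:I==> h i:B)==> (##i:I. h i):B"
proof (induct I rule: finite_induct)
 case (insert i I)
 hence "(##i:insert i I. h i) = h i +: (##i:I. h i)" using BR by(intro finsum_insert) auto
 thus ?case using insert subringE(7)[OF B] by simp
qed (use subringE(2)[OF B] in simp)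

text \<open>With more independent elements than spanning ones, the coordinates give a homogeneous
  system with more unknowns than equations, whose solution is a forbidden relation.\<close>

lemma ind_card:
 assumes I: "ind B I v" and V: "finite V" "V<:$R" and sub: "!!i. i:I==> v i:cl B V"
 shows "card I <= card V"
proof (rule ccontr)
 assume "~card I <= card V"
 hence c: "card V < card I" by simp
 note D = indD[OF I]
 have "EX \<beta> c. \<beta> : B & \<beta> ~= #0 & (ALL u:V. c u:B) & \<beta> *: v i = (##u:V. c u*:u)" if "i:I" for i
 proof -
  obtain \<beta> where b: "\<beta> : B" "\<beta> ~= #0" "\<beta> *: v i:sp B V" using sub[OF \<open>i:I\<close>] by(auto simp:cl_def)
  obtain c where "ALL u:V. c u:B" "\<beta> *: v i = (##u:V. c u*:u)"
   using b(3) sp_fin[of V "%x. x" "\<beta> *: v i"] V by auto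
  thus ?thesis using b by blast
 qed
 hence "ALL i:I. EX \<beta> c. \<beta> : B & \<beta> ~= #0 & (ALL u:V. c u:B) & \<beta> *: v i = (##u:V. c u*:u)" by blast
 from bchoice[OF this] obtain \<beta> where "ALL i:I. EX c. \<beta> i:B & \<beta> i ~= #0 & (ALL u:V. c u:B) & \<beta> i*:v i = (##u:V. c u*:u)" by(elim exE)
 from bchoice[OF this] obtain c where bc: "ALL i:I. \<beta> i:B & \<beta> i ~= #0 & (ALL u:V. c i u:B) & \<beta> i*:v i = (##u:V. c i u*:u)" by(elim exE)
 have b: "\<beta> i:B" "\<beta> i ~= #0" "\<beta> i:$R" "\<beta> i*:v i = (##u:V. c i u*:u)" if "i:I" for i using bc that BR by auto
 have cB: "c i u:B" "c i u:$R" if "i:I" "u:V" for i u using bc that BR by auto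
 obtain x where x: "x:I \<rightarrow> B" "EX i:I. x i ~= #0" "ALL u:V.(##i:I. c i u*:x i) = #0"
  using homog[OF B V(1) D(1) c, of "%u i. c i u"] cB by blast
 have xB: "x i:B" "x i:$R" if "i:I" for i using x(1) that BR by auto
 have uR: "u:$R" if "u:V" for u using V that by blast
 have "(##i:I.(x i *: \<beta> i)*:v i) = (##i:I.##u:V.(c i u*:x i)*:u)"
 proof (rule finsum_cong')
  fix i assume i: "i:I"
  have "(x i *: \<beta> i)*:v i = x i*:(##u:V. c i u*:u)" using xB[OF i] b[OF i] D(2)[OF i] by(simp add:m_assoc)
  also have "... = (##u:V. x i*:(c i u*:u))" using xB[OF i] cB[OF i] uR V(1) by(intro finsum_rdistr) auto
  also have "... = (##u:V.(c i u*:x i)*:u)" using xB[OF i] cB[OF i] uR by(intro finsum_cong') (auto simp:m_ac)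
  finally show "(x i *: \<beta> i)*:v i = (##u:V.(c i u*:x i)*:u)" .
 qed (use xB cB uR in \<open>auto intro!: finsum_closed\<close>)
 also have "... = (##u:V.##i:I.(c i u*:x i)*:u)" using xB cB uR D(1) V(1) by(intro finsum_swap) auto
 also have "... = (##u:V.#0)"
 proof (rule finsum_cong')
  fix u assume u: "u:V"
  have "(##i:I.(c i u*:x i)*:u) = (##i:I. c i u*:x i)*:u" using xB cB u uR D(1) by(intro finsum_ldistr[symmetric]) auto
  thus "(##i:I.(c i u*:x i)*:u) = #0" using x(3) u uR by simp
 qed auto
 finally have s: "(##i:I.(x i *: \<beta> i)*:v i) = #0" by simp
 have "x i *: \<beta> i = #0" if i: "i:I" for i
  using D(3)[of "%i. x i *: \<beta> i" i] s i xB b subringE(6)[OF B] by simp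
 hence "x i = #0" if "i:I" for i using integral[of "x i" "\<beta> i"] xB[OF that] b[OF that] that by blast
 thus False using x(2) by blast
qed

lemma sp_sub_cl: assumes "V<:$R" shows "sp B V<:cl B V"
proof
 interpret M: mdl "R@:B" "selfm R" by(rule mdl_self)
 fix a assume a: "a:sp B V"
 hence "a:$R" using M.spn_closed[of V a] assms by simp
 thus "a:cl B V" unfolding cl_def using a subringE(3)[OF B] by(auto intro!: bexI[of _ \<one>])
qed

text \<open>\<open>ind_card\<close> bounds the size of independent sets, so one of greatest size
  above \<open>V0\<close> exists. Any further element then satisfies a relation in which its own
  coefficient is nonzero.\<close>

lemma ex_basis:
 assumes W: "finite W" "W<:$R" and G: "G<:$R" "G<:cl B W" and V0: "V0<:G" "ind B V0 (%x. x)"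
 shows "EX V. V0<:V & V<:G & ind B V (%x. x) & G<:cl B V"
proof -
 let ?P = "%V. V0<:V & V<:G & ind B V (%x. x)"
 interpret M: mdl "R@:B" "selfm R" by(rule mdl_self)
 have "?P V0" using V0 by simp
 moreover have "ALL V. ?P V--> card V < Suc (card W)" using ind_card[OF _ W] G(2) by(meson less_Suc_eq_le subsetD)
 ultimately have "EX V. ?P V & (ALL U. ?P U--> card U <= card V)" by(rule ex_has_greatest_nat[of ?P])
 then obtain V where V: "?P V" "!!U. ?P U==> card U <= card V" by(elim exE conjE) (rule that, auto)
 note D = indD[OF conjunct2[OF conjunct2[OF V(1)]]]
 have VR: "V<:$R" using V(1) G(1) by blast
 have "a:cl B V" if aG: "a:G" for a
 proof (cases "a:V")
  case True
  thus ?thesis using M.spn_incl[of V a] VR sp_sub_cl[OF VR] by auto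
 next
  case False
  have a: "a:$R" using aG G(1) by blast
  have "~ind B (insert a V) (%x. x)" using V False D(1) aG by(metis card_insert_disjoint insert_subset lessI linorder_not_le subset_insertI2)
  then obtain b where b: "b:insert a V \<rightarrow> B" "(##i:insert a V. b i*:i) = #0" "~(ALL i:insert a V. b i = #0)"
   unfolding ind_def using D(1) VR a by auto
  have bB: "b i:B" "b i:$R" if "i:insert a V" for i using b(1) that BR by auto
  let ?s = "##i:V. b i*:i"
  have sR: "?s:$R" using bB VR by(intro finsum_closed) auto
  have "(##i:insert a V. b i*:i) = b a*:a +: ?s" by(rule finsum_insert[OF D(1) False]) (use bB VR a in auto)
  hence e: "b a*:a +: ?s = #0" using b(2) by simp
  have "b a ~= #0"
  proof
   assume z: "b a = #0"
   hence "?s = #0" using e a sR by simp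
   hence "b i = #0" if "i:V" for i using D(3)[of b i] bB that by blast
   thus False using b(3) z by blast
  qed
  moreover have "?s:sp B V" using sp_fin[of V "%x. x" ?s] D(1) VR bB by auto
  hence "\<ominus>\<^bsub>selfm R\<^esub> ?s:sp B V" using M.smD(5)[OF M.spn_sm] VR by simp
  moreover have "\<ominus>\<^bsub>selfm R\<^esub> ?s = \<ominus> ?s" by(simp add:a_inv_def m_inv_def selfm_def)
  moreover have "b a*:a = \<ominus> ?s" using e a sR bB by(metis insertI1 m_closed minus_equality)
  ultimately show ?thesis unfolding cl_def using a bB by auto
 qed
 thus ?thesis using V(1) by blast
qed

text \<open>Tower law for independence: \<open>B\<close> is the intermediate ring and contains the
  second family.\<close>

lemma ind_prod:
 assumes I: "ind B I u" and J: "ind S J v" and v: "!!j. j:J==> v j:B" and S: "S<:B"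
 shows "ind S (I \<times> J) (%p. u (fst p)*:v (snd p))"
proof (rule indI)
 note D = indD[OF I] and E = indD[OF J]
 show "finite (I \<times> J)" using D E by simp
 show "u (fst p)*:v (snd p):$R" if "p:I \<times> J" for p using that D E by auto
 fix b p assume b: "!!p. p:I \<times> J==> b p:S" and s: "(##p:I \<times> J. b p*:(u (fst p)*:v (snd p))) = #0" and p: "p:I \<times> J"
 have bB: "b (i,j):B" "b (i,j):$R" if "i:I" "j:J" for i j using b[of "(i,j)"] that S BR by auto
 have "(##p:I \<times> J. b p*:(u (fst p)*:v (snd p))) = (##i:I.##j:J. b (i,j)*:(u i*:v j))"
  using bB D E by(subst finsum_Times) auto
 also have "... = (##i:I.(##j:J. b (i,j)*:v j)*:u i)"
 proof (rule finsum_cong')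
  fix i assume i: "i:I"
  have "(##j:J. b (i,j)*:v j)*:u i = (##j:J.(b (i,j)*:v j)*:u i)" using i bB D E by(intro finsum_ldistr) auto
  also have "... = (##j:J. b (i,j)*:(u i*:v j))" using i bB D E by(intro finsum_cong') (auto simp:m_ac)
  finally show "(##j:J. b (i,j)*:(u i*:v j)) = (##j:J. b (i,j)*:v j)*:u i" by simp
 qed (use bB D E in \<open>auto intro!: finsum_closed m_closed\<close>)
 finally have z: "(##i:I.(##j:J. b (i,j)*:v j)*:u i) = #0" using s by simp
 obtain i j where ij: "i:I" "j:J" "p = (i,j)" using p by auto
 have "(##j:J. b (i,j)*:v j) = #0"
  by(rule D(3)[OF _ z ij(1)]) (use bB v E(1) subringE(6)[OF B] in \<open>auto intro!: B_finsum\<close>)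
 from E(3)[OF _ this ij(2)] show "b p = #0" using b ij by auto
qed

lemma ind_coord:
 assumes I: "ind B I v"
 shows "EX \<phi>.(ALL i:I. lm (R@:B) ((selfm R)\<lparr>carrier := sp B (v ` I)\<rparr>) (selfm R) (\<phi> i)) &
(ALL x:sp B (v ` I).(ALL i:I. \<phi> i x:B) & x = (##i:I. \<phi> i x*:v i)) &
(ALL b.(ALL i:I. b i:B)--> (ALL i:I. \<phi> i (##j:I. b j*:v j) = b i))"
proof -
 interpret M: mdl "R@:B" "selfm R" by(rule mdl_self)
 note D = indD[OF I]
 have vR: "v ` I<:$(selfm R)" using D by auto
 have "ALL x:sp B (v ` I). EX c.(ALL i:I. c i:B) & x = (##i:I. c i*:v i)" using sp_fin[where v=v, OF D(1,2)] by blast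
 from bchoice[OF this] obtain cf where cf: "ALL x:sp B (v ` I).(ALL i:I. cf x i:B) & x = (##i:I. cf x i*:v i)" by(elim exE)
 have c1: "cf x i:B" "cf x i:$R" if "x:sp B (v ` I)" "i:I" for x i using cf that BR by auto
 have c2: "x = (##i:I. cf x i*:v i)" if "x:sp B (v ` I)" for x using cf that by blast
 have uniq: "b i = c i" if b: "!!i. i:I==> b i:B" and c: "!!i. i:I==> c i:B"
  and e: "(##i:I. b i*:v i) = (##i:I. c i*:v i)" and i: "i:I" for b c i
 proof -
  have bc: "b i:$R" "c i:$R" if "i:I" for i using b c BR that by auto
  have "(##i:I.(b i -: c i)*:v i) +: (##i:I. c i*:v i) = (##i:I.(b i -: c i)*:v i +: c i*:v i)"
   using bc D by(intro finsum_addf[symmetric]) auto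
  also have "... = (##i:I. b i*:v i)" using bc D by(intro finsum_cong') (auto simp:l_distr[symmetric] add_diff_cancel)
  finally have "(##i:I.(b i -: c i)*:v i) +: (##i:I. c i*:v i) = #0 +: (##i:I. c i*:v i)" using e bc D by(simp add:finsum_closed)
  hence "(##i:I.(b i -: c i)*:v i) = #0" using bc D by(subst (asm) add.r_cancel) (auto intro!: finsum_closed)
  from D(3)[OF _ this i] have "b i -: c i = #0" using b c subringE(5,7)[OF B] by(simp add:a_minus_def)
  thus ?thesis using bc i diff_eq_iff by simp
 qed
 have sp: "(##i:I. b i*:v i):sp B (v ` I)" if "ALL i:I. b i:B" for b using sp_fin[where v=v, OF D(1,2)] that by blast
 have val: "cf (##i:I. b i*:v i) i = b i" if b: "ALL i:I. b i:B" and i: "i:I" for b i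
  by(rule uniq[OF _ _ _ i]) (use c1[OF sp[OF b]] c2[OF sp[OF b]] b in auto)
 have "lm (R@:B) ((selfm R)\<lparr>carrier := sp B (v ` I)\<rparr>) (selfm R) (%x. cf x i)" if i: "i:I" for i
 proof (rule lmI[OF M.sm_module[OF M.spn_sm[OF vR]] M.module_axioms])
  fix x y assume "x:$((selfm R)\<lparr>carrier := sp B (v ` I)\<rparr>)" "y:$((selfm R)\<lparr>carrier := sp B (v ` I)\<rparr>)"
  hence xy: "x:sp B (v ` I)" "y:sp B (v ` I)" by auto
  have "x +: y = (##i:I. cf x i*:v i) +: (##i:I. cf y i*:v i)" using c2[OF xy(1)] c2[OF xy(2)] by simp
  also have "... = (##i:I. cf x i*:v i +: cf y i*:v i)" using c1 xy D by(intro finsum_addf[symmetric]) auto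
  also have "... = (##i:I.(cf x i +: cf y i)*:v i)" using c1 xy D by(intro finsum_cong') (auto simp:l_distr)
  finally have "x +: y = (##i:I.(cf x i +: cf y i)*:v i)" .
  moreover have "cf (##i:I.(cf x i +: cf y i)*:v i) i = cf x i +: cf y i"
   by(rule val[OF _ i]) (use c1 xy subringE(7)[OF B] in auto)
  ultimately show "cf (x+[(selfm R)\<lparr>carrier := sp B (v ` I)\<rparr>] y) i = cf x i+[selfm R] cf y i" by simp
 next
  fix a x assume "a:$(R@:B)" "x:$((selfm R)\<lparr>carrier := sp B (v ` I)\<rparr>)"
  hence x: "a:B" "a:$R" "x:sp B (v ` I)" using BR by auto
  have "a*:x = a*:(##i:I. cf x i*:v i)" using c2[OF x(3)] by simp
  also have "... = (##i:I. a*:(cf x i*:v i))" using c1 x D by(intro finsum_rdistr) auto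
  also have "... = (##i:I.(a*:cf x i)*:v i)" using c1 x D by(intro finsum_cong') (auto simp:m_assoc)
  finally have "a*:x = (##i:I.(a*:cf x i)*:v i)" .
  moreover have "cf (##i:I.(a*:cf x i)*:v i) i = a*:cf x i"
   by(rule val[OF _ i]) (use c1 x subringE(6)[OF B] in auto)
  ultimately show "cf (a*[(selfm R)\<lparr>carrier := sp B (v ` I)\<rparr>] x) i = a*[selfm R] cf x i" by simp
 qed (use c1 i in auto)
 thus ?thesis using c1 c2 val by(intro exI[of _ "%i x. cf x i"]) blast
qed

text \<open>The minimal polynomial over the fraction field of \<open>B\<close> with denominators
  cleared, hence with leading coefficient nonzero but not normalised to 1.\<close>

lemma min_rel:
 fixes N :: nat
 assumes \<theta>: "\<theta> : $R" and N: "~ind B {..<N} (%k. \<theta> [^] k)"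
 shows "EX n f. n < N & ind B {..<n} (%k. \<theta> [^] k) & (ALL k<=n. f k:B) & f n ~= #0 & (##k:{..n}. f k *: \<theta> [^] k) = #0"
proof -
 let ?v = "%k::nat. \<theta> [^] k"
 define l where "l = (LEAST N.~ind B {..<N} ?v)"
 have l: "~ind B {..<l} ?v" "l <= N" unfolding l_def using LeastI[of "%N.~ind B {..<N} ?v", OF N] Least_le[of "%N.~ind B {..<N} ?v", OF N] by auto
 have "ind B {..<0::nat} ?v" by(rule indI) auto
 then obtain n where n: "l = Suc n" using l(1) by(cases l) auto
 have "n < (LEAST N.~ind B {..<N} ?v)" using n unfolding l_def by simp
 from not_less_Least[OF this] have i: "ind B {..<n} ?v" by blast
 obtain f where f: "f:{..<l} \<rightarrow> B" "(##k:{..<l}. f k*:?v k) = #0" "~(ALL k:{..<l}. f k = #0)"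
  using l(1) \<theta> unfolding ind_def by auto
 have ln: "{..<l} = {..n}" "{..<l} = insert n {..<n}" using n by auto
 have fB: "f k:B" if "k <= n" for k using f(1) that n by auto
 note fB = fB BR[OF fB]
 have "f n ~= #0"
 proof
  assume z: "f n = #0"
  have "(##k:{..<l}. f k*:?v k) = f n*:?v n +: (##k:{..<n}. f k*:?v k)"
   unfolding ln(2) using fB \<theta> by(intro finsum_insert) auto
  moreover have "(##k:{..<n}. f k*:?v k):$R" using fB \<theta> by(intro finsum_closed) auto
  ultimately have "(##k:{..<n}. f k*:?v k) = #0" using f(2) z \<theta> by simp
  hence "f k = #0" if "k < n" for k using indD(3)[OF i, of f k] fB that by auto
  thus False using f(3) z n by(auto simp:less_Suc_eq)
 qed
 thus ?thesis using i f(2) fB n l(2) unfolding ln(1) by(intro exI[of _ n] exI[of _ f]) auto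
qed

lemma fin_rel:
 assumes W: "finite W" "W<:$R" "$R<:cl B W" and \<theta>: "\<theta> : $R"
 shows "~ind B {..<Suc (card W)} (%k. \<theta> [^] (k::nat))"
proof
 assume i: "ind B {..<Suc (card W)} (%k. \<theta> [^] (k::nat))"
 have "\<theta> [^] (k::nat):cl B W" for k using W(3) nat_pow_closed[OF \<theta>] by blast
 thus False using ind_card[OF i W(1,2)] by simp
qed

text \<open>Split the constant term off the minimal relation of \<open>a\<close>: the rest is
  \<open>a\<close> times some \<open>?s\<close>, and the product is minus that constant term, hence
  in \<open>B\<close>.\<close>

lemma mult_in:
 assumes W: "finite W" "W<:$R" "$R<:cl B W" and a: "a:$R" "a ~= #0"
 shows "EX a':$R. a*:a':B & a*:a' ~= #0"
proof -
 obtain n f where f: "ind B {..<n::nat} (%k. a [^] k)" "ALL k<=n. f k:B" "f n ~= #0" "(##k:{..n}. f k*:a [^] k) = #0"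
  using min_rel[OF a(1) fin_rel[OF W a(1)]] by blast
 have fR: "f k:$R" if "k <= n" for k using f(2) that BR by blast
 show ?thesis
 proof (cases n)
  case 0
  hence "f 0 = #0" using f(4) fR finsum_0[of "%k. f k*:a [^] k"] by simp
  thus ?thesis using f(3) 0 by simp
 next
  case (Suc j)
  let ?s = "##k:{..j}. f (Suc k)*:a [^] k"
  have sR: "?s:$R" using fR a Suc by(intro finsum_closed) auto
  have "(##k:{..n}. f k*:a [^] k) = (##k:{..j}. f (Suc k)*:a [^] Suc k) +: f 0*:a [^] (0::nat)"
   unfolding Suc using fR a Suc by(intro finsum_Suc2) auto
  also have "(##k:{..j}. f (Suc k)*:a [^] Suc k) = (##k:{..j}. a*:(f (Suc k)*:a [^] k))"
   using fR a Suc by(intro finsum_cong') (auto simp:m_ac)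
  also have "... = a*:?s" using fR a Suc by(intro finsum_rdistr[symmetric]) auto
  finally have e: "a*:?s +: f 0 = #0" using f(4) fR by simp
  \<comment> \<open>\<open>?s\<close> is a relation of smaller degree with the same leading
    coefficient, so minimality keeps it nonzero.\<close>
  have "?s ~= #0"
  proof
   assume z: "?s = #0"
   have "f (Suc j) = #0" by(rule indD(3)[OF f(1), of "%k. f (Suc k)" j]) (use z f(2) Suc in \<open>auto simp:lessThan_Suc_atMost\<close>)
   thus False using f(3) Suc by simp
  qed
  hence "a*:?s ~= #0" using integral a sR by blast
  moreover have "a*:?s = \<ominus> f 0" using e sR a fR by(metis le0 m_closed minus_equality)
  ultimately show ?thesis using sR f(2) subringE(5)[OF B] by(metis le0)
 qed
qed

end

end

section \<open>Averaging\<close>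

lemma (in cring) smult_finsum_l:
 assumes "module R M" "finite I" "!!i. i:I==> a i:$R" "x:$M"
 shows "(##i:I. a i)*[M] x = (##[M]i:I. a i*[M] x)"
 using assms(2,3)
proof (induct I)
 interpret M: module R M by fact
 case empty show ?case using assms(4) by simp
next
 interpret M: module R M by fact
 case (insert i I)
 thus ?case using assms(4) by(simp add:finsum_insert M.finsum_insert M.smult_l_distr finsum_closed Pi_def)
qed

context cring begin

lemma pw_fac:
 assumes S: "subring S R" and c: "c:S" and B: "fac (R@:S) CC B B (%x. c*[B] x)" and E: "E:pw R B"
 shows "fac (R@:S) CC E E (%x. c*[E] x)"
 using E
proof (induct rule: pw.induct)
 case (zero Z)
 hence Zm: "module R Z" by(simp add:fin_gen_def)
 interpret Z: module R Z by fact
 have "c:$R" using c subringE(1)[OF S] by blast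
 thus ?case using zero module_restrict[OF Zm S] by(intro fac.zero) auto
next
 case (step N P p q i j)
 note D = bipD[OF step(3)]
 note L = lm_restrict[OF _ S]
 have cR: "c:$R" using c subringE(1)[OF S] by blast
 have "fac (R@:S) CC P P (%x. i (c*[B] p x)+[P] j (c*[N] q x))"
  using fac_add[OF fac_pre[OF fac_post[OF B L[OF D(3)]] L[OF D(1)]] fac_pre[OF fac_post[OF step(2) L[OF D(4)]] L[OF D(2)]]] .
 thus ?case
 proof (rule fac_cong)
  fix x assume x: "x:$P"
  interpret P: module R P by(rule lmD(1)[OF D(1)])
  have pq: "p x:$B" "q x:$N" "i (p x):$P" "j (q x):$P" using lmD(3)[OF D(1) x] lmD(3)[OF D(2) x] lmD(3)[OF D(3)] lmD(3)[OF D(4)] by auto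
  have "c*[P] x = c*[P] (i (p x)+[P] j (q x))" using D(9)[OF x] by simp
  also have "... = i (c*[B] p x)+[P] j (c*[N] q x)" using pq cR lmD(5)[OF D(3) cR pq(1)] lmD(5)[OF D(4) cR pq(2)] by(simp add:P.smult_r_distr)
  finally show "c*[P] x = i (c*[B] p x)+[P] j (c*[N] q x)" .
 qed
qed

text \<open>If \<open>\<theta>\<close> is a root of \<open>f\<close>, then \<open>\<Sum>\<^sub>k f\<^sub>k \<Sum>\<^sub>j\<^sub><\<^sub>k \<theta>\<^sup>k\<^sup>-\<^sup>1\<^sup>-\<^sup>j \<phi>(\<theta>\<^sup>j x)\<close> commutes with \<open>\<theta>\<close>;
 on sections \<open>\<phi>\<close> of \<open>g\<close> up to \<open>c\<close> it produces the factor \<open>f'(\<theta>)\<close>.\<close>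
lemma avg:
 fixes M E :: "'a umod" and n :: nat
 assumes C: "subring C R" and \<phi>: "lm (R@:C) M E \<phi>" and g: "lm R E M g"
  and gp: "!!x. x:$M==> g (\<phi> x) = c*[M] x" and c: "c:$R"
  and \<theta>: "\<theta> : $R" and f: "!!k. k <= n==> f k:C" and rel: "(##k:{..n}. f k *: \<theta> [^] k) = #0"
  and \<delta>: "\<delta> = (##k:{..n}. f k *: [k] \<cdot> (\<theta> [^] (k - 1)))"
 shows "EX T C'. subring C' R & C<:C' & \<theta> : C' & lm (R@:C') M E T & (ALL x:$M. g (T x) = (\<delta> *: c)*[M] x)"
proof -
 have Mm: "module R M" and Em: "module R E" using lmD(1,2)[OF g] by auto
 interpret M: mdl R M using Mm by rule
 interpret E: mdl R E using Em by rule
 note L = lm_restrict[OF _ C]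
 have fR: "f k:$R" if "k <= n" for k using f[OF that] subringE(1)[OF C] by blast
 \<comment> \<open>Horner form of the inner sum over j < k of \<theta>^(k-1-j) applied to \<phi> of
   \<theta>^j x.\<close>
 define U where "U k x = rec_nat 0[E] (%k u. \<theta> *[E] u+[E] \<phi> (\<theta> [^] k*[M] x)) k" for k :: nat and x
 have U0: "U 0 x = 0[E]" and US: "U (Suc k) x = \<theta> *[E] U k x+[E] \<phi> (\<theta> [^] k*[M] x)" for k x by(simp_all add:U_def)
 have sc: "lm (R@:C) M M (%x. r*[M] x)" "lm (R@:C) E E (%x. r*[E] x)" if "r:$R" for r
  using L[OF lm_smult[OF lm_id[OF Mm] that]] L[OF lm_smult[OF lm_id[OF Em] that]] by auto
 have Ul: "lm (R@:C) M E (U k)" for k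
 proof (induct k)
  case 0 show ?case by(rule lm_cong[OF lm_zero[OF module_restrict[OF Mm C] module_restrict[OF Em C]]]) (rule U0)
 next
  case (Suc k)
  have "lm (R@:C) M E (%x. \<theta> *[E] U k x+[E] \<phi> (\<theta> [^] k*[M] x))"
   using lm_add[OF lm_comp[OF Suc sc(2)[OF \<theta>]] lm_comp[OF sc(1) \<phi>, of "\<theta> [^] k"]] \<theta> by simp
  thus ?case by(rule lm_cong) (rule US)
 qed
 have Uc: "U k x:$E" if "x:$M" for k x using lmD(3)[OF Ul that] .
 have \<phi>c: "\<phi> x:$E" if "x:$M" for x using lmD(3)[OF \<phi> that] .
 define T where "T x = (##[E]k:{..n}. f k*[E] U k x)" for x
 have Tl: "lm (R@:C) M E T"
 proof -
  have "lm (R@:C) M E (%x.##[E]k:{..n}. f k*[E] U k x)"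
   using lmD(1,2)[OF \<phi>] lm_comp[OF Ul sc(2)[OF fR]] by(intro lm_sum) auto
  thus ?thesis by(rule lm_cong) (rule T_def)
 qed
 note Tc = lmD(3)[OF Tl]
 \<comment> \<open>The same sum with its j = 0 term split off instead of its last term; comparing
   both recursions gives commutation with \<open>\<theta>\<close>.\<close>
 have comm: "U (Suc k) x = U k (\<theta> *[M] x)+[E] \<theta> [^] k*[E] \<phi> x" if x: "x:$M" for k x
 proof (induct k)
  case 0 thus ?case using x \<theta> \<phi>c by(simp add:US U0)
 next
  case (Suc k)
  have e: "\<theta> [^] Suc k*[M] x = \<theta> [^] k*[M] (\<theta> *[M] x)" using x \<theta> by(simp add:M.smult_assoc1)
  have tx: "\<theta> *[M] x:$M" "\<theta> [^] k*[M] (\<theta> *[M] x):$M" using x \<theta> by auto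
  have "U (Suc (Suc k)) x = \<theta> *[E] (U k (\<theta> *[M] x)+[E] \<theta> [^] k*[E] \<phi> x)+[E] \<phi> (\<theta> [^] k*[M] (\<theta> *[M] x))"
   unfolding US[of "Suc k"] Suc e ..
  also have "... = U (Suc k) (\<theta> *[M] x)+[E] \<theta> [^] Suc k*[E] \<phi> x"
   using Uc[OF tx(1)] \<phi>c[OF x] \<phi>c[OF tx(2)] \<theta> by(simp add:US E.smult_r_distr E.smult_assoc1[symmetric] m_comm E.a_ac)
  finally show ?case .
 qed
 \<comment> \<open>The two boundary sums are f(\<theta>) acting on \<open>\<phi> x\<close> and,
   inside \<open>\<phi>\<close>, on \<open>x\<close>; both vanish because \<open>\<theta>\<close> is
   a root.\<close>
 have T\<theta>: "T (\<theta> *[M] x) = \<theta> *[E] T x" if x: "x:$M" for x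
 proof -
  have tx: "\<theta> *[M] x:$M" "!!k::nat. \<theta> [^] k*[M] x:$M" using x \<theta> by auto
  have "T (\<theta> *[M] x)+[E] (##[E]k:{..n}. f k*[E] (\<theta> [^] k*[E] \<phi> x)) = (##[E]k:{..n}. f k*[E] U k (\<theta> *[M] x)+[E] f k*[E] (\<theta> [^] k*[E] \<phi> x))"
   unfolding T_def using fR Uc[OF tx(1)] \<phi>c[OF x] \<theta> by(intro E.finsum_addf[symmetric]) auto
  also have "... = (##[E]k:{..n}. f k*[E] U (Suc k) x)"
   using fR Uc[OF x] Uc[OF tx(1)] \<phi>c[OF x] \<theta> by(intro E.finsum_cong') (auto simp:comm[OF x] E.smult_r_distr)
  also have "... = (##[E]k:{..n}. \<theta> *[E] (f k*[E] U k x)+[E] \<phi> (f k*[M] (\<theta> [^] k*[M] x)))"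
  proof (rule E.finsum_cong')
   fix k assume "k:{..n}"
   hence k: "f k:C" "f k:$R" using f fR by auto
   show "f k*[E] U (Suc k) x = \<theta> *[E] (f k*[E] U k x)+[E] \<phi> (f k*[M] (\<theta> [^] k*[M] x))"
    using lmD(5)[OF \<phi>, of "f k" "\<theta> [^] k*[M] x"] k tx(2)[of k] Uc[OF x] \<phi>c[OF tx(2)] \<theta> by(simp add:US E.smult_r_distr E.smult_assoc1[symmetric] m_comm)
  qed (use fR Uc[OF x] \<phi>c tx \<theta> in auto)
  also have "... = (##[E]k:{..n}. \<theta> *[E] (f k*[E] U k x))+[E] (##[E]k:{..n}. \<phi> (f k*[M] (\<theta> [^] k*[M] x)))"
   using fR Uc[OF x] \<phi>c tx \<theta> by(intro E.finsum_addf) auto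
  also have "(##[E]k:{..n}. \<theta> *[E] (f k*[E] U k x)) = \<theta> *[E] T x"
   unfolding T_def using fR Uc[OF x] \<theta> by(intro E.finsum_smult_ldistr[symmetric]) auto
  also have "(##[E]k:{..n}. \<phi> (f k*[M] (\<theta> [^] k*[M] x))) = \<phi> (##[M]k:{..n}. f k*[M] (\<theta> [^] k*[M] x))"
   using fR tx by(intro lm_finsum[OF \<phi>, symmetric]) auto
  also have "(##[M]k:{..n}. f k*[M] (\<theta> [^] k*[M] x)) = 0[M]"
  proof -
   have "(##[M]k:{..n}. f k*[M] (\<theta> [^] k*[M] x)) = (##[M]k:{..n}.(f k *: \<theta> [^] k)*[M] x)"
    using fR \<theta> x by(intro M.finsum_cong') (auto simp:M.smult_assoc1)
   also have "... = (##k:{..n}. f k *: \<theta> [^] k)*[M] x" using fR \<theta> x by(intro smult_finsum_l[OF Mm, symmetric]) auto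
   finally show ?thesis using rel x by simp
  qed
  also have "(##[E]k:{..n}. f k*[E] (\<theta> [^] k*[E] \<phi> x)) = 0[E]"
  proof -
   have "(##[E]k:{..n}. f k*[E] (\<theta> [^] k*[E] \<phi> x)) = (##[E]k:{..n}.(f k *: \<theta> [^] k)*[E] \<phi> x)"
    using fR \<theta> \<phi>c[OF x] by(intro E.finsum_cong') (auto simp:E.smult_assoc1)
   also have "... = (##k:{..n}. f k *: \<theta> [^] k)*[E] \<phi> x" using fR \<theta> \<phi>c[OF x] by(intro smult_finsum_l[OF Em, symmetric]) auto
   finally show ?thesis using rel \<phi>c[OF x] by simp
  qed
  finally show ?thesis using lmD(6)[OF \<phi>] Tc[OF x] Tc[OF tx(1)] \<theta> by simp
 qed
 \<comment> \<open>The scalars that commute with \<open>T\<close> form a subring, so linearity over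
   \<open>C\<close> and over \<open>\<theta>\<close> combine.\<close>
 let ?C = "{a:$R. ALL x:$M. T (a*[M] x) = a*[E] T x}"
 have Ta: "T (x+[M] y) = T x+[E] T y" if "x:$M" "y:$M" for x y using lmD(4)[OF Tl that] .
 have sub: "subring ?C R"
 proof (rule subringI)
  fix a b assume a: "a:?C" and b: "b:?C"
  show "a*:b:?C" using a b Tc by(auto simp:M.smult_assoc1 E.smult_assoc1)
  show "a +: b:?C" using a b Tc Ta by(auto simp:M.smult_l_distr E.smult_l_distr)
 next
  fix a assume a: "a:?C"
  thus "\<ominus> a:?C" using Tc lmD(7)[OF Tl] by(auto simp:M.smult_l_minus E.smult_l_minus)
 qed (use Tc in auto)
 have CC: "C<:?C" using lmD(5)[OF Tl] subringE(1)[OF C] by auto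
 have lT: "lm (R@:?C) M E T"
  by(rule lmI[OF module_restrict[OF Mm sub] module_restrict[OF Em sub]]) (use Tc Ta in auto)
 \<comment> \<open>\<open>g\<close> is linear over \<open>R\<close>, so each of the k terms of the
   sum contributes the same \<theta>^(k-1) c: this produces the derivative.\<close>
 have gU: "g (U k x) = ([k] \<cdot> (\<theta> [^] (k - 1))*:c)*[M] x" if x: "x:$M" for k x
 proof (induct k)
  case 0 thus ?case using lmD(6)[OF g] U0 x c by simp
 next
  case (Suc k)
  have tk: "\<theta> *: [k] \<cdot> (\<theta> [^] (k - 1)) = [k] \<cdot> (\<theta> [^] k)"
  proof (cases k)
   case (Suc j) thus ?thesis using add_pow_rdistr[of \<theta> "\<theta> [^] j" k] \<theta> by(simp add:m_comm)
  qed (use \<theta> in simp)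
  have tx: "\<theta> [^] k*[M] x:$M" using x \<theta> by simp
  have "g (U (Suc k) x) = \<theta> *[M] g (U k x)+[M] c*[M] (\<theta> [^] k*[M] x)"
   using lmD(4)[OF g, of "\<theta> *[E] U k x" "\<phi> (\<theta> [^] k*[M] x)"] lmD(5)[OF g \<theta> Uc[OF x, of k]] gp[OF tx] Uc[OF x] \<phi>c[OF tx] \<theta> by(simp add:US)
  also have "... = ((\<theta> *: [k] \<cdot> (\<theta> [^] (k - 1)))*:c +: \<theta> [^] k*:c)*[M] x"
   unfolding Suc using x \<theta> c by(simp add:M.smult_l_distr M.smult_assoc1[symmetric] m_assoc m_comm[of c])
  also have "(\<theta> *: [k] \<cdot> (\<theta> [^] (k - 1)))*:c +: \<theta> [^] k*:c = [Suc k] \<cdot> (\<theta> [^] (Suc k - 1))*:c"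
   unfolding tk using \<theta> c by(simp add:l_distr)
  finally show ?case .
 qed
 have "g (T x) = (\<delta> *: c)*[M] x" if x: "x:$M" for x
 proof -
  have "g (T x) = (##[M]k:{..n}. g (f k*[E] U k x))" unfolding T_def using fR Uc[OF x] by(intro lm_finsum[OF g]) auto
  also have "... = (##[M]k:{..n}.(f k *: [k] \<cdot> (\<theta> [^] (k - 1)))*[M] (c*[M] x))"
  proof (rule M.finsum_cong')
   fix k assume "k:{..n}"
   thus "g (f k*[E] U k x) = (f k *: [k] \<cdot> (\<theta> [^] (k - 1)))*[M] (c*[M] x)"
    using lmD(5)[OF g fR Uc[OF x]] gU[OF x] fR \<theta> c x by(simp add:M.smult_assoc1)
  qed (use fR \<theta> c x in auto)
  also have "... = \<delta> *[M] (c*[M] x)" unfolding \<delta> using fR \<theta> c x by(intro smult_finsum_l[OF Mm, symmetric]) auto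
  finally show ?thesis using x c fR \<theta> by(simp add:M.smult_assoc1 \<delta> finsum_closed)
 qed
 thus ?thesis using sub CC lT T\<theta> \<theta> by blast
qed

end

section \<open>Simple roots, and averaging over all generators\<close>

context domain begin

text \<open>\<open>\<theta>\<close> is a simple root of some polynomial over \<open>S\<close>, that
  is, separable over the fraction field of \<open>S\<close>.\<close>

definition sepr :: "'a set=> 'a=> bool" where
 "sepr S \<theta> \<longleftrightarrow> (EX (n::nat) f.(ALL k<=n. f k:S) & (##k:{..n}. f k *: \<theta> [^] k) = #0 &
(##k:{..n}. f k *: [k] \<cdot> (\<theta> [^] (k - 1))) ~= #0)"

context fixes S assumes S: "subring S R"
begin

text \<open>One averaging for each element of \<Theta>, with the subring of linearity growing each
  time. \<open>D\<close> is the product of the derivative values and is fixed before the modules are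
  chosen, as a uniform \<open>x\<close> requires.\<close>

lemma avg_all:
 assumes "finite \<Theta>" "\<Theta> <: $R" "!!\<theta>. \<theta> : \<Theta>==> sepr S \<theta>"
 shows "EX D:$R. D ~= #0 & (ALL (M :: 'a umod) (E :: 'a umod) g \<phi>. ALL c:$R. lm (R@:S) M E \<phi>--> lm R E M g -->
(ALL x:$M. g (\<phi> x) = c*[M] x)--> (EX T C'. subring C' R & S<:C' & \<Theta> <: C' & lm (R@:C') M E T &
(ALL x:$M. g (T x) = (D*:c)*[M] x)))"
 using assms
proof (induct)
 case empty
 show ?case
 proof (intro bexI[of _ \<one>] conjI allI ballI impI)
  fix M E :: "'a umod" and g \<phi> c assume "c:$R" "lm (R@:S) M E \<phi>" "ALL x:$M. g (\<phi> x) = c*[M] x"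
  thus "EX T C'. subring C' R & S<:C' & {}<:C' & lm (R@:C') M E T & (ALL x:$M. g (T x) = (#1*:c)*[M] x)"
   using S by(intro exI[of _ \<phi>] exI[of _ S]) auto
 qed auto
next
 case (insert \<theta> \<Theta>)
 then obtain D where D: "D:$R" "D ~= #0" and H: "ALL (M :: 'a umod) (E :: 'a umod) g \<phi>. ALL c:$R. lm (R@:S) M E \<phi>--> lm R E M g -->
(ALL x:$M. g (\<phi> x) = c*[M] x)--> (EX T C'. subring C' R & S<:C' & \<Theta> <: C' & lm (R@:C') M E T &
(ALL x:$M. g (T x) = (D*:c)*[M] x))" by auto
 have \<theta>: "\<theta> : $R" using insert by simp
 obtain n :: nat and f where f: "!!k. k <= n==> f k:S" "(##k:{..n}. f k *: \<theta> [^] k) = #0" "(##k:{..n}. f k *: [k] \<cdot> (\<theta> [^] (k - 1))) ~= #0"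
  using insert(5)[of \<theta>] unfolding sepr_def by auto
 define \<delta> where "\<delta> = (##k:{..n}. f k *: [k] \<cdot> (\<theta> [^] (k - 1)))"
 have fR: "f k:$R" if "k <= n" for k using f(1)[OF that] subringE(1)[OF S] by blast
 have \<delta>: "\<delta> : $R" "\<delta> ~= #0" using f(3) fR \<theta> by(auto simp:\<delta>_def intro!: finsum_closed)
 show ?case
 proof (intro bexI[of _ "\<delta> *: D"] conjI allI ballI impI)
  show "\<delta> *: D ~= #0" using integral \<delta> D by blast
  show "\<delta> *: D:$R" using \<delta> D by simp
  fix M E :: "'a umod" and g \<phi> c assume c: "c:$R" and l: "lm (R@:S) M E \<phi>" "lm R E M g" "ALL x:$M. g (\<phi> x) = c*[M] x"
  obtain T C' where T: "subring C' R" "S<:C'" "\<Theta> <: C'" "lm (R@:C') M E T" "ALL x:$M. g (T x) = (D*:c)*[M] x"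
   using H[rule_format, OF c l(1,2)] l(3) by blast
  have "EX T' C''. subring C'' R & C'<:C'' & \<theta> : C'' & lm (R@:(C'')) M E T' & (ALL x:$M. g (T' x) = (\<delta> *: (D*:c))*[M] x)"
   by(rule avg[OF T(1,4) l(2) _ _ \<theta> _ f(2) \<delta>_def]) (use T(2,5) f(1) c D in auto)
  then obtain T' C'' where T': "subring C'' R" "C'<:C''" "\<theta> : C''" "lm (R@:(C'')) M E T'" "ALL x:$M. g (T' x) = (\<delta> *: (D*:c))*[M] x" by blast
  thus "EX T C'. subring C' R & S<:C' & insert \<theta> \<Theta> <: C' & lm (R@:C') M E T & (ALL x:$M. g (T x) = (\<delta> *: D*:c)*[M] x)"
   using T(2,3) \<delta> D c by(intro exI[of _ T'] exI[of _ C'']) (auto simp:m_assoc)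
 qed
qed

lemma fin_gen_restrict:
 assumes e: "finite e" "e<:$R" "$R<:sp S e" and M: "fin_gen R M"
 shows "fin_gen (R@:S) M"
proof -
 have Mm: "module R M" using M by(simp add:fin_gen_def)
 interpret M: mdl R M using Mm by rule
 interpret MS: mdl "R@:S" M using module_restrict[OF Mm S] by rule
 obtain V where V: "finite V" "V<:$M" "$M<:spn R M V" using M M.fin_gen_iff by blast
 define W where "W = (%(a,v). a*[M] v) ` (e \<times> V)"
 have W: "finite W" "W<:$M" using e V by(auto simp:W_def)
 have rv: "r*[M] v:spn (R@:S) M W" if "r:$R" "v:V" for r v
 proof -
  have v: "v:$M" using that V by blast
  have "lm R (selfm R) M (%a. a*[M] v)" by(rule lmI[OF module_selfm Mm]) (use v in \<open>auto simp:M.smult_l_distr M.smult_assoc1\<close>)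
  from lm_image_spn[OF lm_restrict[OF this S], of e] e that(1)
  have "r*[M] v:spn (R@:S) M ((%a. a*[M] v) ` e)" by auto
  moreover have "(%a. a*[M] v) ` e<:W" using that(2) by(auto simp:W_def)
  ultimately show ?thesis using MS.spn_mono[OF _ W(2)] by blast
 qed
 have "x:spn (R@:S) M W" if "x:spn R M V" for x
  using that by(induct rule: spn.induct) (use rv MS.spn_add[OF W(2)] spn.zero in auto)
 thus ?thesis using V(3) W MS.fin_gen_iff by blast
qed

text \<open>Zero annihilator makes \<open>B\<close> a copy of \<open>R\<close>. Multiplication by
  \<open>c\<close> maps it into the free \<open>S\<close>-module on \<open>V\<close>, and the
  coordinates there give the factorisation term by term.\<close>

lemma cyc_fac:
 assumes V: "V<:$R" "ind S V (%x. x)" and c: "c:S" "!!a. a:$R==> c*:a:sp S V" and B: "cyc B b { #0}"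
 shows "fac (R@:S) {free_mod (R@:S) 1} B B (%x. c*[B] x)"
proof -
 let ?S = "R@:S" and ?F = "free_mod (R@:S) 1"
 have Bm: "module R B" and b: "b:$B" using B by(auto simp:cyc_def fin_gen_def)
 interpret B: mdl R B using Bm by rule
 interpret Sr: cring ?S using sub_cring[OF S] .
 interpret F: mdl ?S ?F using Sr.module_free by rule
 have cR: "c:$R" using c(1) subringE(1)[OF S] by blast
 have h: "lm R (selfm R) B (%r. r*[B] b)" by(rule lmI[OF module_selfm Bm]) (use b in \<open>auto simp:B.smult_l_distr B.smult_assoc1\<close>)
 have "inj_on (%r. r*[B] b) ($(selfm R))" using B by(intro lm_inj[OF h]) (auto simp:cyc_def)
 moreover have "(%r. r*[B] b) ` $(selfm R) = $B" using B b by(auto simp:cyc_def)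
 ultimately obtain \<rho> where \<rho>: "lm R B (selfm R) \<rho>" "ALL y:$B. \<rho> y*[B] b = y"
  using lm_inverse[OF h] by(auto simp:bij_betw_def)
 obtain \<phi> where \<phi>: "!!i. i:V==> lm ?S ((selfm R)\<lparr>carrier := sp S ((%x. x) ` V)\<rparr>) (selfm R) (\<phi> i)"
  "!!x i. x:sp S ((%x. x) ` V)==> i:V==> \<phi> i x:S" "!!x. x:sp S ((%x. x) ` V)==> x = (##i:V. \<phi> i x*:i)"
  using ind_coord[OF S V(2)] by blast
 have idV: "(%x. x) ` V = V" by simp
 note \<phi> = \<phi>[unfolded idV]
 have \<rho>c: "\<rho> x:$R" if "x:$B" for x using lmD(3)[OF \<rho>(1) that] by simp
 let ?t = "%x. c *: \<rho> x"
 have tl: "lm R B (selfm R) ?t" using lm_smult[OF \<rho>(1) cR] by simp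
 have tS: "?t x:sp S V" if "x:$B" for x using c(2) \<rho>c[OF that] by blast
 interpret M: mdl ?S "selfm R" by(rule mdl_self[OF S])
 have VS: "V<:$(selfm R)" using V(1) by simp
 have t: "lm ?S B ((selfm R)\<lparr>carrier := sp S V\<rparr>) ?t"
  by(rule lmI[OF module_restrict[OF Bm S] M.sm_module[OF M.spn_sm[OF VS]]])
   (use tS lmD(4)[OF tl] lmD(5)[OF tl] subringE(1)[OF S] in auto)
 have finV: "finite V" using indD(1)[OF V(2)] .
 have "fac ?S {?F} B B (%x.##[B]i:W. \<phi> i (?t x)*[B] (i*[B] b))" if W: "finite W" "W<:V" for W
  using W
 proof (induct)
  case empty thus ?case using module_restrict[OF Bm S] by(intro fac.zero) auto
 next
  case (insert v W)
  have v: "v:V" "v:$R" using insert V by auto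
  have pS: "\<phi> i (?t x):S" if "x:$B" "i:V" for i x using \<phi>(2)[OF tS[OF that(1)] that(2)] .
  have l1: "lm ?S B ?F (%x. \<lambda>i\<in>{..<1::nat}. \<phi> v (?t x))"
  proof (rule lmI[OF module_restrict[OF Bm S] Sr.module_free])
   note l = lm_comp[OF t \<phi>(1)[OF v(1)]]
   show "(\<lambda>i\<in>{..<1::nat}. \<phi> v (?t x)):$?F" if "x:$B" for x using pS[OF that v(1)] by(auto simp:free_mod_carrier)
   show "(\<lambda>i\<in>{..<1::nat}. \<phi> v (?t (x+[B] y))) = (\<lambda>i\<in>{..<1::nat}. \<phi> v (?t x))+[?F] (\<lambda>i\<in>{..<1::nat}. \<phi> v (?t y))" if "x:$B" "y:$B" for x y
    using lmD(4)[OF l that] by(auto simp:free_mod_def fun_eq_iff)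
   show "(\<lambda>i\<in>{..<1::nat}. \<phi> v (?t (a*[B] x))) = a*[?F] (\<lambda>i\<in>{..<1::nat}. \<phi> v (?t x))" if "a:$?S" "x:$B" for a x
    using lmD(5)[OF l that] by(auto simp:free_mod_def fun_eq_iff)
  qed
  have l2: "lm ?S ?F B (%u. u 0*[B] (v*[B] b))"
  proof (rule lmI[OF Sr.module_free module_restrict[OF Bm S]])
   have u: "u 0:$R" if "u:$?F" for u using free_mod_nth[OF that, of 0] subringE(1)[OF S] by auto
   show "u 0*[B] (v*[B] b):$B" if "u:$?F" for u using u[OF that] v b by simp
   show "(u+[?F] w) 0*[B] (v*[B] b) = u 0*[B] (v*[B] b)+[B] w 0*[B] (v*[B] b)" if "u:$?F" "w:$?F" for u w
    using u[OF that(1)] u[OF that(2)] v b by(simp add:free_mod_def B.smult_l_distr)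
   show "(a*[?F] u) 0*[B] (v*[B] b) = a*[B] (u 0*[B] (v*[B] b))" if "a:$?S" "u:$?F" for a u
    using u[OF that(2)] that(1) subringE(1)[OF S] v b by(simp add:free_mod_def B.smult_assoc1 subset_iff)
  qed
  have "fac ?S {?F} B B (%x.##[B]i:W. \<phi> i (?t x)*[B] (i*[B] b))" using insert by auto
  from fac.step[OF this singletonI l1 l2] show ?case
  proof (rule fac_cong)
   fix x assume x: "x:$B"
   have R: "\<phi> i (?t x):$R" "i:$R" if "i:V" for i using pS[OF x that] subringE(1)[OF S] that V(1) by auto
   have "(##[B]i:insert v W. \<phi> i (?t x)*[B] (i*[B] b)) = \<phi> v (?t x)*[B] (v*[B] b)+[B] (##[B]i:W. \<phi> i (?t x)*[B] (i*[B] b))"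
    by(rule B.finsum_insert) (use insert R b in auto)
   thus "(##[B]i:insert v W. \<phi> i (?t x)*[B] (i*[B] b)) = (\<lambda>i\<in>{..<1::nat}. \<phi> v (?t x)) 0*[B] (v*[B] b)+[B] (##[B]i:W. \<phi> i (?t x)*[B] (i*[B] b))" by simp
  qed (rule refl)
 qed
 from this[OF finV order_refl] show ?thesis
 proof (rule fac_cong)
  fix x assume x: "x:$B"
  have R: "\<phi> i (?t x):$R" "i:$R" if "i:V" for i using \<phi>(2)[OF tS[OF x] that] subringE(1)[OF S] that V(1) by auto
  have "c*[B] x = c*[B] (\<rho> x*[B] b)" using \<rho>(2) x by simp
  also have "... = ?t x*[B] b" using cR \<rho>c[OF x] b by(simp add:B.smult_assoc1)
  also have "... = (##i:V. \<phi> i (?t x)*:i)*[B] b" using \<phi>(3)[OF tS[OF x]] by simp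
  also have "... = (##[B]i:V.(\<phi> i (?t x)*:i)*[B] b)" using R b finV by(intro smult_finsum_l[OF Bm]) auto
  also have "... = (##[B]i:V. \<phi> i (?t x)*[B] (i*[B] b))" using R b by(intro B.finsum_cong') (auto simp:B.smult_assoc1)
  finally show "c*[B] x = (##[B]i:V. \<phi> i (?t x)*[B] (i*[B] b))" .
 qed
qed

text \<open>The product of denominators for the finitely many module generators works for all of
  \<open>R\<close>.\<close>

lemma near_free:
 assumes V: "V<:$R" "$R<:cl S V" and e: "finite e" "e<:$R" "$R<:sp S e"
 shows "EX c:S. c ~= #0 & (ALL a:$R. c*:a:sp S V)"
proof -
 interpret M: mdl "R@:S" "selfm R" by(rule mdl_self[OF S])
 have VS: "V<:$(selfm R)" using V(1) by simp
 have SR: "s:$R" if "s:S" for s using that subringE(1)[OF S] by blast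
 have "EX c:S. c ~= #0 & (ALL a:e. c*:a:sp S V)" using e(1,2)
 proof (induct)
  case empty show ?case using subringE(3)[OF S] by(intro bexI[of _ \<one>]) auto
 next
  case (insert x e)
  then obtain c where c: "c:S" "c ~= #0" "ALL a:e. c*:a:sp S V" by auto
  obtain b where b: "b:S" "b ~= #0" "b*:x:sp S V" using V(2) insert by(auto simp:cl_def)
  have "(b*:c)*:a:sp S V" if a: "a:insert x e" for a
  proof -
   have aR: "a:$R" using a insert by auto
   show ?thesis
   proof (cases "a = x")
    case True
    have "(b*:c)*:a = c*:(b*:x)" using True aR b c SR by(simp add:m_ac)
    thus ?thesis using M.spn_smult[OF VS, of c "b*:x"] b c by simp
   next
    case False
    hence "c*:a:sp S V" using c a by blast
    moreover have "(b*:c)*:a = b*:(c*:a)" using aR b c SR by(simp add:m_ac)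
    ultimately show ?thesis using M.spn_smult[OF VS, of b "c*:a"] b by simp
   qed
  qed
  moreover have "b*:c ~= #0" using integral b c SR by blast
  ultimately show ?case using subringE(6)[OF S b(1) c(1)] by blast
 qed
 then obtain c where c: "c:S" "c ~= #0" "ALL a:e. c*:a:sp S V" by blast
 have l: "lm (R@:S) (selfm R) (selfm R) (%x. c*:x)"
  using lm_restrict[OF lm_smult[OF lm_id[OF module_selfm] SR[OF c(1)]] S] by simp
 have "sm (R@:S) (selfm R) {a:$(selfm R). c*:a:sp S V}" using lm_vimage[OF l M.spn_sm[OF VS]] .
 hence "sp S e<:{a:$(selfm R). c*:a:sp S V}" using M.spn_least c(3) e(2) by auto
 thus ?thesis using c e(3) by auto
qed

text \<open>Over \<open>S\<close> the finite projective dimension gives a section up to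
  \<open>c^(2 s)\<close>; averaging along the generators \<open>e\<close> makes it linear over
  \<open>R\<close> at the cost of \<open>D\<close>. Both constants depend on \<open>R\<close> and
  \<open>S\<close> only.\<close>

lemma lift_thm:
 assumes e: "finite e" "e<:$R" "$R<:sp S e" and gd: "!!N :: 'a umod. fin_gen (R@:S) N==> pdf (R@:S) s N"
  and sep: "!!\<theta>. \<theta> : $R==> sepr S \<theta>"
 shows "EX x:$R. x ~= #0 & (ALL B b (M :: nat=> 'a umod) E f g. cyc B b { #0}--> (ALL i<=s. ses R (M (Suc i)) (E i) (M i) (f i) (g i) & E i:pw R B) -->
fin_gen R (M 0)--> (EX h. lm R (M s) (E s) h & (ALL y:$(M s). g s (h y) = x*[M s] y)))"
proof -
 let ?S = "R@:S"
 interpret Sr: cring ?S using sub_cring[OF S] .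
 have SR: "s:$R" if "s:S" for s using that subringE(1)[OF S] by blast
 have "$R<:cl S e" using e(3) sp_sub_cl[OF S e(2)] by blast
 then obtain V where V: "V<:$R" "ind S V (%x. x)" "$R<:cl S V" using ex_basis[OF S e(1,2) order_refl, of "{}"] indI[of "{}"] by auto
 obtain c where c: "c:S" "c ~= #0" "ALL a:$R. c*:a:sp S V" using near_free[OF V(1,3) e] by blast
 obtain D where D: "D:$R" "D ~= #0" and H: "ALL (M :: 'a umod) (E :: 'a umod) g \<phi>. ALL c:$R. lm ?S M E \<phi>--> lm R E M g -->
(ALL x:$M. g (\<phi> x) = c*[M] x)--> (EX T C'. subring C' R & S<:C' & e<:C' & lm (R@:C') M E T &
(ALL x:$M. g (T x) = (D*:c)*[M] x))" using avg_all[OF e(1,2)] sep e(2) by blast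
 have cR: "c [^] (2 * s):$R" using c SR by simp
 show ?thesis
 proof (intro bexI[of _ "D*:c [^] (2 * s)"] conjI allI impI)
  show "D*:c [^] (2 * s):$R" using D cR by simp
  show "D*:c [^] (2 * s) ~= #0" using integral[of D "c [^] (2 * s)"] D cR pow_eq_zero[of c "2 * s"] c SR by blast
  fix B b E f g and M :: "nat=> 'a umod" assume B: "cyc B b { #0}" and ch: "ALL i<=s. ses R (M (Suc i)) (E i) (M i) (f i) (g i) & E i:pw R B" and M0: "fin_gen R (M 0)"
  have fB: "fac ?S {free_mod ?S 1} B B (%x. c*[B] x)" using cyc_fac[OF V(1,2) c(1) _ B] c(3) by blast
  have ch': "ALL i<=s. ses ?S (M (Suc i)) (E i) (M i) (f i) (g i) & fac ?S {free_mod ?S 1} (E i) (E i) (%x. c*[E i] x)"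
   using ch ses_restrict[OF _ S] pw_fac[OF S c(1) fB] by blast
  have pd: "pdl ?S s (M 0)" using Sr.pdf_pdl[OF gd[OF fin_gen_restrict[OF e M0]]] .
  have c': "c:$?S" using c by simp
  obtain h where h: "lm ?S (M s) (E s) h" "ALL y:$(M s). g s (h y) = c [^]\<^bsub>?S\<^esub> (2 * s)*[M s] y"
   using Sr.near_split[OF c' pd ch'] by blast
  have h2: "ALL y:$(M s). g s (h y) = c [^] (2 * s)*[M s] y" using h(2) by(simp add:nat_pow_consistent[symmetric])
  have gl: "lm R (E s) (M s) (g s)" using ch sesD(2) by blast
  obtain T C' where T: "subring C' R" "S<:C'" "e<:C'" "lm (R@:C') (M s) (E s) T" "ALL x:$(M s). g s (T x) = (D*:c [^] (2 * s))*[M s] x"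
   using H[rule_format, OF cR h(1) gl] h2 by blast
  \<comment> \<open>\<open>C'\<close> contains \<open>S\<close> and the generators \<open>e\<close>,
    so as an \<open>S\<close>-submodule it is all of \<open>R\<close>.\<close>
  have "sm ?S (selfm R) C'" using T(1,2) subringE(1,2,6,7)[OF T(1)] by(auto simp:sm_def)
  hence "sp S e<:C'" using mdl.spn_least[OF mdl_self[OF S] _ T(3)] by blast
  hence "C' = $R" using e(3) subringE(1)[OF T(1)] by blast
  hence "lm R (M s) (E s) T" using T(4) by simp
  thus "EX h. lm R (M s) (E s) h & (ALL y:$(M s). g s (h y) = (D*:c [^] (2 * s))*[M s] y)" using T(5) by blast
 qed
qed

end

end

section \<open>The p-step\<close>

lemma (in abelian_monoid) finsum_sub:
 assumes "!!x. x:U==> x:$G" "#0:U" "!!x y. x:U==> y:U==> x +: y:U"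
  and "finite I" "!!i. i:I==> h i:U"
 shows "(##[G\<lparr>carrier := U\<rparr>]i:I. h i) = (##i:I. h i)"
proof -
 interpret U: abelian_monoid "G\<lparr>carrier := U\<rparr>"
  by(rule abelian_monoidI) (use assms(1-3) a_assoc a_comm in auto)
 show ?thesis using assms(4,5)
 proof (induct I)
  case (insert i I)
  thus ?case using assms(1) finsum_insert[of I i h] U.finsum_insert[of I i h] by(auto simp:Pi_def)
 qed simp
qed

context domain begin

lemma ind_subset: assumes B: "subring B R" and i: "ind B I v" "J<:I" shows "ind B J v"
proof (rule indI)
 note D = indD[OF i(1)]
 show "finite J" using D(1) i(2) finite_subset by blast
 show "v i:$R" if "i:J" for i using D(2) i(2) that by blast
 fix b i assume b: "!!i. i:J==> b i:B" and s: "(##i:J. b i*:v i) = #0" and iJ: "i:J"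
 let ?b = "%i. if i:J then b i else #0"
 have BR: "b i:$R" if "i:J" for i using b[OF that] subringE(1)[OF B] by blast
 have "(##i:J. b i*:v i) = (##i:I. ?b i*:v i)"
  by(rule add.finprod_mono_neutral_cong_left[OF D(1) i(2)]) (use BR D(2) in auto)
 hence "(##i:I. ?b i*:v i) = #0" using s by simp
 from D(3)[of ?b i, OF _ this] show "b i = #0" using b iJ i(2) subringE(2)[OF B] by auto
qed

lemma ind_reindex: assumes B: "subring B R" and i: "ind B I v" and h: "bij_betw h J I" shows "ind B J (%j. v (h j))"
proof (rule indI)
 note D = indD[OF i]
 have hI: "h ` J = I" "inj_on h J" using h by(auto simp:bij_betw_def)
 show "finite J" using D(1) h bij_betw_finite by blast
 show "v (h j):$R" if "j:J" for j using D(2) hI that by blast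
 fix b j assume b: "!!i. i:J==> b i:B" and s: "(##i:J. b i*:v (h i)) = #0" and j: "j:J"
 let ?b = "%i. b (inv_into J h i)"
 have inv: "inv_into J h (h j) = j" if "j:J" for j using inv_into_f_f[OF hI(2) that] .
 have bR: "b i:$R" if "i:J" for i using b[OF that] subringE(1)[OF B] by blast
 have "(##i:h ` J. ?b i*:v i) = (##j:J. ?b (h j)*:v (h j))"
  by(rule finsum_reindex) (use hI bR D(2) inv in auto)
 also have "... = (##j:J. b j*:v (h j))" using bR D(2) hI inv by(intro finsum_cong') auto
 finally have "(##i:I. ?b i*:v i) = #0" using s hI by simp
 moreover have "?b i:B" if "i:I" for i using b inv_into_into[of i h J] hI(1) that by simp
 ultimately have "?b (h j) = #0" using D(3)[of ?b "h j"] hI(1) j by blast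
 thus "b j = #0" using inv[OF j] by simp
qed

lemma ind_inj: assumes B: "subring B R" and i: "ind B I v" shows "inj_on v I"
proof (rule inj_onI, rule ccontr)
 note D = indD[OF i]
 fix x y assume xy: "x:I" "y:I" "v x = v y" "x ~= y"
 have "ind B {x,y} v" using ind_subset[OF B i, of "{x,y}"] xy by simp
 note E = indD(3)[OF this, of "%i. if i = x then #1 else \<ominus> #1" x]
 have "(##i:{x,y}.(if i = x then #1 else \<ominus> #1)*:v i) = #1*:v x +: (\<ominus> #1)*:v y"
  using xy D(2) by(subst finsum_insert) auto
 also have "... = #0" using xy(3) D(2)[OF xy(2)] by(simp add:l_minus r_neg)
 finally have z: "(##i:{x,y}.(if i = x then #1 else \<ominus> #1)*:v i) = #0" .
 have "(if i = x then #1 else \<ominus> #1):B" for i using subringE(3,5)[OF B] by simp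
 thus False using E[OF _ z] by simp
qed

text \<open>The derivative is a relation of degree below \<open>n\<close> among independent powers,
  so each of its coefficients k f(k) vanishes.\<close>

lemma deriv_zero:
 fixes n :: nat
 assumes B: "subring B R" and \<theta>: "\<theta> : $R" and i: "ind B {..<n} (%k. \<theta> [^] k)" and f: "!!k. k <= n==> f k:B"
  and d: "(##k:{..n}. f k *: [k] \<cdot> (\<theta> [^] (k - 1))) = #0" and k: "k <= n"
 shows "[k] \<cdot> f k = #0"
proof (cases k)
 case (Suc j)
 then obtain l where l: "n = Suc l" using k by(cases n) auto
 have fR: "f k:$R" if "k <= n" for k using f[OF that] subringE(1)[OF B] by blast
 have nB: "[q] \<cdot> b:B" if "b:B" for b and q :: nat using that subringE(1)[OF B] by(induct q) (auto intro:subringE(2,7)[OF B])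
 have "(##k:{..n}. f k *: [k] \<cdot> (\<theta> [^] (k - 1))) = (##k:{..l}. f (Suc k) *: [Suc k] \<cdot> (\<theta> [^] (Suc k - 1))) +: f 0 *: [(0::nat)] \<cdot> (\<theta> [^] (0 - 1 :: nat))"
  unfolding l using fR \<theta> l by(intro finsum_Suc2) auto
 also have "... = (##k:{..l}. f (Suc k) *: [Suc k] \<cdot> (\<theta> [^] k))" using fR \<theta> l by(simp add:finsum_closed Pi_def)
 also have "... = (##k:{..<n}.([Suc k] \<cdot> f (Suc k)) *: \<theta> [^] k)"
  unfolding l lessThan_Suc_atMost using fR \<theta> l by(intro finsum_cong') (auto simp:add_pow_ldistr add_pow_rdistr simp del:add.nat_pow_Suc)
 finally have "(##k:{..<n}.([Suc k] \<cdot> f (Suc k)) *: \<theta> [^] k) = #0" using d by simp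
 from indD(3)[OF i _ this, of j] show ?thesis using nB f l Suc k by(auto simp del:add.nat_pow_Suc)
qed simp

lemma sp_one: assumes B: "subring B R" shows "sp B { #1} = B"
proof -
 interpret M: mdl "R@:B" "selfm R" by(rule mdl_self[OF B])
 have BR: "B<:$R" using subringE(1)[OF B] .
 have "sm (R@:B) (selfm R) B" using BR subringE(2,6,7)[OF B] by(auto simp:sm_def)
 hence "sp B { #1}<:B" using M.spn_least[of B "{ #1}"] subringE(3)[OF B] by blast
 moreover have "b:sp B { #1}" if "b:B" for b
  using M.spn_smult[of "{ #1}" b \<one>] M.spn_incl[of "{ #1}" \<one>] that BR by auto
 ultimately show ?thesis by blast
qed

text \<open>An element whose p-th power lies in the base field has degree 1 or p over it.
  Irreducibility of X^p - b is avoided: a relation of smaller degree n is differentiated by means of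
  iterated commutators with \<open>W\<close>, which forces n = 0 in the ring although 0 < n <
  p.\<close>

lemma pstep:
 assumes p: "Factorial_Ring.prime p" "[p] \<cdot> #1 = #0" and B: "subring B R" and Ap: "!!a. a:$R==> a [^] p:B"
  and w: "w:$R" "w~:cl B { #1}"
 shows "ind B {..<p} (%k. w [^] (k::nat))"
proof (rule ccontr)
 assume "~?thesis"
 then obtain n f where n: "n < p" and i: "ind B {..<n} (%k. w [^] k)" and f: "ALL k<=n. f k:B" "f n ~= #0" and rel: "(##k:{..n}. f k*:w [^] k) = #0"
  using min_rel[OF B w(1)] by blast
 have BR: "b:$R" if "b:B" for b using that subringE(1)[OF B] by blast
 have fR: "f k:$R" "f k:B" if "k <= n" for k using f(1) that BR by auto
 \<comment> \<open>A linear relation would place \<open>w\<close> in the fraction field of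
   \<open>B\<close>.\<close>
 have n2: "2 <= n"
 proof (rule ccontr)
  assume "~2 <= n"
  then consider "n = 0" | "n = Suc 0" by linarith
  thus False
  proof cases
   case 1 thus False using rel f(2) fR(1)[of 0] finsum_0[of "%k. f k*:w [^] k"] by simp
  next
   case 2
   have "(##k:{..n}. f k*:w [^] k) = f (Suc 0)*:w [^] Suc 0 +: (##k:{..0}. f k*:w [^] k)"
    unfolding 2 using fR w 2 by(intro finsum_Suc) auto
   hence "f n*:w +: f 0 = #0" using rel fR[of 0] w finsum_0[of "%k. f k*:w [^] k"] 2 by simp
   hence "f n*:w = \<ominus> f 0" using fR[of 0] fR[of n] w by(metis le0 le_refl m_closed minus_equality)
   thus False using w f(2) fR[of n] fR[of 0] subringE(5)[OF B] by(auto simp:cl_def sp_one[OF B])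
  qed
 qed
 \<comment> \<open>Scaling \<open>w\<close> by the leading coefficient makes the relation monic, so
   that B[W] is free over \<open>B\<close> on powers of \<open>W\<close>.\<close>
 define a where "a = f n"
 define W where "W = a*:w"
 have aB: "a:B" "a:$R" "a ~= #0" using fR f by(auto simp:a_def)
 have powB: "a [^] (k::nat):B" for k by(induct k) (use aB subringE(3,6)[OF B] in auto)
 have w0: "w ~= #0" using w(2) subringE(2,3)[OF B] by(auto simp:cl_def sp_one[OF B] intro!: bexI[of _ \<one>])
 have W: "W:$R" "W ~= #0" using aB w w0 integral by(auto simp:W_def)
 have WR: "W [^] (k::nat):$R" for k using W by simp
 have Wk: "W [^] (k::nat) = a [^] k*:w [^] k" for k using aB w by(simp add:W_def nat_pow_distrib)
 have iW: "ind B {..<n} (%k. W [^] k)"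
 proof (rule indI)
  fix b k assume b: "!!i. i:{..<n}==> b i:B" and s: "(##k:{..<n}. b k*:W [^] k) = #0" and k: "k:{..<n}"
  have "(##k:{..<n}. b k*:W [^] k) = (##k:{..<n}.(b k*:a [^] k)*:w [^] k)"
   using b BR aB w by(intro finsum_cong') (auto simp:Wk m_assoc)
  hence "(##k:{..<n}.(b k*:a [^] k)*:w [^] k) = #0" using s by simp
  from indD(3)[OF i _ this k] have "b k*:a [^] k = #0" using b powB subringE(6)[OF B] by auto
  thus "b k = #0" using integral[of "b k" "a [^] k"] pow_eq_zero[of a k] b[OF k] BR aB by auto
 qed (use W in auto)
 define F where "F k = (if k = n then #1 else f k*:a [^] (n - 1 - k))" for k
 have F: "F k:B" "F k:$R" if "k <= n" for k using fR[OF that] powB aB subringE(3,6)[OF B] by(auto simp:F_def)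
 have relW: "(##k:{..n}. F k*:W [^] k) = #0"
 proof -
  have "F k*:W [^] k = a [^] (n - 1)*:(f k*:w [^] k)" if k: "k <= n" for k
  proof (cases "k = n")
   case True
   have "a [^] n = a [^] (n - 1)*:a" using n2 nat_pow_Suc[of a "n - 1"] by simp
   thus ?thesis using True aB w by(simp add:F_def Wk a_def[symmetric] m_assoc)
  next
   case False
   hence "a [^] (n - 1) = a [^] (n - 1 - k)*:a [^] k" using nat_pow_mult[OF aB(2), of "n - 1 - k" k] k by simp
   thus ?thesis using False aB w fR[OF k] by(simp add:F_def Wk m_ac)
  qed
  hence "(##k:{..n}. F k*:W [^] k) = (##k:{..n}. a [^] (n - 1)*:(f k*:w [^] k))" using fR aB w by(intro finsum_cong') auto
  also have "... = a [^] (n - 1)*:(##k:{..n}. f k*:w [^] k)" using fR aB w by(intro finsum_rdistr[symmetric]) auto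
  finally show ?thesis using rel aB by simp
 qed
 let ?B = "R@:B"
 interpret Mo: mdl ?B "selfm R" by(rule mdl_self[OF B])
 \<comment> \<open>\<open>M\<close> is B[W], with basis the powers of \<open>W\<close> below n;
   \<phi> will be the coordinate at 1.\<close>
 define M where "M = sp B ((%k. W [^] k) ` {..<n})"
 let ?M = "(selfm R)\<lparr>carrier := M\<rparr>"
 have gR: "(%k. W [^] k) ` {..<n}<:$(selfm R)" using W by auto
 have smM: "sm ?B (selfm R) M" unfolding M_def using Mo.spn_sm[OF gR] .
 note SM = Mo.smD[OF smM]
 have MR: "x:$R" if "x:M" for x using SM(1)[OF that] by simp
 have Wn: "W [^] n:M"
 proof -
  have s: "(##k:{..<n}. F k*:W [^] k):M" unfolding M_def using sp_fin[OF B, of "{..<n}" "%k. W [^] k"] W F by(auto intro!: exI[of _ F])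
  have "{..n} = insert n {..<n}" using n2 by auto
  hence "(##k:{..n}. F k*:W [^] k) = F n*:W [^] n +: (##k:{..<n}. F k*:W [^] k)" using finsum_insert[of "{..<n}" n "%k. F k*:W [^] k"] F W by auto
  hence "W [^] n +: (##k:{..<n}. F k*:W [^] k) = #0" using relW W by(simp add:F_def)
  hence "W [^] n = \<ominus> (##k:{..<n}. F k*:W [^] k)" using MR[OF s] WR by(metis minus_equality)
  thus ?thesis using SM(5)[OF s] by(simp add:a_inv_def m_inv_def selfm_def)
 qed
 have Wkn: "W [^] k:M" if "k < n" for k unfolding M_def using Mo.spn_incl[OF gR] that by auto
 have WM: "W*:x:M" if x: "x:M" for x
 proof -
  have l: "lm ?B (selfm R) (selfm R) (%x. W*:x)" using lm_restrict[OF lm_smult[OF lm_id[OF module_selfm] W(1)] B] by simp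
  have "W*:W [^] k:M" if "k < n" for k
  proof -
   have "W [^] Suc k:M" using Wkn[of "Suc k"] Wn that by(cases "Suc k = n") auto
   thus ?thesis using W by(simp add:m_comm)
  qed
  hence "(%k. W [^] k) ` {..<n}<:{x:$(selfm R). W*:x:M}" using W by auto
  from Mo.spn_least[OF lm_vimage[OF l smM] this] show ?thesis using x unfolding M_def[symmetric] by blast
 qed
 have W1: "#1:M" "W:M" using Wkn[of 0] Wkn[of 1] n2 W by auto
 have WkM: "W [^] (k::nat)*:x:M" if "x:M" for k x
 proof (induct k)
  case (Suc k)
  have "W [^] Suc k*:x = W*:(W [^] k*:x)" using W MR[OF that] by(simp add:m_ac)
  thus ?case using WM[OF Suc] by simp
 qed (use that MR in simp)
 obtain \<phi> where \<phi>: "lm ?B ?M (selfm R) \<phi>" and \<phi>b: "!!b.(ALL i:{..<n}. b i:B)==> \<phi> (##j:{..<n}. b j*:W [^] j) = b 0"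
 proof -
  obtain \<phi> where "ALL i:{..<n}. lm ?B ?M (selfm R) (\<phi> i)" "ALL b.(ALL i:{..<n}. b i:B)--> (ALL i:{..<n}. \<phi> i (##j:{..<n}. b j*:W [^] j) = b i)"
   using ind_coord[OF B iW] unfolding M_def[symmetric] by blast
  thus ?thesis using n2 by(intro that[of "\<phi> 0"]) auto
 qed
 have \<phi>k: "\<phi> (W [^] k) = (if k = 0 then #1 else #0)" if k: "k < n" for k
 proof -
  have "(##j:{..<n}.(if k = j then #1 else #0)*:W [^] j) = (##j:{..<n}. if k = j then W [^] j else #0)"
   using W by(intro finsum_cong') auto
  also have "... = W [^] k" using k W by(intro finsum_singleton) auto
  finally show ?thesis using \<phi>b[of "%j. if k = j then #1 else #0"] subringE(2,3)[OF B] by auto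
 qed
 \<comment> \<open>\<open>A k\<close> is the k-fold commutator of \<phi> with multiplication by
   \<open>W\<close>.\<close>
 define A where "A k = rec_nat \<phi> (%_ \<psi> x. W *: \<psi> x -: \<psi> (W*:x)) k" for k :: nat
 have A0: "A 0 = \<phi>" and AS: "A (Suc k) x = W*:A k x -: A k (W*:x)" for k x by(simp_all add:A_def)
 have lW: "lm ?B ?M ?M (%x. W*:x)"
  by(rule lmI[OF Mo.sm_module[OF smM] Mo.sm_module[OF smM]]) (use WM W MR BR in \<open>auto simp:r_distr m_lcomm\<close>)
 have lR: "lm ?B (selfm R) (selfm R) (%x. W*:x)" using lm_restrict[OF lm_smult[OF lm_id[OF module_selfm] W(1)] B] by simp
 have Al: "lm ?B ?M (selfm R) (A k)" for k
 proof (induct k)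
  case (Suc k)
  have "lm ?B ?M (selfm R) (%x. W*:A k x -: A k (W*:x))" using lm_diff[OF lm_comp[OF Suc lR] lm_comp[OF lW Suc]] by simp
  thus ?case by(rule lm_cong) (rule AS)
 qed (use \<phi> A0 in simp)
 have AR: "A k x:$R" if "x:M" for k x using lmD(3)[OF Al, of x k] that by simp
 have AB: "A k (b*:x) = b*:A k x" if "b:B" "x:M" for k b x using lmD(5)[OF Al, of b x k] that by simp
 \<comment> \<open>Multiplying by \<open>W\<close> after and before \<phi> are commuting operations,
   so the p-fold commutator is the commutator with W^p; that vanishes because W^p lies in
   \<open>B\<close> and \<phi> is \<open>B\<close>-linear.\<close>
 have Ap0: "A p x = #0" if x: "x:M" for x
 proof -
  let ?A = "%(k::nat) (i::nat) (j::nat). W [^] i*:((\<ominus> #1) [^] j*:A k (W [^] j*:x))"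
  have "?A p 0 0 = ?A 0 (0 + p) 0 +: ?A 0 0 (0 + p)"
  proof (rule pascal_p[of p ?A 0 0, OF p])
   fix k i j :: nat
   define s where "s = (\<ominus> #1) [^] j"
   define u where "u = A k (W [^] j*:x)"
   define v where "v = A k (W [^] Suc j*:x)"
   have c: "s:$R" "u:$R" "v:$R" "W [^] i:$R"
    using AR[OF WkM[OF x, of j]] AR[OF WkM[OF x, of "Suc j"]] W unfolding s_def u_def v_def by(simp_all del:nat_pow_Suc)
   have e: "A (Suc k) (W [^] j*:x) = W*:u -: v" unfolding AS u_def v_def using W MR[OF x] by(simp add:m_ac)
   have "W [^] i*:(s*:(W*:u -: v)) = W [^] i*:W*:(s*:u) +: W [^] i*:(s*:(\<ominus> #1)*:v)"
    using c W by(simp add:a_minus_def r_distr r_minus l_minus, simp add:m_ac)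
   thus "?A (Suc k) i j = ?A k (Suc i) j +: ?A k i (Suc j)" unfolding e unfolding s_def u_def v_def by simp
   show "?A k i j:$R" using AR WkM[OF x] W by simp
  qed
  hence "A p x = W [^] p *: \<phi> x +: (\<ominus> #1) [^] p *: \<phi> (W [^] p*:x)" using AR[OF x, of p] AR[OF x, of 0, unfolded A0] AR[OF WkM[OF x, of p], of 0, unfolded A0] MR[OF x] W unfolding A0 by simp
  also have "(\<ominus> #1) [^] p = \<ominus> #1" using frob_neg[OF p one_closed] by simp
  also have "\<phi> (W [^] p*:x) = W [^] p *: \<phi> x" using AB[OF Ap[OF W(1)] x, of 0] A0 by simp
  finally show ?thesis using AR[OF x, of 0] A0 W by(simp add:l_minus r_neg)
 qed
 \<comment> \<open>The first vanishing commutator. It is at least the second one: \<open>A 0\<close>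
   sends 1 to 1, and \<open>A 1\<close> sends 1 to \<open>W\<close> because n >= 2 makes the
   coordinate of \<open>W\<close> at 1 zero.\<close>
 define l where "l = (LEAST l. ALL x:M. A l x = #0)"
 have l0: "ALL x:M. A l x = #0" unfolding l_def using LeastI[of "%l. ALL x:M. A l x = #0" p] Ap0 by blast
 have "A 0 #1 = #1" using A0 \<phi>k[of 0] n2 by simp
 hence "l ~= 0" using l0 W1(1) one_not_zero by metis
 moreover have "A (Suc 0) #1 = W"
  unfolding AS A0 using \<phi>k[of 0] \<phi>k[of 1] n2 W by(simp add:diff_zero)
 hence "l ~= Suc 0" using l0 W1(1) W(2) by metis
 ultimately obtain q where q: "l = Suc (Suc q)" by(metis not0_implies_Suc)
 have "Suc q < l" using q by simp
 then obtain x0 where x0: "x0:M" "A (Suc q) x0 ~= #0" using not_less_Least[of "Suc q" "%l. ALL x:M. A l x = #0"] unfolding l_def by blast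
 define D where "D = A (Suc q)"
 define \<psi> where "\<psi> = A q"
 \<comment> \<open>The last nonzero commutator commutes with \<open>W\<close>, so it is
   multiplication by its value \<open>c\<close> at 1.\<close>
 have DW: "D (W*:x) = W*:D x" if x: "x:M" for x
 proof -
  have "W*:D x -: D (W*:x) = #0" using l0 x unfolding q D_def AS[of "Suc q"] by blast
  thus ?thesis using AR[OF x, of "Suc q"] AR[OF WM[OF x], of "Suc q"] W diff_eq_iff[of "W*:D x" "D (W*:x)"] unfolding D_def by simp
 qed
 have WkM1: "W [^] (k::nat):M" for k using WkM[OF W1(1), of k] W by simp
 have Dk: "D (W [^] (k::nat)) = W [^] k*:D #1" for k
 proof (induct k)
  case 0 thus ?case using AR[OF W1(1)] by(simp add:D_def)
 next
  case (Suc k) thus ?case using DW[OF WkM1[of k]] AR[OF W1(1)] W by(simp add:D_def m_ac)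
 qed
 define c where "c = D #1"
 have cR: "c:$R" using AR[OF W1(1)] by(simp add:c_def D_def)
 have c0: "c ~= #0"
 proof
  assume z: "c = #0"
  have "M<:{x:$?M. D x = 0[selfm R]}"
   unfolding M_def
  proof (rule Mo.spn_least)
   have "sm ?B ?M {x:$?M. D x = 0[selfm R]}" using lm_ker[OF Al[of "Suc q"]] unfolding D_def .
   thus "sm ?B (selfm R) {x:$((selfm R)\<lparr>carrier := sp B ((%k. W [^] k) ` {..<n})\<rparr>). D x = 0[selfm R]}"
    unfolding M_def[symmetric] using MR by(auto simp:sm_def)
   show "(%k. W [^] k) ` {..<n}<:{x:$((selfm R)\<lparr>carrier := sp B ((%k. W [^] k) ` {..<n})\<rparr>). D x = 0[selfm R]}"
    unfolding M_def[symmetric] using WkM1 Dk z W by(auto simp:c_def)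
  qed
  thus False using x0 by(auto simp:D_def)
 qed
 have \<psi>R: "\<psi> x:$R" if "x:M" for x using AR[OF that] by(simp add:\<psi>_def)
 \<comment> \<open>The commutator before it is therefore, up to multiplication by \<psi> 1, minus
   \<open>c\<close> times the formal derivative. Applied to the relation of \<open>W\<close> it
   shows that the derivative of that relation vanishes at \<open>W\<close>.\<close>
 have \<psi>k: "\<psi> (W [^] k) +: [k] \<cdot> (W [^] (k - 1))*:c = W [^] k *: \<psi> #1" for k :: nat
 proof (induct k)
  case 0 thus ?case using \<psi>R[OF W1(1)] cR by simp
 next
  case (Suc k)
  have e: "W *: \<psi> (W [^] k) -: \<psi> (W [^] Suc k) = W [^] k*:c"
   using Dk[of k] W unfolding D_def c_def \<psi>_def AS[of q] by(simp add:m_comm)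
  have r: "\<psi> (W [^] k):$R" "\<psi> (W [^] Suc k):$R" using \<psi>R WkM1 by blast+
  have kk: "W *: [k] \<cdot> (W [^] (k - 1)) = [k] \<cdot> (W [^] k)"
  proof (cases k)
   case (Suc j) thus ?thesis using add_pow_rdistr[of W "W [^] j" k] W by(simp add:m_comm)
  qed (use W in simp)
  have "\<psi> (W [^] Suc k) +: W [^] k*:c = W *: \<psi> (W [^] k)" unfolding e[symmetric] using r W by(simp add:add_diff_swap)
  hence "\<psi> (W [^] Suc k) +: (W [^] k*:c +: W*:([k] \<cdot> (W [^] (k - 1))*:c)) = W *: \<psi> (W [^] k) +: W*:([k] \<cdot> (W [^] (k - 1))*:c)"
   using r W cR by(simp add:a_assoc[symmetric])
  also have "... = W*:(W [^] k *: \<psi> #1)" using r W cR by(simp add:r_distr[symmetric] Suc)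
  also have "W [^] k*:c +: W*:([k] \<cdot> (W [^] (k - 1))*:c) = [Suc k] \<cdot> (W [^] (Suc k - 1))*:c"
   using kk W cR by(simp add:m_assoc[symmetric] l_distr a_comm)
  finally show ?case using W \<psi>R[OF W1(1)] by(simp add:m_ac)
 qed
 have "#0 = \<psi> (##k:{..n}. F k*:W [^] k)" using lmD(6)[OF Al[of q]] relW by(simp add:\<psi>_def)
 also have "(##k:{..n}. F k*:W [^] k) = (##[?M]k:{..n}. F k*:W [^] k)"
  using Mo.finsum_sub[of M "{..n}" "%k. F k*:W [^] k", OF SM(1-3)] SM(4) F WkM1 by simp
 also have "\<psi> (##[?M]k:{..n}. F k*:W [^] k) = (##k:{..n}. \<psi> (F k*:W [^] k))"
  using lm_finsum[OF Al[of q], of "{..n}" "%k. F k*:W [^] k"] SM(4) F WkM1 by(auto simp:\<psi>_def)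
 also have "... = (##k:{..n}. F k *: \<psi> (W [^] k))" using AB[OF F(1) WkM1] F \<psi>R WkM1 by(intro finsum_cong') (auto simp:\<psi>_def)
 finally have z: "(##k:{..n}. F k *: \<psi> (W [^] k)) = #0" by simp
 have "(##k:{..n}. F k *: \<psi> (W [^] k)) +: (##k:{..n}.(F k *: [k] \<cdot> (W [^] (k - 1)))*:c) = (##k:{..n}. F k *: \<psi> (W [^] k) +: (F k *: [k] \<cdot> (W [^] (k - 1)))*:c)"
  using F \<psi>R WkM1 W cR by(intro finsum_addf[symmetric]) auto
 also have "... = (##k:{..n}.(F k*:W [^] k) *: \<psi> #1)"
 proof (rule finsum_cong')
  fix k assume "k:{..n}"
  hence k: "F k:$R" using F by auto
  have "F k *: \<psi> (W [^] k) +: (F k *: [k] \<cdot> (W [^] (k - 1)))*:c = F k*:(\<psi> (W [^] k) +: [k] \<cdot> (W [^] (k - 1))*:c)"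
   using k \<psi>R[OF WkM1] W cR by(simp add:r_distr m_assoc)
  thus "F k *: \<psi> (W [^] k) +: (F k *: [k] \<cdot> (W [^] (k - 1)))*:c = (F k*:W [^] k) *: \<psi> #1"
   unfolding \<psi>k using k W \<psi>R[OF W1(1)] by(simp add:m_assoc)
 qed (use F W \<psi>R[OF W1(1)] in auto)
 also have "... = (##k:{..n}. F k*:W [^] k) *: \<psi> #1" using F W \<psi>R[OF W1(1)] by(intro finsum_ldistr[symmetric]) auto
 finally have "(##k:{..n}.(F k *: [k] \<cdot> (W [^] (k - 1)))*:c) = #0" using z relW F W cR \<psi>R[OF W1(1)] by(simp add:finsum_closed)
 moreover have "(##k:{..n}.(F k *: [k] \<cdot> (W [^] (k - 1)))*:c) = (##k:{..n}. F k *: [k] \<cdot> (W [^] (k - 1)))*:c"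
  using F W cR by(intro finsum_ldistr[symmetric]) auto
 moreover have dR: "(##k:{..n}. F k *: [k] \<cdot> (W [^] (k - 1))):$R" using F W by(intro finsum_closed) auto
 ultimately have "(##k:{..n}. F k *: [k] \<cdot> (W [^] (k - 1))) = #0" using integral[OF _ dR cR] c0 by simp
 \<comment> \<open>The relation is monic, so its top coefficient yields n = 0 in the ring.\<close>
 from deriv_zero[OF B W(1) iW F(1) this le_refl] have "[n] \<cdot> #1 = #0" by(simp add:F_def)
 moreover have "~p dvd n" using n n2 by(auto dest:dvd_imp_le)
 ultimately show False using charp_ndvd[OF p, of n \<one>] by simp
qed

end

section \<open>Separability\<close>

text \<open>The Frobenius is an injective ring homomorphism, so it carries the power series
  structure over to p-th powers.\<close>

lemma (in pser) frob_pser: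
 assumes p: "Factorial_Ring.prime (p::nat)" "[p] \<cdot> #1 = #0"
 shows "pser (R@:((%x. x [^] p) ` $R)) ((%x. x [^] p) ` C) (t [^] p)"
proof (intro pser.intro pser_axioms.intro)
 let ?S = "(%x. x [^] p) ` $R" and ?C = "(%x. x [^] p) ` C"
 have sS: "subring ?S R" using frob_subring[OF p carrier_is_subring] .
 show "domain (R@:?S)" using subring_is_domain[OF sS] .
 show "subring ?C (R@:?S)" using subring_sub[OF frob_subring[OF p subC] sS] CR by auto
 show "t [^] p:$(R@:?S)" using tR by simp
 show "t [^] p ~= 0[R@:?S]" using pow_eq_zero[OF tR] t0 by auto
 show "EX c:?C. EX s':$(R@:?S). s = c+[R@:?S] t [^] p \<otimes>\<^bsub>R@:?S\<^esub> s'" if s: "s:$(R@:?S)" for s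
 proof -
  obtain r where r: "r:$R" "s = r [^] p" using s by auto
  obtain c r' where c: "c:C" "r':$R" "r = c +: t*:r'" using dec[OF r(1)] by blast
  have "s = c [^] p +: t [^] p*:r' [^] p" using r c CR tR frob_add[OF p] by(simp add:nat_pow_distrib)
  thus ?thesis using c by auto
 qed
 show "c = 0[R@:?S]" if c: "c:?C" "s:$(R@:?S)" "c = t [^] p \<otimes>\<^bsub>R@:?S\<^esub> s" for c s
 proof -
  obtain c' where c': "c':C" "c = c' [^] p" using c(1) by blast
  obtain s' where s': "s':$R" "s = s' [^] p" using c(2) by auto
  have "c' [^] p = (t*:s') [^] p" using c c' s' tR by(simp add:nat_pow_distrib)
  hence "c' = t*:s'" using frob_inj[OF p] CR[OF c'(1)] tR s' by simp
  hence "c' = #0" using triv c'(1) s'(1) by blast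
  thus ?thesis using c' prime_gt_0_nat[OF p(1)] by(simp add:nat_pow_zero)
 qed
 show "s = 0[R@:?S]" if s: "s:$(R@:?S)"
  and d: "!!n::nat. EX s':$(R@:?S). s = (t [^] p) [^]\<^bsub>R@:?S\<^esub> n \<otimes>\<^bsub>R@:?S\<^esub> s'" for s
 proof -
  obtain r where r: "r:$R" "s = r [^] p" using s by auto
  have "EX r':$R. r = t [^] n*:r'" for n :: nat
  proof -
   obtain r' where r': "r':$R" "s = (t [^] p) [^] n*:r' [^] p" using d[of n] by(auto simp:nat_pow_consistent[symmetric])
   have "r [^] p = (t [^] n*:r') [^] p" using r r' tR by(simp add:nat_pow_distrib nat_pow_pow mult.commute)
   hence "r = t [^] n*:r'" using frob_inj[OF p r(1)] r' tR by simp
   thus ?thesis using r' by blast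
  qed
  hence "r = #0" using sep[OF r(1)] by blast
  thus ?thesis using r prime_gt_0_nat[OF p(1)] by(simp add:nat_pow_zero)
 qed
 show "EX a. ALL n. a n:$(R@:?S) & a n = cs n+[R@:?S] t [^] p \<otimes>\<^bsub>R@:?S\<^esub> a (Suc n)"
  if "!!n::nat. cs n:?C" for cs
 proof -
  have "ALL n. EX c. c:C & cs n = c [^] p" using that by blast
  then obtain c where c: "!!n. c n:C & cs n = c n [^] p" by metis
  have c1: "c n:C" for n using c by blast
  from lim[of c, OF c1] obtain a where a: "ALL n. a n:$R & a n = c n +: t*:a (Suc n)" by(elim exE) (erule that)
  have aR: "a n:$R" and ae: "a n = c n +: t*:a (Suc n)" for n using spec[OF a, of n] by(rule conjunct1, rule conjunct2)
  show ?thesis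
  proof (intro exI[of _ "%n. a n [^] p"] allI conjI)
   fix n show "a n [^] p:$(R@:?S)" using aR by simp
   have "a n [^] p = (c n +: t*:a (Suc n)) [^] p" by(rule arg_cong[OF ae])
   also have "... = cs n +: t [^] p*:a (Suc n) [^] p" using c[of n] CR aR[of "Suc n"] tR frob_add[OF p] by(simp add:nat_pow_distrib)
   finally show "a n [^] p = cs n+[R@:?S] t [^] p \<otimes>\<^bsub>R@:?S\<^esub> a (Suc n) [^] p" by simp
  qed
 qed
qed

text \<open>Expanding the first p terms of a series leaves a remainder divisible by t^p, and
  \<open>nak\<close> over the p-th powers, with parameter t^p, finishes. Each variable thus
  multiplies the number of generators by p.\<close>

lemma (in pser) frob_span:
 assumes p: "Factorial_Ring.prime (p::nat)" "[p] \<cdot> #1 = #0" and E: "finite E" "E<:C"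
  and CE: "C<:spn (R@:((%x. x [^] p) ` C)) (selfm R) E"
 shows "$R<:spn (R@:((%x. x [^] p) ` $R)) (selfm R) ((%(e,k). e*:t [^] k) ` (E \<times> {..<p}))"
proof -
 let ?S = "(%x. x [^] p) ` $R" and ?C = "(%x. x [^] p) ` C" and ?V = "(%(e,k). e*:t [^] k) ` (E \<times> {..<p})"
 interpret P: pser "R@:?S" ?C "t [^] p" by(rule frob_pser[OF p])
 have sC: "subring ?C R" using frob_subring[OF p subC] .
 have sS: "subring ?S R" using frob_subring[OF p carrier_is_subring] .
 interpret M: mdl "R@:?C" "selfm R" by(rule mdl_self[OF sC])
 have ER: "E<:$(selfm R)" using E CR by auto
 have V: "finite ?V" "?V<:$(selfm R)" using E CR tR by auto
 have ct: "c*:t [^] k:spn (R@:?C) (selfm R) ?V" if "c:C" "k < p" for c k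
 proof -
  have "lm (R@:?C) (selfm R) (selfm R) (%x. t [^] k*:x)"
   using lm_restrict[OF lm_smult[OF lm_id[OF module_selfm]] sC, of "t [^] k"] tR by simp
  from lm_image_spn[OF this ER] have "t [^] k*:c:spn (R@:?C) (selfm R) ((%x. t [^] k*:x) ` E)" using CE that(1) by blast
  moreover have "t [^] k*:c = c*:t [^] k" using CR[OF that(1)] tR by(simp add:m_comm)
  moreover have "(%x. t [^] k*:x) ` E<:?V" using that(2) E CR tR by(force simp:m_comm)
  ultimately show ?thesis using M.spn_mono[OF _ V(2)] by auto
 qed
 have st: "EX w:spn (R@:?C) (selfm R) ?V. EX z':$R. z = w +: t [^] k*:z'" if "z:$R" "k <= p" for z k
  using that
 proof (induct k)
  case 0
  have "z = #0 +: t [^] (0::nat)*:z" using 0 by simp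
  moreover have "#0:spn (R@:?C) (selfm R) ?V" using spn.zero[of "selfm R" "R@:?C" ?V] by simp
  ultimately show ?case using 0 by blast
 next
  case (Suc k)
  then obtain w z' where w: "w:spn (R@:?C) (selfm R) ?V" "z':$R" "z = w +: t [^] k*:z'" by auto
  obtain c z1 where c: "c:C" "z1:$R" "z' = c +: t*:z1" using dec[OF w(2)] by blast
  have wR: "w:$R" using M.spn_closed[OF V(2) w(1)] by simp
  have "z = (w +: c*:t [^] k) +: t [^] Suc k*:z1" using w(3) c wR CR tR by(simp add:r_distr m_ac a_ac)
  moreover have "w +: c*:t [^] k:spn (R@:?C) (selfm R) ?V" using M.spn_add[OF V(2) w(1) ct[OF c(1), of k]] Suc(3) by simp
  ultimately show ?case using c(2) by blast
 qed
 have "$(selfm R)<:spn (R@:?S) (selfm R) ?V"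
 proof (rule P.nak[OF module_restrict[OF module_selfm sS] _ V])
  show "P.sepm (selfm R)" unfolding P.sepm_def
  proof (intro ballI impI)
   fix z assume z: "z:$(selfm R)" and d: "ALL n::nat. EX z':$(selfm R). z = (t [^] p) [^]\<^bsub>R@:?S\<^esub> n*[selfm R] z'"
   have "EX s':$R. z = t [^] n*:s'" for n :: nat
   proof -
    obtain z' where z': "z':$R" "z = (t [^] p) [^] n*:z'" using d by(auto simp:nat_pow_consistent[symmetric])
    have "p * n = n + (p - 1) * n" using prime_gt_0_nat[OF p(1)] by(simp add:algebra_simps)
    hence "(t [^] p) [^] n = t [^] n*:t [^] ((p - 1) * n)" using tR by(simp add:nat_pow_pow nat_pow_mult mult.commute)
    hence "z = t [^] n*:(t [^] ((p - 1) * n)*:z')" using z' tR by(simp add:m_assoc)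
    thus ?thesis using z' tR by blast
   qed
   thus "z = 0[selfm R]" using sep[of z] z by simp
  qed
  show "EX w:spn (R\<lparr>carrier := ?S,carrier := ?C\<rparr>) (selfm R) ?V. EX z':$(selfm R). z = w+[selfm R] t [^] p*[selfm R] z'" if "z:$(selfm R)" for z
   using st[of z p] that by simp
 qed
 thus ?thesis by simp
qed

section \<open>Closures over fraction fields, and separability from the Frobenius\<close>

context domain begin

context fixes B assumes B: "subring B R"
begin

lemma cl_sm: assumes U: "U<:$R" shows "sm (R@:B) (selfm R) (cl B U)"
proof -
 interpret M: mdl "R@:B" "selfm R" by(rule mdl_self[OF B])
 have US: "U<:$(selfm R)" using U by simp
 have BR: "b:$R" if "b:B" for b using that subringE(1)[OF B] by blast
 have sm: "b*:x:sp B U" if "b:B" "x:sp B U" for b x using M.spn_smult[OF US, of b x] that by simp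
 show ?thesis unfolding sm_def
 proof (intro conjI ballI)
  show "0[selfm R]:cl B U" using sp_sub_cl[OF B U] spn.zero[of "selfm R" "R@:B" U] by auto
  fix x assume x: "x:cl B U"
  then obtain b where b: "b:B" "b ~= #0" "b*:x:sp B U" and xR: "x:$R" by(auto simp:cl_def)
  { fix y assume "y:cl B U"
   then obtain c where c: "c:B" "c ~= #0" "c*:y:sp B U" and yR: "y:$R" by(auto simp:cl_def)
   have "(b*:c)*:(x +: y) = c*:(b*:x) +: b*:(c*:y)" using b c xR yR BR by(simp add:r_distr m_ac)
   also have "... : sp B U" using M.spn_add[OF US sm[OF c(1) b(3)] sm[OF b(1) c(3)]] by simp
   finally show "x+[selfm R] y:cl B U" unfolding cl_def using xR yR b c subringE(6)[OF B b(1) c(1)] integral[of b c] BR by auto }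
  fix a assume "a:$(R@:B)"
  hence a: "a:B" "a:$R" using BR by auto
  have "b*:(a*:x) = a*:(b*:x)" using a b xR BR by(simp add:m_lcomm)
  hence "b*:(a*:x):sp B U" using sm[OF a(1) b(3)] by simp
  thus "a*[selfm R] x:cl B U" unfolding cl_def using b a xR by auto
 qed (auto simp:cl_def)
qed

lemma cl_trans: assumes "U<:$R" "G<:cl B U" shows "cl B G<:cl B U"
proof
 interpret M: mdl "R@:B" "selfm R" by(rule mdl_self[OF B])
 have BR: "b:$R" if "b:B" for b using that subringE(1)[OF B] by blast
 fix x assume "x:cl B G"
 then obtain b where b: "b:B" "b ~= #0" "b*:x:sp B G" and xR: "x:$R" by(auto simp:cl_def)
 have "b*:x:cl B U" using M.spn_least[OF cl_sm[OF assms(1)] assms(2)] b(3) by blast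
 then obtain c where c: "c:B" "c ~= #0" "c*:(b*:x):sp B U" by(auto simp:cl_def)
 moreover have "c*:(b*:x) = (c*:b)*:x" using b c xR BR by(simp add:m_assoc)
 ultimately show "x:cl B U" unfolding cl_def using xR b subringE(6)[OF B c(1) b(1)] integral[of c b] BR by auto
qed

end

lemma ind_cong:
 assumes B: "subring B R" and i: "ind B I v" and e: "!!i. i:I==> u i = v i" shows "ind B I u"
proof (rule indI)
 note D = indD[OF i]
 show "finite I" by(rule D(1))
 show "u i:$R" if "i:I" for i using D(2) e that by simp
 fix b k assume b: "!!i. i:I==> b i:B" and s: "(##i:I. b i*:u i) = #0" and k: "k:I"
 have bR: "b i:$R" if "i:I" for i using b[OF that] subringE(1)[OF B] by blast
 have "(##i:I. b i*:u i) = (##i:I. b i*:v i)" using e bR D(2) by(intro finsum_cong') auto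
 thus "b k = #0" using D(3)[of b k, OF b _ k] s by simp
qed

context fixes p :: nat and S :: "'a set" and W :: "'a set"
 assumes p: "Factorial_Ring.prime p" "[p] \<cdot> #1 = #0" and S: "subring S R" and W: "finite W" "W<:$R" "$R<:cl S W"
begin

text \<open>Extend the family to a maximal independent set V. By \<open>star\<close> the p-th powers
  of V still span; as there are at most |V| of them, they must be independent.\<close>

lemma frob_ind:
 assumes star: "!!V. finite V==> V<:$R==> $R<:cl S V==> $R<:cl S ((%x. x [^] p) ` V)"
  and i: "ind S I v"
 shows "ind S I (%i. v i [^] p)"
proof -
 note D = indD[OF i]
 have inj: "inj_on v I" using ind_inj[OF S i] .
 have "bij_betw (inv_into I v) (v ` I) I" using bij_betw_inv_into[OF inj_on_imp_bij_betw[OF inj]] .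
 from ind_reindex[OF S i this] have iX: "ind S (v ` I) (%x. x)" by(rule ind_cong[OF S]) (auto simp:f_inv_into_f)
 have XR: "v ` I<:$R" using D by auto
 obtain V where V: "v ` I<:V" "V<:$R" "ind S V (%x. x)" "$R<:cl S V"
  using ex_basis[OF S W(1,2) order_refl W(3) XR iX] by blast
 note VD = indD[OF V(3)]
 let ?V = "(%x. x [^] p) ` V"
 have VR: "?V<:$R" "finite ?V" using V(2) VD by auto
 have c1: "$R<:cl S ?V" using star[OF VD(1) V(2,4)] .
 obtain U where U: "U<:?V" "ind S U (%x. x)" "?V<:cl S U"
  using ex_basis[OF S VR(2,1) VR(1), of "{}"] c1 VR(1) indI[of "{}" "%x. x"] by auto
 have UR: "U<:$R" "finite U" using U(1) VR finite_subset by auto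
 have "$R<:cl S U" using c1 cl_trans[OF S UR(1) U(3)] by blast
 hence "card V <= card U" using ind_card[OF S V(3) UR(2,1)] V(2) by blast
 moreover have "card ?V <= card V" using card_image_le[OF VD(1)] .
 ultimately have "U = ?V" using card_subset_eq[OF VR(2) U(1)] card_mono[OF VR(2) U(1)] by simp
 hence iV: "ind S ?V (%x. x)" using U(2) by simp
 let ?u = "%i. v i [^] p"
 have iu: "ind S (?u ` I) (%x. x)" by(rule ind_subset[OF S iV]) (use V(1) in auto)
 have "inj_on ?u I"
 proof (rule inj_onI)
  fix x y assume xy: "x:I" "y:I" "v x [^] p = v y [^] p"
  hence "v x = v y" using frob_inj[OF p] D(2) by blast
  thus "x = y" using inj xy by(auto dest:inj_onD)
 qed
 from ind_reindex[OF S iu inj_on_imp_bij_betw[OF this]] show ?thesis .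
qed

text \<open>If the minimal relation had zero derivative, only exponents divisible by p would occur.
  It would then relate the p-th powers of \<theta>^k for k <= q with q < n, although these
  \<theta>^k are independent and \<open>frob_ind\<close> keeps them so.\<close>

lemma sep_p:
 assumes star: "!!V. finite V==> V<:$R==> $R<:cl S V==> $R<:cl S ((%x. x [^] p) ` V)"
  and \<theta>: "\<theta> : $R"
 shows "sepr S \<theta>"
proof -
 obtain n f where i: "ind S {..<n::nat} (%k. \<theta> [^] k)" and f: "ALL k<=n. f k:S" "f n ~= #0" and rel: "(##k:{..n}. f k *: \<theta> [^] k) = #0"
  using min_rel[OF S \<theta> fin_rel[OF S W \<theta>]] by blast
 have fR: "f k:$R" if "k <= n" for k using f(1) that subringE(1)[OF S] by blast
 have "(##k:{..n}. f k *: [k] \<cdot> (\<theta> [^] (k - 1))) ~= #0"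
 proof
  assume d: "(##k:{..n}. f k *: [k] \<cdot> (\<theta> [^] (k - 1))) = #0"
  have z: "f k = #0" if "k <= n" "~p dvd k" for k
   using charp_ndvd[OF p that(2) fR[OF that(1)]] deriv_zero[OF S \<theta> i _ d that(1)] f(1) by blast
  hence "p dvd n" using f(2) by blast
  then obtain q where q: "n = p * q" by blast
  have p2: "2 <= p" using prime_ge_2_nat[OF p(1)] .
  have "n ~= 0"
  proof
   assume "n = 0" thus False using rel f(2) fR[of 0] finsum_0[of "%k. f k *: \<theta> [^] k"] by simp
  qed
  hence "q ~= 0" using q by auto
  moreover have "2 * q <= n" using q p2 by simp
  ultimately have qn: "Suc q <= n" by linarith
  have "ind S {..q} (%k.(\<theta> [^] k) [^] p)"
   by(rule frob_ind[OF star ind_subset[OF S i]]) (use qn in auto)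
  moreover have "(##k:{..q}. f (p * k)*:(\<theta> [^] k) [^] p) = #0"
  proof -
   let ?h = "%k. f k *: \<theta> [^] k"
   have "(##k:(%k. p * k) ` {..q}. ?h k) = (##k:{..n}. ?h k)"
   proof (rule add.finprod_mono_neutral_cong_left)
    show "(%k. p * k) ` {..q}<:{..n}" using q by auto
    fix k assume k: "k:{..n} - (%k. p * k) ` {..q}"
    have "~p dvd k"
    proof
     assume "p dvd k"
     then obtain j where "k = p * j" by blast
     moreover hence "j <= q" using k q p2 by auto
     ultimately show False using k by auto
    qed
    thus "?h k = #0" using z k \<theta> by auto
   qed (use fR \<theta> in auto)
   moreover have "(##k:(%k. p * k) ` {..q}. ?h k) = (##k:{..q}. ?h (p * k))"
    by(rule finsum_reindex) (use fR \<theta> q p2 in \<open>auto simp:inj_on_def\<close>)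
   moreover have "(##k:{..q}. ?h (p * k)) = (##k:{..q}. f (p * k)*:(\<theta> [^] k) [^] p)"
    using fR \<theta> q by(intro finsum_cong') (auto simp:nat_pow_pow mult.commute)
   ultimately show ?thesis using rel by simp
  qed
  ultimately have "f (p * q) = #0" using indD(3)[of S "{..q}" "%k.(\<theta> [^] k) [^] p" "%k. f (p * k)" q] f(1) q by auto
  thus False using f(2) q by simp
 qed
 thus ?thesis unfolding sepr_def using f(1) rel by blast
qed

end

text \<open>No positive integer kills a nonzero element, by induction over its prime factors, so the
  top coefficient of the derivative of a minimal relation survives.\<close>

lemma sep_0:
 assumes ch: "!!p::nat. Factorial_Ring.prime p==> [p] \<cdot> #1 ~= #0" and S: "subring S R" and W: "finite W" "W<:$R" "$R<:cl S W"
  and \<theta>: "\<theta> : $R"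
 shows "sepr S \<theta>"
proof -
 have nz: "k ~= 0==> x:$R==> [k] \<cdot> x = #0==> x = #0" for k :: nat and x
 proof (induct k arbitrary: x rule: less_induct)
  case (less k)
  show ?case
  proof (cases "k = 1")
   case True thus ?thesis using less(3,4) by simp
  next
   case False
   then obtain p where p: "Factorial_Ring.prime p" "p dvd k" using prime_factor_nat by blast
   then obtain j where j: "k = p * j" by blast
   have jk: "j ~= 0" "j < k" using less(2) j prime_gt_1_nat[OF p(1)] by auto
   have "[p] \<cdot> #1*:([j] \<cdot> x) = [p] \<cdot> ([j] \<cdot> x)" using add_pow_ldistr[of \<one> "[j] \<cdot> x" p] less(3) by simp
   also have "... = [k] \<cdot> x" using add.nat_pow_pow[OF less(3), of p j] j by(simp add:mult.commute)
   finally have "[j] \<cdot> x = #0" using integral[of "[p] \<cdot> #1" "[j] \<cdot> x"] less(3,4) ch[OF p(1)] by auto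
   thus ?thesis using less(1)[OF jk(2,1) less(3)] by blast
  qed
 qed
 obtain n f where i: "ind S {..<n::nat} (%k. \<theta> [^] k)" and f: "ALL k<=n. f k:S" "f n ~= #0" and rel: "(##k:{..n}. f k *: \<theta> [^] k) = #0"
  using min_rel[OF S \<theta> fin_rel[OF S W \<theta>]] by blast
 have fR: "f k:$R" if "k <= n" for k using f(1) that subringE(1)[OF S] by blast
 have "(##k:{..n}. f k *: [k] \<cdot> (\<theta> [^] (k - 1))) ~= #0"
 proof
  assume d: "(##k:{..n}. f k *: [k] \<cdot> (\<theta> [^] (k - 1))) = #0"
  have "n ~= 0"
  proof
   assume "n = 0" thus False using rel f(2) fR[of 0] finsum_0[of "%k. f k *: \<theta> [^] k"] by simp
  qed
  thus False using nz[OF _ fR[of n]] deriv_zero[OF S \<theta> i _ d le_refl] f by blast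
 qed
 thus ?thesis unfolding sepr_def using f(1) rel by blast
qed

end

section \<open>p-bases and prime avoidance\<close>

context domain begin

lemma subring_pow: "subring B R==> b:B==> b [^] (n::nat):B"
 by(induct n) (auto intro:subringE(3,6))

context fixes p :: nat assumes p: "Factorial_Ring.prime p" "[p] \<cdot> #1 = #0"
begin

abbreviation fr :: "'a=> 'a" where "fr x == x [^] p"

lemma fr0: "fr #0 = #0" using prime_gt_0_nat[OF p(1)] by(simp add:nat_pow_zero)

lemma frob_finsum: "finite I==> (!!i. i:I==> h i:$R)==> fr (##i:I. h i) = (##i:I. fr (h i))"
proof (induct I rule: finite_induct)
 case (insert i I)
 hence "fr (h i +: (##i:I. h i)) = fr (h i) +: (##i:I. fr (h i))" using frob_add[OF p, of "h i" "##i:I. h i"] by(simp add:finsum_closed Pi_def)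
 thus ?case using insert by(simp add:finsum_insert Pi_def)
qed (use fr0 in simp)

text \<open>The degree count [A : A^p] [A^p : S^p] = [A : S] [S : S^p], in which [A^p : S^p] =
  [A : S] because the Frobenius is an isomorphism onto p-th powers; here it is carried out as an
  inequality with |V| cancelled.\<close>

lemma rank_bound:
 assumes S: "subring S R" and V: "V<:$R" "ind S V (%x. x)" "$R<:cl S V"
  and E: "finite E" "E<:$R" "S<:sp (fr ` S) E" and u: "ind (fr ` $R) J u"
 shows "card J <= card E"
proof -
 let ?S = "fr ` S" and ?A = "fr ` $R"
 have sS: "subring ?S R" and sA: "subring ?A R" using frob_subring[OF p S] frob_subring[OF p carrier_is_subring] by auto
 have SR: "s:$R" if "s:S" for s using that subringE(1)[OF S] by blast
 note VD = indD[OF V(2)]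
 have iV: "ind ?S V fr"
 proof (rule indI[OF VD(1)])
  fix b k assume b: "!!i. i:V==> b i:?S" and s: "(##i:V. b i*:fr i) = #0" and k: "k:V"
  have "ALL i:V. EX r. r:S & b i = fr r" using b by blast
  from bchoice[OF this] obtain r where r: "ALL i:V. r i:S & b i = fr (r i)" by(elim exE)
  have rS: "r i:S" "r i:$R" "b i = fr (r i)" if "i:V" for i using r that SR by auto
  have "fr (##i:V. r i*:i) = (##i:V. fr (r i*:i))" using rS VD by(intro frob_finsum) auto
  also have "... = (##i:V. b i*:fr i)" using rS VD by(intro finsum_cong') (auto simp:nat_pow_distrib)
  finally have "fr (##i:V. r i*:i) = #0" using s by simp
  moreover have "(##i:V. r i*:i):$R" using rS VD by(intro finsum_closed) auto
  ultimately have "(##i:V. r i*:i) = #0" using pow_eq_zero by blast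
  hence "r k = #0" using VD(3)[of r k] rS k by blast
  thus "b k = #0" using rS(3)[OF k] fr0 by simp
 qed (use V(1) in auto)
 \<comment> \<open>\<open>u\<close> is independent over the p-th powers of \<open>R\<close>, and the
   p-th powers of \<open>V\<close> are independent over those of \<open>S\<close>: the tower law
   multiplies both.\<close>
 have iP: "ind ?S (J \<times> V) (%q. u (fst q)*:fr (snd q))"
  by(rule ind_prod[OF sA u iV]) (use V(1) SR in auto)
 define G where "G = (%(x,w). x*:w) ` (E \<times> V)"
 have G: "finite G" "G<:$R" using E V(1) VD(1) by(auto simp:G_def)
 have GS: "G<:$(selfm R)" using G by simp
 interpret M: mdl "R@:?S" "selfm R" by(rule mdl_self[OF sS])
 interpret MS: mdl "R@:S" "selfm R" by(rule mdl_self[OF S])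
 have VS: "V<:$(selfm R)" using V(1) by simp
 have sv: "s*:v:sp ?S G" if "s:S" "v:V" for s v
 proof -
  have v: "v:$R" using that V(1) by blast
  have "lm (R@:?S) (selfm R) (selfm R) (%x. v*:x)" using lm_restrict[OF lm_smult[OF lm_id[OF module_selfm] v] sS] by simp
  from lm_image_spn[OF this, of E] have "v*:s:sp ?S ((%x. v*:x) ` E)" using E(2,3) that(1) by auto
  moreover have "(%x. v*:x) ` E<:G"
  proof
   fix x assume "x:(%x. v*:x) ` E"
   then obtain e where "e:E" "x = e*:v" using E(2) v m_comm by auto
   thus "x:G" using that(2) by(auto simp:G_def)
  qed
  ultimately show ?thesis using M.spn_mono[OF _ GS] m_comm[OF v SR[OF that(1)]] by auto
 qed
 have sub: "sp S V<:sp ?S G"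
 proof
  fix x assume "x:sp S V" thus "x:sp ?S G"
  proof (induct rule: spn.induct)
   case zero show ?case by(rule spn.zero)
  next
   case (step a x y) thus ?case using M.spn_add[OF GS sv[of a x]] by simp
  qed
 qed
 have cG: "a:cl ?S G" if a: "a:$R" for a
 proof -
  obtain s where s: "s:S" "s ~= #0" "s*:a:sp S V" using V(3) a by(auto simp:cl_def)
  obtain q where q: "p = Suc q" using prime_gt_0_nat[OF p(1)] gr0_implies_Suc by blast
  \<comment> \<open>Raising the denominator to the power p puts it among the p-th powers of
    \<open>S\<close>.\<close>
  have "s [^] q*:(s*:a):sp S V" using MS.spn_smult[OF VS, of "s [^] q" "s*:a"] s subring_pow[OF S s(1)] by simp
  moreover have "s [^] q*:(s*:a) = fr s*:a" using s SR a q by(simp add:m_assoc)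
  ultimately have "fr s*:a:sp ?S G" using sub by auto
  moreover have "fr s ~= #0" using pow_eq_zero s SR by blast
  ultimately show ?thesis unfolding cl_def using a s(1) by blast
 qed
 have "card (J \<times> V) <= card G" by(rule ind_card[OF sS iP G]) (use cG indD(2)[OF iP] in blast)
 also have "... <= card (E \<times> V)" unfolding G_def using E VD(1) by(intro card_image_le) auto
 finally have "card J * card V <= card E * card V" by(simp add:card_cartesian_product)
 moreover have "card V ~= 0"
 proof
  assume "card V = 0"
  hence "V = {}" using VD(1) by simp
  moreover obtain s where s: "s:S" "s ~= #0" "s *: #1:sp S V" using V(3) one_closed by(auto simp:cl_def)
  ultimately have "s *: #1 = #0" using MS.spn_least[OF MS.sm_zero, of "{}"] by auto
  thus False using s SR by simp
 qed
 ultimately show ?thesis by simp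
qed

text \<open>\<open>B\<close> is the ring generated by the p-th powers and z 0, ..., z (i - 1),
  described by minimality; \<open>u\<close> witnesses that its rank over the p-th powers is at least
  p^i.\<close>

definition pgood :: "'a set=> nat=> 'a set=> (nat=> 'a)=> (nat=> 'a)=> bool" where
 "pgood I i B z u \<longleftrightarrow> subring B R & fr ` $R<:B & (ALL j<i. z j:I) &
(ALL T. subring T R--> fr ` $R<:T--> (ALL j<i. z j:T)--> B<:T) & ind (fr ` $R) {..<p ^ i} u & (ALL j<p ^ i. u j:B)"

lemma pgoodD:
 assumes "pgood I i B z u"
 shows "subring B R" "fr ` $R<:B" "ALL j<i. z j:I"
  "ALL T. subring T R--> fr ` $R<:T--> (ALL j<i. z j:T)--> B<:T" "ind (fr ` $R) {..<p ^ i} u" "ALL j<p ^ i. u j:B"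
proof -
 note a = assms[unfolded pgood_def]
 show "subring B R" by(rule conjunct1[OF a])
 note a = conjunct2[OF a]
 show "fr ` $R<:B" by(rule conjunct1[OF a])
 note a = conjunct2[OF a]
 show "ALL j<i. z j:I" by(rule conjunct1[OF a])
 note a = conjunct2[OF a]
 show "ALL T. subring T R--> fr ` $R<:T--> (ALL j<i. z j:T)--> B<:T" by(rule conjunct1[OF a])
 note a = conjunct2[OF a]
 show "ind (fr ` $R) {..<p ^ i} u" "ALL j<p ^ i. u j:B" by(rule conjunct1[OF a], rule conjunct2[OF a])
qed

text \<open>As long as the fraction field of \<open>B\<close> is too small, adjoining one more
  element multiplies the rank by p, by \<open>pstep\<close>. The bound p^d stops this after at most
  d elements.\<close>

lemma pbasis:
 assumes I: "ideal I R" "t:I" "t ~= #0" and bd: "!!(J :: nat set) u. ind (fr ` $R) J u==> card J <= p ^ d"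
 shows "EX B z. subring B R & fr ` $R<:B & (ALL j<d. z j:I) &
(ALL T. subring T R--> fr ` $R<:T--> (ALL j<d. z j:T)--> B<:T) & $R<:cl B { #1}"
proof -
 interpret I: ideal I R by(rule I(1))
 have tR: "t:$R" using I.Icarr I(2) .
 let ?A = "fr ` $R"
 have sA: "subring ?A R" using frob_subring[OF p carrier_is_subring] .
 have "EX i B z u. pgood I i B z u & $R<:cl B { #1}"
 proof (rule ccontr)
  assume H: "~?thesis"
  have "EX B z u. pgood I i B z u" for i
  proof (induct i)
   case 0
   have "ind ?A {..<p ^ 0} (%_.#1)"
   proof (rule indI)
    fix b k assume b: "!!i. i:{..<p ^ 0}==> b i:?A" and s: "(##i:{..<p ^ 0}. b i *: #1) = #0" and k: "k:{..<p ^ 0}"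
    have b0: "b 0:$R" using b[of 0] by auto
    have "{..<p ^ 0} = {0::nat}" by auto
    hence "(##i:{..<p ^ 0}. b i *: #1) = b 0" using b0 finsum_insert[of "{}" 0 "%i. b i *: #1"] by simp
    thus "b k = #0" using s k by simp
   qed auto
   hence "pgood I 0 ?A (%_.#0) (%_.#1)" unfolding pgood_def using sA subringE(3)[OF sA] by auto
   thus ?case by blast
  next
   case (Suc i)
   then obtain B z u where gg: "pgood I i B z u" by(elim exE) (rule that)
   note g = pgoodD[OF gg]
   have BR: "b:$R" if "b:B" for b using that subringE(1)[OF g(1)] by blast
   obtain w where w: "w:$R" "w~:cl B { #1}" using H gg by blast
   \<comment> \<open>The factor \<open>fr t\<close> lies in \<open>B\<close>, so \<open>w'\<close>
     generates the same extension as \<open>w\<close> and moreover lies in \<open>I\<close>.\<close>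
   define w' where "w' = fr t*:w"
   have ft: "fr t:B" "fr t ~= #0" "fr t:$R" using g(2) tR pow_eq_zero[OF tR] I(3) by auto
   have w'R: "w':$R" using ft w by(simp add:w'_def)
   have w'n: "w'~:cl B { #1}"
   proof
    assume "w':cl B { #1}"
    then obtain b where b: "b:B" "b ~= #0" "b*:w':sp B { #1}" by(auto simp:cl_def)
    have "b*:w' = (b*:fr t)*:w" using b BR ft w by(simp add:w'_def m_assoc)
    thus False using w b ft BR subringE(6)[OF g(1) b(1) ft(1)] integral[of b "fr t"] unfolding cl_def by auto
   qed
   obtain q where q: "p = Suc q" using prime_gt_0_nat[OF p(1)] gr0_implies_Suc by blast
   have "fr t:I" using I.I_l_closed[OF I(2), of "t [^] q"] tR q by simp
   hence w'I: "w':I" using I.I_r_closed w(1) by(simp add:w'_def)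
   have iw: "ind B {..<p} (%k. w' [^] (k::nat))" by(rule pstep[OF p g(1) _ w'R w'n]) (use g(2) in auto)
   define B' where "B' = \<Inter>{T. subring T R & B<:T & w':T}"
   have sB': "subring B' R" unfolding B'_def by(rule subring_Inter) (use carrier_is_subring subringE(1)[OF g(1)] w'R in auto)
   have BB': "B<:B'" "w':B'" by(auto simp:B'_def)
   have "ind ?A ({..<p} \<times> {..<p ^ i}) (%r. w' [^] fst r*:u (snd r))" by(rule ind_prod[OF g(1) iw g(5)]) (use g in auto)
   moreover obtain h where h: "bij_betw h {..<p ^ Suc i} ({..<p} \<times> {..<p ^ i})"
    using finite_same_card_bij[of "{..<p ^ Suc i}" "{..<p} \<times> {..<p ^ i}"] by(auto simp:card_cartesian_product)
   ultimately have iu: "ind ?A {..<p ^ Suc i} (%k. w' [^] fst (h k)*:u (snd (h k)))" using ind_reindex[OF sA] by blast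
   have uB: "w' [^] fst (h k)*:u (snd (h k)):B'" if "k < p ^ Suc i" for k
   proof -
    have "h k:{..<p} \<times> {..<p ^ i}" using h that by(auto simp:bij_betw_def)
    hence "u (snd (h k)):B'" using g(6) BB'(1) by auto
    thus ?thesis using subringE(6)[OF sB' subring_pow[OF sB' BB'(2)]] by blast
   qed
   have "pgood I (Suc i) B' (z(i := w')) (%k. w' [^] fst (h k)*:u (snd (h k)))" unfolding pgood_def
   proof (intro conjI allI impI)
    show "(z(i := w')) j:I" if "j < Suc i" for j using that g(3) w'I by(auto simp:less_Suc_eq)
    show "subring B' R" by(rule sB')
    show "?A<:B'" using g(2) BB'(1) by(rule order_trans)
    show "ind ?A {..<p ^ Suc i} (%k. w' [^] fst (h k)*:u (snd (h k)))" by(rule iu)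
    show "w' [^] fst (h k)*:u (snd (h k)):B'" if "k < p ^ Suc i" for k using uB[OF that] .
    fix T assume T: "subring T R" "?A<:T" "ALL j<Suc i.(z(i := w')) j:T"
    have "z j:T" if "j < i" for j using T(3)[rule_format, of j] that by auto
    hence "B<:T" using g(4) T(1,2) by blast
    moreover have "w':T" using T(3)[rule_format, of i] by simp
    ultimately show "B'<:T" unfolding B'_def using T(1) by blast
   qed
   thus ?case by blast
  qed
  from this[of "Suc d"] obtain B z u where "pgood I (Suc d) B z u" by(elim exE) (rule that)
  hence "card {..<p ^ Suc d} <= p ^ d" by(rule bd[OF pgoodD(5)])
  thus False using prime_gt_1_nat[OF p(1)] by simp
 qed
 then obtain i B z u where gg: "pgood I i B z u" and cl: "$R<:cl B { #1}" by(elim exE conjE) (rule that)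
 note g = pgoodD[OF gg]
 have "card {..<p ^ i} <= p ^ d" by(rule bd[OF g(5)])
 hence id: "i <= d" using power_le_imp_le_exp[OF prime_gt_1_nat[OF p(1)]] by simp
 \<comment> \<open>Padding with zeros yields exactly d elements, one for each parameter.\<close>
 let ?z = "%j. if j < i then z j else #0"
 have zI: "ALL j<d. ?z j:I" using g(3) by auto
 have mn: "ALL T. subring T R--> ?A<:T--> (ALL j<d. ?z j:T)--> B<:T"
 proof (intro allI impI)
  fix T assume T: "subring T R" "?A<:T" "ALL j<d. ?z j:T"
  have "ALL j<i. z j:T"
  proof (intro allI impI)
   fix j assume "j < i" thus "z j:T" using T(3)[rule_format, of j] id by simp
  qed
  thus "B<:T" using spec[OF g(4), of T] T(1,2) by simp
 qed
 show ?thesis by(intro exI[of _ B] exI[of _ ?z] conjI g(1,2) zI mn cl)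
qed

text \<open>If \<open>S\<close> and the p-th powers generate the fraction field, then every element
  is an \<open>S\<close>-combination of p-th powers up to a denominator, and raising expansions
  along \<open>V\<close> to the power p reduces these to p-th powers of \<open>V\<close>. The
  closure of the p-th powers is shown to be a subring here, which is why \<open>sub\<close> may
  assume it: minimality of \<open>B\<close> then applies.\<close>

lemma star:
 assumes S: "subring S R" and W: "finite W" "W<:$R" "$R<:cl S W"
  and B: "subring B R" "$R<:cl B { #1}" and sub: "subring (cl S (fr ` $R)) R==> B<:cl S (fr ` $R)"
  and V: "finite V" "V<:$R" "$R<:cl S V"
 shows "$R<:cl S (fr ` V)"
proof -
 let ?A = "fr ` $R"
 have sA: "subring ?A R" using frob_subring[OF p carrier_is_subring] .
 interpret M: mdl "R@:S" "selfm R" by(rule mdl_self[OF S])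
 have AR: "?A<:$R" by auto
 have AS: "?A<:$(selfm R)" by auto
 have SR: "s:$R" if "s:S" for s using that subringE(1)[OF S] by blast
 have spR: "x:$R" if "x:sp S ?A" for x using M.spn_closed[OF AS that] by simp
 have lmul: "lm (R@:S) (selfm R) (selfm R) (%x. r*:x)" if "r:$R" for r
  using lm_restrict[OF lm_smult[OF lm_id[OF module_selfm] that] S] by simp
 have mA: "a*:x:sp S ?A" if a: "a:?A" and x: "x:sp S ?A" for a x
 proof -
  have aR: "a:$R" using a AR by blast
  have "a*:x:sp S ((%x. a*:x) ` ?A)" using lm_image_spn[OF lmul[OF aR] AS] x by blast
  moreover have "(%x. a*:x) ` ?A<:?A" using subringE(6)[OF sA a] by blast
  ultimately show ?thesis using M.spn_mono[OF _ AS] by blast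
 qed
 have mm: "x*:y:sp S ?A" if x: "x:sp S ?A" and y: "y:sp S ?A" for x y
 proof -
  have "x*:z:sp S ?A" if z: "z:?A" for z
  proof -
   have "z:$R" using z AR by blast
   thus ?thesis using mA[OF z x] m_comm[OF spR[OF x]] by simp
  qed
  hence "?A<:{z:$(selfm R). x*:z:sp S ?A}" by auto
  hence "sp S ?A<:{z:$(selfm R). x*:z:sp S ?A}"
   by(rule M.spn_least[OF lm_vimage[OF lmul[OF spR[OF x]] M.spn_sm[OF AS]]])
  thus ?thesis using y by blast
 qed
 note C = M.smD[OF cl_sm[OF S AR], simplified]
 have sT: "subring (cl S ?A) R"
 proof (rule subringI)
  show "cl S ?A<:$R" by(auto simp:cl_def)
  show "#1:cl S ?A" using sp_sub_cl[OF S AR] M.spn_incl[OF AS subringE(3)[OF sA]] by blast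
  show "\<ominus> x:cl S ?A" if "x:cl S ?A" for x using C(5)[OF that] by(simp add:a_inv_def m_inv_def selfm_def)
  fix x y assume xy: "x:cl S ?A" "y:cl S ?A"
  show "x +: y:cl S ?A" using C(3)[OF xy] .
  obtain b where b: "b:S" "b ~= #0" "b*:x:sp S ?A" "x:$R" using xy(1) by(auto simp:cl_def)
  obtain c where c: "c:S" "c ~= #0" "c*:y:sp S ?A" "y:$R" using xy(2) by(auto simp:cl_def)
  have "(b*:c)*:(x*:y) = (b*:x)*:(c*:y)" using b c SR by(simp add:m_ac)
  hence "(b*:c)*:(x*:y):sp S ?A" using mm[OF b(3) c(3)] by simp
  thus "x*:y:cl S ?A" unfolding cl_def using b c subringE(6)[OF S b(1) c(1)] integral[of b c] SR by auto
 qed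
 have BT: "B<:cl S ?A" using sub[OF sT] .
 have BR: "b:$R" if "b:B" for b using that subringE(1)[OF B(1)] by blast
 obtain q where q: "p = Suc q" using prime_gt_0_nat[OF p(1)] gr0_implies_Suc by blast
 have "a:cl S ?A" if a: "a:$R" for a
 proof -
  obtain b where b: "b:B" "b ~= #0" "b*:a:B" using B(2) a unfolding cl_def sp_one[OF B(1)] by blast
  have "b [^] q*:(b*:a):B" using subringE(6)[OF B(1) subring_pow[OF B(1) b(1)] b(3)] .
  hence "fr b*:a:B" using q b BR a by(simp add:m_assoc)
  hence "fr b*:a:cl S ?A" using BT by blast
  then obtain s where s: "s:S" "s ~= #0" "s*:(fr b*:a):sp S ?A" by(auto simp:cl_def)
  \<comment> \<open>Turns the denominator, a p-th power of an element of \<open>B\<close>, into a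
    p-th power of an element of \<open>S\<close>.\<close>
  obtain b' where b': "b':$R" "b*:b':S" "b*:b' ~= #0" using mult_in[OF S W BR[OF b(1)] b(2)] by blast
  have "fr b'*:(s*:(fr b*:a)):sp S ?A" using mA[OF _ s(3)] b'(1) by blast
  moreover have "fr b'*:(s*:(fr b*:a)) = (s*:fr (b*:b'))*:a" using b' s SR BR[OF b(1)] a by(simp add:nat_pow_distrib m_ac)
  moreover have "s*:fr (b*:b'):S" using subringE(6)[OF S s(1) subring_pow[OF S b'(2)]] .
  moreover have "s*:fr (b*:b') ~= #0" using integral[of s "fr (b*:b')"] pow_eq_zero[of "b*:b'" p] b' s SR BR[OF b(1)] by auto
  ultimately show ?thesis unfolding cl_def using a by auto
 qed
 moreover have VV: "fr ` V<:$R" using V(2) by auto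
 have "?A<:cl S (fr ` V)"
 proof
  fix x assume "x:?A"
  then obtain a where a: "a:$R" "x = fr a" by blast
  obtain s where s: "s:S" "s ~= #0" "s*:a:sp S V" using V(3) a(1) by(auto simp:cl_def)
  obtain c where c: "ALL v:V. c v:S" "s*:a = (##v:V. c v*:v)" using s(3) sp_fin[OF S V(1), of "%x. x" "s*:a"] V(2) by auto
  have cR: "c v:$R" "v:$R" if "v:V" for v using c(1) SR V(2) that by auto
  have "fr s*:x = fr (s*:a)" using a s SR by(simp add:nat_pow_distrib)
  also have "... = (##v:V. fr (c v*:v))" unfolding c(2) using cR V(1) by(intro frob_finsum) auto
  also have "... = (##v:V. fr (c v)*:fr v)" using cR by(intro finsum_cong') (auto simp:nat_pow_distrib)
  also have "... : sp S (fr ` V)"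
  proof -
   have "EX k.(ALL i:V. k i:S) & (##v:V. fr (c v)*:fr v) = (##i:V. k i*:fr i)"
    using c(1) subring_pow[OF S] by(intro exI[of _ "%v. fr (c v)"]) blast
   moreover have "fr i:$R" if "i:V" for i using cR(2)[OF that] by simp
   ultimately show ?thesis using sp_fin[OF S V(1), of fr] by blast
  qed
  finally show "x:cl S (fr ` V)" unfolding cl_def using a s subring_pow[OF S s(1)] pow_eq_zero[of s p] SR by auto
 qed
 ultimately show "$R<:cl S (fr ` V)" using cl_trans[OF S VV] by blast
qed

end

end

section \<open>Finiteness of minimal primes, and prime avoidance\<close>

context noeth_local begin

text \<open>When a b lies in \<open>I\<close>, a prime above \<open>I\<close> lies above I + a R or
  I + b R, so two finite lists combine.\<close>

lemma prime_list:
 assumes I: "ideal I R"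
 shows "EX \<Q>. finite \<Q> & (ALL T:\<Q>. primeideal T R & I<:T) & (ALL T. primeideal T R--> I<:T--> (EX T':\<Q>. T'<:T))"
proof (rule noeth_induct[OF noetherian_ring_axioms _ I])
 let ?P = "%I. EX \<Q>. finite \<Q> & (ALL T:\<Q>. primeideal T R & I<:T) & (ALL T. primeideal T R--> I<:T--> (EX T':\<Q>. T'<:T))"
 fix I assume I: "ideal I R" and IH: "!!J. ideal J R==> I \<subset> J==> ?P J"
 consider "I = $R" | "primeideal I R" | "I ~= $R" "~primeideal I R" by blast
 thus "?P I"
 proof cases
  case 1
  have "~I<:T" if "primeideal T R" for T using 1 primeideal.I_notcarr[OF that] ideal.Icarr[OF primeideal.axioms(1)[OF that]] by blast
  thus ?thesis by(intro exI[of _ "{}"]) auto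
 next
  case 2 thus ?thesis by(intro exI[of _ "{I}"]) auto
 next
  case 3
  then obtain a b where ab: "a:$R" "b:$R" "a*:b:I" "a~:I" "b~:I"
   using primeidealI[OF I cring_axioms] by blast
  note A = idadd[OF I ab(1)] and B = idadd[OF I ab(2)]
  have sA: "I \<subset> idadd I a" and sB: "I \<subset> idadd I b" using A(2,3) B(2,3) ab(4,5) by blast+
  obtain QA where QA: "finite QA" "ALL T:QA. primeideal T R & idadd I a<:T" "ALL T. primeideal T R--> idadd I a<:T--> (EX T':QA. T'<:T)"
   using IH[OF A(1) sA] by blast
  obtain QB where QB: "finite QB" "ALL T:QB. primeideal T R & idadd I b<:T" "ALL T. primeideal T R--> idadd I b<:T--> (EX T':QB. T'<:T)"
   using IH[OF B(1) sB] by blast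
  show ?thesis
  proof (intro exI[of _ "QA \<union> QB"] conjI ballI allI impI)
   fix T assume T: "primeideal T R" "I<:T"
   have Ti: "ideal T R" using primeideal.axioms(1)[OF T(1)] .
   have "a:T | b:T" using primeideal.I_prime[OF T(1) ab(1,2)] ab(3) T(2) by blast
   hence "idadd I a<:T | idadd I b<:T" using A(4)[OF Ti T(2)] B(4)[OF Ti T(2)] by blast
   thus "EX T':QA \<union> QB. T'<:T" using QA(3) QB(3) T(1) by blast
  next
   fix T assume "T:QA \<union> QB"
   thus "primeideal T R" "I<:T" using QA(2) QB(2) A(2) B(2) by blast+
  qed (use QA(1) QB(1) in auto)
 qed
qed

text \<open>Single out a minimal member T, so that no other member lies inside T. Then some u in
  \<open>J\<close> lies in all others but not in T, and either x or x + u avoids everything.\<close>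

lemma prime_avoid:
 assumes J: "ideal J R"
 shows "finite \<Q>==> (!!T. T : \<Q>==> primeideal T R & ~J<:T)==> EX x:J. ALL T:\<Q>. x~:T"
proof (induct "card \<Q>" arbitrary: \<Q>)
 case 0 thus ?case using additive_subgroup.zero_closed[OF ideal.axioms(1)[OF J]] by auto
next
 case (Suc n)
 interpret J: ideal J R by(rule J)
 have "\<Q> ~= {}" using Suc(2) by auto
 then obtain T where T: "T : \<Q>" "ALL T':\<Q>. T'<:T--> T = T'" using finite_has_minimal[OF Suc(3)] by blast
 let ?Q = "\<Q> - {T}"
 have pT: "primeideal T R" "~J<:T" using Suc(4) T(1) by auto
 interpret T: primeideal T R by(rule pT(1))
 have "n = card ?Q" using Suc(2,3) T(1) by simp
 then obtain x where x: "x:J" "ALL T':?Q. x~:T'" using Suc(1)[of ?Q] Suc(3,4) by auto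
 have "EX u:J. u~:T & (ALL T':Q'. u:T')" if "finite Q'" "Q'<:?Q" for Q'
  using that
 proof (induct)
  case empty thus ?case using pT(2) by blast
 next
  case (insert T' Q')
  then obtain u where u: "u:J" "u~:T" "ALL T':Q'. u:T'" by blast
  have "~T'<:T" using T(2) insert(4) by auto
  then obtain v where v: "v:T'" "v~:T" by blast
  have T'i: "ideal T' R" using Suc(4)[of T'] insert(4) primeideal.axioms(1) by blast
  have c: "u:$R" "v:$R" using J.Icarr u ideal.Icarr[OF T'i v(1)] by auto
  have "u*:v~:T" using T.I_prime[OF c] u v by blast
  moreover have "u*:v:T''" if T'': "T'':insert T' Q'" for T''
  proof -
   have i: "ideal T'' R" using Suc(4)[of T''] T'' insert(4) primeideal.axioms(1) by blast
   show ?thesis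
   proof (cases "T'' = T'")
    case True thus ?thesis using ideal.I_l_closed[OF T'i v(1) c(1)] by simp
   next
    case False thus ?thesis using ideal.I_r_closed[OF i _ c(2), of u] u(3) T'' by blast
   qed
  qed
  ultimately show ?case using J.I_r_closed[OF u(1) c(2)] by blast
 qed
 from this[of ?Q] obtain u where u: "u:J" "u~:T" "ALL T':?Q. u:T'" using Suc(3) by auto
 have c: "x:$R" "u:$R" using J.Icarr x u by auto
 show ?case
 proof (cases "x:T")
  case False thus ?thesis using x by blast
 next
  case True
  have "x +: u~:T"
  proof
   assume "x +: u:T"
   hence "(u +: x) -: x:T" using True c by(simp add:a_minus_def a_comm)
   thus False using u c by(simp add:diff_add_cancel)
  qed
  moreover have "x +: u~:T'" if T': "T':?Q" for T'
  proof
   assume a: "x +: u:T'"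
   interpret T': ideal T' R using Suc(4)[of T'] T' primeideal.axioms(1) by blast
   have "(x +: u) -: u:T'" using a u(3) T' by(simp add:a_minus_def)
   thus False using x(2) T' c by(simp add:diff_add_cancel)
  qed
  ultimately show ?thesis using x(1) u(1) by blast
 qed
qed

end

section \<open>Systems of parameters\<close>

lemma (in ring) prime_pow: assumes "primeideal Q R" "x:$R" "x [^] (n::nat):Q" shows "x:Q"
 using assms(3)
proof (induct n)
 case 0
 hence "Q = $R" using ideal.one_imp_carrier[OF primeideal.axioms(1)[OF assms(1)]] by simp
 thus ?case using primeideal.I_notcarr[OF assms(1)] by blast
next
 case (Suc n) thus ?case using primeideal.I_prime[OF assms(1), of "x [^] n" x] assms(2) by auto
qed

context cdom begin

definition chn :: "nat=> (nat=> 'a set)=> bool" where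
 "chn n C \<longleftrightarrow> (ALL i<=n. primeideal (C i) R) & (ALL i<n. C i \<subset> C (Suc i))"

lemma chn_mono: assumes "chn n C" "primeideal T R" "C n<:T" shows "chn n (C(n := T))"
proof -
 have "(C(n := T)) i \<subset> (C(n := T)) (Suc i)" if i: "i < n" for i
 proof -
  have "C i \<subset> C (Suc i)" using assms(1) i unfolding chn_def by blast
  thus ?thesis using i assms(3) by(cases "Suc i = n") auto
 qed
 thus ?thesis using assms(1,2) unfolding chn_def by auto
qed

lemma chn_ext: assumes "chn n C" "primeideal T R" "C n \<subset> T" shows "chn (Suc n) (C(Suc n := T))"
 using assms unfolding chn_def by(auto simp:less_Suc_eq le_Suc_eq)

text \<open>Start from a longest chain of primes, which runs from 0 to \<open>m\<close>. Its
  parameters are chosen so that every prime containing the first i of them is the top of a chain of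
  length i; a prime containing all of them must then be \<open>m\<close>, or the chain could be
  prolonged.\<close>

lemma ex_sysp:
 assumes ch: "chain_le { #0} s"
 shows "EX d<=s. EX P y. sysp d P y"
proof -
 have mp: "primeideal m R" using maximalideal_prime[OF maxi] .
 let ?P = "%n. EX C. chn n C"
 have "?P 0" using mp by(intro exI[of _ "%_. m"]) (auto simp:chn_def)
 moreover have "ALL n. ?P n--> n < Suc s"
 proof (intro allI impI, rule ccontr)
  fix n assume "?P n" and n: "~n < Suc s"
  then obtain C where C: "chn n C" by blast
  have "(ALL i<=Suc s. primeideal (C i) R & { #0}<:C i) & (ALL i<Suc s. C i \<subset> C (Suc i))"
  proof (intro conjI allI impI)
   fix i assume "i <= Suc s"
   thus "primeideal (C i) R" using C n unfolding chn_def by auto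
   thus "{ #0}<:C i" using additive_subgroup.zero_closed[OF ideal.axioms(1)[OF primeideal.axioms(1)]] by blast
  next
   fix i assume "i < Suc s" thus "C i \<subset> C (Suc i)" using C n unfolding chn_def by auto
  qed
  thus False using ch unfolding chain_le_def by blast
 qed
 ultimately obtain d where "?P d & (ALL n. ?P n--> n <= d)" using ex_has_greatest_nat[of ?P 0 "%n. n" "Suc s"] by auto
 then obtain C where C: "chn d C" and mx: "!!n C'. chn n C'==> n <= d" by blast
 have ds: "d <= s" using \<open>ALL n. ?P n--> n < Suc s\<close> C by auto
 have Cp: "primeideal (C i) R" if "i <= d" for i using C that unfolding chn_def by blast
 have Cl: "C i \<subset> C (Suc i)" if "i < d" for i using C that unfolding chn_def by blast
 have Ci: "ideal (C i) R" if "i <= d" for i using primeideal.axioms(1)[OF Cp[OF that]] .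
 have pm: "T<:m" if "primeideal T R" for T using proper_sub[OF primeideal.axioms(1)[OF that]] primeideal.I_notcarr[OF that] by blast
 have C0: "C 0 = { #0}"
 proof (rule ccontr)
  assume "C 0 ~= { #0}"
  moreover have "#0:C 0" using additive_subgroup.zero_closed[OF ideal.axioms(1)[OF Ci[of 0]]] by simp
  ultimately have "{ #0} \<subset> C 0" by blast
  hence "chn (Suc d) (case_nat { #0} C)" unfolding chn_def using Cp Cl zeroprimeideal by(auto split:nat.split simp:less_Suc_eq_0_disj)
  thus False using mx[of "Suc d"] by auto
 qed
 have Cd: "C d = m"
 proof (rule ccontr)
  assume "C d ~= m"
  hence "C d \<subset> m" using pm[OF Cp[of d]] by blast
  thus False using mx[OF chn_ext[OF C mp]] by simp
 qed
 have Ck: "chn k C" if "k <= d" for k using C that unfolding chn_def by auto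
 \<comment> \<open>The chain condition on primes above the partial sequence replaces a height
   argument and is strong enough for induction.\<close>
 have "EX x.(ALL k<i. x k:C (Suc k) & x k~:C k) & (ALL T. primeideal T R--> x ` {..<i}<:T--> (EX D. chn i D & D i = T))" if "i <= d" for i
  using that
 proof (induct i)
  case 0
  have "EX D. chn 0 D & D 0 = T" if "primeideal T R" for T using that by(intro exI[of _ "%_. T"]) (auto simp:chn_def)
  thus ?case by auto
 next
  case (Suc i)
  then obtain x where x: "ALL k<i. x k:C (Suc k) & x k~:C k" "ALL T. primeideal T R--> x ` {..<i}<:T--> (EX D. chn i D & D i = T)" by auto
  have xR: "x ` {..<i}<:$R"
  proof
   fix v assume "v:x ` {..<i}"
   then obtain k where k: "k < i" "v = x k" by auto
   hence "v:C (Suc k)" using x(1) by blast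
   thus "v:$R" using ideal.Icarr[OF Ci[of "Suc k"]] k Suc(2) by auto
  qed
  obtain Q where Q: "finite Q" "ALL T:Q. primeideal T R & genideal R (x ` {..<i})<:T"
   "ALL T. primeideal T R--> genideal R (x ` {..<i})<:T--> (EX T':Q. T'<:T)" using prime_list[OF genideal_ideal[OF xR]] by blast
  \<comment> \<open>Besides the minimal primes not containing C (i + 1), the prime
    \<open>C i\<close> is avoided, which keeps the new element out of it.\<close>
  let ?Q = "insert (C i) {T:Q.~C (Suc i)<:T}"
  have "EX v:C (Suc i). ALL T:?Q. v~:T"
  proof (rule prime_avoid[OF Ci])
   show "Suc i <= d" using Suc(2) .
   show "finite ?Q" using Q(1) by simp
   show "primeideal T R & ~C (Suc i)<:T" if "T:?Q" for T using that Q(2) Cp[of i] Cl[of i] Suc(2) by auto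
  qed
  then obtain v where v: "v:C (Suc i)" "v~:C i" "!!T. T:Q==> ~C (Suc i)<:T==> v~:T" by blast
  have "EX D. chn (Suc i) D & D (Suc i) = T" if T: "primeideal T R" "(x(i := v)) ` {..<Suc i}<:T" for T
  proof -
   have vT: "v:T" using T(2) by auto
   have "x ` {..<i}<:T" using T(2) by(auto simp:image_subset_iff less_Suc_eq)
   hence "genideal R (x ` {..<i})<:T" using genideal_minimal[OF primeideal.axioms(1)[OF T(1)]] by blast
   then obtain T' where T': "T':Q" "T'<:T" using Q(3) T(1) by blast
   have pT': "primeideal T' R" "x ` {..<i}<:T'" using Q(2) T'(1) genideal_self[OF xR] by auto
   show ?thesis
   \<comment> \<open>In the first case \<open>T\<close> replaces the top of the given chain. In the
     second the new element lies in \<open>T\<close> but not in \<open>T'\<close>, so the chain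
     ending in \<open>T'\<close> extends by \<open>T\<close>.\<close>
   proof (cases "C (Suc i)<:T'")
    case True
    hence "chn (Suc i) (C(Suc i := T))" using chn_mono[OF Ck[OF Suc(2)] T(1)] T'(2) by blast
    thus ?thesis by(intro exI[of _ "C(Suc i := T)"]) auto
   next
    case False
    hence "T' \<subset> T" using v(3)[OF T'(1)] vT T'(2) by blast
    obtain D where D: "chn i D" "D i = T'" using x(2) pT' by blast
    have "chn (Suc i) (D(Suc i := T))" using chn_ext[OF D(1) T(1)] D(2) \<open>T' \<subset> T\<close> by simp
    thus ?thesis by(intro exI[of _ "D(Suc i := T)"]) auto
   qed
  qed
  moreover have "ALL k<Suc i.(x(i := v)) k:C (Suc k) & (x(i := v)) k~:C k" using x(1) v by(auto simp:less_Suc_eq)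
  ultimately show ?case by(intro exI[of _ "x(i := v)"]) blast
 qed
 from this[OF le_refl] obtain x where x: "!!k. k < d==> x k:C (Suc k) & x k~:C k"
  "!!T. primeideal T R==> x ` {..<d}<:T==> EX D. chn d D & D d = T" by blast
 \<comment> \<open>Reversed order: the primes of \<open>sysp\<close> descend from \<open>m\<close>,
   those of the chain ascend from 0.\<close>
 define y where "y j = x (d - 1 - j)" for j
 have "sysp d (%j. C (d - j)) y" unfolding sysp_def
 proof (intro conjI allI impI)
  fix j assume j: "j < d"
  hence e: "Suc (d - 1 - j) = d - j" "d - Suc j = d - 1 - j" by auto
  show "C (d - Suc j)<:C (d - j)" "y j:C (d - j)" "y j~:C (d - Suc j)"
   using Cl[of "d - 1 - j"] x(1)[of "d - 1 - j"] j unfolding y_def e by auto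
 next
  fix Q assume Q: "primeideal Q R" "y ` {..<d}<:Q"
  have "x ` {..<d}<:Q"
  proof
   fix v assume "v:x ` {..<d}"
   then obtain k where k: "k < d" "v = x k" by auto
   hence "v = y (d - 1 - k)" "d - 1 - k < d" by(auto simp:y_def)
   thus "v:Q" using Q(2) by auto
  qed
  then obtain D where D: "chn d D" "D d = Q" using x(2) Q(1) by blast
  show "Q = m"
  proof (rule ccontr)
   assume "Q ~= m"
   hence "D d \<subset> m" using pm[OF Q(1)] D(2) by blast
   thus False using mx[OF chn_ext[OF D(1) mp]] by simp
  qed
 qed (use C0 Cd Cp in auto)
 thus ?thesis using ds by blast
qed

lemma tw_mono: assumes sys: "sysp d P y" and "j <= k" shows "k <= d==> tw y j<:tw y k"
 using assms(2)
proof (induct k rule: dec_induct)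
 case (step k)
 have "subring (tw y k) R" using tower[OF sys, of k] step by simp
 thus ?case using psx_C[OF _ ym(1)[OF sys, of k]] step by auto
qed simp

text \<open>Perfectness makes \<open>K\<close> equal to its p-th powers, which is rank one at the
  start; each power series variable contributes a factor p by \<open>frob_span\<close>.\<close>

lemma tw_frob:
 assumes sys: "sysp d P y" and p: "Factorial_Ring.prime (p::nat)" "[p] \<cdot> #1 = #0"
 shows "j <= d==> EX E. finite E & E<:tw y j & card E <= p ^ j & tw y j<:sp ((%x. x [^] p) ` tw y j) E"
proof (induct j)
 case 0
 have "(%x. x [^] p) ` K = K"
 proof
  show "(%x. x [^] p) ` K<:K" using subring_pow[OF subK] by blast
  show "K<:(%x. x [^] p) ` K"
  proof
   fix a assume "a:K"
   then obtain b where "b:K" "b [^] p = a" using perf[OF p] by blast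
   thus "a:(%x. x [^] p) ` K" by blast
  qed
 qed
 thus ?case using sp_one[OF subK] subringE(3)[OF subK] by(intro exI[of _ "{ #1}"]) auto
next
 case (Suc j)
 then obtain E where E: "finite E" "E<:tw y j" "card E <= p ^ j" "tw y j<:sp ((%x. x [^] p) ` tw y j) E" by auto
 let ?S = "tw y (Suc j)" and ?t = "y j"
 have j: "j < d" using Suc by simp
 interpret P: pser "R@:?S" "tw y j" ?t by(rule tower_pser[OF sys j])
 have sj: "subring (tw y j) R" and sS: "subring ?S R" using tower[OF sys, of j] tower[OF sys, of "Suc j"] j by auto
 have pw: "x [^]\<^bsub>R@:?S\<^esub> (n::nat) = x [^] n" for x n using nat_pow_consistent[of x n ?S] by simp
 have ad: "[p] \<cdot>\<^bsub>R@:?S\<^esub> \<one>\<^bsub>R@:?S\<^esub> = 0[R@:?S]" using p(2) by(simp add:add_pow_def nat_pow_def)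
 have sf: "selfm (R@:?S) = (selfm R)\<lparr>carrier := ?S\<rparr>" by(simp add:selfm_def)
 note fs = P.frob_span[OF p(1) ad E(1,2), unfolded pw sf spn_carrier_upd]
 let ?E = "(%(e,k). e*:?t [^] k) ` (E \<times> {..<p})"
 have "?S<:sp ((%x. x [^] p) ` ?S) ?E" using fs E(4) by simp
 moreover have "card ?E <= p ^ Suc j"
 proof -
  have "card ?E <= card (E \<times> {..<p})" using E(1) by(intro card_image_le) auto
  also have "... = card E * p" by(simp add:card_cartesian_product)
  also have "... <= p ^ j * p" using E(3) by(rule mult_right_mono) simp
  finally show ?thesis by(simp add:mult.commute)
 qed
 moreover have "?E<:?S"
 proof -
  have "?t:?S" "E<:?S" using psx_t[OF sj ym(1)[OF sys j]] psx_C[OF sj ym(1)[OF sys j]] E(2) by auto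
  thus ?thesis using subringE(6)[OF sS] subring_pow[OF sS] by auto
 qed
 ultimately show ?case using E(1) by(intro exI[of _ ?E]) auto
qed

text \<open>With the new parameters y'_j = y_j^p (1 + z_j), each z_j = y'_j / y_j^p - 1 lies in the
  field generated by the new tower ring and the p-th powers. Since the z_j generate everything over
  the p-th powers, \<open>star\<close> and \<open>sep_p\<close> apply.\<close>

lemma sep_sys:
 assumes sys: "sysp d P y"
 shows "EX y'. sysp d P y' & (ALL \<theta>:$R. sepr (tw y' d) \<theta>)"
proof -
 have gens: "EX e. finite e & e<:$R & $R<:cl (tw y d) e" if sys: "sysp d P y" for y
  using tower_gen[OF sys] sp_sub_cl tower[OF sys le_refl] by(metis order_trans)
 show ?thesis
 proof (cases "EX p::nat. Factorial_Ring.prime p & [p] \<cdot> #1 = #0")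
  case False
  obtain e where e: "finite e" "e<:$R" "$R<:cl (tw y d) e" using gens[OF sys] by blast
  have S: "subring (tw y d) R" using tower[OF sys] by simp
  have "sepr (tw y d) \<theta>" if "\<theta> : $R" for \<theta> by(rule sep_0[OF _ S e that]) (use False in blast)
  thus ?thesis using sys by blast
 next
  case True
  then obtain p :: nat where p: "Factorial_Ring.prime p" "[p] \<cdot> #1 = #0" by blast
  let ?A = "(%x. x [^] p) ` $R"
  show ?thesis
  proof (cases "d = 0")
   case d0: True
   have "P 0 = m" "P d = { #0}" using sys by(auto simp:sysp_def)
   hence m0: "m = { #0}" using d0 by simp
   have KR: "K<:$R" using subringE(1)[OF subK] .
   have "sepr (tw y d) \<theta>" if \<theta>: "\<theta> : $R" for \<theta>
   proof -
    obtain k u where "k:K" "u:m" "\<theta> = k +: u" using decK[OF \<theta>] by blast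
    hence \<theta>K: "\<theta> : K" using m0 KR by auto
    \<comment> \<open>Here \<open>m\<close> is zero, so \<open>\<theta>\<close> lies in
      \<open>K\<close> and is a simple root of X - \<theta>.\<close>
    let ?f = "%k::nat. if k = 0 then \<ominus> \<theta> else #1"
    have "(##k:{..Suc 0}. ?f k *: \<theta> [^] k) = #1 *: \<theta> [^] Suc 0 +: (##k:{..0::nat}. ?f k *: \<theta> [^] k)"
     using \<theta> by(subst finsum_Suc) auto
    hence 1: "(##k:{..Suc 0}. ?f k *: \<theta> [^] k) = #0" using \<theta> finsum_0[of "%k. ?f k *: \<theta> [^] k"] by(simp add:r_neg)
    have "(##k:{..Suc 0}. ?f k *: [k] \<cdot> (\<theta> [^] (k - 1))) = #1 *: [Suc 0] \<cdot> (\<theta> [^] (Suc 0 - 1)) +: (##k:{..0::nat}. ?f k *: [k] \<cdot> (\<theta> [^] (k - 1)))"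
     using \<theta> by(subst finsum_Suc) auto
    hence 2: "(##k:{..Suc 0}. ?f k *: [k] \<cdot> (\<theta> [^] (k - 1))) ~= #0" using \<theta> finsum_0[of "%k. ?f k *: [k] \<cdot> (\<theta> [^] (k - 1))"] by simp
    show ?thesis unfolding sepr_def d0 tw.simps
     by(intro exI[of _ "Suc 0"] exI[of _ ?f] conjI 1 2) (use \<theta>K subringE(3,5)[OF subK] in auto)
   qed
   thus ?thesis using sys by blast
  next
   case False
   have S: "subring (tw y d) R" using tower[OF sys] by simp
   obtain e where e: "finite e" "e<:$R" "$R<:cl (tw y d) e" using gens[OF sys] by blast
   obtain V where V: "V<:$R" "ind (tw y d) V (%x. x)" "$R<:cl (tw y d) V"
    using ex_basis[OF S e(1,2) order_refl e(3), of "{}"] indI[of "{}" "%x. x"] by auto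
   obtain E where E: "finite E" "E<:tw y d" "card E <= p ^ d" "tw y d<:sp ((%x. x [^] p) ` tw y d) E" using tw_frob[OF sys p le_refl] by blast
   have ER: "E<:$R" using E(2) subringE(1)[OF S] by blast
   have bd: "card J <= p ^ d" if "ind ?A J u" for J :: "nat set" and u
    using rank_bound[OF p S V E(1) ER E(4) that] E(3) by simp
   \<comment> \<open>\<open>pbasis\<close> needs a nonzero element of \<open>m\<close>, which exists
     because d > 0.\<close>
   have y0: "y 0:m" "y 0 ~= #0" using ym[OF sys, of 0] False by auto
   obtain B z where B: "subring B R" "?A<:B" "ALL j<d. z j:m" "ALL T. subring T R--> ?A<:T--> (ALL j<d. z j:T)--> B<:T" "$R<:cl B { #1}"
   proof -
    have "EX B z. subring B R & ?A<:B & (ALL j<d. z j:m) &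
(ALL T. subring T R--> ?A<:T--> (ALL j<d. z j:T)--> B<:T) & $R<:cl B { #1}"
     by(rule pbasis[OF p m_ideal y0]) (erule bd)
    thus ?thesis by(elim exE conjE) (rule that)
   qed
   \<comment> \<open>The p-th power makes the old parameter disappear from the field generated over
     p-th powers, so that only the unit \<open>1 + z j\<close> is new.\<close>
   define y' where "y' j = y j [^] p*:(#1 +: z j)" for j
   have yz: "y j:$R" "z j:$R" "#1 +: z j~:m" if "j < d" for j
    using ym(1)[OF sys that] B(3) that mR unit_one_minus(2) by auto
   obtain q where q: "p = Suc q" using prime_gt_0_nat[OF p(1)] gr0_implies_Suc by blast
   \<comment> \<open>As \<open>1 + z j\<close> is a unit, a prime contains \<open>y' j\<close> only
     if it contains \<open>y j\<close>; hence the new parameters fit the same chain of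
     primes.\<close>
   have prm: "y j:Q" if "primeideal Q R" "j < d" "y' j:Q" for Q j
   proof -
    have "#1 +: z j~:Q" using yz(3)[OF that(2)] proper_sub[OF primeideal.axioms(1)[OF that(1)]] primeideal.I_notcarr[OF that(1)] by blast
    hence "y j [^] p:Q" using primeideal.I_prime[OF that(1), of "y j [^] p" "#1 +: z j"] that(3) yz[OF that(2)] by(auto simp:y'_def)
    thus ?thesis using prime_pow[OF that(1)] yz(1)[OF that(2)] by blast
   qed
   have sys': "sysp d P y'" unfolding sysp_def
   proof (intro conjI allI impI)
    show "P 0 = m" "P d = { #0}" using sys by(auto simp:sysp_def)
    show "primeideal (P j) R" if "j <= d" for j using sys that by(auto simp:sysp_def)
    fix j assume j: "j < d"
    have Pj: "ideal (P j) R" "primeideal (P (Suc j)) R" "y j:P j" "y j~:P (Suc j)" "P (Suc j)<:P j" using sys j by(auto simp:sysp_def primeideal_def)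
    show "P (Suc j)<:P j" by fact
    have "y j [^] p:P j" using ideal.I_l_closed[OF Pj(1,3), of "y j [^] q"] yz(1)[OF j] q by simp
    thus "y' j:P j" using ideal.I_r_closed[OF Pj(1)] yz[OF j] by(simp add:y'_def)
    show "y' j~:P (Suc j)" using prm[OF Pj(2) j] Pj(4) by blast
   next
    fix Q assume Q: "primeideal Q R" "y' ` {..<d}<:Q"
    have "y ` {..<d}<:Q" using prm[OF Q(1)] Q(2) by auto
    thus "Q = m" using sys Q(1) unfolding sysp_def by blast
   qed
   let ?S = "tw y' d"
   have S': "subring ?S R" using tower[OF sys'] by simp
   obtain W where W: "finite W" "W<:$R" "$R<:cl ?S W" using gens[OF sys'] by blast
   interpret M: mdl "R@:?S" "selfm R" by(rule mdl_self[OF S'])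
   have AS: "?A<:$(selfm R)" "?A<:$R" by auto
   have SR: "s:$R" if "s:?S" for s using that subringE(1)[OF S'] by blast
   \<comment> \<open>\<open>y j\<close> itself may lie outside the new tower ring. A multiple y_j b
     inside it is taken, and its p-th power is the denominator: times z_j + 1 it gives y'_j
     b^p.\<close>
   have zc: "z j:cl ?S ?A" if j: "j < d" for j
   proof -
    have "y' j:tw y' (Suc j)" using psx_t[OF _ ym(1)[OF sys' j]] tower[OF sys', of j] j by simp
    hence y'S: "y' j:?S" using tw_mono[OF sys', of "Suc j" d] j by auto
    note yj = yz[OF j] and y'R = SR[OF y'S]
    obtain b where b: "b:$R" "y j*:b:?S" "y j*:b ~= #0" using mult_in[OF S' W yj(1) ym(2)[OF sys j]] by blast
    let ?s = "(y j*:b) [^] p"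
    have s: "?s:?S" "?s ~= #0" using subring_pow[OF S' b(2)] pow_eq_zero[of "y j*:b" p] b yj by auto
    have "?s*:z j +: ?s = y' j*:b [^] p" using b yj by(simp add:y'_def nat_pow_distrib r_distr m_ac, simp add:a_comm)
    hence e: "?s*:z j = y' j*:b [^] p -: ?s" using b yj s SR diff_add_cancel[of "?s*:z j" ?s] by simp
    have i: "x:sp ?S ?A" if "x:?A" for x using M.spn_incl[OF AS(1) that] .
    have "y' j*:b [^] p:sp ?S ?A" using M.spn_smult[OF AS(1), of "y' j" "b [^] p"] i[of "b [^] p"] y'S b by auto
    moreover have "?s:sp ?S ?A" using i[of ?s] b yj by auto
    ultimately have "y' j*:b [^] p -: ?s:sp ?S ?A" using M.smD(6)[OF M.spn_sm[OF AS(1)]] by auto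
    thus ?thesis unfolding cl_def using s yj e by auto
   qed
   have sub: "B<:cl ?S ?A" if "subring (cl ?S ?A) R"
   proof -
    have "?A<:cl ?S ?A" using sp_sub_cl[OF S' AS(2)] M.spn_incl[OF AS(1)] by blast
    thus ?thesis using B(4) that zc by blast
   qed
   have "sepr ?S \<theta>" if "\<theta> : $R" for \<theta>
    by(rule sep_p[OF p S' W star[OF p S' W B(1,5) sub] that])
   thus ?thesis using sys' by blast
  qed
 qed
qed

text \<open>The tower has d variables, where d <= s is the length of a longest prime chain, so
  modules over it have projective dimension at most s.\<close>

lemma thmB_dom:
 assumes ch: "chain_le { #0} s"
 shows "EX x:$R. x ~= #0 & (ALL B b (M :: nat=> 'a umod) E f g. cyc B b { #0}--> (ALL i<=s. ses R (M (Suc i)) (E i) (M i) (f i) (g i) & E i:pw R B) -->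
fin_gen R (M 0)--> (EX h. lm R (M s) (E s) h & (ALL y:$(M s). g s (h y) = x*[M s] y)))"
proof -
 obtain d P y0 where d: "d <= s" "sysp d P y0" using ex_sysp[OF ch] by blast
 obtain y where y: "sysp d P y" "ALL \<theta>:$R. sepr (tw y d) \<theta>" using sep_sys[OF d(2)] by blast
 have S: "subring (tw y d) R" and gd: "!!N :: 'a umod. fin_gen (R@:(tw y d)) N==> pdf (R@:(tw y d)) d N" using tower[OF y(1) le_refl] by auto
 obtain e where e: "finite e" "e<:$R" "$R<:sp (tw y d) e" using tower_gen[OF y(1)] by blast
 have gd': "pdf (R@:(tw y d)) s N" if "fin_gen (R@:(tw y d)) N" for N :: "'a umod"
  using cring.pdf_mono[OF sub_cring[OF S] gd[OF that] d(1)] .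
 show ?thesis by(rule lift_thm[OF S e gd']) (use y(2) in auto)
qed

end

section \<open>Transfer to residue domains\<close>

text \<open>R / P is carried by representatives selected by \<open>r\<close>, so its elements have
  the same type as those of \<open>R\<close>. An \<open>R\<close>-module killed by \<open>P\<close>
  is then literally a module over \<open>A\<close>, in the same \<open>'a umod\<close>.\<close>

locale qdom = noeth_local R m for R (structure) and m + fixes P :: "'a set" and r :: "'a=> 'a" and A :: "'a ring"
 assumes PP: "primeideal P R"
  and rR: "x:$R==> r x:$R & r x -: x:P"
  and rr: "x:$R==> y:$R==> r x = r y \<longleftrightarrow> x -: y:P"
  and A: "A = image_ring r R"
begin

lemma Pi: "ideal P R" using primeideal.axioms(1)[OF PP] .

lemma wm: "weak_ring_morphism r P R" by(rule weak_ring_morphismI[OF Pi]) (rule rr)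

lemma domA: "domain A"
 using domain.ring_iso_imp_img_domain[OF primeideal.quotient_is_domain[OF PP] weak_ring_morphism_is_iso[OF wm]]
 unfolding image_ring_zero'[OF wm] A by simp

sublocale A: domain A by(rule domA)

lemma hom: "r:ring_hom R A"
proof -
 let ?h = "(%x. the_elem (r ` x)) \<circ> (+>) P"
 have H: "?h:ring_hom R A"
  using ring_hom_trans[OF ideal.rcos_ring_hom[OF Pi]] weak_ring_morphism_is_iso[OF wm] unfolding A ring_iso_def by blast
 have e: "?h x = r x" if "x:$R" for x using weak_ring_morphism_range[OF wm that] by simp
 show ?thesis
 proof (rule ring_hom_memI)
  fix x y assume xy: "x:$R" "y:$R"
  show "r x:$A" using ring_hom_closed[OF H xy(1)] e[OF xy(1)] by simp
  show "r (x*:y) = r x \<otimes>\<^bsub>A\<^esub> r y" using ring_hom_mult[OF H xy] unfolding e[OF xy(1)] e[OF xy(2)] e[OF m_closed[OF xy]] .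
  show "r (x +: y) = r x+[A] r y" using ring_hom_add[OF H xy] unfolding e[OF xy(1)] e[OF xy(2)] e[OF a_closed[OF xy]] .
 next
  show "r #1 = \<one>\<^bsub>A\<^esub>" using ring_hom_one[OF H] unfolding e[OF one_closed] .
 qed
qed

lemma Ac: "$A = r ` $R" unfolding A by(rule image_ring_carrier)

lemma rA: "x:$R==> r x:$A" unfolding Ac by blast

lemma rid: assumes "a:$A" shows "a:$R" "r a = a"
proof -
 obtain x where x: "x:$R" "a = r x" using assms Ac by auto
 show "a:$R" using x rR by blast
 thus "r a = a" using rr[of a x] rR[OF x(1)] x by simp
qed

lemma rops: "x:$R==> y:$R==> r (x +: y) = r x+[A] r y" "x:$R==> y:$R==> r (x*:y) = r x \<otimes>\<^bsub>A\<^esub> r y" "r #1 = \<one>\<^bsub>A\<^esub>"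
 using hom by(auto simp:ring_hom_def)

lemma rzero: "r #0 = 0[A]" unfolding A by(rule image_ring_zero[symmetric])

lemma r0: "x:$R==> r x = 0[A] \<longleftrightarrow> x:P"
 using rr[of x \<zero>] rzero by(simp add:diff_zero)

lemma rneg: "x:$R==> r (\<ominus> x) = \<ominus>\<^bsub>A\<^esub> r x"
 using rops(1)[of "\<ominus> x" x] rzero A.minus_equality[of "r (\<ominus> x)" "r x"] rA by(simp add:l_neg)

lemma rpow: "x:$R==> r (x [^] (n::nat)) = r x [^]\<^bsub>A\<^esub> n"
 by(induct n) (auto simp:rops)

lemma raddpow: "x:$R==> r ([(n::nat)] \<cdot> x) = [n] \<cdot>\<^bsub>A\<^esub> r x"
 by(induct n) (auto simp:rops rzero)

lemma Aops: "a:$A==> b:$A==> a+[A] b = r (a +: b)" "a:$A==> b:$A==> a \<otimes>\<^bsub>A\<^esub> b = r (a*:b)"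
 using rops rid by auto

definition up :: "'a set=> 'a set" where "up T = {x:$R. r x:T}"

lemma up_ideal: assumes "ideal T A" shows "ideal (up T) R" "P<:up T"
proof -
 interpret T: ideal T A by fact
 show "ideal (up T) R"
  by(rule ideal_intro) (use rops rzero T.zero_closed T.a_closed T.I_l_closed rA in \<open>auto simp:up_def\<close>)
 show "P<:up T"
 proof
  fix x assume x: "x:P"
  have xR: "x:$R" using ideal.Icarr[OF Pi x] .
  hence "r x = 0[A]" using r0 x by blast
  hence "r x:T" using T.zero_closed by metis
  thus "x:up T" using xR by(simp add:up_def)
 qed
qed

lemma up_image: assumes "T<:$A" shows "r ` up T = T"
proof
 show "T<:r ` up T"
 proof
  fix a assume a: "a:T"
  hence "a:$R" "r a = a" using rid assms by auto
  thus "a:r ` up T" using a by(intro image_eqI[of _ _ a]) (auto simp:up_def)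
 qed
qed (auto simp:up_def)

lemma idealA: "ideal T A==> T<:$A" using ideal.Icarr[of T A] by blast

lemma noethA: "noetherian_ring A"
proof (rule A.noetherian_ringI)
 fix J assume J: "ideal J A"
 obtain G where G: "G<:$R" "finite G" "up J = genideal R G" using finetely_gen[OF up_ideal(1)[OF J]] by blast
 have rG: "r ` G<:$A" using G(1) rA by blast
 have "J = genideal A (r ` G)"
 proof
  have "G<:up J" using genideal_self[OF G(1)] G(3) by simp
  hence "r ` G<:J" by(auto simp:up_def)
  thus "genideal A (r ` G)<:J" using A.genideal_minimal[OF J] by blast
  have "G<:up (genideal A (r ` G))" using A.genideal_self[OF rG] G(1) by(auto simp:up_def)
  hence "up J<:up (genideal A (r ` G))" unfolding G(3) using genideal_minimal[OF up_ideal(1)[OF A.genideal_ideal[OF rG]]] by blast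
  hence "r ` up J<:genideal A (r ` G)" by(auto simp:up_def)
  thus "J<:genideal A (r ` G)" using up_image[OF idealA[OF J]] by simp
 qed
 thus "\<exists>G\<subseteq>$A. finite G & J = genideal A G" using rG G(2) by blast
qed

lemma Pm: "P<:m" using proper_sub[OF Pi] primeideal.I_notcarr[OF PP] by blast

lemma rm: "x:$R==> r x:r ` m \<longleftrightarrow> x:m"
proof
 interpret m: ideal m R by(rule m_ideal)
 assume x: "x:$R" and "r x:r ` m"
 then obtain u where u: "u:m" "r x = r u" by blast
 hence "x -: u:m" using rr[OF x mR[OF u(1)]] Pm by blast
 hence "(x -: u) +: u:m" using u by simp
 thus "x:m" using x mR[OF u(1)] by(simp add:add_diff_cancel)
qed simp

lemma mA_sub: assumes T: "ideal T A" "T ~= $A" shows "T<:r ` m"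
proof -
 have "up T ~= $R"
 proof
  assume "up T = $R"
  hence "T = $A" using up_image[OF idealA[OF T(1)]] Ac by simp
  thus False using T(2) by blast
 qed
 hence "up T<:m" using proper_sub[OF up_ideal(1)[OF T(1)]] by blast
 thus ?thesis using up_image[OF idealA[OF T(1)]] by blast
qed

lemma mA_ideal: "ideal (r ` m) A" "r ` m ~= $A"
proof -
 interpret m: ideal m R by(rule m_ideal)
 show "ideal (r ` m) A"
 proof (rule A.ideal_intro)
  show "r ` m<:$A" using mR rA by blast
  show "0[A]:r ` m" using rzero m.zero_closed by(metis image_eqI)
  fix x assume "x:r ` m"
  then obtain u where u: "u:m" "x = r u" by blast
  show "x+[A] y:r ` m" if y: "y:r ` m" for y
  proof -
   obtain v where "v:m" "y = r v" using y by(elim imageE) (rule that)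
   thus ?thesis using rops(1)[of u v] u mR m.a_closed[of u v] by(metis image_eqI)
  qed
  fix c assume c: "c:$A"
  have "r (c*:u) = c \<otimes>\<^bsub>A\<^esub> x" using rops(2)[of c u] rid[OF c] mR u by simp
  thus "c \<otimes>\<^bsub>A\<^esub> x:r ` m" using m.I_l_closed[OF u(1) rid(1)[OF c]] by(metis image_eqI)
 qed
 have "#1~:m" using m.one_imp_carrier maximalideal.I_notcarr[OF maxi] by blast
 hence "r #1~:r ` m" using rm by simp
 thus "r ` m ~= $A" using rA[OF one_closed] by blast
qed

lemma localA: "noeth_local A (r ` m)"
proof (intro noeth_local.intro noeth_local_axioms.intro)
 show "cring A" by(rule A.cring_axioms)
 show "noetherian_ring A" by(rule noethA)
 show "maximalideal (r ` m) A"
  by(rule maximalidealI[OF mA_ideal(1)]) (use mA_ideal(2) mA_sub in blast)+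
 fix T assume T: "maximalideal T A"
 hence "ideal T A" "T ~= $A" using maximalideal.axioms(1) maximalideal.I_notcarr by blast+
 hence "T<:r ` m" by(rule mA_sub)
 thus "T = r ` m" using maximalideal.I_maximal[OF T mA_ideal(1)] mA_ideal(2) idealA[OF mA_ideal(1)] by blast
qed

lemma chainA: assumes ch: "chain_le P s" shows "A.chain_le {0[A]} s"
 unfolding A.chain_le_def
proof
 assume "EX Q.(ALL i<=Suc s. primeideal (Q i) A & {0[A]}<:Q i) & (ALL i<Suc s. Q i \<subset> Q (Suc i))"
 then obtain Q where Q: "!!i. i <= Suc s==> primeideal (Q i) A" "!!i. i < Suc s==> Q i \<subset> Q (Suc i)" by blast
 have Qi: "ideal (Q i) A" if "i <= Suc s" for i using primeideal.axioms(1)[OF Q(1)[OF that]] .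
 have 1: "primeideal (up (Q i)) R" if i: "i <= Suc s" for i
 proof (rule primeidealI[OF up_ideal(1)[OF Qi[OF i]] cring_axioms])
  have "\<one>\<^bsub>A\<^esub> ~: Q i" using ideal.one_imp_carrier[OF Qi[OF i]] primeideal.I_notcarr[OF Q(1)[OF i]] by blast
  hence "#1~:up (Q i)" by(simp add:up_def rops(3))
  thus "$R ~= up (Q i)" using one_closed by metis
  fix a b assume ab: "a:$R" "b:$R" "a*:b:up (Q i)"
  thus "a:up (Q i) | b:up (Q i)" using primeideal.I_prime[OF Q(1)[OF i] rA[OF ab(1)] rA[OF ab(2)]] rops(2) by(auto simp:up_def)
 qed
 have 2: "up (Q i) \<subset> up (Q (Suc i))" if i: "i < Suc s" for i
 proof -
  have "up (Q i)<:up (Q (Suc i))" using Q(2)[OF i] by(auto simp:up_def)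
  moreover have "up (Q i) ~= up (Q (Suc i))" using Q(2)[OF i] up_image[OF idealA[OF Qi]] i by(metis Suc_leI less_imp_le psubset_eq)
  ultimately show ?thesis by blast
 qed
 have "EX C.(ALL i<=Suc s. primeideal (C i) R & P<:C i) & (ALL i<Suc s. C i \<subset> C (Suc i))"
  by(rule exI[of _ "%i. up (Q i)"]) (use 1 2 up_ideal(2)[OF Qi] in simp)
 thus False using ch unfolding chain_le_def by(rule notE[rotated])
qed

section \<open>Modules killed by P as modules over the residue domain\<close>

definition kl :: "('a,'e) module=> bool" where
 "kl M \<longleftrightarrow> module R M & (ALL a:P. ALL x:$M. a*[M] x = 0[M])"

lemma kl_r: assumes "kl M" "x:$R" "y:$M" shows "r x*[M] y = x*[M] y"
proof -
 interpret M: mdl R M using assms(1) by(simp add:kl_def mdl_def)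
 have d: "r x:$R" "r x -: x:P" using rR[OF assms(2)] by auto
 have "r x*[M] y = ((r x -: x) +: x)*[M] y" using d assms(2) by(simp add:add_diff_cancel)
 also have "... = (r x -: x)*[M] y+[M] x*[M] y" using d assms by(intro M.smult_l_distr) auto
 also have "(r x -: x)*[M] y = 0[M]" using assms d by(simp add:kl_def)
 finally show ?thesis using assms by simp
qed

lemma modA: assumes "kl M" shows "module A M"
proof -
 interpret M: module R M using assms by(simp add:kl_def)
 show ?thesis
 proof (rule moduleI[OF A.cring_axioms M.abelian_group_axioms])
  fix a b x assume ab: "a:$A" "b:$A" "x:$M"
  note R = rid(1)[OF ab(1)] rid(1)[OF ab(2)]
  show "(a+[A] b)*[M] x = a*[M] x+[M] b*[M] x" unfolding Aops(1)[OF ab(1,2)] using kl_r[OF assms] R ab(3) by(simp add:M.smult_l_distr)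
  show "(a \<otimes>\<^bsub>A\<^esub> b)*[M] x = a*[M] (b*[M] x)" unfolding Aops(2)[OF ab(1,2)] using kl_r[OF assms] R ab(3) by(simp add:M.smult_assoc1)
 next
  fix x assume x: "x:$M"
  show "\<one>\<^bsub>A\<^esub> *[M] x = x" unfolding rops(3)[symmetric] using kl_r[OF assms one_closed x] x by simp
 qed (use rid(1) in \<open>auto simp:M.smult_r_distr\<close>)
qed

lemma lmA: assumes "kl M" "kl N" shows "lm A M N f \<longleftrightarrow> lm R M N f"
proof
 assume f: "lm A M N f"
 show "lm R M N f"
 proof (rule lmI)
  show "module R M" "module R N" using assms by(auto simp:kl_def)
  show "f x:$N" if "x:$M" for x using lmD(3)[OF f that] .
  show "f (x+[M] y) = f x+[N] f y" if "x:$M" "y:$M" for x y using lmD(4)[OF f that] .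
  show "f (a*[M] x) = a*[N] f x" if a: "a:$R" "x:$M" for a x
   using lmD(5)[OF f rA[OF a(1)] a(2)] kl_r[OF assms(1) a] kl_r[OF assms(2) a(1) lmD(3)[OF f a(2)]] by simp
 qed
next
 assume f: "lm R M N f"
 show "lm A M N f" by(rule lmI[OF modA[OF assms(1)] modA[OF assms(2)]]) (use lmD(3,4,5)[OF f] rid(1) in auto)
qed

lemma fgA: assumes "kl M" "fin_gen R M" shows "fin_gen A M"
proof -
 interpret M: module R M using assms(1) by(simp add:kl_def)
 obtain n g where g: "gens_by R M n g" using assms(2) by(auto simp:fin_gen_def)
 have gM: "g i:$M" if "i < n" for i using g that by(auto simp:gens_by_def)
 have "EX c:{..<n} \<rightarrow> $A. x = (##[M]i:{..<n}. c i*[M] g i)" if x: "x:$M" for x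
 proof -
  obtain c where c: "c:{..<n} \<rightarrow> $R" "x = (##[M]i:{..<n}. c i*[M] g i)" using g x by(auto simp:gens_by_def)
  have cR: "c i:$R" if "i < n" for i using c(1) that by auto
  have "(##[M]i:{..<n}. c i*[M] g i) = (##[M]i:{..<n}. r (c i)*[M] g i)"
   using cR gM rR kl_r[OF assms(1)] by(intro M.finsum_cong') auto
  thus ?thesis using c(2) cR rA by(intro bexI[of _ "%i. r (c i)"]) auto
 qed
 hence "gens_by A M n g" using g by(simp add:gens_by_def)
 thus ?thesis using modA[OF assms(1)] by(auto simp:fin_gen_def)
qed

lemma kill_kl: "M:kill P==> kl M" by(auto simp:kill_def kl_def fin_gen_def)

lemma pwA: assumes B: "B:kill P" and E: "E:pw R B" shows "E:pw A B"
 using E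
proof (induct rule: pw.induct)
 case (zero Z)
 have "kl Z" using kill_kl[OF pw_kill[OF _ B pw.zero[OF zero]]] ideal.Icarr[OF Pi] by blast
 thus ?case using pw.zero[OF fgA] zero by blast
next
 case (step N Q p q i j)
 have k: "kl N" "kl Q" using kill_kl[OF pw_kill[OF _ B step(1)]] kill_kl[OF pw_kill[OF _ B pw.step[OF step(1,3)]]] ideal.Icarr[OF Pi] by blast+
 have "bip A B N Q p q i j" using step(3) unfolding bip_def lmA[OF k(2) kill_kl[OF B]] lmA[OF k(2,1)] lmA[OF kill_kl[OF B] k(2)] lmA[OF k] .
 thus ?case using pw.step step(2) by blast
qed

text \<open>For modules killed by \<open>P\<close>, linearity, exactness and powers of
  \<open>B\<close> mean the same over \<open>R\<close> and over \<open>A\<close>, and annihilator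
  \<open>P\<close> becomes annihilator zero. The kernels in the chain are killed by \<open>P\<close>
  because they embed in powers of \<open>B\<close>.\<close>

lemma transfer:
 assumes x: "x:$A" "x ~= 0[A]"
  and H: "ALL B b (M :: nat=> 'a umod) E f g. A.cyc B b {0[A]}--> (ALL i<=s. ses A (M (Suc i)) (E i) (M i) (f i) (g i) & E i:pw A B) -->
fin_gen A (M 0)--> (EX h. lm A (M s) (E s) h & (ALL y:$(M s). g s (h y) = x*[M s] y))"
 shows "EX x:$R - P. ALL B e M E f g. cyc B e P -->
(ALL i<=s. ses R (M (Suc i)) (E i) (M i) (f i) (g i) & E i:pw R B)--> M 0:kill P -->
(EX h. lm R (M s) (E s) h & (ALL y:$(M s). g s (h y) = x*[M s] y))"
proof (intro bexI[of _ x] allI impI)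
 show "x:$R - P" using rid[OF x(1)] r0[of x] x(2) by auto
 fix B e E f g and M :: "nat=> 'a umod"
 assume B: "cyc B e P" and ch: "ALL i<=s. ses R (M (Suc i)) (E i) (M i) (f i) (g i) & E i:pw R B" and M0: "M 0:kill P"
 have Bk: "B:kill P" using cyc_kill[OF Pi B] .
 have PR: "P<:$R" using ideal.Icarr[OF Pi] by blast
 have Ek: "kl (E i)" if "i <= s" for i using kill_kl[OF pw_kill[OF PR Bk]] ch that by blast
 have Mk: "kl (M i)" if "i <= Suc s" for i
 proof (cases i)
  case 0 thus ?thesis using kill_kl[OF M0] by simp
 next
  case (Suc j)
  hence j: "j <= s" using that by simp
  note D = sesD[OF conjunct1[OF ch[rule_format, OF j]]]
  have "a*[M (Suc j)] y = 0[M (Suc j)]" if a: "a:P" "y:$(M (Suc j))" for a y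
  proof -
   have aR: "a:$R" using a PR by blast
   interpret L: module R "M (Suc j)" by(rule D(4))
   have "f j (a*[M (Suc j)] y) = f j 0[M (Suc j)]"
    using lmD(5)[OF D(1) aR a(2)] lmD(6)[OF D(1)] Ek[OF j] a lmD(3)[OF D(1) a(2)] by(simp add:kl_def)
   thus ?thesis using inj_onD[OF D(3)] L.smult_closed[OF aR a(2)] L.zero_closed by blast
  qed
  thus ?thesis using D(4) Suc by(simp add:kl_def)
 qed
 have chA: "ALL i<=s. ses A (M (Suc i)) (E i) (M i) (f i) (g i) & E i:pw A B"
 proof (intro allI impI conjI)
  fix i assume i: "i <= s"
  have k: "kl (M (Suc i))" "kl (E i)" "kl (M i)" using Mk Ek i by auto
  show "ses A (M (Suc i)) (E i) (M i) (f i) (g i)" using ch i unfolding ses_def lmA[OF k(1,2)] lmA[OF k(2,3)] by blast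
  show "E i:pw A B" using pwA[OF Bk] ch i by blast
 qed
 have "A.cyc B e {0[A]}" unfolding A.cyc_def
 proof (intro conjI ballI)
  show "fin_gen A B" using fgA[OF kill_kl[OF Bk]] B by(simp add:cyc_def)
  show e: "e:$B" using B by(simp add:cyc_def)
  show "EX a:$A. b = a*[B] e" if b: "b:$B" for b
  proof -
   obtain a where "a:$R" "b = a*[B] e" using B b by(auto simp:cyc_def)
   thus ?thesis using kl_r[OF kill_kl[OF Bk] _ e] rA by(intro bexI[of _ "r a"]) auto
  qed
  show "a*[B] e = 0[B] \<longleftrightarrow> a:{0[A]}" if a: "a:$A" for a
   using B rid[OF a] r0[of a] by(auto simp:cyc_def)
 qed
 moreover have fg: "fin_gen A (M 0)" using fgA[OF kill_kl[OF M0]] M0 by(simp add:kill_def)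
 note H1 = H[THEN spec, of B, THEN spec, of e, THEN spec, of M, THEN spec, of E, THEN spec, of f, THEN spec, of g]
 ultimately obtain h where "lm A (M s) (E s) h" "ALL y:$(M s). g s (h y) = x*[M s] y" using H1 chA fg by blast
 thus "EX h. lm R (M s) (E s) h & (ALL y:$(M s). g s (h y) = x*[M s] y)" using lmA[OF Mk[of s] Ek[of s]] by auto
qed

end

section \<open>Sums of power series from m-adic completeness, and the residue domains\<close>

context noeth_local begin

lemma ideal_pow_facts: "ideal (ideal_pow R m n) R" "ideal_pow R m (Suc n)<:ideal_pow R m n"
proof -
 show i: "ideal (ideal_pow R m n) R" for n
  by(induct n) (auto intro:oneideal ideal_prod_is_ideal m_ideal)
 show "ideal_pow R m (Suc n)<:ideal_pow R m n" using ideal_prod_inter[OF m_ideal i[of n]] by auto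
qed

text \<open>The solution is a n = sum over k of t^k * cs (n + k). Each tail is a separate limit, and
  the recursion between them holds modulo every power of \<open>m\<close>.\<close>

lemma complete_lim:
 assumes cm: "madic_complete R m" and t: "t:m" and cs: "!!n::nat. cs n:$R"
 shows "EX a. ALL n. a n:$R & a n = cs n +: t*:a (Suc n)"
proof -
 note tR = mR[OF t]
 \<comment> \<open>\<open>xs N n\<close> is the partial sum with N terms of the tail starting at n;
   recursing on N for all n at once makes the relation between neighbouring tails a defining
   equation.\<close>
 define xs where "xs N = rec_nat (%n.#0) (%_ f n. cs n +: t*:f (Suc n)) N" for N :: nat
 have x0: "xs 0 n = #0" and xS: "xs (Suc N) n = cs n +: t*:xs N (Suc n)" for N n by(simp_all add:xs_def)
 have xR: "xs N n:$R" for N n by(induct N arbitrary: n) (use x0 xS cs tR in auto)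
 let ?I = "ideal_pow R m"
 have tm: "t*:u:?I (Suc N)" if "u:?I N" for u N using that t by(auto intro:ideal_prod.prod)
 have tdiff: "t*:u -: t*:v = t*:(u -: v)" if "u:$R" "v:$R" for u v
  using that tR by(simp add:a_minus_def r_distr r_minus)
 have d: "xs (Suc N) n -: xs N n:?I N" for N n
 proof (induct N arbitrary: n)
  case 0 thus ?case using xR by simp
 next
  case (Suc N)
  have "xs (Suc (Suc N)) n -: xs (Suc N) n = t*:(xs (Suc N) (Suc n) -: xs N (Suc n))"
   unfolding xS[of "Suc N" n] xS[of N n] using cs[of n] xR tR by(simp add:diff_add_diff diff_self tdiff del:x0)
  thus ?case using tm[OF Suc[of "Suc n"]] by(simp del:ideal_pow.simps)
 qed
 have "ALL n. EX y. y:$R & (ALL N. y -: xs N n:?I N)"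
 proof
  fix n
  have "(ALL N.(%N. xs N n) N:$R) & (ALL N.(%N. xs N n) (Suc N) -: (%N. xs N n) N:?I N)" using xR d by simp
  thus "EX y. y:$R & (ALL N. y -: xs N n:?I N)" using conjunct2[OF cm[unfolded madic_complete_def], THEN spec, of "%N. xs N n", THEN mp] by blast
 qed
 then obtain y where y: "!!n. y n:$R" "!!n N. y n -: xs N n:?I N" by metis
 have "y n = cs n +: t*:y (Suc n)" for n
 proof -
  let ?z = "y n -: (cs n +: t*:y (Suc n))"
  have zR: "cs n +: t*:y (Suc n):$R" using cs y tR by simp
  have "?z:?I N" for N
  proof -
   interpret IN: ideal "?I N" R by(rule ideal_pow_facts)
   define u where "u = y n -: xs (Suc N) n"
   define v where "v = t*:(y (Suc n) -: xs N (Suc n))"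
   have uv: "u:?I N" "v:?I N" using y(2)[of n "Suc N"] tm[OF y(2)[of "Suc n" N]] ideal_pow_facts(2)[of N] unfolding u_def v_def by blast+
   have R: "y n:$R" "cs n:$R" "t*:y (Suc n):$R" "t*:xs N (Suc n):$R" using y cs xR tR by auto
   have ve: "v = t*:y (Suc n) -: t*:xs N (Suc n)" unfolding v_def using tdiff y xR by simp
   have "?z +: v = u"
    unfolding ve u_def xS using R by(simp add:a_minus_def minus_add a_ac r_neg1 r_neg2)
   hence "?z = u -: v" using R ve by(metis R(1) zR diff_add_cancel minus_closed)
   thus ?thesis using uv by(simp add:a_minus_def)
  qed
  hence "?z:(\<Inter>N. ?I N)" by blast
  hence "?z = #0" using cm by(auto simp:madic_complete_def)
  thus ?thesis using y(1) zR diff_eq_iff by simp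
 qed
 thus ?thesis using y(1) by(intro exI[of _ y]) blast
qed

text \<open>All hypotheses of \<open>cdom\<close> descend to R / P: the coefficient field maps
  injectively, and series are summed by lifting their coefficients to \<open>R\<close>.\<close>

lemma thmB_prime:
 assumes cm: "madic_complete R m" and K: "coefficient_field R m K" "perfect_subfield R K"
  and P: "primeideal P R" and ch: "chain_le P s"
 shows "EX x:$R - P. ALL B e M E f g. cyc B e P -->
(ALL i<=s. ses R (M (Suc i)) (E i) (M i) (f i) (g i) & E i:pw R B)--> M 0:kill P -->
(EX h. lm R (M s) (E s) h & (ALL y:$(M s). g s (h y) = x*[M s] y))"
proof -
 interpret P: ideal P R using primeideal.axioms(1)[OF P] .
 \<comment> \<open>The choice depends on the coset alone, so congruent elements get equal
   representatives.\<close>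
 define r where "r x = (SOME y. y:P +> x)" for x
 have rin: "r x:P +> x" if "x:$R" for x unfolding r_def using P.a_rcos_self[OF that] by(rule someI)
 have cos: "P +> x = P +> y \<longleftrightarrow> x -: y:P" if "x:$R" "y:$R" for x y
  using quotient_eq_iff_same_a_r_cos[OF P.ideal_axioms that] by simp
 have rR: "r x:$R & r x -: x:P" if x: "x:$R" for x
 proof -
  obtain u where u: "u:P" "r x = u +: x" using rin[OF x] by(auto simp:a_r_coset_def')
  thus ?thesis using x P.Icarr by(simp add:diff_add_cancel)
 qed
 have rr: "r x = r y \<longleftrightarrow> x -: y:P" if xy: "x:$R" "y:$R" for x y
 proof
  assume "x -: y:P" thus "r x = r y" using cos[OF xy] by(simp add:r_def)
 next
  assume e: "r x = r y"
  have c: "r x:$R" "r x -: x:P" "r x -: y:P" using rR[OF xy(1)] rR[OF xy(2)] e by auto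
  have "x -: y = (r x -: y) -: (r x -: x)" using c(1) xy
   by(simp add:a_minus_def minus_add a_ac r_neg1 r_neg2, simp add:a_lcomm[of "r x"] r_neg)
  thus "x -: y:P" using c by(simp add:a_minus_def)
 qed
 interpret Q: qdom R m P r "image_ring r R" by(intro qdom.intro qdom_axioms.intro noeth_local_axioms P rR rr refl)
 let ?A = "image_ring r R"
 have sK: "subfield K R" using K(1) by(simp add:coefficient_field_def)
 have KR: "k:$R" if "k:K" for k using that subfieldE(3)[OF sK] by blast
 note SK = subringE[OF subfieldE(1)[OF sK]]
 have Kinv: "EX k':K. k'*:k = #1" if "k:K" "k ~= #0" for k using subfield_m_inv[OF sK, of k] that by blast
 have "cdom ?A (r ` m) (r ` K)"
 proof (intro cdom.intro cdom_axioms.intro Q.localA Q.domA)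
  show "subring (r ` K) ?A"
  proof (rule Q.A.subringI)
   show "r ` K<:$?A" using KR Q.rA by blast
   show "\<one>\<^bsub>?A\<^esub> : r ` K" using Q.rops(3) SK(3) by(metis image_eqI)
   fix h assume "h:r ` K"
   then obtain k where k: "k:K" "h = r k" by blast
   show "\<ominus>\<^bsub>?A\<^esub> h:r ` K" using Q.rneg[OF KR[OF k(1)]] SK(5)[OF k(1)] k by(metis image_eqI)
   fix h' assume "h':r ` K"
   then obtain k' where k': "k':K" "h' = r k'" by blast
   show "h \<otimes>\<^bsub>?A\<^esub> h':r ` K" using Q.rops(2)[OF KR[OF k(1)] KR[OF k'(1)]] SK(6)[OF k(1) k'(1)] k k' by(metis image_eqI)
   show "h+[?A] h':r ` K" using Q.rops(1)[OF KR[OF k(1)] KR[OF k'(1)]] SK(7)[OF k(1) k'(1)] k k' by(metis image_eqI)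
  qed
  show "EX k':r ` K. k' \<otimes>\<^bsub>?A\<^esub> k = \<one>\<^bsub>?A\<^esub>" if k: "k:r ` K" "k ~= 0[?A]" for k
  proof -
   obtain c where c: "c:K" "k = r c" using k(1) by blast
   hence "c ~= #0" using k(2) Q.rzero by auto
   then obtain c' where c': "c':K" "c'*:c = #1" using Kinv c(1) by blast
   hence "r c' \<otimes>\<^bsub>?A\<^esub> k = \<one>\<^bsub>?A\<^esub>" using Q.rops(2)[OF KR[OF c'(1)] KR[OF c(1)]] Q.rops(3) c by simp
   thus ?thesis using c'(1) by blast
  qed
  show "EX k:r ` K. EX u:r ` m. a = k+[?A] u" if a: "a:$?A" for a
  proof -
   have aR: "a:$R" "r a = a" using Q.rid[OF a] by auto
   have "m +> a:(%k. m +> k) ` K" using K(1) a_rcosetsI[OF _ aR(1), of m] mR by(auto simp:coefficient_field_def bij_betw_def FactRing_def)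
   then obtain k where k: "k:K" "m +> a = m +> k" by blast
   hence "a:m +> k" using ideal.axioms(1)[OF m_ideal] abelian_subgroup.a_rcos_self[OF abelian_subgroupI3[OF _ abelian_group_axioms] aR(1), of m] by simp
   then obtain u where u: "u:m" "a = u +: k" by(auto simp:a_r_coset_def')
   have "a = r k+[?A] r u" using Q.rops(1)[OF KR[OF k(1)] mR[OF u(1)]] aR u KR[OF k(1)] mR[OF u(1)] by(simp add:a_comm)
   thus ?thesis using k(1) u(1) by blast
  qed
  show "EX b:r ` K. b [^]\<^bsub>?A\<^esub> p = a" if p: "Factorial_Ring.prime p" "[p] \<cdot>\<^bsub>?A\<^esub> \<one>\<^bsub>?A\<^esub> = 0[?A]" and a: "a:r ` K" for p :: nat and a
  proof -
   \<comment> \<open>The multiple p * 1 lies both in \<open>P\<close> and in \<open>K\<close>; a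
     nonzero element of \<open>K\<close> is a unit, so p already vanishes in \<open>R\<close>, where
     perfectness is available.\<close>
   have pP: "[p] \<cdot> #1:P" using Q.raddpow[OF one_closed, of p] Q.rops(3) p(2) Q.r0[of "[p] \<cdot> #1"] by simp
   have pK: "[q] \<cdot> #1:K" for q :: nat by(induct q) (use SK in auto)
   have "[p] \<cdot> #1 = #0"
   proof (rule ccontr)
    assume "[p] \<cdot> #1 ~= #0"
    then obtain k where "k:K" "k *: [p] \<cdot> #1 = #1" using Kinv[OF pK] by blast
    hence "#1:P" using P.I_l_closed[OF pP KR] by metis
    thus False using P.one_imp_carrier primeideal.I_notcarr[OF P] by blast
   qed
   moreover obtain k where k: "k:K" "a = r k" using a by blast
   ultimately obtain b where "b:K" "b [^] p = k" using K(2) p(1) unfolding perfect_subfield_def by blast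
   thus ?thesis using Q.rpow[OF KR, of b p] k(2) by(intro bexI[of _ "r b"]) auto
  qed
  show "EX a. ALL n. a n:$?A & a n = cs n+[?A] t \<otimes>\<^bsub>?A\<^esub> a (Suc n)" if t: "t:r ` m" and cs: "!!n::nat. cs n:$?A" for t cs
  proof -
   have tA: "t:$?A" using t mR Q.rA by blast
   have tR: "t:$R" "r t = t" using Q.rid[OF tA] by auto
   have tm: "t:m" using Q.rm[OF tR(1)] t tR(2) by simp
   have cR: "cs n:$R" "r (cs n) = cs n" for n using Q.rid[OF cs] by auto
   \<comment> \<open>Sum the lifted series in \<open>R\<close>, then project each tail.\<close>
   obtain a where a: "ALL n. a n:$R & a n = cs n +: t*:a (Suc n)" using complete_lim[OF cm tm, of cs, OF cR(1)] by(elim exE) (erule that)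
   have aR: "a n:$R" and ae: "a n = cs n +: t*:a (Suc n)" for n using spec[OF a, of n] by(rule conjunct1, rule conjunct2)
   show ?thesis
   proof (intro exI[of _ "%n. r (a n)"] allI conjI)
    fix n show "r (a n):$?A" using Q.rA[OF aR] .
    have "r (a n) = r (cs n +: t*:a (Suc n))" by(rule arg_cong[OF ae])
    also have "... = r (cs n)+[?A] r (t*:a (Suc n))" using cR tR aR by(intro Q.rops(1)) auto
    also have "r (t*:a (Suc n)) = r t \<otimes>\<^bsub>?A\<^esub> r (a (Suc n))" using tR aR by(intro Q.rops(2)) auto
    finally show "r (a n) = cs n+[?A] t \<otimes>\<^bsub>?A\<^esub> r (a (Suc n))" unfolding cR(2) tR(2) .
   qed
  qed
 qed
 from cdom.thmB_dom[OF this Q.chainA[OF ch]] show ?thesis by(elim bexE conjE) (rule Q.transfer)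
qed

end

theorem theorem5p7:
 fixes R :: "'a ring" and m :: "'a set" and d :: nat
 assumes "cring R" and "noetherian_ring R"
  and "maximalideal m R" and "\<forall>I. maximalideal I R \<longrightarrow> I = m"
  and "krull_dim R = enat d"
  and "madic_complete R m"
  and "\<exists>K. coefficient_field R m K \<and> perfect_subfield R K"
 shows "mod_size R (syz_class R d) < \<infinity> \<and> mod_radius R (syz_class R d) < \<infinity>"
proof -
 interpret noeth_local R m
 proof (intro noeth_local.intro noeth_local_axioms.intro assms(1-3))
  show "I = m" if "maximalideal I R" for I using assms(4) that by blast
 qed
 obtain K where K: "coefficient_field R m K" "perfect_subfield R K" using assms(7) by blast
 show ?thesis by(rule size_radius_local[OF assms(5)]) (rule thmB_prime[OF assms(6) K])
qed

end
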